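(* Let $1<p<\infty$, $p-2<\alpha\le p-1$, and let $g$ be an analytic function in the unit disc $\mathbb{D}$. Then the generalized Hilbert operator $\mathcal{H}_g:\mathcal{D}^p_\alpha\to\mathcal{D}^p_\alpha$ is compact if and only if $g\in\lambda\left(p,\frac1p\right)$.
   Context: $dA=\frac1\pi dx\,dy$. For $0<p<\infty$ and $\alpha>-1$, set $\|f\|_{A^p_\alpha}=\left((\alpha+1)\int_{\mathbb{D}}|f(z)|^p(1-|z|^2)^\alpha\,dA(z)\right)^{1/p}$; the Dirichlet type space $\mathcal{D}^p_\alpha$ consists of analytic $f$ in $\mathbb{D}$ with $\|f\|_{\mathcal{D}^p_\alpha}^p=|f(0)|^p+\|f'\|_{A^p_\alpha}^p<\infty$. Given $g$ analytic in $\mathbb{D}$, the generalized Hilbert operator is $\mathcal{H}_g(f)(z)=\int_0^1 f(t)g'(tz)\,dt$, $z\in\mathbb{D}$, defined for analytic $f$ with $\int_0^1|f(t)|\,dt<\infty$ (this holds for every $f\in\mathcal{D}^p_\alpha$ when $p>1$ and $p-2<\alpha\le p-1$). Let $M_p(r,f)=\left(\frac1{2\pi}\int_0^{2\pi}|f(re^{it})|^p\,dt\right)^{1/p}$ and let $H^p$ be the Hardy space of analytic $f$ with $\sup_{0<r<1}M_p(r,f)<\infty$. Little-oh mean Lipschitz spaces: for $1\le p<\infty$ and $0<\alpha<1$, $\lambda(p,\alpha)$ is the set of $g\in H^p$ whose boundary function satisfies $\omega_p(g,t)=o(t^\alpha)$ as $t\to0$, where $\omega_p(g,t)=\sup_{0<h\le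 t}\left(\int_0^{2\pi}|g(e^{i(\theta+h)})-g(e^{i\theta})|^p\frac{d\theta}{2\pi}\right)^{1/p}$; equivalently, $g\in H^p$ and $M_p(r,g')=o((1-r)^{\alpha-1})$ as $r\to1^-$. *)

theory Defs
  imports "HOL-Complex_Analysis.Complex_Analysis" "HOL-Library.Landau_Symbols"
begin

abbreviation unit_disc :: "complex set" where
  "unit_disc \<equiv> ball 0 1"

definition area :: "complex measure" where
  "area = scale_measure (ennreal (1 / pi)) lborel"

definition bergman_norm :: "real \<Rightarrow> real \<Rightarrow> (complex \<Rightarrow> complex) \<Rightarrow> real" where
  "bergman_norm p \<alpha> f =
     ((\<alpha> + 1) * (LINT z:unit_disc|area. norm (f z) powr p * (1 - (norm z)\<^sup>2) powr \<alpha>)) powr (1 / p)"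

definition dirichlet_norm :: "real \<Rightarrow> real \<Rightarrow> (complex \<Rightarrow> complex) \<Rightarrow> real" where
  "dirichlet_norm p \<alpha> f =
     (norm (f 0) powr p + bergman_norm p \<alpha> (deriv f) powr p) powr (1 / p)"

(* The Bochner integral is 0 for non-integrable functions, so finiteness of the norm is
   expressed as integrability.  Only the values on the disc matter for membership and norm;
   values elsewhere are arbitrary. *)
definition dirichlet_space :: "real \<Rightarrow> real \<Rightarrow> (complex \<Rightarrow> complex) set" where
  "dirichlet_space p \<alpha> =
     {f. f holomorphic_on unit_disc \<and>
         set_integrable area unit_disc (\<lambda>z. norm (deriv f z) powr p * (1 - (norm z)\<^sup>2) powr \<alpha>)}"

definition gen_hilbert :: "(complex \<Rightarrow> complex) \<Rightarrow> (complex \<Rightarrow> complex) \<Rightarrow> complex \<Rightarrow> complex" where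
  "gen_hilbert g f z = (LINT t:{0..<1}|lborel. f (of_real t) * deriv g (of_real t * z))"

(* T maps V into V and sends bounded sequences to sequences with a subsequence converging in V.
   The sequential form is insensitive to N being only a seminorm on functions defined on all of
   the complex plane (it vanishes on functions that vanish on the disc). *)
definition compact_operator_on ::
  "(complex \<Rightarrow> complex) set \<Rightarrow> ((complex \<Rightarrow> complex) \<Rightarrow> real) \<Rightarrow>
   ((complex \<Rightarrow> complex) \<Rightarrow> complex \<Rightarrow> complex) \<Rightarrow> bool" where
  "compact_operator_on V N T \<longleftrightarrow>
     T ` V \<subseteq> V \<and>
     (\<forall>f :: nat \<Rightarrow> complex \<Rightarrow> complex.
        range f \<subseteq> V \<and> bdd_above (range (\<lambda>n. N (f n))) \<longrightarrow>
        (\<exists>h\<in>V. \<exists>r. strict_mono r \<and> (\<lambda>n. N (\<lambda>z. T (f (r n)) z - h z)) \<longlonglongrightarrow> 0))"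

definition integral_mean :: "real \<Rightarrow> real \<Rightarrow> (complex \<Rightarrow> complex) \<Rightarrow> real" where
  "integral_mean p r f =
     (1 / (2 * pi) * (LINT t:{0..2*pi}|lborel. norm (f (of_real r * cis t)) powr p)) powr (1 / p)"

definition hardy_space :: "real \<Rightarrow> (complex \<Rightarrow> complex) set" where
  "hardy_space p =
     {f. f holomorphic_on unit_disc \<and> bdd_above ((\<lambda>r. integral_mean p r f) ` {0<..<1})}"

definition boundary_fun :: "(complex \<Rightarrow> complex) \<Rightarrow> complex \<Rightarrow> complex" where
  "boundary_fun g \<zeta> = Lim (at_left 1) (\<lambda>r::real. g (of_real r * \<zeta>))"

definition mean_modulus :: "real \<Rightarrow> (complex \<Rightarrow> complex) \<Rightarrow> real \<Rightarrow> real" where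
  "mean_modulus p g t =
     (SUP h\<in>{0<..t}.
        (LINT \<theta>:{0..2*pi}|lebesgue.
           norm (boundary_fun g (cis (\<theta> + h)) - boundary_fun g (cis \<theta>)) powr p / (2 * pi))
        powr (1 / p))"

(* The second conjunct makes explicit that the boundary function exists, i.e. that the radial
   limits chosen by boundary_fun exist almost everywhere; for functions in the Hardy space this is
   Fatou's theorem.  Membership in the Hardy space also makes the supremum in mean_modulus one of
   a bounded set (Fatou's lemma). *)
definition little_mean_lipschitz :: "real \<Rightarrow> real \<Rightarrow> (complex \<Rightarrow> complex) set" where
  "little_mean_lipschitz p a =
     {g \<in> hardy_space p.
        (AE \<theta> in lebesgue. \<exists>l. ((\<lambda>r::real. g (of_real r * cis \<theta>)) \<longlongrightarrow> l) (at_left 1)) \<and>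
        mean_modulus p g \<in> o[at_right 0](\<lambda>t. t powr a)}"

end

theory Submission
  imports Defs
begin

text \<open>
  Both conditions are equivalent to \<open>M\<^sub>p(r, g'') = o((1 - r) powr (1/p - 2))\<close>.

  If this growth holds, then Minkowski's inequality applied to
  \<open>(H\<^sub>g f)'(z) = \<integral> t f(t) g''(tz) dt\<close>, followed by the Schur test and the bound of the weighted
  \<open>L\<^sup>p\<close> norms of \<open>f\<close> and \<open>f'\<close> on the radius by the norm of \<open>f\<close>, gives
  \<open>\<parallel>H\<^sub>g f\<parallel> \<le> \<epsilon> \<parallel>f\<parallel> + C\<^sub>\<epsilon> \<integral> |f(t)| dt\<close> for every \<open>\<epsilon>\<close>. The second term tends to 0 along bounded
  sequences that converge to 0 locally uniformly, so Montel's theorem yields compactness.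

  Conversely, let \<open>\<phi>\<^sub>k(z) = (1 - a) powr (\<sigma> + k) / (1 - a z) ^ k\<close> with \<open>\<sigma> = 1 - (\<alpha> + 2)/p\<close>. These are
  bounded and tend to 0 pointwise as \<open>a \<rightarrow> 1\<close>, so compactness forces \<open>\<parallel>H\<^sub>g \<phi>\<^sub>k\<parallel> \<rightarrow> 0\<close>. Integration by parts
  gives \<open>(1 - a) powr \<sigma> g' = (1 - a)\<^sup>-\<^sup>1 H\<^sub>g \<phi>\<^sub>2 + z (H\<^sub>g \<phi>\<^sub>1)'\<close>; differentiating and taking \<open>a = r\<close>
  bounds \<open>M\<^sub>p(r, g'')\<close>.

  The growth of \<open>g''\<close> follows from the modulus of continuity of the boundary function \<open>b\<close> through
  Cauchy's formula for \<open>g''\<close> with \<open>b - b(w)\<close> in place of \<open>b\<close>. In the other direction it integrates to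
  \<open>M\<^sub>p(r, g') = o((1 - r) powr (1/p - 1))\<close>, and for \<open>r = 1 - h\<close> the difference \<open>b(e\<^sup>i\<^sup>h w) - b(w)\<close> is bounded
  by integrals of \<open>|g'|\<close> over two radial segments and one arc.
\<close>

section \<open>Integral inequalities\<close>

text \<open>The intermediate growth condition does not mention \<open>\<alpha>\<close>; this is why
  one space of symbols serves the whole range. The lower end \<open>p - 2 < \<alpha>\<close> is what
  Hardy's inequality on the radius needs. The upper end \<open>\<alpha> \<le> p - 1\<close> makes
  the weight \<open>y powr (\<alpha> + 1 - p)\<close> at least 1 there, so that norm-bounded
  families are bounded in L^p of the radius and the term with the factor
  \<open>C\<^sub>\<epsilon>\<close> is a compact perturbation.

  The second derivative appears because differentiating the operator once produces it. Its critical
  rate gives a kernel that is homogeneous of degree \<open>1 / p - 2\<close> in the distances to the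
  boundary, so power weights can be used in the Schur test.

  Two test functions are used because \<open>z\<close> times the first has exactly a multiple of the
  second as derivative: integration by parts then isolates \<open>deriv g\<close> at a single point,
  without a remainder.

  Weak convergence and duality are avoided. Integrals are taken in the extended nonnegative reals,
  so that finiteness is a conclusion and not a side condition.\<close>

lemma powr_tangent_ge:
  fixes x m p :: real
  assumes "1 < p" "0 \<le> x" "0 < m"
  shows "p * m powr (p - 1) * x \<le> x powr p + (p - 1) * m powr p"
proof -
  \<comment> \<open>Young's inequality with the conjugate exponent, read as: the graph of
    \<open>x powr p\<close> lies above its tangent at \<open>m\<close>.\<close>
  define q where "q = p / (p - 1)"
  have q: "1 < q" "1 / p + 1 / q = 1"
    using assms by (auto simp: q_def field_simps)
  have "x * m powr (p - 1) \<le> x powr p / p + (m powr (p - 1)) powr q / q"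
    using assms q by (intro Youngs_inequality) auto
  also have "(m powr (p - 1)) powr q = m powr p"
    using assms by (simp add: powr_powr q_def)
  finally have "p * (x * m powr (p - 1)) \<le> p * (x powr p / p + m powr p / q)"
    using assms by (intro mult_left_mono) auto
  also have "\<dots> = x powr p + (p - 1) * m powr p"
    using assms by (simp add: q_def field_simps)
  finally show ?thesis by (simp add: mult_ac)
qed

text \<open>The tangent inequality at the mean \<open>m = a / W\<close> is integrated against
  \<open>w\<close>. The data are one-sided, \<open>a\<close> bounding the weighted integral from
  below and \<open>W\<close> the mass from above, so the integral of \<open>f x * w x\<close> may
  even be infinite.\<close>

lemma nn_integral_jensen_powr:
  fixes f w :: "'a \<Rightarrow> real" and a W p :: real
  assumes [measurable]: "f \<in> borel_measurable M" "w \<in> borel_measurable M"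
    and nonneg: "\<And>x. x \<in> space M \<Longrightarrow> 0 \<le> f x" "\<And>x. x \<in> space M \<Longrightarrow> 0 \<le> w x" and p: "1 < p"
    and a: "0 \<le> a" "ennreal a \<le> (\<integral>\<^sup>+x. f x * w x \<partial>M)"
    and W: "(\<integral>\<^sup>+x. w x \<partial>M) \<le> ennreal W"
  shows "ennreal (a powr p) \<le> ennreal (W powr (p - 1)) * (\<integral>\<^sup>+x. f x powr p * w x \<partial>M)"
proof (cases "a = 0")
  case False
  then have a0: "0 < a" using a by simp
  have W0: "W > 0"
  proof (rule ccontr)
    assume "\<not> W > 0"
    then have "(\<integral>\<^sup>+x. w x \<partial>M) = 0" using W by (simp add: ennreal_neg)
    then have "AE x in M. ennreal (w x) = 0" by (subst (asm) nn_integral_0_iff_AE) auto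
    then have "AE x in M. ennreal (f x * w x) = 0"
      by (rule AE_mp) (use nonneg in \<open>auto intro!: AE_I2 simp: ennreal_eq_0_iff mult_le_0_iff dest: antisym\<close>)
    then have "(\<integral>\<^sup>+x. f x * w x \<partial>M) = 0" by (subst nn_integral_0_iff_AE) auto
    with a a0 show False by (simp add: ennreal_eq_0_iff)
  qed
  show ?thesis
  proof (cases "(\<integral>\<^sup>+x. f x powr p * w x \<partial>M) = \<infinity>")
    case True
    with W0 show ?thesis by (simp add: ennreal_mult_top)
  next
    case False
    then obtain X where X: "(\<integral>\<^sup>+x. f x powr p * w x \<partial>M) = ennreal X" "0 \<le> X"
      by (cases "\<integral>\<^sup>+x. f x powr p * w x \<partial>M" rule: ennreal_cases) auto
    define m where "m = a / W"
    have m: "0 < m" using a0 W0 by (simp add: m_def)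
    define c where "c = p * m powr (p - 1)"
    have c0: "0 \<le> c" using p by (simp add: c_def)
    have "ennreal (c * a) = ennreal c * ennreal a"
      using c0 a by (simp add: ennreal_mult)
    also have "\<dots> \<le> ennreal c * (\<integral>\<^sup>+x. f x * w x \<partial>M)"
      by (intro mult_left_mono a) auto
    also have "\<dots> = (\<integral>\<^sup>+x. ennreal c * ennreal (f x * w x) \<partial>M)"
      by (intro nn_integral_cmult[symmetric]) auto
    also have "\<dots> \<le> (\<integral>\<^sup>+x. ennreal (f x powr p * w x) + ennreal ((p - 1) * m powr p) * ennreal (w x) \<partial>M)"
    proof (intro nn_integral_mono)
      fix x assume x: "x \<in> space M"
      have "c * f x * w x \<le> (f x powr p + (p - 1) * m powr p) * w x"
        unfolding c_def using nonneg x p m by (intro mult_right_mono powr_tangent_ge) auto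
      then have "ennreal (c * (f x * w x)) \<le> ennreal (f x powr p * w x + (p - 1) * m powr p * w x)"
        by (intro ennreal_leI) (simp add: algebra_simps)
      then show "ennreal c * ennreal (f x * w x)
          \<le> ennreal (f x powr p * w x) + ennreal ((p - 1) * m powr p) * ennreal (w x)"
        using nonneg[OF x] p c0 by (simp add: ennreal_mult)
    qed
    also have "\<dots> = ennreal X + ennreal ((p - 1) * m powr p) * (\<integral>\<^sup>+x. w x \<partial>M)"
      by (simp add: nn_integral_add nn_integral_cmult X)
    also have "\<dots> \<le> ennreal X + ennreal ((p - 1) * m powr p) * ennreal W"
      by (intro add_left_mono mult_left_mono W) auto
    also have "\<dots> = ennreal (X + (p - 1) * m powr p * W)"
      using X p W0 by (simp add: ennreal_mult[symmetric] ennreal_plus[symmetric] del: ennreal_plus)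
    finally have "c * a \<le> X + (p - 1) * m powr p * W"
      using X p W0 by (subst (asm) ennreal_le_iff) auto
    moreover have "m powr p * W = m powr (p - 1) * a"
      using m W0 a0 by (simp add: powr_diff m_def)
    ultimately have "p * (m powr (p - 1) * a) \<le> X + (p - 1) * (m powr (p - 1) * a)"
      unfolding c_def mult.assoc by simp
    then have *: "m powr (p - 1) * a \<le> X" by (simp add: algebra_simps)
    have "a powr p = W powr (p - 1) * (m powr (p - 1) * a)"
      using a0 W0 by (simp add: m_def powr_divide powr_diff)
    also have "\<dots> \<le> W powr (p - 1) * X" by (intro mult_left_mono *) auto
    finally have "ennreal (a powr p) \<le> ennreal (W powr (p - 1) * X)" by (rule ennreal_leI)
    then show ?thesis using X by (simp add: ennreal_mult)
  qed
qed simp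

text \<open>Jensen's inequality for the weight \<open>k y * \<phi> y\<close> is applied to
  \<open>f x y / \<phi> y\<close>; after exchanging the integrals the slice at \<open>y\<close>
  contributes at most \<open>k y * \<phi> y\<close>. Dividing by the bound \<open>\<phi>\<close>,
  and not by the slice norm itself, keeps the divisor positive and measurable.\<close>

lemma nn_integral_minkowski:
  fixes A :: "'a \<Rightarrow> real" and f :: "'a \<Rightarrow> 'b \<Rightarrow> real" and k \<phi> :: "'b \<Rightarrow> real"
  assumes "sigma_finite_measure M" "sigma_finite_measure N"
    and fm: "(\<lambda>(x, y). f x y) \<in> borel_measurable (M \<Otimes>\<^sub>M N)"
    and [measurable]: "k \<in> borel_measurable N" "\<phi> \<in> borel_measurable N"
    and nonneg: "\<And>x y. x \<in> space M \<Longrightarrow> y \<in> space N \<Longrightarrow> 0 \<le> f x y"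
    and k: "\<And>y. y \<in> space N \<Longrightarrow> 0 \<le> k y"
    and \<phi>: "\<And>y. y \<in> space N \<Longrightarrow> 0 < \<phi> y" and p: "1 < p"
    and bound: "\<And>y. y \<in> space N \<Longrightarrow> (\<integral>\<^sup>+x. f x y powr p \<partial>M) \<le> ennreal (\<phi> y powr p)"
    and \<Phi>: "(\<integral>\<^sup>+y. k y * \<phi> y \<partial>N) \<le> ennreal \<Phi>" "0 \<le> \<Phi>"
    and A: "AE x in M. 0 \<le> A x \<and> ennreal (A x) \<le> (\<integral>\<^sup>+y. k y * f x y \<partial>N)"
  shows "(\<integral>\<^sup>+x. A x powr p \<partial>M) \<le> ennreal (\<Phi> powr p)"
proof -
  interpret M: sigma_finite_measure M by fact
  interpret N: sigma_finite_measure N by fact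
  interpret P: pair_sigma_finite M N ..
  note fm[measurable]
  have fm1[measurable]: "(\<lambda>y. f x y) \<in> borel_measurable N" if "x \<in> space M" for x
    using measurable_compose[OF measurable_Pair1'[OF that] fm] by simp
  let ?h = "\<lambda>x y. (f x y / \<phi> y) powr p * (k y * \<phi> y)"
  have "AE x in M. ennreal (A x powr p) \<le> ennreal (\<Phi> powr (p - 1)) * (\<integral>\<^sup>+y. ?h x y \<partial>N)"
    using A
  proof (rule AE_mp, intro AE_I2 impI)
    fix x assume x[measurable]: "x \<in> space M" and *: "0 \<le> A x \<and> ennreal (A x) \<le> (\<integral>\<^sup>+y. k y * f x y \<partial>N)"
    have "(\<integral>\<^sup>+y. k y * f x y \<partial>N) = (\<integral>\<^sup>+y. (f x y / \<phi> y) * (k y * \<phi> y) \<partial>N)"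
      using \<phi> by (intro nn_integral_cong) (auto simp: less_le mult.commute)
    with * show "ennreal (A x powr p) \<le> ennreal (\<Phi> powr (p - 1)) * (\<integral>\<^sup>+y. ?h x y \<partial>N)"
      using x nonneg \<phi> k p \<Phi> by (intro nn_integral_jensen_powr) (auto simp: less_imp_le)
  qed
  then have "(\<integral>\<^sup>+x. A x powr p \<partial>M) \<le> (\<integral>\<^sup>+x. ennreal (\<Phi> powr (p - 1)) * (\<integral>\<^sup>+y. ?h x y \<partial>N) \<partial>M)"
    by (rule nn_integral_mono_AE)
  also have "\<dots> = ennreal (\<Phi> powr (p - 1)) * (\<integral>\<^sup>+x. \<integral>\<^sup>+y. ?h x y \<partial>N \<partial>M)"
    by (intro nn_integral_cmult) measurable
  also have "(\<integral>\<^sup>+x. \<integral>\<^sup>+y. ?h x y \<partial>N \<partial>M) = (\<integral>\<^sup>+y. \<integral>\<^sup>+x. ?h x y \<partial>M \<partial>N)"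
    by (intro P.Fubini'[symmetric]) measurable
  also have "\<dots> \<le> (\<integral>\<^sup>+y. k y * \<phi> y \<partial>N)"
  proof (intro nn_integral_mono)
    fix y assume y[measurable]: "y \<in> space N"
    have [measurable]: "(\<lambda>x. f x y) \<in> borel_measurable M"
      using measurable_compose[OF measurable_Pair2'[OF y] fm] by simp
    have "(\<integral>\<^sup>+x. ?h x y \<partial>M) = (\<integral>\<^sup>+x. ennreal (k y * \<phi> y powr (1 - p)) * ennreal (f x y powr p) \<partial>M)"
      using \<phi>[OF y] k[OF y] nonneg[OF _ y]
      by (intro nn_integral_cong) (simp add: ennreal_mult[symmetric] powr_divide powr_diff)
    also have "\<dots> = ennreal (k y * \<phi> y powr (1 - p)) * (\<integral>\<^sup>+x. ennreal (f x y powr p) \<partial>M)"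
      by (intro nn_integral_cmult) measurable
    also have "\<dots> \<le> ennreal (k y * \<phi> y powr (1 - p)) * ennreal (\<phi> y powr p)"
      by (intro mult_left_mono bound y) auto
    also have "\<dots> = ennreal (k y * \<phi> y)"
      using \<phi>[OF y] k[OF y] by (simp add: ennreal_mult[symmetric] mult.assoc powr_add[symmetric])
    finally show "(\<integral>\<^sup>+x. ?h x y \<partial>M) \<le> ennreal (k y * \<phi> y)" .
  qed
  also have "\<dots> \<le> ennreal \<Phi>" by (rule \<Phi>)
  also have "ennreal (\<Phi> powr (p - 1)) * ennreal \<Phi> = ennreal (\<Phi> powr p)"
    using \<Phi>(2) p by (cases "\<Phi> = 0") (auto simp: ennreal_mult[symmetric] powr_diff)
  finally show ?thesis by (simp add: mult_left_mono)
qed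

text \<open>Jensen's inequality in \<open>y\<close> for the weight \<open>v y * K x y\<close>, of
  mass at most \<open>W x\<close>, is applied to \<open>F y / v y\<close>; the
  \<open>x\<close>-integral that remains after Fubini is bounded by \<open>V\<close>. Leaving
  \<open>v\<close>, \<open>W\<close> and \<open>V\<close> arbitrary lets each application choose its
  own powers.\<close>

lemma nn_integral_schur_test:
  fixes A F W :: "real \<Rightarrow> real" and K :: "real \<Rightarrow> real \<Rightarrow> real"
  assumes "sigma_finite_measure M" "sigma_finite_measure N"
    and Km: "(\<lambda>(x, y). K x y) \<in> borel_measurable (M \<Otimes>\<^sub>M N)"
    and [measurable]: "v \<in> borel_measurable N" "F \<in> borel_measurable N"
      "W \<in> borel_measurable M" "\<omega> \<in> borel_measurable M"
    and K: "\<And>x y. x \<in> space M \<Longrightarrow> y \<in> space N \<Longrightarrow> 0 \<le> K x y"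
    and F: "\<And>y. y \<in> space N \<Longrightarrow> 0 \<le> F y"
    and v: "\<And>y. y \<in> space N \<Longrightarrow> 0 < v y" and p: "1 < p"
    and \<omega>: "\<And>x. x \<in> space M \<Longrightarrow> 0 \<le> \<omega> x"
    and W: "\<And>x. x \<in> space M \<Longrightarrow> (\<integral>\<^sup>+y. v y * K x y \<partial>N) \<le> ennreal (W x)"
    and V: "\<And>y. y \<in> space N \<Longrightarrow> (\<integral>\<^sup>+x. \<omega> x * W x powr (p - 1) * K x y \<partial>M) \<le> ennreal (V y)"
    and A: "\<And>x. x \<in> space M \<Longrightarrow> 0 \<le> A x \<and> ennreal (A x) \<le> (\<integral>\<^sup>+y. F y * K x y \<partial>N)"
  shows "(\<integral>\<^sup>+x. \<omega> x * A x powr p \<partial>M) \<le> (\<integral>\<^sup>+y. F y powr p * v y powr (1 - p) * V y \<partial>N)"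
proof -
  interpret M: sigma_finite_measure M by fact
  interpret N: sigma_finite_measure N by fact
  interpret P: pair_sigma_finite M N ..
  note Km[measurable]
  have Km1: "(\<lambda>y. K x y) \<in> borel_measurable N" if "x \<in> space M" for x
    using measurable_compose[OF measurable_Pair1'[OF that] Km] by simp
  let ?h = "\<lambda>x y. \<omega> x * W x powr (p - 1) * ((F y / v y) powr p * (v y * K x y))"
  have "(\<integral>\<^sup>+x. \<omega> x * A x powr p \<partial>M) \<le> (\<integral>\<^sup>+x. \<integral>\<^sup>+y. ?h x y \<partial>N \<partial>M)"
  proof (intro nn_integral_mono)
    fix x assume x[measurable]: "x \<in> space M"
    note Km1[OF x, measurable]
    have "ennreal (A x) \<le> (\<integral>\<^sup>+y. F y * K x y \<partial>N)"
      using A[OF x] by simp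
    also have "\<dots> = (\<integral>\<^sup>+y. (F y / v y) * (v y * K x y) \<partial>N)"
      using v by (intro nn_integral_cong) (auto simp: less_le)
    finally have "ennreal (A x powr p) \<le> ennreal (W x powr (p - 1)) *
        (\<integral>\<^sup>+y. (F y / v y) powr p * (v y * K x y) \<partial>N)"
      using A[OF x] x K F v p W by (intro nn_integral_jensen_powr) (auto simp: less_imp_le)
    then have "ennreal (\<omega> x) * ennreal (A x powr p) \<le> ennreal (\<omega> x) * (ennreal (W x powr (p - 1)) *
        (\<integral>\<^sup>+y. (F y / v y) powr p * (v y * K x y) \<partial>N))"
      by (rule mult_left_mono) auto
    also have "\<dots> = ennreal (\<omega> x * W x powr (p - 1)) * (\<integral>\<^sup>+y. (F y / v y) powr p * (v y * K x y) \<partial>N)"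
      using \<omega>[OF x] by (simp add: ennreal_mult mult_ac)
    also have "\<dots> = (\<integral>\<^sup>+y. ennreal (\<omega> x * W x powr (p - 1)) * ennreal ((F y / v y) powr p * (v y * K x y)) \<partial>N)"
      by (intro nn_integral_cmult[symmetric]) measurable
    also have "\<dots> = (\<integral>\<^sup>+y. ?h x y \<partial>N)"
      using \<omega>[OF x] v K x by (intro nn_integral_cong) (auto simp: ennreal_mult less_imp_le)
    finally show "ennreal (\<omega> x * A x powr p) \<le> (\<integral>\<^sup>+y. ?h x y \<partial>N)"
      using \<omega>[OF x] by (simp add: ennreal_mult)
  qed
  also have "\<dots> = (\<integral>\<^sup>+y. \<integral>\<^sup>+x. ?h x y \<partial>M \<partial>N)"
    by (intro P.Fubini'[symmetric]) measurable
  also have "\<dots> \<le> (\<integral>\<^sup>+y. F y powr p * v y powr (1 - p) * V y \<partial>N)"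
  proof (intro nn_integral_mono)
    fix y assume y[measurable]: "y \<in> space N"
    have [measurable]: "(\<lambda>x. K x y) \<in> borel_measurable M"
      using measurable_compose[OF measurable_Pair2'[OF y] Km] by simp
    let ?c = "F y powr p * v y powr (1 - p)"
    have "(\<integral>\<^sup>+x. ?h x y \<partial>M) = (\<integral>\<^sup>+x. ennreal ?c * ennreal (\<omega> x * W x powr (p - 1) * K x y) \<partial>M)"
      using v[OF y] F[OF y] K[OF _ y] \<omega>
      by (intro nn_integral_cong) (simp add: ennreal_mult[symmetric] powr_divide powr_diff field_simps)
    also have "\<dots> = ennreal ?c * (\<integral>\<^sup>+x. ennreal (\<omega> x * W x powr (p - 1) * K x y) \<partial>M)"
      by (intro nn_integral_cmult) measurable
    also have "\<dots> \<le> ennreal ?c * ennreal (V y)"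
      by (intro mult_left_mono V y) auto
    also have "\<dots> = ennreal (?c * V y)"
      by (simp add: ennreal_mult')
    finally show "(\<integral>\<^sup>+x. ?h x y \<partial>M) \<le> ennreal (?c * V y)" .
  qed
  finally show ?thesis .
qed

text \<open>Truncation at height \<open>N\<close>: the truncated functions converge by domination on
  the finite measure space, while the part above \<open>N\<close> costs at most
  \<open>N powr (1 - p) * B\<close> uniformly in \<open>n\<close>. Convergence in L^p itself may
  fail.\<close>

lemma L1_tendsto_of_Lp_bounded:
  fixes u :: "nat \<Rightarrow> 'a \<Rightarrow> real"
  assumes [measurable]: "\<And>n. u n \<in> borel_measurable M" and fin: "emeasure M (space M) < \<infinity>"
    and nonneg: "\<And>n x. x \<in> space M \<Longrightarrow> 0 \<le> u n x" and p: "1 < p"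
    and lim: "AE x in M. (\<lambda>n. u n x) \<longlonglongrightarrow> 0"
    and bound: "\<And>n. (\<integral>\<^sup>+x. u n x powr p \<partial>M) \<le> ennreal B"
  shows "(\<lambda>n. \<integral>\<^sup>+x. u n x \<partial>M) \<longlonglongrightarrow> 0"
proof -
  have trunc: "(\<lambda>n. \<integral>\<^sup>+x. min (u n x) N \<partial>M) \<longlonglongrightarrow> 0" if "N > 0" for N :: real
  proof -
    have "(\<lambda>n. \<integral>\<^sup>+x. ennreal (min (u n x) N) \<partial>M) \<longlonglongrightarrow> (\<integral>\<^sup>+x. 0 \<partial>M)"
    proof (rule nn_integral_dominated_convergence[where w = "\<lambda>_. ennreal N"])
      show "(\<integral>\<^sup>+x. ennreal N \<partial>M) < \<infinity>" using fin by (simp add: ennreal_mult_less_top)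
      show "AE x in M. (\<lambda>n. ennreal (min (u n x) N)) \<longlonglongrightarrow> 0"
        using lim
      proof (rule AE_mp, intro AE_I2 impI)
        fix x assume "(\<lambda>n. u n x) \<longlonglongrightarrow> 0"
        then have "(\<lambda>n. min (u n x) N) \<longlonglongrightarrow> min 0 N" by (intro tendsto_intros)
        then show "(\<lambda>n. ennreal (min (u n x) N)) \<longlonglongrightarrow> 0"
          using that tendsto_ennrealI by fastforce
      qed
    qed (auto simp: ennreal_leI)
    then show ?thesis by simp
  qed
  have split: "(\<integral>\<^sup>+x. u n x \<partial>M) \<le> (\<integral>\<^sup>+x. min (u n x) N \<partial>M) + ennreal (N powr (1 - p) * max B 0)"
    if "N > 0" for n and N :: real
  proof -
    have "(\<integral>\<^sup>+x. u n x \<partial>M) \<le> (\<integral>\<^sup>+x. ennreal (min (u n x) N) + ennreal (N powr (1 - p)) * ennreal (u n x powr p) \<partial>M)"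
    proof (intro nn_integral_mono)
      fix x assume x: "x \<in> space M"
      have "u n x \<le> min (u n x) N + N powr (1 - p) * u n x powr p"
      proof (cases "u n x \<le> N")
        case False
        have "N powr (1 - p) * u n x powr p = (u n x / N) powr (p - 1) * u n x"
          using False \<open>N > 0\<close> by (simp add: powr_diff powr_divide)
        moreover have "(u n x / N) powr (p - 1) \<ge> 1"
          using False \<open>N > 0\<close> p by (intro ge_one_powr_ge_zero) auto
        then have "(u n x / N) powr (p - 1) * u n x \<ge> 1 * u n x"
          using nonneg[OF x] by (intro mult_right_mono) auto
        ultimately have "u n x \<le> N powr (1 - p) * u n x powr p" by linarith
        then show ?thesis using \<open>N > 0\<close> False by linarith
      qed simp
      then show "ennreal (u n x) \<le> ennreal (min (u n x) N) + ennreal (N powr (1 - p)) * ennreal (u n x powr p)"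
        using nonneg[OF x, of n] \<open>N > 0\<close>
        by (simp add: ennreal_mult[symmetric] ennreal_plus[symmetric] del: ennreal_plus)
    qed
    also have "\<dots> = (\<integral>\<^sup>+x. min (u n x) N \<partial>M) + ennreal (N powr (1 - p)) * (\<integral>\<^sup>+x. u n x powr p \<partial>M)"
      by (simp add: nn_integral_add nn_integral_cmult)
    also have "\<dots> \<le> (\<integral>\<^sup>+x. min (u n x) N \<partial>M) + ennreal (N powr (1 - p)) * ennreal (max B 0)"
      by (intro add_left_mono mult_left_mono order_trans[OF bound] ennreal_leI) auto
    finally show ?thesis by (simp add: ennreal_mult)
  qed
  show ?thesis
  proof (rule tendsto_zero_ennreal)
    fix r :: real assume "0 < r"
    have "((\<lambda>N. N powr (1 - p) * max B 0) \<longlongrightarrow> 0 * max B 0) at_top"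
      using p by (intro tendsto_intros tendsto_neg_powr filterlim_ident) auto
    then have "\<forall>\<^sub>F N in at_top. N powr (1 - p) * max B 0 < r / 2 \<and> N > 0"
      using \<open>0 < r\<close> by (intro eventually_conj order_tendstoD(2) eventually_gt_at_top) auto
    then obtain N where N: "N powr (1 - p) * max B 0 < r / 2" "N > 0"
      by (auto simp: eventually_at_top_linorder)
    have "\<forall>\<^sub>F n in sequentially. (\<integral>\<^sup>+x. min (u n x) N \<partial>M) < ennreal (r / 2)"
      using trunc[OF N(2)] \<open>0 < r\<close> by (intro order_tendstoD(2)) auto
    then show "\<forall>\<^sub>F n in sequentially. (\<integral>\<^sup>+x. u n x \<partial>M) < ennreal r"
    proof eventually_elim
      case (elim n)
      have "(\<integral>\<^sup>+x. u n x \<partial>M) \<le> (\<integral>\<^sup>+x. min (u n x) N \<partial>M) + ennreal (N powr (1 - p) * max B 0)"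
        by (rule split[OF N(2)])
      also have "\<dots> < ennreal (r / 2) + ennreal (r / 2)"
      proof -
        have "(\<integral>\<^sup>+x. min (u n x) N \<partial>M) + ennreal (N powr (1 - p) * max B 0)
            \<le> ennreal (r / 2) + (\<integral>\<^sup>+x. min (u n x) N \<partial>M)"
          using N(1) by (subst add.commute) (intro add_right_mono ennreal_leI, simp)
        also have "\<dots> < ennreal (r / 2) + ennreal (r / 2)"
          using elim by (subst ennreal_add_left_cancel_less) auto
        finally show ?thesis .
      qed
      also have "\<dots> = ennreal r" using \<open>0 < r\<close> by (simp add: ennreal_plus[symmetric] del: ennreal_plus)
      finally show ?case .
    qed
  qed
qed

section \<open>Power integrals in the distance to the boundary\<close>

definition unit_ivl :: "real measure" where
  "unit_ivl = restrict_space lborel {0<..<1}"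

lemma space_unit_ivl [simp]: "space unit_ivl = {0<..<1}"
  by (simp add: unit_ivl_def space_restrict_space)

lemma measurable_ident_unit_ivl [measurable (raw)]: "(\<lambda>x. x) \<in> borel_measurable unit_ivl"
  unfolding unit_ivl_def by (intro measurable_restrict_space1) auto

lemma measurable_pair_unit_ivl [measurable (raw)]:
  "(\<lambda>x. fst x) \<in> borel_measurable (unit_ivl \<Otimes>\<^sub>M N)" "(\<lambda>x. snd x) \<in> borel_measurable (N \<Otimes>\<^sub>M unit_ivl)"
  using measurable_compose[OF measurable_fst measurable_ident_unit_ivl] measurable_compose[OF measurable_snd measurable_ident_unit_ivl]
  by auto

lemma nn_integral_unit_ivl:
  "(\<integral>\<^sup>+x. f x \<partial>unit_ivl) = (\<integral>\<^sup>+x. f x * indicator {0<..<1} x \<partial>lborel)"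
  by (simp add: unit_ivl_def nn_integral_restrict_space)

lemma emeasure_unit_ivl: "emeasure unit_ivl {0<..<1} = 1"
  by (simp add: unit_ivl_def emeasure_restrict_space)

interpretation unit_ivl: finite_measure unit_ivl
  by standard (simp add: emeasure_unit_ivl)

lemma nn_integral_powr_from_0:
  fixes a c :: real
  assumes "-1 < a" "0 \<le> c"
  shows "(\<integral>\<^sup>+y. ennreal (y powr a) * indicator {0..c} y \<partial>lborel) = ennreal (c powr (a + 1) / (a + 1))"
  by (rule nn_integral_has_integral_lebesgue'[OF _ has_integral_powr_from_0]) (use assms in auto)

lemma nn_integral_powr_to_inf:
  fixes b c :: real
  assumes "1 < b" "0 < c"
  shows "(\<integral>\<^sup>+y. ennreal (y powr - b) * indicator {c..} y \<partial>lborel) = ennreal (c powr (1 - b) / (b - 1))"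
  using nn_integral_has_integral_lebesgue'[OF _ has_integral_powr_to_inf[of "-b" c]] assms
  by (simp add: minus_divide_left[symmetric] divide_minus_right[symmetric] field_simps del: divide_minus_right)

text \<open>The integral is split at \<open>y = x\<close>, where the maximum changes its argument;
  the conditions on \<open>a\<close> and \<open>b\<close> give convergence at 0 and at infinity. The
  kernel stands for \<open>(1 - t * r) powr - b\<close>, with \<open>x\<close> and \<open>y\<close>
  measuring the distances of \<open>r\<close> and \<open>t\<close> from 1.\<close>

lemma nn_integral_powr_max:
  fixes a b x :: real
  assumes "-1 < a" "a + 1 < b" "0 < x"
  shows "(\<integral>\<^sup>+y. y powr a * max x y powr - b \<partial>unit_ivl)
     \<le> ennreal ((1 / (a + 1) + 1 / (b - a - 1)) * x powr (a + 1 - b))"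
proof -
  have "(\<integral>\<^sup>+y. y powr a * max x y powr - b \<partial>unit_ivl)
      = (\<integral>\<^sup>+y. ennreal (y powr a * max x y powr - b) * indicator {0<..<1} y \<partial>lborel)"
    by (rule nn_integral_unit_ivl)
  also have "\<dots> \<le> (\<integral>\<^sup>+y. ennreal (x powr -b) * (ennreal (y powr a) * indicator {0..x} y)
       + ennreal (y powr - (b - a)) * indicator {x..} y \<partial>lborel)"
    using assms by (intro nn_integral_mono)
      (auto simp: indicator_def max_def ennreal_mult[symmetric] powr_add[symmetric] mult.commute)
  also have "\<dots> = ennreal (x powr -b) * ennreal (x powr (a + 1) / (a + 1)) + ennreal (x powr (1 - (b - a)) / (b - a - 1))"
    using nn_integral_powr_from_0[of a x] nn_integral_powr_to_inf[of "b - a" x] assms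
    by (simp add: nn_integral_add nn_integral_cmult)
  also have "\<dots> = ennreal ((1 / (a + 1) + 1 / (b - a - 1)) * x powr (a + 1 - b))"
  proof -
    have "x powr - b * (x powr (a + 1) / (a + 1)) = x powr (a + 1 - b) / (a + 1)"
      by (simp add: powr_add[symmetric])
    moreover have "x powr (1 - (b - a)) = x powr (a + 1 - b)" by (simp add: algebra_simps)
    ultimately show ?thesis
      using assms by (simp add: ennreal_mult[symmetric] ennreal_plus[symmetric] distrib_right del: ennreal_plus)
  qed
  finally show ?thesis .
qed

section \<open>Integration over the circle and the disc\<close>

lemma borel_measurable_continuous_on_comp:
  assumes "continuous_on S f" "h \<in> borel_measurable M" "\<And>x. x \<in> space M \<Longrightarrow> h x \<in> S"
  shows "(\<lambda>x. f (h x)) \<in> borel_measurable M"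
  by (rule measurable_compose[OF _ borel_measurable_continuous_on_restrict[OF assms(1)]])
     (use assms in \<open>auto intro!: measurable_restrict_space2\<close>)

section \<open>Rotation invariance of planar Lebesgue measure\<close>

lemma lborel_complex_eq: "lborel = distr (lborel \<Otimes>\<^sub>M lborel) borel (\<lambda>(x, y). Complex x y)"
proof (rule lborel_eqI)
  have [measurable]: "(\<lambda>(x, y). Complex x y) \<in> borel_measurable (lborel \<Otimes>\<^sub>M lborel)"
    unfolding lborel_prod by (auto simp: case_prod_beta intro!: borel_measurable_continuous_onI continuous_intros)
  fix l u :: complex assume lu: "\<And>b. b \<in> Basis \<Longrightarrow> l \<bullet> b \<le> u \<bullet> b"
  have *: "Re l \<le> Re u" "Im l \<le> Im u" using lu[of 1] lu[of \<i>] by (auto simp: Basis_complex_def inner_complex_def)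
  have "(\<lambda>(x, y). Complex x y) -` box l u \<inter> space (lborel \<Otimes>\<^sub>M lborel) = {Re l<..<Re u} \<times> {Im l<..<Im u}"
    by (auto simp: box_def Basis_complex_def inner_complex_def space_pair_measure)
  then have "emeasure (distr (lborel \<Otimes>\<^sub>M lborel) borel (\<lambda>(x, y). Complex x y)) (box l u)
      = emeasure (lborel \<Otimes>\<^sub>M lborel) ({Re l<..<Re u} \<times> {Im l<..<Im u})"
    by (subst emeasure_distr) auto
  also have "\<dots> = ennreal ((Re u - Re l) * (Im u - Im l))"
    using * by (simp add: lborel.emeasure_pair_measure_Times ennreal_mult)
  also have "(Re u - Re l) * (Im u - Im l) = (\<Prod>b\<in>Basis. (u - l) \<bullet> b)"
    by (simp add: Basis_complex_def inner_complex_def)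
  finally show "emeasure (distr (lborel \<Otimes>\<^sub>M lborel) borel (\<lambda>(x, y). Complex x y)) (box l u)
      = (\<Prod>b\<in>Basis. (u - l) \<bullet> b)" .
qed simp

lemma measurable_Complex [measurable (raw)]:
  assumes [measurable]: "f \<in> borel_measurable M" "g \<in> borel_measurable M"
  shows "(\<lambda>x. Complex (f x) (g x)) \<in> borel_measurable M"
proof -
  have "(\<lambda>x. complex_of_real (f x) + \<i> * complex_of_real (g x)) \<in> borel_measurable M" by measurable
  then show ?thesis by (simp add: complex_eq_iff Complex_eq)
qed

lemma nn_integral_lborel_complex:
  assumes [measurable]: "f \<in> borel_measurable borel"
  shows "(\<integral>\<^sup>+z. f z \<partial>lborel) = (\<integral>\<^sup>+x. \<integral>\<^sup>+y. f (Complex x y) \<partial>lborel \<partial>lborel)"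
    and "(\<integral>\<^sup>+z. f z \<partial>lborel) = (\<integral>\<^sup>+y. \<integral>\<^sup>+x. f (Complex x y) \<partial>lborel \<partial>lborel)"
proof -
  have "(\<integral>\<^sup>+z. f z \<partial>lborel) = (\<integral>\<^sup>+z. (case z of (x, y) \<Rightarrow> f (Complex x y)) \<partial>(lborel \<Otimes>\<^sub>M lborel))"
    by (subst lborel_complex_eq, subst nn_integral_distr) (auto simp: case_prod_beta')
  then show *: "(\<integral>\<^sup>+z. f z \<partial>lborel) = (\<integral>\<^sup>+x. \<integral>\<^sup>+y. f (Complex x y) \<partial>lborel \<partial>lborel)"
    by (subst (asm) lborel.nn_integral_fst[symmetric]) (auto simp: case_prod_beta')
  also have "\<dots> = (\<integral>\<^sup>+y. \<integral>\<^sup>+x. f (Complex x y) \<partial>lborel \<partial>lborel)"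
    by (rule lborel_pair.Fubini') measurable
  finally show "(\<integral>\<^sup>+z. f z \<partial>lborel) = (\<integral>\<^sup>+y. \<integral>\<^sup>+x. f (Complex x y) \<partial>lborel \<partial>lborel)" .
qed

lemma nn_integral_lborel_shear:
  fixes s :: real
  assumes [measurable]: "f \<in> borel_measurable borel"
  shows "(\<integral>\<^sup>+z. f (Complex (Re z + s * Im z) (Im z)) \<partial>lborel) = (\<integral>\<^sup>+z. f z \<partial>lborel)"
    and "(\<integral>\<^sup>+z. f (Complex (Re z) (Im z + s * Re z)) \<partial>lborel) = (\<integral>\<^sup>+z. f z \<partial>lborel)"
proof -
  have "(\<integral>\<^sup>+x. f (Complex x y) \<partial>lborel) = (\<integral>\<^sup>+x. f (Complex (x + s * y) y) \<partial>lborel)" for y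
    using nn_integral_real_affine[of "\<lambda>x. f (Complex x y)" 1 "s * y"] by (simp add: add.commute)
  then show "(\<integral>\<^sup>+z. f (Complex (Re z + s * Im z) (Im z)) \<partial>lborel) = (\<integral>\<^sup>+z. f z \<partial>lborel)"
    by (subst (1 2) nn_integral_lborel_complex(2)) auto
  have "(\<integral>\<^sup>+y. f (Complex x y) \<partial>lborel) = (\<integral>\<^sup>+y. f (Complex x (y + s * x)) \<partial>lborel)" for x
    using nn_integral_real_affine[of "\<lambda>y. f (Complex x y)" 1 "s * x"] by (simp add: add.commute)
  then show "(\<integral>\<^sup>+z. f (Complex (Re z) (Im z + s * Re z)) \<partial>lborel) = (\<integral>\<^sup>+z. f z \<partial>lborel)"
    by (subst (1 2) nn_integral_lborel_complex(1)) auto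
qed

text \<open>A rotation that is not real is a product of three shears.\<close>
lemma nn_integral_lborel_rotate:
  fixes c :: complex and f :: "complex \<Rightarrow> ennreal"
  assumes [measurable]: "f \<in> borel_measurable borel" and c: "norm c = 1"
  shows "(\<integral>\<^sup>+z. f (c * z) \<partial>lborel) = (\<integral>\<^sup>+z. f z \<partial>lborel)"
proof -
  have *: "(\<integral>\<^sup>+z. f (c * z) \<partial>lborel) = (\<integral>\<^sup>+z. f z \<partial>lborel)"
    if [measurable]: "f \<in> borel_measurable borel" and c: "norm c = 1" and i: "Im c \<noteq> 0" for f :: "complex \<Rightarrow> ennreal" and c
  proof -
    \<comment> \<open>For \<open>c = cis \<theta>\<close> this is
      \<open>- tan (\<theta> / 2)\<close>, the parameter of the two outer shears; the middle one has
      parameter \<open>sin \<theta>\<close>.\<close>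
    define \<tau> where "\<tau> = (Re c - 1) / Im c"
    have c2: "(Re c)\<^sup>2 + (Im c)\<^sup>2 = 1" using c by (simp add: cmod_def)
    then have im: "Im c * Im c = 1 - Re c * Re c" by (simp add: power2_eq_square)
    have t1: "\<tau> * Im c = Re c - 1" using i by (simp add: \<tau>_def)
    have t2: "\<tau> + \<tau> * Re c = - Im c"
    proof -
      have "\<tau> + \<tau> * Re c = (Re c * Re c - 1) / Im c" using i by (simp add: \<tau>_def field_simps)
      also have "\<dots> = - Im c" using i im by (simp add: field_simps)
      finally show ?thesis .
    qed
    let ?S = "\<lambda>s z. Complex (Re z + s * Im z) (Im z)" and ?R = "\<lambda>s z. Complex (Re z) (Im z + s * Re z)"
    have dec: "c * z = ?S \<tau> (?R (Im c) (?S \<tau> z))" for z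
    proof (rule complex_eqI)
      have "Re z + \<tau> * Im z + \<tau> * (Im z + Im c * (Re z + \<tau> * Im z))
        = Re z * (1 + \<tau> * Im c) + Im z * (\<tau> + \<tau> * (1 + \<tau> * Im c))" by (simp add: algebra_simps)
      also have "\<dots> = Re z * Re c - Im z * Im c" using t1 t2 by (simp add: algebra_simps)
      finally show "Re (c * z) = Re (?S \<tau> (?R (Im c) (?S \<tau> z)))" by (simp add: mult_ac)
      have "Im z + Im c * (Re z + \<tau> * Im z) = Im z * (1 + \<tau> * Im c) + Im c * Re z"
        by (simp add: algebra_simps)
      also have "\<dots> = Im z * Re c + Im c * Re z" using t1 by simp
      finally show "Im (c * z) = Im (?S \<tau> (?R (Im c) (?S \<tau> z)))" by (simp add: mult_ac)
    qed
    have "(\<integral>\<^sup>+z. f (c * z) \<partial>lborel) = (\<integral>\<^sup>+z. f (?S \<tau> (?R (Im c) (?S \<tau> z))) \<partial>lborel)"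
      by (simp only: dec)
    also have "\<dots> = (\<integral>\<^sup>+z. f (?S \<tau> (?R (Im c) z)) \<partial>lborel)"
      by (rule nn_integral_lborel_shear(1)[of "\<lambda>z. f (?S \<tau> (?R (Im c) z))"]) measurable
    also have "\<dots> = (\<integral>\<^sup>+z. f (?S \<tau> z) \<partial>lborel)"
      by (rule nn_integral_lborel_shear(2)[of "\<lambda>z. f (?S \<tau> z)"]) measurable
    also have "\<dots> = (\<integral>\<^sup>+z. f z \<partial>lborel)"
      by (rule nn_integral_lborel_shear(1)) measurable
    finally show ?thesis .
  qed
  show ?thesis
  proof (cases "Im c = 0")
    case True
    \<comment> \<open>For real \<open>c\<close> the substitution of \<open>\<i> * z\<close> is
      inserted first: neither \<open>\<i>\<close> nor \<open>c * \<i>\<close> is real, so the case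
      already treated applies twice.\<close>
    with c have "Im (c * \<i>) \<noteq> 0" by (auto simp: cmod_def)
    have "(\<integral>\<^sup>+z. f (c * z) \<partial>lborel) = (\<integral>\<^sup>+z. f (c * (\<i> * z)) \<partial>lborel)"
      by (rule *[symmetric]) auto
    also have "\<dots> = (\<integral>\<^sup>+z. f ((c * \<i>) * z) \<partial>lborel)" by (simp add: mult.assoc)
    also have "\<dots> = (\<integral>\<^sup>+z. f z \<partial>lborel)"
      by (rule *) (use c \<open>Im (c * \<i>) \<noteq> 0\<close> in \<open>auto simp: norm_mult\<close>)
    finally show ?thesis .
  qed (use * c in auto)
qed

text \<open>Arc length normalized to mass one. The underlying space is the circle itself, so that
  \<open>norm w = 1\<close> becomes membership in the space; the half-open interval of angles meets
  each point once.\<close>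

definition circ :: "complex measure" where
  "circ = distr (density lborel (\<lambda>t::real. ennreal (1 / (2 * pi)) * indicator {0..<2 * pi} t))
     (restrict_space borel (sphere 0 1)) cis"

lemma space_circ [simp]: "space circ = sphere 0 1"
  by (simp add: circ_def space_restrict_space)

lemma sets_circ [measurable_cong]: "sets circ = sets (restrict_space borel (sphere 0 1))"
  by (simp add: circ_def)

lemma measurable_cis [measurable]: "cis \<in> borel \<rightarrow>\<^sub>M restrict_space borel (sphere 0 1)"
  by (intro measurable_restrict_space2 borel_measurable_continuous_onI continuous_intros) auto

lemma measurable_cis' [measurable]: "cis \<in> borel \<rightarrow>\<^sub>M circ"
  by measurable

lemma measurable_ident_circ [measurable (raw)]: "(\<lambda>z. z) \<in> borel_measurable circ"
  unfolding measurable_cong_sets[OF sets_circ refl] by (intro measurable_restrict_space1) simp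

lemma measurable_pair_circ [measurable (raw)]:
  "(\<lambda>x. fst x) \<in> borel_measurable (circ \<Otimes>\<^sub>M N)" "(\<lambda>x. snd x) \<in> borel_measurable (N \<Otimes>\<^sub>M circ)"
  using measurable_compose[OF measurable_fst measurable_ident_circ] measurable_compose[OF measurable_snd measurable_ident_circ]
  by auto

lemma nn_integral_circ:
  assumes [measurable]: "f \<in> borel_measurable circ"
  shows "(\<integral>\<^sup>+z. f z \<partial>circ)
    = (\<integral>\<^sup>+t. ennreal (1 / (2 * pi)) * (indicator {0..<2 * pi} t * f (cis t)) \<partial>lborel)"
proof -
  have [measurable]: "f \<in> borel_measurable (restrict_space borel (sphere 0 1))"
    using assms by (simp only: measurable_cong_sets[OF sets_circ refl])
  show ?thesis
    unfolding circ_def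
    by (subst nn_integral_distr, measurable, subst nn_integral_density, measurable) (simp add: mult.assoc)
qed

lemma emeasure_circ: "emeasure circ (sphere 0 1) = 1"
proof -
  have "emeasure circ (space circ) = (\<integral>\<^sup>+z. 1 \<partial>circ)" by simp
  also have "\<dots> = ennreal (1 / (2 * pi)) * (\<integral>\<^sup>+t. indicator {0..<2 * pi} t \<partial>lborel)"
    by (subst nn_integral_circ) (auto simp: nn_integral_cmult)
  also have "\<dots> = 1" by (simp add: ennreal_mult[symmetric] del: ennreal_mult)
  finally show ?thesis by simp
qed

interpretation circ: finite_measure circ
  by standard (simp add: emeasure_circ)

lemma AE_circ:
  assumes "AE t in lborel. P (cis t)" and [measurable]: "{z \<in> space circ. P z} \<in> sets circ"
  shows "AE z in circ. P z"
proof -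
  have [measurable]: "{z \<in> space (restrict_space borel (sphere 0 1)). P z} \<in> sets (restrict_space borel (sphere 0 1))"
    using assms(2) by (simp add: sets_circ space_restrict_space)
  have "AE t in lborel. 0 < ennreal (1 / (2 * pi)) * (indicator {0..<2 * pi} t) \<longrightarrow> P (cis t)"
    using assms(1) by eventually_elim auto
  then show ?thesis
    unfolding circ_def by (subst AE_distr_iff, measurable, subst AE_density, measurable)
qed

lemma measurable_circ_mult: "norm \<eta> = 1 \<Longrightarrow> (\<lambda>z. \<eta> * z) \<in> circ \<rightarrow>\<^sub>M circ"
  unfolding measurable_cong_sets[OF refl sets_circ]
  by (intro measurable_restrict_space2) (auto simp: norm_mult)

lemma nn_integral_circ_rotate:
  assumes [measurable]: "f \<in> borel_measurable circ" and \<eta>: "norm \<eta> = 1"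
  shows "(\<integral>\<^sup>+z. f (\<eta> * z) \<partial>circ) = (\<integral>\<^sup>+z. f z \<partial>circ)"
proof -
  define s where "s = Arg2pi \<eta>"
  have s: "0 \<le> s" "s < 2 * pi" "\<eta> = cis s"
    using Arg2pi[of \<eta>] \<eta> unfolding s_def is_Arg_def cis_conv_exp by auto
  define h where "h t = f (cis t)" for t
  have [measurable]: "h \<in> borel_measurable borel" unfolding h_def by measurable
  have per: "h (2 * pi + t) = h t" for t by (simp add: h_def cis_mult[symmetric])
  note [measurable] = measurable_compose[OF measurable_circ_mult[OF \<eta>] assms(1)]
  have "(\<integral>\<^sup>+z. f (\<eta> * z) \<partial>circ)
      = ennreal (1 / (2 * pi)) * (\<integral>\<^sup>+t. indicator {0..<2 * pi} t * h (s + t) \<partial>lborel)"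
    by (subst nn_integral_circ, measurable) (simp add: nn_integral_cmult h_def s(3) cis_mult)
  also have "(\<integral>\<^sup>+t. indicator {0..<2 * pi} t * h (s + t) \<partial>lborel)
      = (\<integral>\<^sup>+t. indicator {s..<s + 2 * pi} (s + t) * h (s + t) \<partial>lborel)"
    by (intro nn_integral_cong) (auto simp: indicator_def)
  also have "\<dots> = (\<integral>\<^sup>+t. indicator {s..<s + 2 * pi} t * h t \<partial>lborel)"
    using nn_integral_real_affine[of "\<lambda>t. indicator {s..<s + 2 * pi} t * h t" 1 s] by simp
  \<comment> \<open>The shifted interval is cut at \<open>2 * pi\<close>, and the overhang is moved
    back by one period.\<close>
  also have "\<dots> = (\<integral>\<^sup>+t. indicator {s..<2 * pi} t * h t + indicator {2 * pi..<s + 2 * pi} t * h t \<partial>lborel)"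
    using s by (intro nn_integral_cong) (auto simp: indicator_def)
  also have "\<dots> = (\<integral>\<^sup>+t. indicator {s..<2 * pi} t * h t \<partial>lborel)
      + (\<integral>\<^sup>+t. indicator {2 * pi..<s + 2 * pi} t * h t \<partial>lborel)"
    by (rule nn_integral_add) measurable
  also have "(\<integral>\<^sup>+t. indicator {2 * pi..<s + 2 * pi} t * h t \<partial>lborel)
      = (\<integral>\<^sup>+t. indicator {2 * pi..<s + 2 * pi} (2 * pi + t) * h (2 * pi + t) \<partial>lborel)"
    using nn_integral_real_affine[of "\<lambda>t. indicator {2 * pi..<s + 2 * pi} t * h t" 1 "2 * pi"] by simp
  also have "\<dots> = (\<integral>\<^sup>+t. indicator {0..<s} t * h t \<partial>lborel)"
    by (intro nn_integral_cong) (auto simp: indicator_def per)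
  also have "(\<integral>\<^sup>+t. indicator {s..<2 * pi} t * h t \<partial>lborel) + \<dots>
      = (\<integral>\<^sup>+t. indicator {s..<2 * pi} t * h t + indicator {0..<s} t * h t \<partial>lborel)"
    by (rule nn_integral_add[symmetric]) measurable
  also have "\<dots> = (\<integral>\<^sup>+t. indicator {0..<2 * pi} t * h t \<partial>lborel)"
    using s by (intro nn_integral_cong) (auto simp: indicator_def)
  also have "ennreal (1 / (2 * pi)) * \<dots> = (\<integral>\<^sup>+z. f z \<partial>circ)"
    by (subst nn_integral_circ, measurable) (simp add: nn_integral_cmult h_def)
  finally show ?thesis .
qed

definition disc :: "complex measure" where
  "disc = restrict_space lborel unit_disc"

lemma space_disc [simp]: "space disc = unit_disc"
  by (simp add: disc_def space_restrict_space)

lemma measurable_ident_disc [measurable (raw)]: "(\<lambda>x. x) \<in> borel_measurable disc"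
  unfolding disc_def by (intro measurable_restrict_space1) auto

lemma measurable_pair_disc [measurable (raw)]:
  "(\<lambda>x. fst x) \<in> borel_measurable (disc \<Otimes>\<^sub>M N)" "(\<lambda>x. snd x) \<in> borel_measurable (N \<Otimes>\<^sub>M disc)"
  using measurable_compose[OF measurable_fst measurable_ident_disc] measurable_compose[OF measurable_snd measurable_ident_disc]
  by auto

lemma nn_integral_disc:
  "(\<integral>\<^sup>+x. f x \<partial>disc) = (\<integral>\<^sup>+x. f x * indicator unit_disc x \<partial>lborel)"
  by (simp add: disc_def nn_integral_restrict_space)

interpretation disc: finite_measure disc
  by standard (simp add: disc_def emeasure_restrict_space emeasure_ball)

text \<open>For \<open>0 \<le> a < 1\<close> the condition \<open>a < 1 - (norm z)\<^sup>2\<close>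
  describes a disc of area \<open>pi * (1 - a)\<close>, so this quantity is uniformly distributed.
  With it as the radial variable, polar coordinates carry no Jacobian factor.\<close>

lemma distr_disc_norm:
  "distr disc borel (\<lambda>z. 1 - (norm z)\<^sup>2) = density lborel (\<lambda>x::real. ennreal pi * indicator {0<..<1} x)"
proof (rule measure_eqI_lessThan)
  fix a :: real
  have "emeasure (distr disc borel (\<lambda>z. 1 - (norm z)\<^sup>2)) {a<..}
      = emeasure disc ((\<lambda>z. 1 - (norm z)\<^sup>2) -` {a<..} \<inter> space disc)"
    by (rule emeasure_distr) auto
  also have "(\<lambda>z. 1 - (norm z)\<^sup>2) -` {a<..} \<inter> space disc
      = (if a < 1 then ball 0 (min 1 (sqrt (1 - a))) else {})"
  proof -
    have "norm z < sqrt (1 - a) \<longleftrightarrow> a < 1 - (norm z)\<^sup>2" if "a < 1" for z :: complex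
      using that real_less_rsqrt[of "norm z" "1 - a"] real_sqrt_less_iff[of "(norm z)\<^sup>2" "1 - a"]
      by (auto simp: algebra_simps)
    moreover have "\<not> a < 1 - (norm z)\<^sup>2" if "\<not> a < 1" for z :: complex
      using that zero_le_power2[of "norm z"] by linarith
    ultimately show ?thesis by auto
  qed
  also have "emeasure disc \<dots> = (if a < 1 then ennreal (pi * (min 1 (1 - a))) else 0)"
  proof (cases "a < 1")
    case True
    have "emeasure disc (ball 0 (min 1 (sqrt (1 - a))))
        = emeasure lborel (ball 0 (min 1 (sqrt (1 - a))) :: complex set)"
      unfolding disc_def by (rule emeasure_restrict_space) auto
    also have "\<dots> = ennreal (pi * (min 1 (sqrt (1 - a)))\<^sup>2)"
      using True by (subst emeasure_ball) (auto simp: eval_unit_ball_vol)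
    also have "(min 1 (sqrt (1 - a)))\<^sup>2 = min 1 (1 - a)"
      using True by (auto simp: min_def)
    finally show ?thesis using True by simp
  qed simp
  also have "\<dots> = emeasure (density lborel (\<lambda>x::real. ennreal pi * indicator {0<..<1} x)) {a<..}"
  proof -
    have "emeasure (density lborel (\<lambda>x::real. ennreal pi * indicator {0<..<1} x)) {a<..}
       = (\<integral>\<^sup>+x. ennreal pi * indicator {max 0 a<..<1} x \<partial>lborel)"
      by (subst emeasure_density) (auto intro!: nn_integral_cong simp: indicator_def)
    also have "\<dots> = ennreal pi * ennreal (if a < 1 then min 1 (1 - a) else 0)"
      by (auto simp: nn_integral_cmult_indicator max_def min_def)
    finally show ?thesis by (auto simp: ennreal_mult)
  qed
  finally show *: "emeasure (distr disc borel (\<lambda>z. 1 - (norm z)\<^sup>2)) {a<..}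
      = emeasure (density lborel (\<lambda>x::real. ennreal pi * indicator {0<..<1} x)) {a<..}" .
  have "emeasure (density lborel (\<lambda>x::real. ennreal pi * indicator {0<..<1} x)) {a<..}
      \<le> (\<integral>\<^sup>+x. ennreal pi * indicator {0<..<1::real} x \<partial>lborel)"
    by (subst emeasure_density) (auto intro!: nn_integral_mono simp: indicator_def)
  also have "\<dots> < \<infinity>" by (simp add: nn_integral_cmult_indicator)
  finally show "emeasure (distr disc borel (\<lambda>z. 1 - (norm z)\<^sup>2)) {a<..} < \<infinity>"
    by (simp add: *)
qed auto

text \<open>By rotation invariance the integrand may be averaged over all rotations, which makes it
  radial; a radial integrand depends only on the uniformly distributed
  \<open>1 - (norm z)\<^sup>2\<close>. This replaces a change of variables in the plane.\<close>

lemma nn_integral_disc_polar: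
  fixes h :: "complex \<Rightarrow> ennreal"
  assumes h: "h \<in> borel_measurable disc"
  shows "(\<integral>\<^sup>+z. h z \<partial>disc) = ennreal pi * (\<integral>\<^sup>+x. (\<integral>\<^sup>+w. h (sqrt (1 - x) * w) \<partial>circ) \<partial>unit_ivl)"
proof -
  interpret P: pair_sigma_finite circ "lborel :: complex measure" ..
  define H where "H z = h z * indicator unit_disc z" for z
  have [measurable]: "H \<in> borel_measurable borel"
    unfolding H_def using h unfolding disc_def by (subst (asm) borel_measurable_restrict_space_iff_ennreal) auto
  define m where "m r = (\<integral>\<^sup>+w. H (complex_of_real r * w) \<partial>circ)" for r
  have [measurable]: "m \<in> borel_measurable borel" unfolding m_def by measurable
  have m0: "m r = 0" if "1 \<le> r" for r
  proof -
    have "m r = (\<integral>\<^sup>+w. 0 \<partial>circ)" unfolding m_def H_def using that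
      by (intro nn_integral_cong) (auto simp: norm_mult)
    then show ?thesis by simp
  qed
  have circ_H: "(\<integral>\<^sup>+w. H (w * z) \<partial>circ) = m (norm z)" for z
  proof -
    define \<eta> where "\<eta> = (if z = 0 then 1 else sgn z)"
    have \<eta>: "norm \<eta> = 1" "z = norm z * \<eta>"
      by (auto simp: \<eta>_def norm_sgn sgn_eq norm_divide)
    have "(\<integral>\<^sup>+w. H (w * z) \<partial>circ) = (\<integral>\<^sup>+w. H (norm z * (\<eta> * w)) \<partial>circ)"
      by (subst \<eta>(2)) (simp add: mult_ac)
    also have "\<dots> = m (norm z)"
      unfolding m_def by (rule nn_integral_circ_rotate[OF _ \<eta>(1)]) measurable
    finally show ?thesis .
  qed
  have "(\<integral>\<^sup>+z. h z \<partial>disc) = (\<integral>\<^sup>+z. H z \<partial>lborel)"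
    by (simp add: nn_integral_disc H_def)
  also have "\<dots> = (\<integral>\<^sup>+w. (\<integral>\<^sup>+z. H z \<partial>lborel) \<partial>circ)"
    by (simp add: emeasure_circ)
  also have "\<dots> = (\<integral>\<^sup>+w. (\<integral>\<^sup>+z. H (w * z) \<partial>lborel) \<partial>circ)"
    by (intro nn_integral_cong nn_integral_lborel_rotate[symmetric]) auto
  also have "\<dots> = (\<integral>\<^sup>+z. (\<integral>\<^sup>+w. H (w * z) \<partial>circ) \<partial>lborel)"
    by (rule P.Fubini'[symmetric]) measurable
  also have "\<dots> = (\<integral>\<^sup>+z. m (norm z) \<partial>(lborel :: complex measure))" by (simp add: circ_H)
  also have "\<dots> = (\<integral>\<^sup>+z. m (norm z) \<partial>disc)"
    unfolding nn_integral_disc by (auto intro!: nn_integral_cong simp: indicator_def m0)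
  also have "\<dots> = (\<integral>\<^sup>+z. m (sqrt (1 - (1 - (norm z)\<^sup>2))) \<partial>disc)" by simp
  also have "\<dots> = (\<integral>\<^sup>+x. m (sqrt (1 - x)) \<partial>distr disc borel (\<lambda>z. 1 - (norm z)\<^sup>2))"
    by (rule nn_integral_distr[symmetric]) auto
  also have "\<dots> = (\<integral>\<^sup>+x. ennreal pi * (indicator {0<..<1} x * m (sqrt (1 - x))) \<partial>lborel)"
    unfolding distr_disc_norm by (subst nn_integral_density) (auto simp: mult.assoc)
  also have "\<dots> = ennreal pi * (\<integral>\<^sup>+x. m (sqrt (1 - x)) \<partial>unit_ivl)"
    by (subst nn_integral_cmult) (auto simp: nn_integral_unit_ivl mult.commute)
  also have "(\<integral>\<^sup>+x. m (sqrt (1 - x)) \<partial>unit_ivl)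
      = (\<integral>\<^sup>+x. (\<integral>\<^sup>+w. h (sqrt (1 - x) * w) \<partial>circ) \<partial>unit_ivl)"
    unfolding m_def H_def
    by (intro nn_integral_cong) (auto simp: norm_mult indicator_def)
  finally show ?thesis .
qed

section \<open>Cauchy and Poisson integrals over the circle\<close>

lemma circ_continuous:
  fixes f :: "complex \<Rightarrow> 'a :: {banach, second_countable_topology}"
  assumes "continuous_on (sphere 0 1) f"
  shows borel_measurable_circ_continuous: "f \<in> borel_measurable circ"
    and integrable_circ_continuous: "integrable circ f"
proof -
  show [measurable]: "f \<in> borel_measurable circ"
    unfolding measurable_cong_sets[OF sets_circ refl]
    by (rule borel_measurable_continuous_on_restrict) fact
  have "bounded (f ` sphere 0 1)"
    by (intro compact_imp_bounded compact_continuous_image assms) auto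
  then obtain B where "\<forall>z\<in>sphere 0 1. norm (f z) \<le> B" by (auto simp: bounded_iff)
  then show "integrable circ f"
    by (intro circ.integrable_const_bound[where B = B]) auto
qed

text \<open>The extra factor \<open>w\<close> comes from dw = i w dt, and division by
  \<open>2 * pi * \<i>\<close> turns the contour integral into a mean over
  \<open>circ\<close>.\<close>

lemma has_contour_integral_circ:
  assumes "(f has_contour_integral I) (circlepath 0 1)" and cont: "continuous_on (sphere 0 1) f"
  shows "has_bochner_integral circ (\<lambda>w. f w * w) (I / (2 * pi * \<i>))"
proof -
  have cont': "continuous_on (sphere 0 1) (\<lambda>w. f w * w)" by (intro continuous_intros cont)
  have ct: "continuous_on UNIV (\<lambda>t. f (cis t) * cis t)"
    by (rule continuous_on_compose2[OF cont', of _ cis]) (auto intro!: continuous_intros)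
  have [measurable]: "(\<lambda>t. f (cis t) * cis t) \<in> borel_measurable borel"
    by (rule borel_measurable_continuous_onI[OF ct])
  have si: "set_integrable lborel {0..2 * pi} (\<lambda>t. f (cis t) * cis t)"
    by (rule borel_integrable_atLeastAtMost') (rule continuous_on_subset[OF ct], simp)
  have "((\<lambda>t. f (cis t) * \<i> * cis t) has_integral I) {0..2 * pi}"
    using assms(1) unfolding circlepath_def
    by (subst (asm) has_contour_integral_part_circlepath_iff) auto
  then have "((\<lambda>t. f (cis t) * cis t) has_integral (I / \<i>)) {0..2 * pi}"
    by (drule_tac has_integral_mult_left[where c = "1 / \<i>"]) (simp add: field_simps)
  then have "I / \<i> = (LINT t:{0..2 * pi}|lborel. f (cis t) * cis t)"
    using set_borel_integral_eq_integral(2)[OF si] by (simp add: integral_unique)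
  also have "\<dots> = (LINT t|lborel. indicator {0..<2 * pi} t *\<^sub>R (f (cis t) * cis t))"
    unfolding set_lebesgue_integral_def using AE_lborel_singleton[of "2 * pi"]
    by (intro integral_cong_AE) (auto simp: indicator_def elim!: eventually_mono)
  finally have *: "(LINT t|lborel. indicator {0..<2 * pi} t *\<^sub>R (f (cis t) * cis t)) = I / \<i>" by simp
  have m: "(\<lambda>w. f w * w) \<in> borel_measurable (restrict_space borel (sphere 0 1))"
    by (rule borel_measurable_continuous_on_restrict[OF cont'])
  have dens: "(\<lambda>t. ennreal (1 / (2 * pi)) * indicator {0..<2 * pi} t)
      = (\<lambda>t. ennreal (1 / (2 * pi) * indicator {0..<2 * pi} t))"
    by (auto simp: fun_eq_iff indicator_def)
  have "(LINT w|circ. f w * w) = (LINT t|density lborel (\<lambda>t. ennreal (1 / (2 * pi) * indicator {0..<2 * pi} t)). f (cis t) * cis t)"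
unfolding circ_def using m by (subst integral_distr) (auto simp: dens)
  also have "\<dots> = (LINT t|lborel. (1 / (2 * pi) * indicator {0..<2 * pi} t) *\<^sub>R (f (cis t) * cis t))"
    by (subst integral_density) auto
  also have "\<dots> = (LINT t|lborel. (1 / (2 * pi)) *\<^sub>R (indicator {0..<2 * pi} t *\<^sub>R (f (cis t) * cis t)))"
    by (intro Bochner_Integration.integral_cong) (auto simp: indicator_def)
  also have "\<dots> = (1 / (2 * pi)) *\<^sub>R (I / \<i>)"
    by (subst integral_scaleR_right) (simp add: *)
  also have "\<dots> = I / (2 * pi * \<i>)" by (simp add: scaleR_conv_of_real divide_simps mult.left_commute[of \<i> I])
  finally show ?thesis
    using integrable_circ_continuous[OF cont'] by (simp add: has_bochner_integral_iff)
qed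

lemma cauchy_integral_circ:
  assumes "continuous_on (cball 0 1) f" "f holomorphic_on unit_disc" "norm z < 1"
  shows "has_bochner_integral circ (\<lambda>w. f w * w / (w - z) ^ Suc k) ((deriv ^^ k) f z / fact k)"
proof -
  have c: "continuous_on (sphere 0 1) f" using assms(1) by (rule continuous_on_subset) auto
  have ne: "w - z \<noteq> 0" if "norm w = 1" for w using that assms(3) by auto
  have "has_bochner_integral circ (\<lambda>w. f w / (w - z) ^ Suc k * w)
     ((2 * pi * \<i>) / (fact k) * (deriv ^^ k) f z / (2 * pi * \<i>))"
  proof (rule has_contour_integral_circ)
    show "((\<lambda>u. f u / (u - z) ^ Suc k) has_contour_integral (2 * pi * \<i>) / fact k * (deriv ^^ k) f z) (circlepath 0 1)"
      using Cauchy_has_contour_integral_higher_derivative_circlepath[OF assms(1,2), of z k] assms(3) by simp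
    show "continuous_on (sphere 0 1) (\<lambda>u. f u / (u - z) ^ Suc k)"
      using ne by (intro continuous_intros c) auto
  qed
  then show ?thesis by (simp add: field_simps)
qed

text \<open>Cauchy's formula at \<open>z\<close> is applied to
  \<open>F w = f w * (1 - (norm z)\<^sup>2) / (1 - cnj z * w)\<close>, which is holomorphic in
  \<open>w\<close> and has the value \<open>f z\<close> at \<open>z\<close>. On the circle
  \<open>(w - z) * (1 - cnj z * w)\<close> equals \<open>w\<close> times the square of
  \<open>norm (w - z)\<close>.\<close>

lemma poisson_integral_circ:
  assumes "continuous_on (cball 0 1) f" "f holomorphic_on unit_disc" and z: "norm z < 1"
  shows "has_bochner_integral circ (\<lambda>w. f w * ((1 - (norm z)\<^sup>2) / (norm (w - z))\<^sup>2)) (f z)"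
proof -
  have ne: "1 - cnj z * w \<noteq> 0" if "norm w \<le> 1" for w
  proof
    assume "1 - cnj z * w = 0"
    then have "norm (cnj z * w) = 1" by simp
    moreover have "norm (cnj z * w) \<le> norm z * 1"
      unfolding norm_mult complex_mod_cnj using that by (intro mult_left_mono) auto
    ultimately show False using z by simp
  qed
  define F where "F w = f w * (1 - (norm z)\<^sup>2) / (1 - cnj z * w)" for w
  have "has_bochner_integral circ (\<lambda>w. F w * w / (w - z) ^ Suc 0) ((deriv ^^ 0) F z / fact 0)"
  proof (rule cauchy_integral_circ[OF _ _ z])
    show "continuous_on (cball 0 1) F"
      unfolding F_def using ne by (intro continuous_intros assms) auto
    show "F holomorphic_on unit_disc"
      unfolding F_def using ne by (intro holomorphic_intros assms) auto
  qed
  moreover have 0: "(deriv ^^ 0) F z / fact 0 = f z"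
    using ne[of z] z by (simp add: F_def complex_norm_square[symmetric] mult.commute[of "cnj z"])
  moreover have eq: "F w * w / (w - z) ^ Suc 0 = f w * ((1 - (norm z)\<^sup>2) / (norm (w - z))\<^sup>2)"
    if "w \<in> space circ" for w
  proof -
    have w: "norm w = 1" using that by simp
    then have ww: "w * cnj w = 1" by (simp add: complex_norm_square[symmetric])
    have w0: "w \<noteq> 0" using w by auto
    have "complex_of_real ((norm (w - z))\<^sup>2) = (w - z) * (cnj w - cnj z)"
      using complex_norm_square[of "w - z"] by simp
    also have "\<dots> * w = (w - z) * (w * cnj w - cnj z * w)" by (simp add: algebra_simps)
    also have "\<dots> = (w - z) * (1 - cnj z * w)" by (simp add: ww)
    finally have *: "(w - z) * (1 - cnj z * w) = complex_of_real ((norm (w - z))\<^sup>2) * w" by simp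
    have "F w * w / (w - z) ^ Suc 0 = f w * (1 - (norm z)\<^sup>2) * w / ((w - z) * (1 - cnj z * w))"
      by (simp add: F_def)
    also have "\<dots> = f w * ((1 - (norm z)\<^sup>2) / (norm (w - z))\<^sup>2)"
      unfolding * using w0 by simp
    finally show ?thesis .
  qed
  moreover have "has_bochner_integral circ (\<lambda>w. F w * w / (w - z) ^ Suc 0) ((deriv ^^ 0) F z / fact 0)
     \<longleftrightarrow> has_bochner_integral circ (\<lambda>w. f w * ((1 - (norm z)\<^sup>2) / (norm (w - z))\<^sup>2)) (f z)"
    by (rule has_bochner_integral_cong[OF refl eq 0])
  ultimately show ?thesis by blast
qed

text \<open>This is the Poisson formula for the constant 1. The kernel estimates on the circle below
  are all reduced to the power -2 of \<open>norm (w - z)\<close>, for which the integral is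
  exact.\<close>

lemma nn_integral_poisson_kernel:
  assumes "norm z < 1"
  shows "(\<integral>\<^sup>+w. ennreal (1 / (norm (w - z))\<^sup>2) \<partial>circ) = ennreal (1 / (1 - (norm z)\<^sup>2))"
proof -
  have z2: "0 < 1 - (norm z)\<^sup>2" using assms by (simp add: power_less_one_iff)
  have ne: "w - z \<noteq> 0" if "norm w = 1" for w using that assms by auto
  have "has_bochner_integral circ (\<lambda>w. 1 * complex_of_real ((1 - (norm z)\<^sup>2) / (norm (w - z))\<^sup>2)) 1"
    by (rule poisson_integral_circ) (use assms in auto)
  from has_bochner_integral_Re[OF this]
  have *: "has_bochner_integral circ (\<lambda>w. (1 - (norm z)\<^sup>2) / (norm (w - z))\<^sup>2) 1"
    unfolding mult_1 Re_complex_of_real by simp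
  have "(\<integral>\<^sup>+w. ennreal (1 / (norm (w - z))\<^sup>2) \<partial>circ)
    = (\<integral>\<^sup>+w. ennreal (1 / (1 - (norm z)\<^sup>2)) * ennreal ((1 - (norm z)\<^sup>2) / (norm (w - z))\<^sup>2) \<partial>circ)"
    using z2 by (simp add: ennreal_mult[symmetric])
  also have "\<dots> = ennreal (1 / (1 - (norm z)\<^sup>2)) * (\<integral>\<^sup>+w. ennreal ((1 - (norm z)\<^sup>2) / (norm (w - z))\<^sup>2) \<partial>circ)"
    by (rule nn_integral_cmult) simp
  also have "(\<integral>\<^sup>+w. ennreal ((1 - (norm z)\<^sup>2) / (norm (w - z))\<^sup>2) \<partial>circ) = 1"
    using * z2 by (subst nn_integral_eq_integral) (auto simp: has_bochner_integral_iff)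
  finally show ?thesis by simp
qed

text \<open>A convolution on the circle group: Jensen's inequality for the weight \<open>k\<close>,
  then Fubini, after which the integral of \<open>B powr p\<close> is the same for every rotation.
  \<open>A\<close> is merely dominated by the convolution, as the modulus of a holomorphic function
  is by an integral of moduli.\<close>

lemma nn_integral_circ_young:
  fixes A B k :: "complex \<Rightarrow> real"
  assumes [measurable]: "B \<in> borel_measurable circ" "k \<in> borel_measurable circ"
    and nonneg: "\<And>w. norm w = 1 \<Longrightarrow> 0 \<le> B w" "\<And>w. norm w = 1 \<Longrightarrow> 0 \<le> k w" and p: "1 < p" and K: "0 \<le> K"
    and A: "\<And>\<eta>. norm \<eta> = 1 \<Longrightarrow> 0 \<le> A \<eta> \<and> ennreal (A \<eta>) \<le> (\<integral>\<^sup>+w. B (\<eta> * w) * k w \<partial>circ)"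
    and k: "(\<integral>\<^sup>+w. k w \<partial>circ) \<le> ennreal K"
  shows "(\<integral>\<^sup>+\<eta>. A \<eta> powr p \<partial>circ) \<le> ennreal (K powr p) * (\<integral>\<^sup>+w. B w powr p \<partial>circ)"
proof -
  interpret P: pair_sigma_finite circ circ ..
  have mult: "(\<lambda>x. fst x * snd x) \<in> circ \<Otimes>\<^sub>M circ \<rightarrow>\<^sub>M circ"
    unfolding measurable_cong_sets[OF refl sets_circ]
    by (intro measurable_restrict_space2) (auto simp: norm_mult space_pair_measure)
  have m[measurable]: "(\<lambda>(\<eta>, w). B (\<eta> * w)) \<in> borel_measurable (circ \<Otimes>\<^sub>M circ)"
    using measurable_compose[OF mult assms(1)] by (simp add: case_prod_beta')
  have m1: "(\<lambda>w. B (\<eta> * w)) \<in> borel_measurable circ" if "norm \<eta> = 1" for \<eta>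
    using measurable_compose[OF measurable_Pair1'[of \<eta> circ circ] m] that by simp
  have "(\<integral>\<^sup>+\<eta>. A \<eta> powr p \<partial>circ)
      \<le> (\<integral>\<^sup>+\<eta>. ennreal (K powr (p - 1)) * (\<integral>\<^sup>+w. B (\<eta> * w) powr p * k w \<partial>circ) \<partial>circ)"
    using A nonneg p k by (intro nn_integral_mono nn_integral_jensen_powr m1) (auto simp: norm_mult)
  also have "\<dots> = ennreal (K powr (p - 1)) * (\<integral>\<^sup>+\<eta>. \<integral>\<^sup>+w. B (\<eta> * w) powr p * k w \<partial>circ \<partial>circ)"
    by (rule nn_integral_cmult) measurable
  also have "(\<integral>\<^sup>+\<eta>. \<integral>\<^sup>+w. B (\<eta> * w) powr p * k w \<partial>circ \<partial>circ)
     = (\<integral>\<^sup>+w. \<integral>\<^sup>+\<eta>. B (\<eta> * w) powr p * k w \<partial>circ \<partial>circ)"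
    by (rule P.Fubini'[symmetric]) measurable
  also have "\<dots> = (\<integral>\<^sup>+w. k w * (\<integral>\<^sup>+\<eta>. B \<eta> powr p \<partial>circ) \<partial>circ)"
  proof (intro nn_integral_cong)
    fix w assume w: "w \<in> space circ"
    have "(\<integral>\<^sup>+\<eta>. B (\<eta> * w) powr p * k w \<partial>circ) = (\<integral>\<^sup>+\<eta>. ennreal (k w) * ennreal (B (w * \<eta>) powr p) \<partial>circ)"
      using w nonneg by (intro nn_integral_cong) (simp add: ennreal_mult[symmetric] mult_ac)
    also have "\<dots> = ennreal (k w) * (\<integral>\<^sup>+\<eta>. B (w * \<eta>) powr p \<partial>circ)"
      using m1 w by (intro nn_integral_cmult) auto
    also have "(\<integral>\<^sup>+\<eta>. B (w * \<eta>) powr p \<partial>circ) = (\<integral>\<^sup>+\<eta>. B \<eta> powr p \<partial>circ)"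
      using w by (intro nn_integral_circ_rotate[of "\<lambda>\<eta>. ennreal (B \<eta> powr p)"]) auto
    finally show "(\<integral>\<^sup>+\<eta>. B (\<eta> * w) powr p * k w \<partial>circ) = k w * (\<integral>\<^sup>+\<eta>. B \<eta> powr p \<partial>circ)" .
  qed
  also have "\<dots> = (\<integral>\<^sup>+w. k w \<partial>circ) * (\<integral>\<^sup>+\<eta>. B \<eta> powr p \<partial>circ)"
    by (rule nn_integral_multc) measurable
  also have "ennreal (K powr (p - 1)) * \<dots> \<le> ennreal (K powr (p - 1)) * (ennreal K * (\<integral>\<^sup>+\<eta>. B \<eta> powr p \<partial>circ))"
    by (intro mult_left_mono mult_right_mono k) auto
  also have "\<dots> = ennreal (K powr p) * (\<integral>\<^sup>+w. B w powr p \<partial>circ)"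
    using K p by (cases "K = 0") (auto simp: mult.assoc[symmetric] ennreal_mult[symmetric] powr_diff)
  finally show ?thesis .
qed

text \<open>The p-th power of the usual mean M_p(r, F), extended-real so that finiteness need not be
  known. Bounds on the mean itself therefore appear on the right as
  \<open>ennreal (x powr p)\<close>.\<close>

definition circle_mean :: "real \<Rightarrow> (complex \<Rightarrow> complex) \<Rightarrow> real \<Rightarrow> ennreal" where
  "circle_mean p F r = (\<integral>\<^sup>+w. ennreal (norm (F (r * w)) powr p) \<partial>circ)"

text \<open>The Cauchy and Poisson formulas above ask for continuity on the closed disc; a function
  holomorphic only in the open disc enters them through its dilations.\<close>

lemma dilation_regular:
  assumes "F holomorphic_on unit_disc" "0 \<le> r" "r < 1"
  shows "continuous_on (cball 0 1) (\<lambda>z. F (of_real r * z))"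
    and "(\<lambda>z. F (of_real r * z)) holomorphic_on unit_disc"
    and "continuous_on (sphere 0 1) (\<lambda>z. F (of_real r * z))"
proof -
  have im: "of_real r * z \<in> unit_disc" if "norm z \<le> 1" for z
  proof -
    have "r * norm z \<le> r * 1" using assms that by (intro mult_left_mono) auto
    then show ?thesis using assms by (simp add: norm_mult)
  qed
  show c: "continuous_on (cball 0 1) (\<lambda>z. F (of_real r * z))"
    by (rule continuous_on_compose2[OF holomorphic_on_imp_continuous_on[OF assms(1)]])
       (use im in \<open>auto intro!: continuous_intros\<close>)
  then show "continuous_on (sphere 0 1) (\<lambda>z. F (of_real r * z))"
    by (rule continuous_on_subset) auto
  have "F \<circ> (\<lambda>z. of_real r * z) holomorphic_on unit_disc"
    by (rule holomorphic_on_compose_gen[OF _ assms(1)]) (use im in \<open>auto intro!: holomorphic_intros\<close>)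
  then show "(\<lambda>z. F (of_real r * z)) holomorphic_on unit_disc" by (simp add: o_def)
qed

lemma norm_le_nn_integral_circ:
  assumes "has_bochner_integral M f x" "\<And>w. w \<in> space M \<Longrightarrow> norm (f w) = h w"
  shows "ennreal (norm x) \<le> (\<integral>\<^sup>+w. ennreal (h w) \<partial>M)"
proof -
  have "ennreal (norm x) \<le> (\<integral>\<^sup>+w. ennreal (norm (f w)) \<partial>M)"
    using integral_norm_bound_ennreal[of M f] assms(1) by (auto simp: has_bochner_integral_iff)
  also have "\<dots> = (\<integral>\<^sup>+w. ennreal (h w) \<partial>M)"
    by (intro nn_integral_cong) (simp add: assms(2))
  finally show ?thesis .
qed

lemma norm_rotate_diff:
  fixes \<eta> w z :: complex
  assumes "norm \<eta> = 1"
  shows "norm (\<eta> * w - \<eta> * z) = norm (w - z)"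
  by (simp add: right_diff_distrib[symmetric] norm_mult assms)

text \<open>The values of \<open>F\<close> on the circle of radius \<open>r\<close> are a Poisson
  convolution of those on the circle of radius \<open>\<rho>\<close>, with parameter
  \<open>s = r / \<rho>\<close>. The kernel is nonnegative of mass one, so L^p norms do not
  increase.\<close>

lemma circle_mean_mono:
  assumes F: "F holomorphic_on unit_disc" and r: "0 \<le> r" "r \<le> \<rho>" "\<rho> < 1" and p: "1 < p"
  shows "circle_mean p F r \<le> circle_mean p F \<rho>"
proof (cases "r = \<rho>")
  case False
  define s where "s = r / \<rho>"
  have s: "0 \<le> s" "s < 1" "r = \<rho> * s" using r False by (auto simp: s_def)
  have s2: "0 < 1 - s\<^sup>2" using s by (simp add: power_less_one_iff)
  have ne: "w - complex_of_real s \<noteq> 0" if "norm w = 1" for w using that s by auto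
  note dil = dilation_regular[OF F order_trans[OF r(1,2)] r(3)]
  have "(\<integral>\<^sup>+\<eta>. norm (F (r * \<eta>)) powr p \<partial>circ)
      \<le> ennreal (1 powr p) * (\<integral>\<^sup>+w. norm (F (\<rho> * w)) powr p \<partial>circ)"
  proof (rule nn_integral_circ_young[where k = "\<lambda>w. (1 - s\<^sup>2) * (1 / (norm (w - s))\<^sup>2)"])
    show [measurable]: "(\<lambda>w. norm (F (\<rho> * w))) \<in> borel_measurable circ"
      using borel_measurable_circ_continuous[OF dil(3)] by measurable
    have "(\<integral>\<^sup>+w. ennreal ((1 - s\<^sup>2) * (1 / (norm (w - s))\<^sup>2)) \<partial>circ)
        = (\<integral>\<^sup>+w. ennreal (1 - s\<^sup>2) * ennreal (1 / (norm (w - s))\<^sup>2) \<partial>circ)"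
      using s2 by (intro nn_integral_cong) (auto simp: ennreal_mult[symmetric])
    also have "\<dots> = ennreal (1 - s\<^sup>2) * (\<integral>\<^sup>+w. ennreal (1 / (norm (w - s))\<^sup>2) \<partial>circ)"
      by (rule nn_integral_cmult) measurable
    also have "\<dots> = 1"
      using s s2 by (subst nn_integral_poisson_kernel) (auto simp: ennreal_mult[symmetric])
    finally show "(\<integral>\<^sup>+w. ennreal ((1 - s\<^sup>2) * (1 / (norm (w - s))\<^sup>2)) \<partial>circ) \<le> ennreal 1" by simp
    fix \<eta> :: complex assume \<eta>: "norm \<eta> = 1"
    have nz: "norm (s * \<eta>) = s" using \<eta> s by (simp add: norm_mult)
    have "ennreal (norm (F (\<rho> * (s * \<eta>)))) \<le>
        (\<integral>\<^sup>+w. norm (F (\<rho> * w)) * ((1 - s\<^sup>2) * (1 / (norm (w - s * \<eta>))\<^sup>2)) \<partial>circ)"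
    proof (rule norm_le_nn_integral_circ)
      show "has_bochner_integral circ (\<lambda>w. F (\<rho> * w) * ((1 - s\<^sup>2) / (norm (w - s * \<eta>))\<^sup>2)) (F (\<rho> * (s * \<eta>)))"
        using poisson_integral_circ[OF dil(1,2), of "s * \<eta>"] s unfolding nz by simp
    qed (use s2 in \<open>simp only: norm_mult norm_of_real, simp\<close>)
    \<comment> \<open>Rotating the variable makes the kernel independent of \<open>\<eta>\<close>,
      as the convolution inequality requires.\<close>
    also have "\<dots> = (\<integral>\<^sup>+w. norm (F (\<rho> * (\<eta> * w))) * ((1 - s\<^sup>2) * (1 / (norm (\<eta> * w - s * \<eta>))\<^sup>2)) \<partial>circ)"
      by (rule nn_integral_circ_rotate[symmetric, OF _ \<eta>]) measurable
    also have "\<dots> = (\<integral>\<^sup>+w. norm (F (\<rho> * (\<eta> * w))) * ((1 - s\<^sup>2) * (1 / (norm (w - s))\<^sup>2)) \<partial>circ)"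
      using norm_rotate_diff[OF \<eta>, of _ "of_real s"] by (simp only: mult.commute[of "of_real s" \<eta>])
    finally show "0 \<le> norm (F (r * \<eta>)) \<and> ennreal (norm (F (r * \<eta>)))
        \<le> (\<integral>\<^sup>+w. norm (F (\<rho> * (\<eta> * w))) * ((1 - s\<^sup>2) * (1 / (norm (w - s))\<^sup>2)) \<partial>circ)"
      by (simp add: s(3) mult_ac)
  qed (use s2 p in auto)
  then show ?thesis by (simp add: circle_mean_def)
qed simp

text \<open>Cauchy's formula on the circle of radius \<open>\<rho>\<close> is a convolution whose
  kernel has modulus \<open>1 / \<rho> * (1 / (norm (w - s))\<^sup>2)\<close> with
  \<open>s = r / \<rho>\<close>. Its mass \<open>1 / \<rho> * (1 / (1 - s\<^sup>2))\<close> is at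
  most \<open>1 / (\<rho> - r)\<close>.\<close>

lemma circle_mean_deriv_le:
  assumes F: "F holomorphic_on unit_disc" and r: "0 \<le> r" "r < \<rho>" "\<rho> < 1" and p: "1 < p"
  shows "circle_mean p (deriv F) r \<le> ennreal ((1 / (\<rho> - r)) powr p) * circle_mean p F \<rho>"
proof -
  define s where "s = r / \<rho>"
  have s: "0 \<le> s" "s < 1" "r = \<rho> * s" "0 < \<rho>" using r by (auto simp: s_def)
  have s2: "0 < 1 - s\<^sup>2" using s by (simp add: power_less_one_iff)
  have ne: "w - complex_of_real s \<noteq> 0" if "norm w = 1" for w using that s by auto
  have "0 \<le> \<rho>" using s by simp
  note dil = dilation_regular[OF F this r(3)]
  have "(\<integral>\<^sup>+\<eta>. norm (deriv F (r * \<eta>)) powr p \<partial>circ)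
      \<le> ennreal ((1 / (\<rho> - r)) powr p) * (\<integral>\<^sup>+w. norm (F (\<rho> * w)) powr p \<partial>circ)"
  proof (rule nn_integral_circ_young[where k = "\<lambda>w. 1 / \<rho> * (1 / (norm (w - s))\<^sup>2)"])
    show [measurable]: "(\<lambda>w. norm (F (\<rho> * w))) \<in> borel_measurable circ"
      using borel_measurable_circ_continuous[OF dil(3)] by measurable
    have "(\<integral>\<^sup>+w. ennreal (1 / \<rho> * (1 / (norm (w - s))\<^sup>2)) \<partial>circ)
        = (\<integral>\<^sup>+w. ennreal (1 / \<rho>) * ennreal (1 / (norm (w - s))\<^sup>2) \<partial>circ)"
      using s by (intro nn_integral_cong) (auto simp: ennreal_mult[symmetric])
    also have "\<dots> = ennreal (1 / \<rho>) * (\<integral>\<^sup>+w. ennreal (1 / (norm (w - s))\<^sup>2) \<partial>circ)"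
      by (rule nn_integral_cmult) measurable
    also have "\<dots> = ennreal (1 / \<rho> * (1 / (1 - s\<^sup>2)))"
      using s s2 by (subst nn_integral_poisson_kernel) (auto simp: ennreal_mult[symmetric])
    also have "\<dots> \<le> ennreal (1 / (\<rho> - r))"
    proof (rule ennreal_leI)
      have "\<rho> * s\<^sup>2 \<le> \<rho> * s" using s by (intro mult_left_mono) (auto simp: power2_eq_square mult_left_le)
      then have "\<rho> - r \<le> \<rho> * (1 - s\<^sup>2)" by (simp add: s(3) algebra_simps)
      then show "1 / \<rho> * (1 / (1 - s\<^sup>2)) \<le> 1 / (\<rho> - r)"
        using r by (simp add: divide_left_mono)
    qed
    finally show "(\<integral>\<^sup>+w. ennreal (1 / \<rho> * (1 / (norm (w - s))\<^sup>2)) \<partial>circ) \<le> ennreal (1 / (\<rho> - r))" .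
    fix \<eta> :: complex assume \<eta>: "norm \<eta> = 1"
    have nz: "norm (s * \<eta>) = s" using \<eta> s by (simp add: norm_mult)
    have "of_real \<rho> * (of_real s * \<eta>) \<in> unit_disc"
      using s r \<eta> by (simp add: norm_mult)
    then have "(F has_field_derivative deriv F (of_real \<rho> * (of_real s * \<eta>))) (at (of_real \<rho> * (of_real s * \<eta>)))"
      by (intro holomorphic_derivI[OF F]) auto
    then have "((\<lambda>z. F (of_real \<rho> * z)) has_field_derivative (deriv F (of_real \<rho> * (of_real s * \<eta>)) * of_real \<rho>)) (at (of_real s * \<eta>))"
      by (rule DERIV_chain2) (auto intro!: derivative_eq_intros)
    then have d: "deriv (\<lambda>z. F (of_real \<rho> * z)) (of_real s * \<eta>) = of_real \<rho> * deriv F (of_real r * \<eta>)"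
      by (subst DERIV_imp_deriv) (auto simp: s(3) mult_ac)
    have "has_bochner_integral circ (\<lambda>w. (F (\<rho> * w) * w / (w - s * \<eta>) ^ Suc 1) * (1 / of_real \<rho>)) (deriv F (r * \<eta>))"
      using has_bochner_integral_mult_left[OF cauchy_integral_circ[OF dil(1,2), of "s * \<eta>" 1], of "1 / of_real \<rho>"] s nz d
      by simp
    then have "ennreal (norm (deriv F (r * \<eta>))) \<le>
        (\<integral>\<^sup>+w. norm (F (\<rho> * w)) * (1 / \<rho> * (1 / (norm (w - s * \<eta>))\<^sup>2)) \<partial>circ)"
      using s by (rule_tac norm_le_nn_integral_circ) (auto simp: norm_mult norm_divide norm_power numeral_2_eq_2)
    also have "\<dots> = (\<integral>\<^sup>+w. norm (F (\<rho> * (\<eta> * w))) * (1 / \<rho> * (1 / (norm (\<eta> * w - s * \<eta>))\<^sup>2)) \<partial>circ)"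
      by (rule nn_integral_circ_rotate[symmetric, OF _ \<eta>]) measurable
    also have "\<dots> = (\<integral>\<^sup>+w. norm (F (\<rho> * (\<eta> * w))) * (1 / \<rho> * (1 / (norm (w - s))\<^sup>2)) \<partial>circ)"
      using norm_rotate_diff[OF \<eta>, of _ "of_real s"] by (simp only: mult.commute[of "of_real s" \<eta>])
    finally show "0 \<le> norm (deriv F (r * \<eta>)) \<and> ennreal (norm (deriv F (r * \<eta>)))
        \<le> (\<integral>\<^sup>+w. norm (F (\<rho> * (\<eta> * w))) * (1 / \<rho> * (1 / (norm (w - s))\<^sup>2)) \<partial>circ)"
      by simp
  qed (use s p r in auto)
  then show ?thesis by (simp add: circle_mean_def)
qed

section \<open>Sub-mean value property and weighted area integrals\<close>

lemma holomorphic_measurable_comp: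
  assumes "F holomorphic_on unit_disc" "h \<in> borel_measurable M" "\<And>x. x \<in> space M \<Longrightarrow> norm (h x) < 1"
  shows "(\<lambda>x. F (h x)) \<in> borel_measurable M"
  by (rule borel_measurable_continuous_on_comp[OF holomorphic_on_imp_continuous_on[OF assms(1)] assms(2)])
     (use assms(3) in auto)

lemma holomorphic_measurable_disc:
  assumes "F holomorphic_on unit_disc"
  shows "F \<in> borel_measurable disc"
  using holomorphic_measurable_comp[OF assms measurable_ident_disc] by simp

text \<open>The circle means about \<open>c\<close> start from \<open>norm (F c) powr p\<close> at
  radius 0 and increase with the radius, so their average over the ball is no smaller.\<close>

lemma submean_ball:
  assumes F: "F holomorphic_on ball c R" and R: "0 < R" and p: "1 < p"
  shows "ennreal (pi * R\<^sup>2 * norm (F c) powr p)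
    \<le> (\<integral>\<^sup>+z. ennreal (norm (F z) powr p) * indicator (ball c R) z \<partial>lborel)"
proof -
  define h where "h z = ennreal (norm (F z) powr p) * indicator (ball c R) z" for z
  have "(\<lambda>z. norm (F z) powr p) \<in> borel_measurable (restrict_space borel (ball c R))"
    using borel_measurable_continuous_on_restrict[OF holomorphic_on_imp_continuous_on[OF F]] by measurable
  then have [measurable]: "h \<in> borel_measurable borel"
    unfolding h_def using borel_measurable_restrict_space_iff_ennreal[of "ball c R" borel "\<lambda>z. ennreal (norm (F z) powr p)"]
    by auto
  define G where "G z = F (c + R *\<^sub>R z)" for z
  have "F \<circ> (\<lambda>z. c + R *\<^sub>R z) holomorphic_on unit_disc"
    by (rule holomorphic_on_compose_gen[OF _ F])
       (use R in \<open>auto intro!: holomorphic_intros simp: scaleR_conv_of_real dist_norm norm_mult\<close>)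
  then have G: "G holomorphic_on unit_disc" by (simp add: o_def G_def[abs_def])
  have hG: "h (c + R *\<^sub>R z) = ennreal (norm (G z) powr p) * indicator unit_disc z" for z
    using R by (auto simp: h_def G_def indicator_def dist_norm)
  have Gm: "(\<lambda>z. ennreal (norm (G z) powr p)) \<in> borel_measurable disc"
    using holomorphic_measurable_disc[OF G] by measurable
  have "circle_mean p G 0 = ennreal (norm (F c) powr p)"
    by (simp add: circle_mean_def emeasure_circ G_def)
  then have "ennreal (norm (F c) powr p) \<le> circle_mean p G (sqrt (1 - x))" if "x \<in> space unit_ivl" for x
    using that circle_mean_mono[OF G _ _ _ p, of 0 "sqrt (1 - x)"] by auto
  then have "(\<integral>\<^sup>+x. ennreal (norm (F c) powr p) \<partial>unit_ivl) \<le> (\<integral>\<^sup>+x. circle_mean p G (sqrt (1 - x)) \<partial>unit_ivl)"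
    by (rule nn_integral_mono)
  also have "(\<integral>\<^sup>+x. ennreal (norm (F c) powr p) \<partial>unit_ivl) = ennreal (norm (F c) powr p)"
    by (simp add: emeasure_unit_ivl)
  finally have "ennreal (pi * R\<^sup>2) * ennreal (norm (F c) powr p)
     \<le> ennreal (pi * R\<^sup>2) * (\<integral>\<^sup>+x. circle_mean p G (sqrt (1 - x)) \<partial>unit_ivl)"
    by (intro mult_left_mono) auto
  also have "\<dots> = ennreal (R\<^sup>2) * (\<integral>\<^sup>+z. ennreal (norm (G z) powr p) \<partial>disc)"
    by (subst nn_integral_disc_polar[OF Gm]) (auto simp: circle_mean_def ennreal_mult mult_ac)
  also have "\<dots> = ennreal (R\<^sup>2) * (\<integral>\<^sup>+z. h (c + R *\<^sub>R z) \<partial>lborel)"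
    by (simp add: hG nn_integral_disc)
  also have "\<dots> = (\<integral>\<^sup>+z. h z \<partial>lborel)"
    using R by (subst (2) lborel_affine[of R c]) (auto simp: nn_integral_density nn_integral_distr nn_integral_cmult)
  finally show ?thesis by (simp add: h_def ennreal_mult)
qed

text \<open>The p-th power of the Bergman norm without the factor
  \<open>(\<alpha> + 1) / pi\<close>. For functions outside the space it is infinite, where the
  Bochner integral in the definitions is 0 by default.\<close>

definition bergman_energy :: "real \<Rightarrow> real \<Rightarrow> (complex \<Rightarrow> complex) \<Rightarrow> ennreal" where
  "bergman_energy p \<alpha> F = (\<integral>\<^sup>+z. ennreal (norm (F z) powr p * (1 - (norm z)\<^sup>2) powr \<alpha>) \<partial>disc)"

lemma bergman_energy_polar:
  assumes F: "F holomorphic_on unit_disc"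
  shows "bergman_energy p \<alpha> F
     = ennreal pi * (\<integral>\<^sup>+x. ennreal (x powr \<alpha>) * circle_mean p F (sqrt (1 - x)) \<partial>unit_ivl)"
proof -
  note [measurable] = holomorphic_measurable_disc[OF F]
  have "(\<integral>\<^sup>+w. ennreal (norm (F (sqrt (1 - x) * w)) powr p * (1 - (norm (sqrt (1 - x) * w))\<^sup>2) powr \<alpha>) \<partial>circ)
      = ennreal (x powr \<alpha>) * circle_mean p F (sqrt (1 - x))" if x: "x \<in> space unit_ivl" for x
  proof -
    have [measurable]: "(\<lambda>w. F (sqrt (1 - x) * w)) \<in> borel_measurable circ"
      by (rule holomorphic_measurable_comp[OF F]) (use x in \<open>auto simp: norm_mult\<close>)
    have "(\<integral>\<^sup>+w. ennreal (norm (F (sqrt (1 - x) * w)) powr p * (1 - (norm (sqrt (1 - x) * w))\<^sup>2) powr \<alpha>) \<partial>circ)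
        = (\<integral>\<^sup>+w. ennreal (x powr \<alpha>) * ennreal (norm (F (sqrt (1 - x) * w)) powr p) \<partial>circ)"
      using x by (intro nn_integral_cong)
        (auto simp: norm_mult ennreal_mult[symmetric] mult.commute power_mult_distrib)
    also have "\<dots> = ennreal (x powr \<alpha>) * circle_mean p F (sqrt (1 - x))"
      unfolding circle_mean_def by (rule nn_integral_cmult) measurable
    finally show ?thesis .
  qed
  then show ?thesis
    unfolding bergman_energy_def
    by (subst nn_integral_disc_polar) (auto intro!: arg_cong2[where f = times] nn_integral_cong)
qed

text \<open>Where \<open>x = 1 - (norm z)\<^sup>2\<close> is at most \<open>1 - r\<close>, the
  radius \<open>sqrt (1 - x)\<close> is at least \<open>r\<close>. Since the means increase, the
  energy is at least \<open>pi * circle_mean p F r\<close> times the integral of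
  \<open>x powr \<alpha>\<close> from 0 to \<open>1 - r\<close>.\<close>

lemma circle_mean_le_energy:
  assumes F: "F holomorphic_on unit_disc" and r: "0 \<le> r" "r < 1" and p: "1 < p" and \<alpha>: "-1 < \<alpha>"
  shows "circle_mean p F r \<le> ennreal ((\<alpha> + 1) / pi * (1 - r) powr - (\<alpha> + 1)) * bergman_energy p \<alpha> F"
proof -
  define d where "d = 1 - r"
  have d: "0 < d" "d \<le> 1" using r by (auto simp: d_def)
  have dr: "r \<le> sqrt (1 - x)" if "x \<le> d" "0 < x" for x
  proof (rule real_le_rsqrt)
    have "r\<^sup>2 \<le> r" using r by (simp add: power2_eq_square mult_left_le)
    then show "r\<^sup>2 \<le> 1 - x" using that by (simp add: d_def)
  qed
  have "ennreal (d powr (\<alpha> + 1) / (\<alpha> + 1)) * circle_mean p F r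
      = (\<integral>\<^sup>+x. ennreal (x powr \<alpha>) * indicator {0..d} x \<partial>lborel) * circle_mean p F r"
    using \<alpha> d by (subst nn_integral_powr_from_0) auto
  also have "(\<integral>\<^sup>+x. ennreal (x powr \<alpha>) * indicator {0..d} x \<partial>lborel)
      = (\<integral>\<^sup>+x. ennreal (x powr \<alpha>) * indicator {0<..<d} x \<partial>lborel)"
  proof (rule nn_integral_cong_AE)
    show "AE x in lborel. ennreal (x powr \<alpha>) * indicator {0..d} x = ennreal (x powr \<alpha>) * indicator {0<..<d} x"
      using AE_lborel_singleton[of 0] AE_lborel_singleton[of d]
      by eventually_elim (auto simp: indicator_def)
  qed
  also have "\<dots> * circle_mean p F r
      = (\<integral>\<^sup>+x. ennreal (x powr \<alpha>) * indicator {0<..<d} x * circle_mean p F r \<partial>lborel)"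
    by (rule nn_integral_multc[symmetric]) measurable
  also have "\<dots> \<le> (\<integral>\<^sup>+x. ennreal (x powr \<alpha>) * circle_mean p F (sqrt (1 - x)) * indicator {0<..<1} x \<partial>lborel)"
    using r d p dr F
    by (intro nn_integral_mono) (auto simp: indicator_def intro!: mult_left_mono circle_mean_mono)
  also have "\<dots> = (\<integral>\<^sup>+x. ennreal (x powr \<alpha>) * circle_mean p F (sqrt (1 - x)) \<partial>unit_ivl)"
    by (simp add: nn_integral_unit_ivl)
  finally have "ennreal ((\<alpha> + 1) * d powr - (\<alpha> + 1)) * (ennreal (d powr (\<alpha> + 1) / (\<alpha> + 1)) * circle_mean p F r)
     \<le> ennreal ((\<alpha> + 1) * d powr - (\<alpha> + 1)) * (\<integral>\<^sup>+x. ennreal (x powr \<alpha>) * circle_mean p F (sqrt (1 - x)) \<partial>unit_ivl)"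
    by (rule mult_left_mono) simp
  also have "\<dots> = ennreal ((\<alpha> + 1) / pi * d powr - (\<alpha> + 1)) * bergman_energy p \<alpha> F"
    using \<alpha> by (simp add: bergman_energy_polar[OF F] mult.assoc[symmetric] ennreal_mult[symmetric])
  also have "ennreal ((\<alpha> + 1) * d powr - (\<alpha> + 1)) * (ennreal (d powr (\<alpha> + 1) / (\<alpha> + 1)) * circle_mean p F r)
     = ennreal (d powr (- (\<alpha> + 1) + (\<alpha> + 1))) * circle_mean p F r"
    using \<alpha> unfolding powr_add by (simp add: mult.assoc[symmetric] ennreal_mult[symmetric])
  also have "\<dots> = circle_mean p F r" using d by simp
  finally show ?thesis by (simp add: d_def)
qed

text \<open>The power increases or decreases according to the sign of \<open>\<alpha>\<close>, and
  each case uses one of the two comparisons; \<open>\<bar>\<alpha>\<bar>\<close> lets one constant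
  cover both.\<close>

lemma powr_le_of_comparable:
  fixes x y c \<alpha> :: real
  assumes "0 < x" "0 < y" "x \<le> c * y" "y \<le> c * x"
  shows "x powr \<alpha> \<le> c powr \<bar>\<alpha>\<bar> * y powr \<alpha>"
proof (cases "0 \<le> \<alpha>")
  case True
  have "0 < c" using assms less_le_trans[OF assms(1,3)] by (simp add: zero_less_mult_iff)
  have "x powr \<alpha> \<le> (c * y) powr \<alpha>" using assms True by (intro powr_mono2) auto
  also have "\<dots> = c powr \<alpha> * y powr \<alpha>" using \<open>0 < c\<close> assms by (simp add: powr_mult)
  finally show ?thesis using True by simp
next
  case False
  have "0 < c" using assms less_le_trans[OF assms(1,3)] by (simp add: zero_less_mult_iff)
  have "x powr \<alpha> \<le> (y / c) powr \<alpha>"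
    using assms False \<open>0 < c\<close> by (intro powr_mono2') (auto simp: field_simps)
  also have "\<dots> = c powr - \<alpha> * y powr \<alpha>" using \<open>0 < c\<close> assms by (simp add: powr_divide powr_minus_divide)
  finally show ?thesis using False by simp
qed

text \<open>Average \<^term>\<open>norm (F z) powr p\<close> over the disc of radius
  \<^term>\<open>y / 2\<close> around \<^term>\<open>1 - y\<close>, where \<^term>\<open>y\<close> and \<^term>\<open>1 - (norm z)\<^sup>2\<close> are comparable.\<close>
lemma radial_trace_le_energy:
  assumes F: "F holomorphic_on unit_disc" and p: "1 < p"
  shows "(\<integral>\<^sup>+y. ennreal (norm (F (1 - of_real y)) powr p * y powr (\<alpha> + 1)) \<partial>unit_ivl)
     \<le> ennreal (24 / pi * 3 powr \<bar>\<alpha>\<bar>) * bergman_energy p \<alpha> F"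
proof -
  interpret P: pair_sigma_finite unit_ivl disc ..
  note [measurable] = holomorphic_measurable_disc[OF F]
  define C where "C = 4 / pi * 3 powr \<bar>\<alpha>\<bar>"
  have C0: "0 \<le> C" by (simp add: C_def)
  \<comment> \<open>The factor \<open>1 / y\<close> is what remains of the averaging constant once
    \<open>y powr \<alpha>\<close> is replaced by the weight at \<open>z\<close>. For fixed
    \<open>z\<close>, with \<open>d = 1 - (norm z)\<^sup>2\<close>, it lives on
    \<open>y \<le> 2 * d\<close> and is at most \<open>3 / d\<close>, so its integral in
    \<open>y\<close> is at most 6; with the 4 in \<open>C\<close> this makes the 24.\<close>
  define k :: "real \<Rightarrow> complex \<Rightarrow> real" where
    "k y z = (if norm (z - (1 - of_real y)) < y / 2 then 1 / y else 0)" for y z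
  define e where "e z = norm (F z) powr p * (1 - (norm z)\<^sup>2) powr \<alpha>" for z
  have [measurable]: "e \<in> borel_measurable disc" unfolding e_def[abs_def] by measurable
  have [measurable]: "(\<lambda>(y, z). k y z) \<in> borel_measurable (unit_ivl \<Otimes>\<^sub>M disc)"
    unfolding k_def by measurable
  have comp: "y / 2 \<le> 1 - (norm z)\<^sup>2" "1 - (norm z)\<^sup>2 \<le> 3 * y" "norm z < 1"
    if y: "0 < y" "y < 1" and z: "norm (z - (1 - of_real y)) < y / 2" for y and z :: complex
  proof -
    have n: "norm (1 - of_real y :: complex) = 1 - y"
      using y norm_of_real[of "1 - y", where 'a = complex] by simp
    have 1: "norm z \<le> (1 - y) + norm (z - (1 - of_real y))"
      using norm_triangle_sub[of z "1 - of_real y"] n by simp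
    have 2: "1 - y \<le> norm z + norm (z - (1 - of_real y))"
      using norm_triangle_sub[of "1 - of_real y" z] n by (simp add: norm_minus_commute)
    show l: "norm z < 1" using 1 z y by simp
    have sq: "1 - (norm z)\<^sup>2 = (1 - norm z) * (1 + norm z)" by (simp add: power2_eq_square algebra_simps)
    have "(1 - norm z) * 1 \<le> (1 - norm z) * (1 + norm z)" using l by (intro mult_left_mono) auto
    then show "y / 2 \<le> 1 - (norm z)\<^sup>2" using 1 z by (simp add: sq)
    have "(1 - norm z) * (1 + norm z) \<le> (1 - norm z) * 2" using l by (intro mult_left_mono) auto
    then show "1 - (norm z)\<^sup>2 \<le> 3 * y" using 2 z by (simp add: sq)
  qed
  have "(\<integral>\<^sup>+y. ennreal (norm (F (1 - of_real y)) powr p * y powr (\<alpha> + 1)) \<partial>unit_ivl)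
      \<le> (\<integral>\<^sup>+y. \<integral>\<^sup>+z. ennreal (C * e z * k y z) \<partial>disc \<partial>unit_ivl)"
  proof (rule nn_integral_mono)
    fix y assume "y \<in> space unit_ivl"
    then have y: "0 < y" "y < 1" by auto
    let ?B = "ball (1 - of_real y) (y / 2) :: complex set"
    have [measurable]: "(indicator ?B :: complex \<Rightarrow> ennreal) \<in> borel_measurable disc"
      unfolding disc_def by (intro measurable_restrict_space1 borel_measurable_indicator) auto
    have sub: "?B \<subseteq> unit_disc" using comp(3)[OF y] by (auto simp: dist_norm norm_minus_commute)
    have "ennreal (norm (F (1 - of_real y)) powr p * y powr (\<alpha> + 1))
       = ennreal (4 / pi * y powr (\<alpha> - 1)) * ennreal (pi * (y / 2)\<^sup>2 * norm (F (1 - of_real y)) powr p)"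
    proof -
      have "y powr (\<alpha> + 1) = y powr (\<alpha> - 1) * y\<^sup>2"
        using y powr_add[of y "\<alpha> - 1" 2] by (simp add: add.commute)
      then show ?thesis by (simp add: ennreal_mult[symmetric] power_divide)
    qed
    also have "\<dots> \<le> ennreal (4 / pi * y powr (\<alpha> - 1))
        * (\<integral>\<^sup>+z. ennreal (norm (F z) powr p) * indicator ?B z \<partial>lborel)"
      by (intro mult_left_mono submean_ball holomorphic_on_subset[OF F sub] p) (use y in auto)
    also have "(\<integral>\<^sup>+z. ennreal (norm (F z) powr p) * indicator ?B z \<partial>lborel)
       = (\<integral>\<^sup>+z. ennreal (norm (F z) powr p) * indicator ?B z \<partial>disc)"
      using sub unfolding nn_integral_disc by (auto intro!: nn_integral_cong simp: indicator_def)
    also have "ennreal (4 / pi * y powr (\<alpha> - 1)) * \<dots>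
       = (\<integral>\<^sup>+z. ennreal (4 / pi * y powr (\<alpha> - 1)) * (ennreal (norm (F z) powr p) * indicator ?B z) \<partial>disc)"
      by (rule nn_integral_cmult[symmetric]) measurable
    also have "\<dots> \<le> (\<integral>\<^sup>+z. ennreal (C * e z * k y z) \<partial>disc)"
    proof (rule nn_integral_mono)
      fix z :: complex assume "z \<in> space disc"
      show "ennreal (4 / pi * y powr (\<alpha> - 1)) * (ennreal (norm (F z) powr p) * indicator ?B z) \<le> ennreal (C * e z * k y z)"
      proof (cases "z \<in> ?B")
        case True
        then have z: "norm (z - (1 - of_real y)) < y / 2" by (simp add: dist_norm norm_minus_commute)
        note c = comp[OF y z]
        have "y powr \<alpha> \<le> 3 powr \<bar>\<alpha>\<bar> * (1 - (norm z)\<^sup>2) powr \<alpha>"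
          using c y by (intro powr_le_of_comparable) auto
        then have "norm (F z) powr p * (4 / pi / y) * y powr \<alpha>
            \<le> norm (F z) powr p * (4 / pi / y) * (3 powr \<bar>\<alpha>\<bar> * (1 - (norm z)\<^sup>2) powr \<alpha>)"
          using y by (intro mult_left_mono) auto
        also have "norm (F z) powr p * (4 / pi / y) * y powr \<alpha> = 4 / pi * y powr (\<alpha> - 1) * norm (F z) powr p"
          using y by (simp add: powr_diff)
        also have "norm (F z) powr p * (4 / pi / y) * (3 powr \<bar>\<alpha>\<bar> * (1 - (norm z)\<^sup>2) powr \<alpha>) = C * e z * k y z"
          using z by (simp add: C_def e_def k_def)
        finally show ?thesis using True by (simp add: ennreal_mult[symmetric] ennreal_leI)
      qed auto
    qed
    finally show "ennreal (norm (F (1 - of_real y)) powr p * y powr (\<alpha> + 1)) \<le> (\<integral>\<^sup>+z. ennreal (C * e z * k y z) \<partial>disc)" .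
  qed
  also have "\<dots> = (\<integral>\<^sup>+z. \<integral>\<^sup>+y. ennreal (C * e z * k y z) \<partial>unit_ivl \<partial>disc)"
    by (rule P.Fubini'[symmetric]) measurable
  also have "\<dots> \<le> (\<integral>\<^sup>+z. ennreal (6 * C) * ennreal (e z) \<partial>disc)"
  proof (rule nn_integral_mono)
    fix z :: complex assume z: "z \<in> space disc"
    define d where "d = 1 - (norm z)\<^sup>2"
    have d: "0 < d" using z by (simp add: d_def power_less_one_iff)
    have e0: "0 \<le> e z" by (simp add: e_def)
    have "(\<integral>\<^sup>+y. ennreal (C * e z * k y z) \<partial>unit_ivl)
        \<le> (\<integral>\<^sup>+y. ennreal (C * e z * (3 / d)) * indicator {0..2 * d} y \<partial>unit_ivl)"
    proof (rule nn_integral_mono)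
      fix y assume "y \<in> space unit_ivl"
      then have y: "0 < y" "y < 1" by auto
      show "ennreal (C * e z * k y z) \<le> ennreal (C * e z * (3 / d)) * indicator {0..2 * d} y"
      proof (cases "norm (z - (1 - of_real y)) < y / 2")
        case True
        have "1 / y \<le> 3 / d" using comp(2)[OF y True] y d by (simp add: d_def[symmetric] field_simps)
        then have "C * e z * k y z \<le> C * e z * (3 / d)"
          using True C0 e0 by (simp only: k_def if_True) (intro mult_left_mono, auto)
        moreover have "y \<in> {0..2 * d}" using comp(1)[OF y True] y by (simp add: d_def[symmetric])
        ultimately show ?thesis by (simp add: ennreal_leI)
      qed (simp add: k_def)
    qed
    also have "\<dots> \<le> (\<integral>\<^sup>+y. ennreal (C * e z * (3 / d)) * indicator {0..2 * d} y \<partial>lborel)"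
      unfolding nn_integral_unit_ivl by (auto intro!: nn_integral_mono simp: indicator_def)
    also have "\<dots> = ennreal (C * e z * (3 / d)) * ennreal (2 * d)"
      using d by (simp add: nn_integral_cmult_indicator)
    also have "\<dots> = ennreal (6 * C) * ennreal (e z)"
      using d C0 e0 by (simp add: ennreal_mult[symmetric])
    finally show "(\<integral>\<^sup>+y. ennreal (C * e z * k y z) \<partial>unit_ivl) \<le> ennreal (6 * C) * ennreal (e z)" .
  qed
  also have "\<dots> = ennreal (6 * C) * (\<integral>\<^sup>+z. ennreal (e z) \<partial>disc)"
    by (rule nn_integral_cmult) measurable
  finally show ?thesis by (simp add: bergman_energy_def e_def C_def)
qed

section \<open>The generalized Hilbert operator\<close>

lemma powr_add_le:
  fixes a b p :: real
  assumes "0 \<le> a" "0 \<le> b" "0 \<le> p"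
  shows "(a + b) powr p \<le> 2 powr p * (a powr p + b powr p)"
proof -
  have "(a + b) powr p \<le> (2 * max a b) powr p"
    using assms by (intro powr_mono2) auto
  also have "\<dots> = 2 powr p * max a b powr p"
    using assms by (simp add: powr_mult)
  also have "max a b powr p \<le> a powr p + b powr p" by (auto simp: max_def)
  finally show ?thesis by (simp add: mult_left_mono)
qed

lemma norm_diff_le_nn_integral:
  fixes \<gamma> :: "real \<Rightarrow> complex"
  assumes "a \<le> b" "\<And>s. a \<le> s \<Longrightarrow> s \<le> b \<Longrightarrow> (\<gamma> has_vector_derivative \<gamma>' s) (at s within {a..b})"
    and "continuous_on {a..b} \<gamma>'"
  shows "ennreal (norm (\<gamma> b - \<gamma> a)) \<le> (\<integral>\<^sup>+s. ennreal (norm (\<gamma>' s)) * indicator {a..b} s \<partial>lborel)"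
proof -
  have "has_bochner_integral lborel (\<lambda>x. indicator {a..b} x *\<^sub>R \<gamma>' x) (\<gamma> b - \<gamma> a)"
    by (rule has_bochner_integral_FTC_Icc) (use assms in auto)
  then have "ennreal (norm (\<gamma> b - \<gamma> a)) \<le> (\<integral>\<^sup>+s. ennreal (indicator {a..b} s * norm (\<gamma>' s)) \<partial>lborel)"
    by (rule norm_le_nn_integral_circ) simp
  also have "\<dots> = (\<integral>\<^sup>+s. ennreal (norm (\<gamma>' s)) * indicator {a..b} s \<partial>lborel)"
    by (intro nn_integral_cong) (auto simp: indicator_def)
  finally show ?thesis .
qed

lemma measurable_le_unit_ivl:
  "(\<lambda>(x, y). if x \<le> y then 1 else 0 :: real) \<in> borel_measurable (unit_ivl \<Otimes>\<^sub>M unit_ivl)"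
  by measurable

text \<open>Hardy's inequality in the distance to the boundary point 1: as \<open>u 0\<close> is the
  value at distance 1, the difference is an integral of the derivative over distances from
  \<open>x\<close> to 1. The Schur test is applied to the kernel that is 1 for
  \<open>x \<le> y\<close>, with the test weight \<open>y powr - c\<close>.\<close>

lemma nn_integral_hardy:
  assumes u: "u holomorphic_on unit_disc" and p: "1 < p" and \<beta>: "-1 < \<beta>"
  defines "c \<equiv> 1 + (\<beta> + 1) / p"
  shows "(\<integral>\<^sup>+x. x powr \<beta> * norm (u (1 - of_real x) - u 0) powr p \<partial>unit_ivl)
    \<le> ennreal (1 / (c - 1) powr (p - 1) * (p / (\<beta> + 1))) *
       (\<integral>\<^sup>+y. norm (deriv u (1 - of_real y)) powr p * y powr (\<beta> + p) \<partial>unit_ivl)"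
proof -
  have c: "1 < c" using p \<beta> by (simp add: c_def)
  \<comment> \<open>The exponent of the second Schur integral. The test needs \<open>1 < c\<close>
    and \<open>-1 < e\<close>, the latter meaning \<open>(c - 1) * (p - 1) < \<beta> + 1\<close>;
    the chosen \<open>c\<close> gives \<open>e + 1 = c - 1 = (\<beta> + 1) / p\<close>.\<close>
  define e where "e = \<beta> + (1 - c) * (p - 1)"
  have e1: "e + 1 = (\<beta> + 1) / p" using p by (simp add: e_def c_def field_simps)
  have e: "-1 < e" using e1 \<beta> p by (smt (verit) divide_pos_pos)
  define D where "D = 1 / (c - 1) powr (p - 1) * (p / (\<beta> + 1))"
  have D: "D = 1 / (c - 1) powr (p - 1) * (1 / (e + 1))" "0 \<le> D" using e1 p \<beta> by (auto simp: D_def)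
  have n: "norm (1 - of_real x :: complex) < 1" if "x \<in> space unit_ivl" for x
    using that norm_of_real[of "1 - x", where 'a = complex] by auto
  have du: "deriv u holomorphic_on unit_disc" by (intro holomorphic_deriv u) auto
  have "(\<lambda>y. deriv u (1 - of_real y)) \<in> borel_measurable unit_ivl"
    by (rule holomorphic_measurable_comp[OF du]) (use n in auto)
  then have [measurable]: "(\<lambda>y. norm (deriv u (1 - of_real y))) \<in> borel_measurable unit_ivl"
    by measurable
  have "(\<integral>\<^sup>+x. x powr \<beta> * norm (u (1 - of_real x) - u 0) powr p \<partial>unit_ivl)
     \<le> (\<integral>\<^sup>+y. norm (deriv u (1 - of_real y)) powr p * (y powr - c) powr (1 - p) * (y powr (e + 1) * D) \<partial>unit_ivl)"
  proof (rule nn_integral_schur_test[where K = "\<lambda>x y. if x \<le> y then 1 else 0" and W = "\<lambda>x. x powr (1 - c) / (c - 1)"])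
    show "(\<lambda>(x, y). if x \<le> y then 1 else 0 :: real) \<in> borel_measurable (unit_ivl \<Otimes>\<^sub>M unit_ivl)"
      by (rule measurable_le_unit_ivl)
    show "sigma_finite_measure unit_ivl" "sigma_finite_measure unit_ivl"
      by unfold_locales
    fix x assume "x \<in> space unit_ivl"
    then have x: "0 < x" "x < 1" by auto
    have "(\<integral>\<^sup>+y. ennreal (y powr - c * (if x \<le> y then 1 else 0)) \<partial>unit_ivl)
        \<le> (\<integral>\<^sup>+y. ennreal (y powr - c) * indicator {x..} y \<partial>lborel)"
      unfolding nn_integral_unit_ivl by (intro nn_integral_mono) (auto simp: indicator_def)
    also have "\<dots> = ennreal (x powr (1 - c) / (c - 1))" by (intro nn_integral_powr_to_inf c x(1))
    finally show "(\<integral>\<^sup>+y. ennreal (y powr - c * (if x \<le> y then 1 else 0)) \<partial>unit_ivl) \<le> ennreal (x powr (1 - c) / (c - 1))" .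
    have "ennreal (norm (u (1 - of_real x) - u 0)) = ennreal (norm (u (1 - of_real 1) - u (1 - of_real x)))"
      by (simp add: norm_minus_commute)
    also have "\<dots> \<le> (\<integral>\<^sup>+y. ennreal (norm (- deriv u (1 - of_real y))) * indicator {x..1} y \<partial>lborel)"
    proof (rule norm_diff_le_nn_integral)
      have in_disc: "(1 - of_real s :: complex) \<in> unit_disc" if "x \<le> s" "s \<le> 1" for s
        using that x norm_of_real[of "1 - s", where 'a = complex] by auto
      fix s assume s: "x \<le> s" "s \<le> 1"
      have "(u has_field_derivative deriv u (1 - of_real s)) (at (1 - of_real s))"
        using in_disc[OF s] by (intro holomorphic_derivI[OF u]) auto
      moreover have "((\<lambda>s. 1 - complex_of_real s) has_vector_derivative -1) (at s within {x..1})"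
        by (auto intro!: derivative_eq_intros)
      ultimately have "(u \<circ> (\<lambda>s. 1 - complex_of_real s) has_vector_derivative - 1 * deriv u (1 - of_real s)) (at s within {x..1})"
        by (intro field_vector_diff_chain_within) (auto intro: has_field_derivative_at_within)
      then show "((\<lambda>s. u (1 - complex_of_real s)) has_vector_derivative - deriv u (1 - of_real s)) (at s within {x..1})"
        by (simp add: o_def)
    next
      show "continuous_on {x..1} (\<lambda>y. - deriv u (1 - of_real y))"
      proof (intro continuous_intros continuous_on_compose2[OF holomorphic_on_imp_continuous_on[OF du]])
        show "(\<lambda>y. 1 - complex_of_real y) ` {x..1} \<subseteq> unit_disc"
        proof clarify
          fix s assume "s \<in> {x..1}"
          then show "(1 - of_real s :: complex) \<in> unit_disc"
            using x norm_of_real[of "1 - s", where 'a = complex] by auto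
        qed
      qed
    qed (use x in auto)
    also have "\<dots> = (\<integral>\<^sup>+y. ennreal (norm (deriv u (1 - of_real y)) * (if x \<le> y then 1 else 0)) \<partial>unit_ivl)"
      unfolding nn_integral_unit_ivl
    proof (rule nn_integral_cong_AE)
      show "AE y in lborel. ennreal (norm (- deriv u (1 - of_real y))) * indicator {x..1} y =
         ennreal (norm (deriv u (1 - of_real y)) * (if x \<le> y then 1 else 0)) * indicator {0<..<1} y"
        using AE_lborel_singleton[of 1] by eventually_elim (use x in \<open>auto simp: indicator_def\<close>)
    qed
    finally show "0 \<le> norm (u (1 - of_real x) - u 0) \<and> ennreal (norm (u (1 - of_real x) - u 0))
      \<le> (\<integral>\<^sup>+y. ennreal (norm (deriv u (1 - of_real y)) * (if x \<le> y then 1 else 0)) \<partial>unit_ivl)" by simp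
  next
    fix y assume "y \<in> space unit_ivl"
    then have y: "0 < y" "y < 1" by auto
    let ?q = "1 / (c - 1) powr (p - 1)"
    have "(\<integral>\<^sup>+x. ennreal (x powr \<beta> * (x powr (1 - c) / (c - 1)) powr (p - 1) * (if x \<le> y then 1 else 0)) \<partial>unit_ivl)
        \<le> (\<integral>\<^sup>+x. ennreal ?q * (ennreal (x powr e) * indicator {0..y} x) \<partial>lborel)"
      unfolding nn_integral_unit_ivl
    proof (rule nn_integral_mono)
      fix x :: real
      show "ennreal (x powr \<beta> * (x powr (1 - c) / (c - 1)) powr (p - 1) * (if x \<le> y then 1 else 0)) * indicator {0<..<1} x
         \<le> ennreal ?q * (ennreal (x powr e) * indicator {0..y} x)"
        using c by (auto simp: indicator_def ennreal_mult[symmetric] powr_divide powr_powr e_def powr_add[symmetric])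
    qed
    also have "\<dots> = ennreal ?q * ennreal (y powr (e + 1) / (e + 1))"
      using e y by (subst nn_integral_cmult) (auto simp: nn_integral_powr_from_0)
    also have "\<dots> = ennreal (y powr (e + 1) * D)"
      using e by (simp add: D(1) ennreal_mult[symmetric])
    finally show "(\<integral>\<^sup>+x. ennreal (x powr \<beta> * (x powr (1 - c) / (c - 1)) powr (p - 1) * (if x \<le> y then 1 else 0)) \<partial>unit_ivl)
       \<le> ennreal (y powr (e + 1) * D)" .
  qed (use p c in auto)
  also have "\<dots> = (\<integral>\<^sup>+y. ennreal D * ennreal (norm (deriv u (1 - of_real y)) powr p * y powr (\<beta> + p)) \<partial>unit_ivl)"
  proof (rule nn_integral_cong)
    fix y assume "y \<in> space unit_ivl"
    then have y: "0 < y" by auto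
    have "(y powr - c) powr (1 - p) * y powr (e + 1) = y powr (\<beta> + p)"
      using y by (simp add: powr_powr powr_add[symmetric] e_def algebra_simps)
    then show "ennreal (norm (deriv u (1 - of_real y)) powr p * (y powr - c) powr (1 - p) * (y powr (e + 1) * D))
      = ennreal D * ennreal (norm (deriv u (1 - of_real y)) powr p * y powr (\<beta> + p))"
      using D(2) by (simp add: ennreal_mult[symmetric] mult_ac)
  qed
  also have "\<dots> = ennreal D * (\<integral>\<^sup>+y. norm (deriv u (1 - of_real y)) powr p * y powr (\<beta> + p) \<partial>unit_ivl)"
    by (rule nn_integral_cmult) measurable
  finally show ?thesis by (simp add: D_def)
qed

text \<open>Hardy's inequality with \<open>\<beta> = \<alpha> + 1 - p\<close> raises the exponent of
  the weight by \<open>p\<close>, to \<open>\<alpha> + 1\<close>, and for that weight the radial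
  trace of the derivative is controlled by its energy. The condition \<open>p - 2 < \<alpha>\<close>
  is exactly \<open>-1 < \<beta>\<close>.\<close>

lemma radial_Lp_le_energy:
  assumes p: "1 < p" and \<alpha>: "p - 2 < \<alpha>"
  obtains C where "0 \<le> C"
    "\<And>u. u holomorphic_on unit_disc \<Longrightarrow>
       (\<integral>\<^sup>+x. x powr (\<alpha> + 1 - p) * norm (u (1 - of_real x)) powr p \<partial>unit_ivl)
       \<le> ennreal C * (ennreal (norm (u 0) powr p) + bergman_energy p \<alpha> (deriv u))"
proof -
  define \<beta> where "\<beta> = \<alpha> + 1 - p"
  have \<beta>: "-1 < \<beta>" using \<alpha> by (simp add: \<beta>_def)
  define c where "c = 1 + (\<beta> + 1) / p"
  define C1 where "C1 = 1 / (c - 1) powr (p - 1) * (p / (\<beta> + 1))"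
  define C2 where "C2 = 24 / pi * 3 powr \<bar>\<alpha>\<bar>"
  have C: "0 \<le> C1" "0 \<le> C2" using p \<beta> by (auto simp: C1_def C2_def)
  define K0 where "K0 = C1 * C2 + 1 / (\<beta> + 1)"
  define K where "K = 2 powr p * K0"
  have K0: "0 \<le> K0" "C1 * C2 \<le> K0" "1 / (\<beta> + 1) \<le> K0" using C \<beta> by (auto simp: K0_def)
  show ?thesis
  proof (rule that)
    show "0 \<le> K" using K0 by (simp add: K_def)
    fix u assume u: "u holomorphic_on unit_disc"
    let ?E = "bergman_energy p \<alpha> (deriv u)"
    have du: "deriv u holomorphic_on unit_disc" by (intro holomorphic_deriv u) auto
    have "(\<lambda>x. u (1 - of_real x)) \<in> borel_measurable unit_ivl"
    proof (rule holomorphic_measurable_comp[OF u])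
      fix x assume "x \<in> space unit_ivl"
      then show "norm (1 - of_real x :: complex) < 1"
        using norm_of_real[of "1 - x", where 'a = complex] by auto
    qed measurable
    then have [measurable]: "(\<lambda>x. norm (u (1 - of_real x) - u 0)) \<in> borel_measurable unit_ivl"
      by measurable
    have h: "(\<integral>\<^sup>+x. x powr \<beta> * norm (u (1 - of_real x) - u 0) powr p \<partial>unit_ivl) \<le> ennreal (C1 * C2) * ?E"
    proof -
      have "(\<integral>\<^sup>+y. norm (deriv u (1 - of_real y)) powr p * y powr (\<beta> + p) \<partial>unit_ivl) \<le> ennreal C2 * ?E"
        using radial_trace_le_energy[OF du p, of \<alpha>] by (simp add: \<beta>_def C2_def add.commute)
      then have "ennreal C1 * (\<integral>\<^sup>+y. norm (deriv u (1 - of_real y)) powr p * y powr (\<beta> + p) \<partial>unit_ivl)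
          \<le> ennreal C1 * (ennreal C2 * ?E)" by (rule mult_left_mono) simp
      with nn_integral_hardy[OF u p \<beta>, folded c_def, folded C1_def]
      have "(\<integral>\<^sup>+x. x powr \<beta> * norm (u (1 - of_real x) - u 0) powr p \<partial>unit_ivl) \<le> ennreal C1 * (ennreal C2 * ?E)"
        by (rule order_trans)
      also have "\<dots> = ennreal (C1 * C2) * ?E"
        unfolding ennreal_mult[OF C] by (rule mult.assoc[symmetric])
      finally show ?thesis .
    qed
    have "(\<integral>\<^sup>+x. x powr \<beta> * norm (u (1 - of_real x)) powr p \<partial>unit_ivl)
      \<le> (\<integral>\<^sup>+x. ennreal (2 powr p) * (ennreal (x powr \<beta> * norm (u (1 - of_real x) - u 0) powr p)
           + ennreal (norm (u 0) powr p) * ennreal (x powr \<beta>)) \<partial>unit_ivl)"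
    proof (rule nn_integral_mono)
      fix x :: real
      have "norm (u (1 - of_real x)) powr p \<le> (norm (u (1 - of_real x) - u 0) + norm (u 0)) powr p"
        using p norm_triangle_sub[of "u (1 - of_real x)" "u 0"] by (intro powr_mono2) (auto simp: add.commute)
      also have "\<dots> \<le> 2 powr p * (norm (u (1 - of_real x) - u 0) powr p + norm (u 0) powr p)"
        using p by (intro powr_add_le) auto
      finally have "x powr \<beta> * norm (u (1 - of_real x)) powr p
         \<le> x powr \<beta> * (2 powr p * (norm (u (1 - of_real x) - u 0) powr p + norm (u 0) powr p))"
        by (rule mult_left_mono) simp
      also have "\<dots> = 2 powr p * (x powr \<beta> * norm (u (1 - of_real x) - u 0) powr p + norm (u 0) powr p * x powr \<beta>)"
        by (simp add: algebra_simps)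
      finally have "ennreal (x powr \<beta> * norm (u (1 - of_real x)) powr p) \<le> ennreal \<dots>" by (rule ennreal_leI)
      then show "ennreal (x powr \<beta> * norm (u (1 - of_real x)) powr p)
        \<le> ennreal (2 powr p) * (ennreal (x powr \<beta> * norm (u (1 - of_real x) - u 0) powr p)
           + ennreal (norm (u 0) powr p) * ennreal (x powr \<beta>))"
        by (simp add: ennreal_mult)
    qed
    also have "\<dots> = ennreal (2 powr p) * ((\<integral>\<^sup>+x. x powr \<beta> * norm (u (1 - of_real x) - u 0) powr p \<partial>unit_ivl)
        + ennreal (norm (u 0) powr p) * (\<integral>\<^sup>+x. x powr \<beta> \<partial>unit_ivl))"
      by (simp add: nn_integral_cmult nn_integral_add)
    also have "(\<integral>\<^sup>+x. ennreal (x powr \<beta>) \<partial>unit_ivl) \<le> (\<integral>\<^sup>+x. ennreal (x powr \<beta>) * indicator {0..1} x \<partial>lborel)"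
      unfolding nn_integral_unit_ivl by (intro nn_integral_mono) (auto simp: indicator_def)
    also have "\<dots> = ennreal (1 / (\<beta> + 1))" using nn_integral_powr_from_0[OF \<beta>, of 1] by simp
    also have "ennreal (2 powr p) * ((\<integral>\<^sup>+x. x powr \<beta> * norm (u (1 - of_real x) - u 0) powr p \<partial>unit_ivl)
        + ennreal (norm (u 0) powr p) * ennreal (1 / (\<beta> + 1)))
      \<le> ennreal (2 powr p) * (ennreal K0 * ?E + ennreal (norm (u 0) powr p) * ennreal K0)"
      using K0 by (intro mult_left_mono add_mono order_trans[OF h] mult_right_mono ennreal_leI) auto
    also have "\<dots> = ennreal K * (ennreal (norm (u 0) powr p) + ?E)"
      using K0 by (simp add: K_def ennreal_mult distrib_left mult_ac add_ac)
    finally show "(\<integral>\<^sup>+x. x powr (\<alpha> + 1 - p) * norm (u (1 - of_real x)) powr p \<partial>unit_ivl)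
       \<le> ennreal K * (ennreal (norm (u 0) powr p) + ?E)"
      by (auto simp: \<beta>_def mult_left_mono add_left_mono)
  qed
qed

text \<open>Since \<open>0 \<le> \<tau> y \<le> 1\<close>, all evaluation points stay in one compact
  disc, on which \<open>deriv G\<close> is bounded by some \<open>B\<close>. Difference quotients of
  the integrand are thus dominated by \<open>B * norm (\<phi> y)\<close>, and dominated convergence
  differentiates under the integral.\<close>

lemma has_field_derivative_integral_dilation:
  fixes \<phi> :: "'a \<Rightarrow> complex" and \<tau> :: "'a \<Rightarrow> real" and G :: "complex \<Rightarrow> complex" and z :: complex
  assumes G: "G holomorphic_on unit_disc" and \<phi>: "integrable M \<phi>"
    and [measurable]: "\<tau> \<in> borel_measurable M" and \<tau>: "\<And>y. y \<in> space M \<Longrightarrow> 0 \<le> \<tau> y \<and> \<tau> y \<le> 1"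
    and z: "norm z < 1"
  shows "((\<lambda>z. LINT y|M. \<phi> y * G (\<tau> y * z)) has_field_derivative
            (LINT y|M. \<phi> y * (\<tau> y * deriv G (\<tau> y * z)))) (at z)"
    and "integrable M (\<lambda>y. \<phi> y * G (\<tau> y * z))"
proof -
  note [measurable] = borel_measurable_integrable[OF \<phi>]
  have dG: "deriv G holomorphic_on unit_disc" by (intro holomorphic_deriv G) auto
  define r where "r = (1 + norm z) / 2"
  have r: "0 \<le> r" "r < 1" "norm z < r" using z by (auto simp: r_def)
  have scale: "norm (of_real (\<tau> y) * w) \<le> r" if "y \<in> space M" "norm w \<le> r" for y and w :: complex
    using \<tau>[OF that(1)] that(2) r mult_mono[of "\<tau> y" 1 "norm w" r] by (simp add: norm_mult)
  have sub: "cball 0 r \<subseteq> unit_disc" using r by auto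
  obtain B0 where B0: "\<forall>w\<in>cball 0 r. norm (G w) \<le> B0"
    using compact_imp_bounded[OF compact_continuous_image[OF continuous_on_subset[OF holomorphic_on_imp_continuous_on[OF G] sub]]]
    by (auto simp: bounded_iff)
  obtain B where B: "\<forall>w\<in>cball 0 r. norm (deriv G w) \<le> B"
    using compact_imp_bounded[OF compact_continuous_image[OF continuous_on_subset[OF holomorphic_on_imp_continuous_on[OF dG] sub]]]
    by (auto simp: bounded_iff)
  have B_nonneg: "0 \<le> B" using B r by (metis mem_cball_0 norm_ge_zero norm_zero order_trans)
  have Gm: "(\<lambda>y. G (\<tau> y * w)) \<in> borel_measurable M" if "norm w \<le> r" for w :: complex
    by (rule holomorphic_measurable_comp[OF G]) (use that r in \<open>auto intro: le_less_trans[OF scale]\<close>)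
  have dGm: "(\<lambda>y. deriv G (\<tau> y * w)) \<in> borel_measurable M" if "norm w \<le> r" for w :: complex
    by (rule holomorphic_measurable_comp[OF dG]) (use that r in \<open>auto intro: le_less_trans[OF scale]\<close>)
  have int: "integrable M (\<lambda>y. \<phi> y * G (\<tau> y * w))" if w: "norm w \<le> r" for w :: complex
  proof (rule Bochner_Integration.integrable_bound[OF integrable_mult_right[OF integrable_norm[OF \<phi>], of B0]])
    show "AE y in M. norm (\<phi> y * G (\<tau> y * w)) \<le> norm (B0 * norm (\<phi> y))"
    proof (intro AE_I2)
      fix y assume "y \<in> space M"
      then have "norm (G (\<tau> y * w)) \<le> B0" using B0 scale w by auto
      then have "norm (\<phi> y) * norm (G (\<tau> y * w)) \<le> norm (\<phi> y) * \<bar>B0\<bar>" by (intro mult_left_mono) auto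
      then show "norm (\<phi> y * G (\<tau> y * w)) \<le> norm (B0 * norm (\<phi> y))"
        by (simp add: norm_mult abs_mult mult.commute)
    qed
  qed (use Gm[OF w] in measurable)
  show "integrable M (\<lambda>y. \<phi> y * G (\<tau> y * z))" using int r by simp
  let ?H = "\<lambda>z::complex. LINT y|M. \<phi> y * G (\<tau> y * z)"
  have lip: "norm (G (\<tau> y * w) - G (\<tau> y * z)) \<le> B * norm (w - z)" if y: "y \<in> space M" and w: "norm w \<le> r" for y and w :: complex
  proof -
    have "norm (G (\<tau> y * w) - G (\<tau> y * z)) \<le> B * norm (\<tau> y * w - \<tau> y * z)"
    proof (rule field_differentiable_bound[of "cball 0 r" G "deriv G"])
      fix v assume "v \<in> cball (0::complex) r"
      then show "(G has_field_derivative deriv G v) (at v within cball 0 r)"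
        using sub by (intro has_field_derivative_at_within[OF holomorphic_derivI[OF G]]) auto
    qed (use B scale[OF y] w r in auto)
    also have "norm (\<tau> y * w - \<tau> y * z) = \<tau> y * norm (w - z)"
      using \<tau>[OF y] by (simp add: right_diff_distrib[symmetric] norm_mult)
    also have "B * (\<tau> y * norm (w - z)) \<le> B * (1 * norm (w - z))"
      using \<tau>[OF y] B_nonneg by (intro mult_left_mono mult_right_mono) auto
    finally show ?thesis by simp
  qed
  show "(?H has_field_derivative (LINT y|M. \<phi> y * (\<tau> y * deriv G (\<tau> y * z)))) (at z)"
    unfolding has_field_derivative_iff tendsto_at_iff_sequentially comp_def
  proof (intro allI impI)
    fix X :: "nat \<Rightarrow> complex" assume X: "\<forall>i. X i \<in> UNIV - {z}" "X \<longlonglongrightarrow> z"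
    have "\<forall>\<^sub>F i in sequentially. norm (X i) < r"
      using tendsto_norm[OF X(2)] r by (intro order_tendstoD(2)) auto
    then obtain N where N: "\<And>i. i \<ge> N \<Longrightarrow> norm (X i) < r" by (auto simp: eventually_sequentially)
    \<comment> \<open>Dropping finitely many terms puts the whole sequence into the disc on which
      the Lipschitz bound holds.\<close>
    define Y where "Y i = X (i + N)" for i
    have Y: "norm (Y i) \<le> r" "Y i \<noteq> z" for i using N[of "i + N"] X by (auto simp: Y_def)
    have Ylim: "Y \<longlonglongrightarrow> z" unfolding Y_def by (intro LIMSEQ_ignore_initial_segment X)
    have eq: "(?H (Y i) - ?H z) / (Y i - z) = (LINT y|M. \<phi> y * ((G (\<tau> y * Y i) - G (\<tau> y * z)) / (Y i - z)))" for i
    proof -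
      have "(LINT y|M. \<phi> y * ((G (\<tau> y * Y i) - G (\<tau> y * z)) / (Y i - z)))
          = (LINT y|M. (\<phi> y * G (\<tau> y * Y i) - \<phi> y * G (\<tau> y * z)) / (Y i - z))"
        by (intro Bochner_Integration.integral_cong refl) (simp add: right_diff_distrib)
      also have "\<dots> = (LINT y|M. \<phi> y * G (\<tau> y * Y i) - \<phi> y * G (\<tau> y * z)) / (Y i - z)"
        by (rule integral_divide_zero)
      also have "\<dots> = (?H (Y i) - ?H z) / (Y i - z)"
        using int[OF Y(1)[of i]] int[of z] r by (subst Bochner_Integration.integral_diff) auto
      finally show ?thesis ..
    qed
    have "(\<lambda>i. LINT y|M. \<phi> y * ((G (\<tau> y * Y i) - G (\<tau> y * z)) / (Y i - z)))
        \<longlonglongrightarrow> (LINT y|M. \<phi> y * (\<tau> y * deriv G (\<tau> y * z)))"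
    proof (rule integral_dominated_convergence[where w = "\<lambda>y. B * norm (\<phi> y)"])
      show "integrable M (\<lambda>y. B * norm (\<phi> y))" using \<phi> by simp
      show "(\<lambda>y. \<phi> y * (\<tau> y * deriv G (\<tau> y * z))) \<in> borel_measurable M"
        using dGm[OF less_imp_le[OF r(3)]] by measurable
      show "(\<lambda>y. \<phi> y * ((G (\<tau> y * Y i) - G (\<tau> y * z)) / (Y i - z))) \<in> borel_measurable M" for i
        using Gm[OF less_imp_le[OF r(3)]] Gm[OF Y(1), of i] by measurable
      show "AE y in M. norm (\<phi> y * ((G (\<tau> y * Y i) - G (\<tau> y * z)) / (Y i - z))) \<le> B * norm (\<phi> y)" for i
      proof (intro AE_I2)
        fix y assume y: "y \<in> space M"
        have "norm ((G (\<tau> y * Y i) - G (\<tau> y * z)) / (Y i - z)) \<le> B"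
          using lip[OF y Y(1)[of i]] Y(2)[of i] by (simp add: norm_divide divide_le_eq)
        then have "norm (\<phi> y) * norm ((G (\<tau> y * Y i) - G (\<tau> y * z)) / (Y i - z)) \<le> norm (\<phi> y) * B"
          by (intro mult_left_mono) auto
        then show "norm (\<phi> y * ((G (\<tau> y * Y i) - G (\<tau> y * z)) / (Y i - z))) \<le> B * norm (\<phi> y)"
          by (simp only: norm_mult mult.commute)
      qed
      show "AE y in M. (\<lambda>i. \<phi> y * ((G (\<tau> y * Y i) - G (\<tau> y * z)) / (Y i - z)))
          \<longlonglongrightarrow> \<phi> y * (\<tau> y * deriv G (\<tau> y * z))"
      proof (intro AE_I2 tendsto_mult tendsto_const)
        fix y assume y: "y \<in> space M"
        have "\<tau> y * z \<in> unit_disc" using scale[OF y, of z] r by auto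
        then have "(G has_field_derivative deriv G (\<tau> y * z)) (at (\<tau> y * z))"
          by (intro holomorphic_derivI[OF G]) auto
        then have "((\<lambda>w. G (\<tau> y * w)) has_field_derivative deriv G (\<tau> y * z) * \<tau> y) (at z)"
          by (rule DERIV_chain2) (auto intro!: derivative_eq_intros)
        then have "((\<lambda>w. (G (\<tau> y * w) - G (\<tau> y * z)) / (w - z)) \<longlongrightarrow> deriv G (\<tau> y * z) * \<tau> y) (at z)"
          by (simp add: has_field_derivative_iff)
        then show "(\<lambda>i. (G (\<tau> y * Y i) - G (\<tau> y * z)) / (Y i - z)) \<longlonglongrightarrow> \<tau> y * deriv G (\<tau> y * z)"
          using Y Ylim by (auto simp: tendsto_at_iff_sequentially comp_def mult.commute)
      qed
    qed
    then have "(\<lambda>i. (?H (X (i + N)) - ?H z) / (X (i + N) - z)) \<longlonglongrightarrow> (LINT y|M. \<phi> y * (\<tau> y * deriv G (\<tau> y * z)))"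
      by (simp only: eq[symmetric]) (simp only: Y_def)
    then show "(\<lambda>i. (?H (X i) - ?H z) / (X i - z)) \<longlonglongrightarrow> (LINT y|M. \<phi> y * (\<tau> y * deriv G (\<tau> y * z)))"
      by (rule LIMSEQ_offset)
  qed
qed

section \<open>Regularity and energy of the image functions\<close>

lemma norm_one_minus_of_real:
  "x \<in> {0<..<1} \<Longrightarrow> norm (1 - of_real x :: complex) = 1 - x"
  using norm_of_real[of "1 - x", where 'a = complex] by auto

lemma radial_measurable:
  assumes "u holomorphic_on unit_disc"
  shows "(\<lambda>x. u (1 - of_real x)) \<in> borel_measurable unit_ivl"
  by (rule holomorphic_measurable_comp[OF assms]) (auto simp: norm_one_minus_of_real)

text \<open>The substitution \<open>y = 1 - t\<close> passes to the distance from the endpoint. It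
  also respects the default value: both sides are 0 together when the integrand is not
  integrable.\<close>

lemma gen_hilbert_eq_unit_ivl:
  assumes u: "u holomorphic_on unit_disc" and g: "g holomorphic_on unit_disc" and z: "norm z < 1"
  shows "gen_hilbert g u z = (LINT y|unit_ivl. u (1 - of_real y) * deriv g (of_real (1 - y) * z))"
proof -
  have dg: "deriv g holomorphic_on unit_disc" by (intro holomorphic_deriv g) auto
  define h where "h t = u (of_real t) * deriv g (of_real t * z)" for t :: real
  have "h \<in> borel_measurable (restrict_space borel {0<..<1})"
    unfolding h_def
  proof (rule borel_measurable_continuous_on_restrict, intro continuous_intros)
    show "continuous_on {0<..<1} (\<lambda>x. u (complex_of_real x))"
      by (rule continuous_on_compose2[OF holomorphic_on_imp_continuous_on[OF u]]) (auto intro!: continuous_intros)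
    have "x * norm z < 1" if "0 < x" "x < 1" for x
      using z that mult_left_le_one_le[of "norm z" x] by simp
    then show "continuous_on {0<..<1} (\<lambda>x. deriv g (complex_of_real x * z))"
      by (intro continuous_on_compose2[OF holomorphic_on_imp_continuous_on[OF dg]])
         (auto intro!: continuous_intros simp: norm_mult)
  qed
  then have [measurable]: "(\<lambda>t. indicator {0<..<1} t *\<^sub>R h t) \<in> borel_measurable borel"
    by (subst (asm) borel_measurable_restrict_space_iff) auto
  have "gen_hilbert g u z = (LINT t|lborel. indicator {0<..<1} t *\<^sub>R h t)"
    unfolding gen_hilbert_def set_lebesgue_integral_def h_def[symmetric]
  proof (rule integral_cong_AE)
    have "(\<lambda>t. indicator {0<..<1} t *\<^sub>R h t + indicator {0} t *\<^sub>R h 0) \<in> borel_measurable borel"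
      by measurable
    also have "(\<lambda>t. indicator {0<..<1} t *\<^sub>R h t + indicator {0} t *\<^sub>R h 0) = (\<lambda>t. indicator {0..<1} t *\<^sub>R h t)"
      by (auto simp: fun_eq_iff indicator_def)
    finally show "(\<lambda>t. indicator {0..<1} t *\<^sub>R h t) \<in> borel_measurable lborel" by simp
    show "AE t in lborel. indicator {0..<1} t *\<^sub>R h t = indicator {0<..<1} t *\<^sub>R h t"
      using AE_lborel_singleton[of 0] by eventually_elim (auto simp: indicator_def)
  qed simp
  also have "\<dots> = (LINT y|lborel. indicator {0<..<1} (1 - y) *\<^sub>R h (1 - y))"
    using lborel_integral_real_affine[of "-1" "\<lambda>t. indicator {0<..<1} t *\<^sub>R h t" 1] by simp
  also have "\<dots> = (LINT y|lborel. indicator {0<..<1} y *\<^sub>R h (1 - y))"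
    by (intro Bochner_Integration.integral_cong) (auto simp: indicator_def)
  also have "\<dots> = (LINT y|unit_ivl. h (1 - y))"
    unfolding unit_ivl_def by (subst integral_restrict_space) auto
  finally show ?thesis by (simp add: h_def)
qed

lemma gen_hilbert_regular:
  assumes u: "u holomorphic_on unit_disc" and g: "g holomorphic_on unit_disc"
    and fin: "(\<integral>\<^sup>+y. norm (u (1 - of_real y)) \<partial>unit_ivl) < \<infinity>"
  shows gen_hilbert_holomorphic: "gen_hilbert g u holomorphic_on unit_disc"
    and norm_gen_hilbert_le: "norm z < 1 \<Longrightarrow> ennreal (norm (gen_hilbert g u z))
      \<le> (\<integral>\<^sup>+y. norm (u (1 - of_real y)) * norm (deriv g (of_real (1 - y) * z)) \<partial>unit_ivl)"
    and norm_deriv_gen_hilbert_le: "norm z < 1 \<Longrightarrow> ennreal (norm (deriv (gen_hilbert g u) z))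
      \<le> (\<integral>\<^sup>+y. norm (u (1 - of_real y)) * norm (deriv (deriv g) (of_real (1 - y) * z)) \<partial>unit_ivl)"
    and gen_hilbert_integrable: "norm z < 1 \<Longrightarrow>
      integrable unit_ivl (\<lambda>y. u (1 - of_real y) * deriv g (of_real (1 - y) * z))"
    and deriv_gen_hilbert_eq: "norm z < 1 \<Longrightarrow> deriv (gen_hilbert g u) z
      = (LINT y|unit_ivl. u (1 - of_real y) * (of_real (1 - y) * deriv (deriv g) (of_real (1 - y) * z)))"
proof -
  have dg: "deriv g holomorphic_on unit_disc" by (intro holomorphic_deriv g) auto
  have int: "integrable unit_ivl (\<lambda>y. u (1 - of_real y))"
    using radial_measurable[OF u] fin by (auto simp: integrable_iff_bounded)
  let ?H = "\<lambda>z. LINT y|unit_ivl. u (1 - of_real y) * deriv g (of_real (1 - y) * z)"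
  note D = has_field_derivative_integral_dilation[OF dg int, of "\<lambda>y. 1 - y"]
  have D1: "(?H has_field_derivative (LINT y|unit_ivl. u (1 - of_real y) * (of_real (1 - y) * deriv (deriv g) (of_real (1 - y) * z)))) (at z)"
    if "norm z < 1" for z
    by (rule D(1)) (use that in auto)
  show "integrable unit_ivl (\<lambda>y. u (1 - of_real y) * deriv g (of_real (1 - y) * z))" if "norm z < 1"
    by (rule D(2)) (use that in auto)
  have eq: "gen_hilbert g u z = ?H z" if "norm z < 1" for z
    using gen_hilbert_eq_unit_ivl[OF u g that] .
  have D2: "(gen_hilbert g u has_field_derivative (LINT y|unit_ivl. u (1 - of_real y) * (of_real (1 - y) * deriv (deriv g) (of_real (1 - y) * z)))) (at z)"
    if z: "norm z < 1" for z
    by (rule has_field_derivative_transform_within_open[OF D1[OF z], of unit_disc]) (use z eq in auto)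
  show "deriv (gen_hilbert g u) z
      = (LINT y|unit_ivl. u (1 - of_real y) * (of_real (1 - y) * deriv (deriv g) (of_real (1 - y) * z)))" if "norm z < 1"
    by (rule DERIV_imp_deriv[OF D2[OF that]])
  have "\<exists>f'. (gen_hilbert g u has_field_derivative f') (at z)" if "z \<in> unit_disc" for z
    using D2[of z] that by (intro exI) auto
  then show "gen_hilbert g u holomorphic_on unit_disc"
    by (simp add: holomorphic_on_open)
  \<comment> \<open>A non-integrable \<open>f\<close> has integral 0 by default, so the bound covers
    every \<open>f\<close>.\<close>
  have bd: "ennreal (norm (LINT y|unit_ivl. f y)) \<le> (\<integral>\<^sup>+y. norm (f y) \<partial>unit_ivl)" for f :: "real \<Rightarrow> complex"
    by (cases "integrable unit_ivl f") (auto intro: integral_norm_bound_ennreal simp: not_integrable_integral_eq)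
  show "ennreal (norm (gen_hilbert g u z))
      \<le> (\<integral>\<^sup>+y. norm (u (1 - of_real y)) * norm (deriv g (of_real (1 - y) * z)) \<partial>unit_ivl)" if z: "norm z < 1"
    using bd[of "\<lambda>y. u (1 - of_real y) * deriv g (of_real (1 - y) * z)"] by (simp add: eq[OF z] norm_mult)
  show "ennreal (norm (deriv (gen_hilbert g u) z))
      \<le> (\<integral>\<^sup>+y. norm (u (1 - of_real y)) * norm (deriv (deriv g) (of_real (1 - y) * z)) \<partial>unit_ivl)" if z: "norm z < 1"
  proof -
    have "ennreal (norm (deriv (gen_hilbert g u) z))
      \<le> (\<integral>\<^sup>+y. norm (u (1 - of_real y) * (of_real (1 - y) * deriv (deriv g) (of_real (1 - y) * z))) \<partial>unit_ivl)"
      unfolding DERIV_imp_deriv[OF D2[OF z]] by (rule bd)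
    also have "\<dots> \<le> (\<integral>\<^sup>+y. norm (u (1 - of_real y)) * norm (deriv (deriv g) (of_real (1 - y) * z)) \<partial>unit_ivl)"
    proof (intro nn_integral_mono ennreal_leI)
      fix y assume "y \<in> space unit_ivl"
      then have "norm (of_real (1 - y) :: complex) \<le> 1" unfolding norm_of_real by auto
      then have "norm (u (1 - of_real y)) * (norm (of_real (1 - y) :: complex) * norm (deriv (deriv g) (of_real (1 - y) * z)))
        \<le> norm (u (1 - of_real y)) * (1 * norm (deriv (deriv g) (of_real (1 - y) * z)))"
        by (intro mult_left_mono mult_right_mono) auto
      then show "norm (u (1 - of_real y) * (of_real (1 - y) * deriv (deriv g) (of_real (1 - y) * z)))
        \<le> norm (u (1 - of_real y)) * norm (deriv (deriv g) (of_real (1 - y) * z))"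
        unfolding norm_mult by simp
    qed
    finally show ?thesis .
  qed
qed

lemma gen_hilbert_diff:
  assumes "u holomorphic_on unit_disc" "v holomorphic_on unit_disc" "g holomorphic_on unit_disc"
    and "(\<integral>\<^sup>+y. norm (u (1 - of_real y)) \<partial>unit_ivl) < \<infinity>" "(\<integral>\<^sup>+y. norm (v (1 - of_real y)) \<partial>unit_ivl) < \<infinity>"
    and z: "norm z < 1"
  shows "gen_hilbert g (\<lambda>z. u z - v z) z = gen_hilbert g u z - gen_hilbert g v z"
proof -
  have "(\<lambda>z. u z - v z) holomorphic_on unit_disc" by (intro holomorphic_intros assms)
  then show ?thesis
    using gen_hilbert_integrable[OF assms(1,3,4) z] gen_hilbert_integrable[OF assms(2,3,5) z]
    by (simp add: gen_hilbert_eq_unit_ivl[OF _ assms(3) z] assms left_diff_distrib)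
qed

text \<open>In Minkowski's inequality the two terms of the growth bound separate: the singular one
  gives \<open>a\<close> times the integral operator \<open>S\<close> with kernel
  \<open>max x y powr - B\<close>, the constant one gives \<open>b * L\<close>. As \<open>C\<close>
  depends only on \<open>p\<close> and \<open>\<alpha>\<close>, \<open>a\<close> can be chosen small
  first and \<open>b\<close> afterwards.\<close>

lemma bergman_energy_gen_hilbert_le:
  assumes p: "1 < p" and \<alpha>: "p - 2 < \<alpha>" "\<alpha> \<le> p - 1"
  obtains C where "0 \<le> C"
    "\<And>g u a b L. g holomorphic_on unit_disc \<Longrightarrow> u holomorphic_on unit_disc \<Longrightarrow> 0 < a \<Longrightarrow> 0 \<le> b \<Longrightarrow>
       (\<And>s. 0 \<le> s \<Longrightarrow> s < 1 \<Longrightarrow> circle_mean p (deriv (deriv g)) s \<le> ennreal ((a * (1 - s) powr (1 / p - 2) + b) powr p)) \<Longrightarrow>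
       (\<integral>\<^sup>+y. norm (u (1 - of_real y)) \<partial>unit_ivl) = ennreal L \<Longrightarrow> 0 \<le> L \<Longrightarrow>
       bergman_energy p \<alpha> (deriv (gen_hilbert g u))
         \<le> ennreal (C * a powr p) * (ennreal (norm (u 0) powr p) + bergman_energy p \<alpha> (deriv u))
           + ennreal (C * (b * L) powr p)"
proof -
  obtain C0 where C0: "0 \<le> C0" "\<And>u. u holomorphic_on unit_disc \<Longrightarrow>
       (\<integral>\<^sup>+x. x powr (\<alpha> + 1 - p) * norm (u (1 - of_real x)) powr p \<partial>unit_ivl)
       \<le> ennreal C0 * (ennreal (norm (u 0) powr p) + bergman_energy p \<alpha> (deriv u))"
    using radial_Lp_le_energy[OF p \<alpha>(1)] by blast
  define B where "B = 2 - 1 / p"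
  have B: "1 < B" using p by (simp add: B_def)
  \<comment> \<open>By homogeneity the Schur test returns the weight
    \<open>y powr (\<alpha> + 1 - p)\<close> for every \<open>s\<close>; the choice only has to make
    both power integrals converge. This \<open>s\<close> gives
    \<open>e + 1 = (\<alpha> + 1) / p\<close>, which lies in (0, 1] because
    \<open>\<alpha> \<le> p - 1\<close>, while \<open>B > 1\<close>.\<close>
  define s where "s = (\<alpha> + 2 - p) / p"
  have s: "0 < s" "s \<le> 1 / p" using \<alpha> p by (auto simp: s_def divide_right_mono)
  have s1: "s < 1" using s p by (simp add: le_less_trans)
  define e where "e = \<alpha> + (p - 1) * (1 - s - B)"
  have e_eq: "e = (\<alpha> + 1) / p - 1"
    using p by (simp add: e_def s_def B_def field_simps power2_eq_square)
  have e: "-1 < e" "e + 1 < B"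
  proof -
    have "0 < (\<alpha> + 1) / p" using \<alpha> p by simp
    then show "-1 < e" by (simp add: e_eq)
    have "(\<alpha> + 1) / p \<le> 1" using \<alpha> p by simp
    then show "e + 1 < B" using B by (simp add: e_eq)
  qed
  define c2 where "c2 = 1 / (- s + 1) + 1 / (B - (- s) - 1)"
  define c3 where "c3 = 1 / (e + 1) + 1 / (B - e - 1)"
  have c2: "0 \<le> c2" using s s1 B by (auto simp: c2_def)
  have c3: "0 \<le> c3" using e by (auto simp: c3_def)
  define c where "c = c2 powr (p - 1) * c3"
  have c: "0 \<le> c" using c3 by (simp add: c_def)
  define c1 where "c1 = 2 powr B"
  have c1: "0 < c1" by (simp add: c1_def)
  have \<alpha>1: "-1 < \<alpha>" using \<alpha> p by simp
  define C' where "C' = c1 powr p * c * C0 + 1 / (\<alpha> + 1)"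
  have C': "0 \<le> C'" "c1 powr p * c * C0 \<le> C'" "1 / (\<alpha> + 1) \<le> C'" using c C0 \<alpha>1 by (auto simp: C'_def)
  show ?thesis
  proof (rule that)
    show "0 \<le> pi * 2 powr p * C'" using C' by simp
    fix g u :: "complex \<Rightarrow> complex" and a b L :: real
    assume g: "g holomorphic_on unit_disc" and u: "u holomorphic_on unit_disc" and a: "0 < a" and b: "0 \<le> b"
      and bound: "\<And>s. 0 \<le> s \<Longrightarrow> s < 1 \<Longrightarrow> circle_mean p (deriv (deriv g)) s \<le> ennreal ((a * (1 - s) powr (1 / p - 2) + b) powr p)"
      and L: "(\<integral>\<^sup>+y. norm (u (1 - of_real y)) \<partial>unit_ivl) = ennreal L" "0 \<le> L"
    let ?T = "gen_hilbert g u"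
    let ?N = "ennreal (norm (u 0) powr p) + bergman_energy p \<alpha> (deriv u)"
    have fin: "(\<integral>\<^sup>+y. norm (u (1 - of_real y)) \<partial>unit_ivl) < \<infinity>" using L by simp
    have g2: "deriv (deriv g) holomorphic_on unit_disc" by (intro holomorphic_deriv g) auto
    have T: "?T holomorphic_on unit_disc" by (rule gen_hilbert_holomorphic[OF u g fin])
    have dT: "deriv ?T holomorphic_on unit_disc" by (intro holomorphic_deriv T) auto
    note [measurable] = radial_measurable[OF u]
    \<comment> \<open>\<open>enn2real\<close> would turn an infinite integral into 0;
      \<open>S_eq\<close> shows that the integral is finite for every \<open>0 < x\<close>.\<close>
    define S where "S x = enn2real (\<integral>\<^sup>+y. norm (u (1 - of_real y)) * max x y powr - B \<partial>unit_ivl)" for x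
    have [measurable]: "S \<in> borel_measurable unit_ivl" unfolding S_def by measurable
    have S_nonneg: "0 \<le> S x" for x by (simp add: S_def)
    have S_eq: "(\<integral>\<^sup>+y. norm (u (1 - of_real y)) * max x y powr - B \<partial>unit_ivl) = ennreal (S x)"
      if x: "0 < x" for x
    proof -
      have "(\<integral>\<^sup>+y. norm (u (1 - of_real y)) * max x y powr - B \<partial>unit_ivl)
          \<le> (\<integral>\<^sup>+y. ennreal (x powr - B) * ennreal (norm (u (1 - of_real y))) \<partial>unit_ivl)"
      proof (rule nn_integral_mono)
        fix y :: real
        have "max x y powr - B \<le> x powr - B" using x B by (intro powr_mono2') auto
        then have "norm (u (1 - of_real y)) * max x y powr - B \<le> norm (u (1 - of_real y)) * x powr - B"
          by (rule mult_left_mono) simp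
        then show "ennreal (norm (u (1 - of_real y)) * max x y powr - B) \<le> ennreal (x powr - B) * ennreal (norm (u (1 - of_real y)))"
          by (simp add: ennreal_mult[symmetric] mult.commute ennreal_leI)
      qed
      also have "\<dots> = ennreal (x powr - B) * ennreal L"
        unfolding L(1)[symmetric] by (rule nn_integral_cmult) measurable
      also have "\<dots> < \<infinity>" by (simp add: ennreal_mult_less_top)
      finally show ?thesis unfolding S_def by simp
    qed
    have mean: "circle_mean p (deriv ?T) (sqrt (1 - x)) \<le> ennreal ((a * c1 * S x + b * L) powr p)"
      if "x \<in> space unit_ivl" for x
    proof -
      define r where "r = sqrt (1 - x)"
      have x: "0 < x" "x < 1" using that by auto
      have r: "0 \<le> r" "r < 1" using x by (auto simp: r_def)
      \<comment> \<open>Thus \<open>1 - r\<close> is at least \<open>x / 2\<close>. Together with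
        \<open>y \<le> 1 - (1 - y) * r\<close> this bounds \<open>1 - (1 - y) * r\<close> from below
        by \<open>max x y / 2\<close>, whence the constant \<open>c1 = 2 powr B\<close>.\<close>
      have "r \<le> 1 - x / 2"
        unfolding r_def by (rule real_le_lsqrt) (use x in \<open>auto simp: power2_eq_square algebra_simps\<close>)
      then have r': "x / 2 \<le> 1 - r" by simp
      have yr: "0 \<le> (1 - y) * r" "(1 - y) * r < 1" "max x y / 2 \<le> 1 - (1 - y) * r"
        if "y \<in> space unit_ivl" for y
      proof -
        have y: "0 < y" "y < 1" using that by auto
        define q where "q = (1 - y) * r"
        have q: "0 \<le> q" "q \<le> 1 - y" "q \<le> r"
          using y r unfolding q_def by (auto intro: mult_left_le mult_left_le_one_le)
        have "max x y \<le> 2 * (1 - q)" using q r' y by (intro max.boundedI) (auto simp: field_simps)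
        then show "0 \<le> (1 - y) * r" "(1 - y) * r < 1" "max x y / 2 \<le> 1 - (1 - y) * r"
          unfolding q_def[symmetric] using q y by (auto simp: field_simps)
      qed
      have in_disc: "norm (of_real (1 - y) * (of_real r * w) :: complex) < 1" if "y \<in> space unit_ivl" "norm w = 1" for y w
        using yr[OF that(1)] that(2) by (simp only: norm_mult norm_of_real mult_1_right abs_mult[symmetric])
      have nr: "norm (of_real r * w) < 1" if "norm w = 1" for w :: complex using that r by (simp add: norm_mult)
      show ?thesis
        unfolding circle_mean_def r_def[symmetric]
      proof (rule nn_integral_minkowski[where N = unit_ivl and k = "\<lambda>y. norm (u (1 - of_real y))"
            and f = "\<lambda>w y. norm (deriv (deriv g) (of_real (1 - y) * (of_real r * w)))"
            and \<phi> = "\<lambda>y. a * (1 - (1 - y) * r) powr (1 / p - 2) + b"])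
        have "(\<lambda>z. deriv (deriv g) (of_real (1 - snd z) * (of_real r * fst z))) \<in> borel_measurable (circ \<Otimes>\<^sub>M unit_ivl)"
          by (rule holomorphic_measurable_comp[OF g2]) (use in_disc in \<open>auto simp: space_pair_measure\<close>)
        then show "(\<lambda>(w, y). norm (deriv (deriv g) (of_real (1 - y) * (of_real r * w)))) \<in> borel_measurable (circ \<Otimes>\<^sub>M unit_ivl)"
          by (simp add: case_prod_beta')
        show "(\<integral>\<^sup>+w. norm (deriv (deriv g) (of_real (1 - y) * (of_real r * w))) powr p \<partial>circ)
          \<le> ennreal ((a * (1 - (1 - y) * r) powr (1 / p - 2) + b) powr p)" if y: "y \<in> space unit_ivl" for y
          using bound[of "(1 - y) * r"] yr[OF y] by (simp add: circle_mean_def mult.assoc)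
        show "0 < a * (1 - (1 - y) * r) powr (1 / p - 2) + b" if y: "y \<in> space unit_ivl" for y
          using yr[OF y] a b by (intro add_pos_nonneg mult_pos_pos) auto
        have "(\<integral>\<^sup>+y. norm (u (1 - of_real y)) * (a * (1 - (1 - y) * r) powr (1 / p - 2) + b) \<partial>unit_ivl)
          \<le> (\<integral>\<^sup>+y. ennreal (a * c1) * ennreal (norm (u (1 - of_real y)) * max x y powr - B)
               + ennreal b * ennreal (norm (u (1 - of_real y))) \<partial>unit_ivl)"
        proof (rule nn_integral_mono)
          fix y assume y: "y \<in> space unit_ivl"
          have "(1 - (1 - y) * r) powr - B \<le> (max x y / 2) powr - B"
            using yr[OF y] B x by (intro powr_mono2') auto
          also have "\<dots> = c1 * max x y powr - B"
            using x by (simp add: powr_divide powr_minus_divide c1_def)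
          finally have "(1 - (1 - y) * r) powr (1 / p - 2) \<le> c1 * max x y powr - B" by (simp add: B_def)
          then have "norm (u (1 - of_real y)) * (a * (1 - (1 - y) * r) powr (1 / p - 2) + b)
            \<le> norm (u (1 - of_real y)) * (a * (c1 * max x y powr - B) + b)"
            using a by (intro mult_left_mono add_mono) auto
          also have "\<dots> = a * c1 * (norm (u (1 - of_real y)) * max x y powr - B) + b * norm (u (1 - of_real y))"
            by (simp add: algebra_simps)
          finally have "ennreal (norm (u (1 - of_real y)) * (a * (1 - (1 - y) * r) powr (1 / p - 2) + b)) \<le> ennreal \<dots>"
            by (rule ennreal_leI)
          also have "\<dots> = ennreal (a * c1) * ennreal (norm (u (1 - of_real y)) * max x y powr - B)
               + ennreal b * ennreal (norm (u (1 - of_real y)))"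
            using a b c1 by (simp add: ennreal_mult[symmetric])
          finally show "ennreal (norm (u (1 - of_real y)) * (a * (1 - (1 - y) * r) powr (1 / p - 2) + b)) \<le> \<dots>" .
        qed
        also have "\<dots> = ennreal (a * c1) * ennreal (S x) + ennreal b * ennreal L"
          unfolding S_eq[OF x(1), symmetric] L(1)[symmetric]
          by (subst nn_integral_add, measurable, subst (1 2) nn_integral_cmult, measurable)
        also have "\<dots> = ennreal (a * c1 * S x + b * L)"
          using a b c1 L(2) S_nonneg by (simp add: ennreal_mult)
        finally show "(\<integral>\<^sup>+y. norm (u (1 - of_real y)) * (a * (1 - (1 - y) * r) powr (1 / p - 2) + b) \<partial>unit_ivl)
          \<le> ennreal (a * c1 * S x + b * L)" .
        show "AE w in circ. 0 \<le> norm (deriv ?T (of_real r * w)) \<and> ennreal (norm (deriv ?T (of_real r * w)))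
          \<le> (\<integral>\<^sup>+y. norm (u (1 - of_real y)) * norm (deriv (deriv g) (of_real (1 - y) * (of_real r * w))) \<partial>unit_ivl)"
          using norm_deriv_gen_hilbert_le[OF u g fin] nr by (intro AE_I2) simp
        show "sigma_finite_measure circ" "sigma_finite_measure unit_ivl" by unfold_locales
        show "0 \<le> a * c1 * S x + b * L" using a b c1 L(2) S_nonneg[of x] by simp
        show "(\<lambda>y. a * (1 - (1 - y) * r) powr (1 / p - 2) + b) \<in> borel_measurable unit_ivl" by measurable
      qed (use p in auto)
    qed
    have schur: "(\<integral>\<^sup>+x. x powr \<alpha> * S x powr p \<partial>unit_ivl) \<le> ennreal (c * C0) * ?N"
    proof -
      have "(\<integral>\<^sup>+x. x powr \<alpha> * S x powr p \<partial>unit_ivl)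
        \<le> (\<integral>\<^sup>+y. norm (u (1 - of_real y)) powr p * (y powr - s) powr (1 - p) * (c * y powr (e + 1 - B)) \<partial>unit_ivl)"
      proof (rule nn_integral_schur_test[where K = "\<lambda>x y. max x y powr - B" and W = "\<lambda>x. c2 * x powr (- s + 1 - B)"])
        show "sigma_finite_measure unit_ivl" "sigma_finite_measure unit_ivl" by unfold_locales
        fix x assume "x \<in> space unit_ivl"
        then have x: "0 < x" by auto
        show "(\<integral>\<^sup>+y. y powr - s * max x y powr - B \<partial>unit_ivl) \<le> ennreal (c2 * x powr (- s + 1 - B))"
          unfolding c2_def by (rule nn_integral_powr_max) (use s s1 B x in auto)
        show "0 \<le> S x \<and> ennreal (S x) \<le> (\<integral>\<^sup>+y. norm (u (1 - of_real y)) * max x y powr - B \<partial>unit_ivl)"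
          using S_eq[OF x] S_nonneg by simp
      next
        fix y assume "y \<in> space unit_ivl"
        then have y: "0 < y" by auto
        have "(\<integral>\<^sup>+x. x powr \<alpha> * (c2 * x powr (- s + 1 - B)) powr (p - 1) * max x y powr - B \<partial>unit_ivl)
          = (\<integral>\<^sup>+x. ennreal (c2 powr (p - 1)) * ennreal (x powr e * max y x powr - B) \<partial>unit_ivl)"
        proof (rule nn_integral_cong)
          fix x assume "x \<in> space unit_ivl"
          have "x powr \<alpha> * (c2 * x powr (- s + 1 - B)) powr (p - 1) = c2 powr (p - 1) * (x powr \<alpha> * x powr ((- s + 1 - B) * (p - 1)))"
            using c2 by (simp add: powr_mult powr_powr)
          also have "x powr \<alpha> * x powr ((- s + 1 - B) * (p - 1)) = x powr e"
            by (simp add: powr_add[symmetric] e_def mult.commute algebra_simps)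
          finally show "ennreal (x powr \<alpha> * (c2 * x powr (- s + 1 - B)) powr (p - 1) * max x y powr - B)
            = ennreal (c2 powr (p - 1)) * ennreal (x powr e * max y x powr - B)"
            by (simp add: ennreal_mult[symmetric] max.commute)
        qed
        also have "\<dots> = ennreal (c2 powr (p - 1)) * (\<integral>\<^sup>+x. x powr e * max y x powr - B \<partial>unit_ivl)"
          by (rule nn_integral_cmult) measurable
        also have "\<dots> \<le> ennreal (c2 powr (p - 1)) * ennreal (c3 * y powr (e + 1 - B))"
          unfolding c3_def by (intro mult_left_mono nn_integral_powr_max) (use e y in auto)
        also have "\<dots> = ennreal (c * y powr (e + 1 - B))"
          using c3 by (simp add: ennreal_mult[symmetric] c_def mult.assoc)
        finally show "(\<integral>\<^sup>+x. x powr \<alpha> * (c2 * x powr (- s + 1 - B)) powr (p - 1) * max x y powr - B \<partial>unit_ivl)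
          \<le> ennreal (c * y powr (e + 1 - B))" .
      qed (use p in auto)
      also have "\<dots> = (\<integral>\<^sup>+y. ennreal c * ennreal (y powr (\<alpha> + 1 - p) * norm (u (1 - of_real y)) powr p) \<partial>unit_ivl)"
      proof (rule nn_integral_cong)
        fix y assume "y \<in> space unit_ivl"
        have "- s * (1 - p) + (e + 1 - B) = \<alpha> + 1 - p"
          using p by (simp add: e_def B_def field_simps)
        then have "(y powr - s) powr (1 - p) * y powr (e + 1 - B) = y powr (\<alpha> + 1 - p)"
          by (simp only: powr_powr powr_add[symmetric])
        then have "norm (u (1 - of_real y)) powr p * (y powr - s) powr (1 - p) * (c * y powr (e + 1 - B))
          = c * (y powr (\<alpha> + 1 - p) * norm (u (1 - of_real y)) powr p)"
          by (metis mult.assoc mult.commute)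
        then show "ennreal (norm (u (1 - of_real y)) powr p * (y powr - s) powr (1 - p) * (c * y powr (e + 1 - B)))
          = ennreal c * ennreal (y powr (\<alpha> + 1 - p) * norm (u (1 - of_real y)) powr p)"
          using c by (simp only: ennreal_mult[symmetric] mult_nonneg_nonneg powr_ge_zero)
      qed
      also have "\<dots> = ennreal c * (\<integral>\<^sup>+y. y powr (\<alpha> + 1 - p) * norm (u (1 - of_real y)) powr p \<partial>unit_ivl)"
        by (rule nn_integral_cmult) measurable
      also have "\<dots> \<le> ennreal c * (ennreal C0 * ?N)"
        by (intro mult_left_mono C0(2)[OF u]) simp
      also have "\<dots> = ennreal (c * C0) * ?N"
        unfolding ennreal_mult[OF c C0(1)] by (rule mult.assoc[symmetric])
      finally show ?thesis .
    qed
    have int\<alpha>: "(\<integral>\<^sup>+x. x powr \<alpha> \<partial>unit_ivl) \<le> ennreal (1 / (\<alpha> + 1))"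
    proof -
      have "(\<integral>\<^sup>+x. ennreal (x powr \<alpha>) \<partial>unit_ivl) \<le> (\<integral>\<^sup>+x. ennreal (x powr \<alpha>) * indicator {0..1} x \<partial>lborel)"
        unfolding nn_integral_unit_ivl by (intro nn_integral_mono) (auto simp: indicator_def)
      then show ?thesis using nn_integral_powr_from_0[OF \<alpha>1, of 1] by simp
    qed
    have "bergman_energy p \<alpha> (deriv ?T)
        = ennreal pi * (\<integral>\<^sup>+x. ennreal (x powr \<alpha>) * circle_mean p (deriv ?T) (sqrt (1 - x)) \<partial>unit_ivl)"
      by (rule bergman_energy_polar[OF dT])
    also have "\<dots> \<le> ennreal pi * (\<integral>\<^sup>+x. ennreal (2 powr p * (a * c1) powr p) * ennreal (x powr \<alpha> * S x powr p)
        + ennreal (2 powr p * (b * L) powr p) * ennreal (x powr \<alpha>) \<partial>unit_ivl)"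
    proof (intro mult_left_mono nn_integral_mono)
      fix x assume x: "x \<in> space unit_ivl"
      have "(a * c1 * S x + b * L) powr p \<le> 2 powr p * ((a * c1 * S x) powr p + (b * L) powr p)"
        using a b c1 L(2) S_nonneg[of x] p by (intro powr_add_le) auto
      also have "(a * c1 * S x) powr p = (a * c1) powr p * S x powr p"
        using a c1 S_nonneg[of x] by (simp add: powr_mult)
      finally have "x powr \<alpha> * (a * c1 * S x + b * L) powr p
          \<le> x powr \<alpha> * (2 powr p * ((a * c1) powr p * S x powr p + (b * L) powr p))"
        by (rule mult_left_mono) simp
      also have "\<dots> = 2 powr p * (a * c1) powr p * (x powr \<alpha> * S x powr p) + 2 powr p * (b * L) powr p * x powr \<alpha>"
        by (simp add: algebra_simps)
      finally have "ennreal (x powr \<alpha> * (a * c1 * S x + b * L) powr p) \<le> ennreal \<dots>" by (rule ennreal_leI)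
      moreover have "ennreal (x powr \<alpha>) * circle_mean p (deriv ?T) (sqrt (1 - x))
          \<le> ennreal (x powr \<alpha>) * ennreal ((a * c1 * S x + b * L) powr p)"
        by (intro mult_left_mono mean x) simp
      ultimately show "ennreal (x powr \<alpha>) * circle_mean p (deriv ?T) (sqrt (1 - x))
          \<le> ennreal (2 powr p * (a * c1) powr p) * ennreal (x powr \<alpha> * S x powr p)
             + ennreal (2 powr p * (b * L) powr p) * ennreal (x powr \<alpha>)"
        by (simp add: ennreal_mult[symmetric] order_trans)
    qed simp
    also have "\<dots> = ennreal pi * (ennreal (2 powr p * (a * c1) powr p) * (\<integral>\<^sup>+x. x powr \<alpha> * S x powr p \<partial>unit_ivl)
        + ennreal (2 powr p * (b * L) powr p) * (\<integral>\<^sup>+x. x powr \<alpha> \<partial>unit_ivl))"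
      by (subst nn_integral_add, measurable, subst (1 2) nn_integral_cmult, measurable)
    also have "\<dots> \<le> ennreal pi * (ennreal (2 powr p * (a * c1) powr p) * (ennreal (c * C0) * ?N)
        + ennreal (2 powr p * (b * L) powr p) * ennreal (1 / (\<alpha> + 1)))"
      by (intro mult_left_mono add_mono schur int\<alpha>) auto
    also have "\<dots> = ennreal (pi * (2 powr p * (a * c1) powr p) * (c * C0)) * ?N
        + ennreal (pi * (2 powr p * (b * L) powr p) * (1 / (\<alpha> + 1)))"
      using c C0 \<alpha>1 by (simp only: distrib_left ennreal_mult[symmetric] mult.assoc[symmetric] pi_ge_zero powr_ge_zero mult_nonneg_nonneg zero_le_divide_1_iff add_nonneg_nonneg)
    also have "\<dots> \<le> ennreal (pi * 2 powr p * C' * a powr p) * ?N + ennreal (pi * 2 powr p * C' * (b * L) powr p)"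
    proof (intro add_mono mult_right_mono ennreal_leI)
      have "pi * (2 powr p * (a * c1) powr p) * (c * C0) = (pi * 2 powr p * a powr p) * (c1 powr p * c * C0)"
        using a c1 by (simp add: powr_mult)
      also have "\<dots> \<le> (pi * 2 powr p * a powr p) * C'" by (intro mult_left_mono C') auto
      finally show "pi * (2 powr p * (a * c1) powr p) * (c * C0) \<le> pi * 2 powr p * C' * a powr p" by (simp add: mult_ac)
      have "(pi * (2 powr p * (b * L) powr p)) * (1 / (\<alpha> + 1)) \<le> (pi * (2 powr p * (b * L) powr p)) * C'"
        by (intro mult_left_mono C') auto
      then show "pi * (2 powr p * (b * L) powr p) * (1 / (\<alpha> + 1)) \<le> pi * 2 powr p * C' * (b * L) powr p"
        by (simp add: mult_ac)
    qed simp
    finally show "bergman_energy p \<alpha> (deriv ?T)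
      \<le> ennreal (pi * 2 powr p * C' * a powr p) * ?N + ennreal (pi * 2 powr p * C' * (b * L) powr p)" .
  qed
qed

text \<open>The sub-mean value property on the ball of radius \<open>(1 - \<rho>) / 2\<close> about
  \<open>w\<close>, where \<open>1 - (norm z)\<^sup>2\<close> stays between that radius and 1. It
  supplies the local bounds for Montel's theorem as well as pointwise convergence of derivatives
  from convergence in norm.\<close>

lemma bergman_pointwise_bound:
  assumes \<rho>: "0 \<le> \<rho>" "\<rho> < 1" and p: "1 < p"
  obtains C where "0 \<le> C"
    "\<And>F (w :: complex). F holomorphic_on unit_disc \<Longrightarrow> norm w \<le> \<rho> \<Longrightarrow> ennreal (norm (F w) powr p) \<le> ennreal C * bergman_energy p \<alpha> F"
proof -
  define R where "R = (1 - \<rho>) / 2"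
  have R: "0 < R" "R < 1" "\<rho> + R + R = 1" using \<rho> by (auto simp: R_def field_simps)
  define M where "M = (1 / R) powr \<bar>\<alpha>\<bar>"
  show ?thesis
  proof (rule that)
    show "0 \<le> 1 / (pi * R\<^sup>2) * M" by (simp add: M_def)
    fix F :: "complex \<Rightarrow> complex" and w :: complex assume F: "F holomorphic_on unit_disc" and w: "norm w \<le> \<rho>"
    note [measurable] = holomorphic_measurable_disc[OF F]
    have nz: "norm z < \<rho> + R" if "z \<in> ball w R" for z
      using that w norm_triangle_sub[of z w] by (simp add: dist_norm norm_minus_commute)
    then have sub: "ball w R \<subseteq> unit_disc" using R by force
    have "ennreal (pi * R\<^sup>2 * norm (F w) powr p) \<le> (\<integral>\<^sup>+z. ennreal (norm (F z) powr p) * indicator (ball w R) z \<partial>lborel)"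
      by (rule submean_ball[OF holomorphic_on_subset[OF F sub] R(1) p])
    also have "\<dots> \<le> (\<integral>\<^sup>+z. (ennreal M * ennreal (norm (F z) powr p * (1 - (norm z)\<^sup>2) powr \<alpha>)) * indicator unit_disc z \<partial>lborel)"
    proof (rule nn_integral_mono)
      fix z
      show "ennreal (norm (F z) powr p) * indicator (ball w R) z
        \<le> (ennreal M * ennreal (norm (F z) powr p * (1 - (norm z)\<^sup>2) powr \<alpha>)) * indicator unit_disc z"
      proof (cases "z \<in> ball w R")
        case True
        have zz: "norm z < \<rho> + R" "norm z < 1" using nz[OF True] R by auto
        have "(norm z)\<^sup>2 \<le> norm z" using zz by (simp add: power2_eq_square mult_left_le)
        then have 1: "R \<le> 1 - (norm z)\<^sup>2" "1 - (norm z)\<^sup>2 \<le> 1" using zz R by auto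
        have "1 \<le> 1 / R * (1 - (norm z)\<^sup>2)" using 1 R by (simp add: field_simps)
        moreover have "1 \<le> 1 / R" using R by simp
        then have "1 - (norm z)\<^sup>2 \<le> 1 / R * 1" using order_trans[OF 1(2)] by simp
        ultimately have "1 powr \<alpha> \<le> M * (1 - (norm z)\<^sup>2) powr \<alpha>"
          unfolding M_def using 1 R by (intro powr_le_of_comparable) auto
        then have "norm (F z) powr p * 1 \<le> norm (F z) powr p * (M * (1 - (norm z)\<^sup>2) powr \<alpha>)"
          by (intro mult_left_mono) auto
        then have "norm (F z) powr p \<le> M * (norm (F z) powr p * (1 - (norm z)\<^sup>2) powr \<alpha>)"
          by (simp add: mult_ac)
        then have "ennreal (norm (F z) powr p) \<le> ennreal M * ennreal (norm (F z) powr p * (1 - (norm z)\<^sup>2) powr \<alpha>)"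
          by (simp only: ennreal_mult[symmetric] M_def mult_nonneg_nonneg powr_ge_zero ennreal_leI)
        then show ?thesis using True sub by auto
      qed simp
    qed
    also have "\<dots> = (\<integral>\<^sup>+z. ennreal M * ennreal (norm (F z) powr p * (1 - (norm z)\<^sup>2) powr \<alpha>) \<partial>disc)"
      by (simp only: nn_integral_disc)
    also have "\<dots> = ennreal M * bergman_energy p \<alpha> F"
      unfolding bergman_energy_def by (rule nn_integral_cmult) measurable
    finally have "ennreal (1 / (pi * R\<^sup>2)) * ennreal (pi * R\<^sup>2 * norm (F w) powr p)
      \<le> ennreal (1 / (pi * R\<^sup>2)) * (ennreal M * bergman_energy p \<alpha> F)" by (rule mult_left_mono) simp
    then show "ennreal (norm (F w) powr p) \<le> ennreal (1 / (pi * R\<^sup>2) * M) * bergman_energy p \<alpha> F"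
      using R by (simp add: ennreal_mult[symmetric] mult.assoc[symmetric] M_def)
  qed
qed

text \<open>The passage from the Bochner integrals of the definitions, where divergence is a lack of
  integrability, to extended nonnegative integrals, where it is a value. The factor
  \<open>1 / pi\<close> is the normalization of \<open>area\<close>.\<close>

lemma dirichlet_space_iff:
  "f \<in> dirichlet_space p \<alpha> \<longleftrightarrow> f holomorphic_on unit_disc \<and> bergman_energy p \<alpha> (deriv f) < \<infinity>"
  and LINT_area_eq:
  "f holomorphic_on unit_disc \<Longrightarrow> (LINT z:unit_disc|area. norm (deriv f z) powr p * (1 - (norm z)\<^sup>2) powr \<alpha>)
     = 1 / pi * enn2real (bergman_energy p \<alpha> (deriv f))"
proof -
  let ?h = "\<lambda>z. indicator unit_disc z *\<^sub>R (norm (deriv f z) powr p * (1 - (norm z)\<^sup>2) powr \<alpha>)"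
  have *: "set_integrable area unit_disc (\<lambda>z. norm (deriv f z) powr p * (1 - (norm z)\<^sup>2) powr \<alpha>)
      \<longleftrightarrow> bergman_energy p \<alpha> (deriv f) < \<infinity>"
    "(LINT z:unit_disc|area. norm (deriv f z) powr p * (1 - (norm z)\<^sup>2) powr \<alpha>)
     = 1 / pi * enn2real (bergman_energy p \<alpha> (deriv f))"
    if f: "f holomorphic_on unit_disc"
  proof -
    have df: "deriv f holomorphic_on unit_disc" by (intro holomorphic_deriv f) auto
    have [measurable]: "(\<lambda>z. 1 - (norm z)\<^sup>2) \<in> borel_measurable (restrict_space borel unit_disc)"
      by (intro measurable_restrict_space1) auto
    have [measurable]: "deriv f \<in> borel_measurable (restrict_space borel unit_disc)"
      by (rule borel_measurable_continuous_on_restrict[OF holomorphic_on_imp_continuous_on[OF df]])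
    have "(\<lambda>z. norm (deriv f z) powr p * (1 - (norm z)\<^sup>2) powr \<alpha>) \<in> borel_measurable (restrict_space borel unit_disc)"
      by measurable
    then have m[measurable]: "?h \<in> borel_measurable borel"
      by (subst (asm) borel_measurable_restrict_space_iff) auto
    have m': "?h \<in> borel_measurable area"
      using m by (simp add: area_def measurable_cong_sets[OF sets_scale_measure refl])
    have "(\<integral>\<^sup>+z. ennreal (norm (?h z)) \<partial>area) = ennreal (1 / pi) * (\<integral>\<^sup>+z. ennreal (norm (?h z)) \<partial>lborel)"
      unfolding area_def by (rule nn_integral_scale_measure) measurable
    also have "(\<integral>\<^sup>+z. ennreal (norm (?h z)) \<partial>lborel) = bergman_energy p \<alpha> (deriv f)"
      unfolding bergman_energy_def nn_integral_disc
      by (intro nn_integral_cong) (auto simp: indicator_def)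
    finally have eq: "(\<integral>\<^sup>+z. ennreal (norm (?h z)) \<partial>area) = ennreal (1 / pi) * bergman_energy p \<alpha> (deriv f)" .
    show "set_integrable area unit_disc (\<lambda>z. norm (deriv f z) powr p * (1 - (norm z)\<^sup>2) powr \<alpha>)
      \<longleftrightarrow> bergman_energy p \<alpha> (deriv f) < \<infinity>"
      unfolding set_integrable_def integrable_iff_bounded eq using m'
      by (auto simp: ennreal_mult_less_top)
    have "(LINT z|area. ?h z) = enn2real (\<integral>\<^sup>+z. ennreal (?h z) \<partial>area)"
      using m' by (intro integral_eq_nn_integral) auto
    also have "(\<integral>\<^sup>+z. ennreal (?h z) \<partial>area) = (\<integral>\<^sup>+z. ennreal (norm (?h z)) \<partial>area)"
      by (intro nn_integral_cong) (auto simp: indicator_def)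
    finally show "(LINT z:unit_disc|area. norm (deriv f z) powr p * (1 - (norm z)\<^sup>2) powr \<alpha>)
     = 1 / pi * enn2real (bergman_energy p \<alpha> (deriv f))"
      unfolding set_lebesgue_integral_def eq by (simp add: enn2real_mult)
  qed
  show "f \<in> dirichlet_space p \<alpha> \<longleftrightarrow> f holomorphic_on unit_disc \<and> bergman_energy p \<alpha> (deriv f) < \<infinity>"
    using *(1) by (auto simp: dirichlet_space_def)
  show "(LINT z:unit_disc|area. norm (deriv f z) powr p * (1 - (norm z)\<^sup>2) powr \<alpha>)
     = 1 / pi * enn2real (bergman_energy p \<alpha> (deriv f))" if "f holomorphic_on unit_disc"
    by (rule *(2)[OF that])
qed

lemma dirichlet_norm_powr:
  assumes p: "1 < p" and \<alpha>: "-1 < \<alpha>" and f: "f \<in> dirichlet_space p \<alpha>"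
  shows "ennreal (dirichlet_norm p \<alpha> f powr p)
    = ennreal (norm (f 0) powr p) + ennreal ((\<alpha> + 1) / pi) * bergman_energy p \<alpha> (deriv f)"
proof -
  have "f holomorphic_on unit_disc" and fin: "bergman_energy p \<alpha> (deriv f) < \<infinity>"
    using f by (auto simp: dirichlet_space_iff)
  then have "bergman_norm p \<alpha> (deriv f) powr p = (\<alpha> + 1) / pi * enn2real (bergman_energy p \<alpha> (deriv f))"
    using p \<alpha> by (simp add: bergman_norm_def LINT_area_eq powr_powr)
  then have "dirichlet_norm p \<alpha> f powr p = norm (f 0) powr p + (\<alpha> + 1) / pi * enn2real (bergman_energy p \<alpha> (deriv f))"
    using p \<alpha> by (simp add: dirichlet_norm_def powr_powr)
  moreover obtain e where "bergman_energy p \<alpha> (deriv f) = ennreal e" "0 \<le> e"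
    using fin by (cases "bergman_energy p \<alpha> (deriv f)" rule: ennreal_cases) auto
  ultimately show ?thesis
    using \<alpha> by (simp add: ennreal_mult[symmetric])
qed

section \<open>Bounded sequences in the Dirichlet space\<close>

lemma dirichlet_norm_nonneg: "0 \<le> dirichlet_norm p \<alpha> f"
  by (simp add: dirichlet_norm_def)

lemma bergman_energy_cong:
  assumes "\<And>z. norm z < 1 \<Longrightarrow> F z = G z"
  shows "bergman_energy p \<alpha> F = bergman_energy p \<alpha> G"
  unfolding bergman_energy_def by (intro nn_integral_cong) (auto simp: assms)

lemma deriv_cong_disc:
  fixes f g :: "complex \<Rightarrow> complex" and w :: complex
  assumes "\<And>z. norm z < 1 \<Longrightarrow> f z = g z" "norm w < 1"
  shows "deriv f w = deriv g w"
proof (rule deriv_cong_ev)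
  have "\<forall>\<^sub>F z in nhds w. z \<in> unit_disc" using assms(2) by (intro eventually_nhds_in_open) auto
  then show "\<forall>\<^sub>F z in nhds w. f z = g z" by eventually_elim (use assms in auto)
qed simp

lemma bergman_energy_diff_le:
  assumes F: "F holomorphic_on unit_disc" and G: "G holomorphic_on unit_disc" and p: "1 < p"
  shows "bergman_energy p \<alpha> (\<lambda>z. F z - G z) \<le> ennreal (2 powr p) * (bergman_energy p \<alpha> F + bergman_energy p \<alpha> G)"
proof -
  note [measurable] = holomorphic_measurable_disc[OF F] holomorphic_measurable_disc[OF G]
  have "bergman_energy p \<alpha> (\<lambda>z. F z - G z)
    \<le> (\<integral>\<^sup>+z. ennreal (2 powr p) * (ennreal (norm (F z) powr p * (1 - (norm z)\<^sup>2) powr \<alpha>)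
         + ennreal (norm (G z) powr p * (1 - (norm z)\<^sup>2) powr \<alpha>)) \<partial>disc)"
    unfolding bergman_energy_def
  proof (rule nn_integral_mono)
    fix z
    have "norm (F z - G z) powr p \<le> (norm (F z) + norm (G z)) powr p"
      using p by (intro powr_mono2 norm_triangle_ineq4) auto
    also have "\<dots> \<le> 2 powr p * (norm (F z) powr p + norm (G z) powr p)"
      using p by (intro powr_add_le) auto
    finally have "norm (F z - G z) powr p * (1 - (norm z)\<^sup>2) powr \<alpha>
        \<le> 2 powr p * (norm (F z) powr p + norm (G z) powr p) * (1 - (norm z)\<^sup>2) powr \<alpha>"
      by (rule mult_right_mono) simp
    also have "\<dots> = 2 powr p * (norm (F z) powr p * (1 - (norm z)\<^sup>2) powr \<alpha> + norm (G z) powr p * (1 - (norm z)\<^sup>2) powr \<alpha>)"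
      by (simp add: algebra_simps)
    finally show "ennreal (norm (F z - G z) powr p * (1 - (norm z)\<^sup>2) powr \<alpha>)
       \<le> ennreal (2 powr p) * (ennreal (norm (F z) powr p * (1 - (norm z)\<^sup>2) powr \<alpha>)
         + ennreal (norm (G z) powr p * (1 - (norm z)\<^sup>2) powr \<alpha>))"
      by (simp add: ennreal_leI ennreal_mult[symmetric] ennreal_plus[symmetric] del: ennreal_plus)
  qed
  also have "\<dots> = ennreal (2 powr p) * (bergman_energy p \<alpha> F + bergman_energy p \<alpha> G)"
    unfolding bergman_energy_def by (subst nn_integral_cmult, measurable, subst nn_integral_add, measurable)
  finally show ?thesis .
qed

text \<open>The exponent \<open>\<alpha> + 1 - p\<close> is at most 0, so the weight in
  \<open>radial_Lp_le_energy\<close> is at least 1 on the unit interval and may be dropped.\<close>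

lemma radial_Lp_bounds:
  assumes p: "1 < p" and \<alpha>: "p - 2 < \<alpha>" "\<alpha> \<le> p - 1"
  obtains C where "0 \<le> C"
    "\<And>u. u holomorphic_on unit_disc \<Longrightarrow> (\<integral>\<^sup>+x. norm (u (1 - of_real x)) powr p \<partial>unit_ivl)
       \<le> ennreal C * (ennreal (norm (u 0) powr p) + bergman_energy p \<alpha> (deriv u))"
proof -
  obtain C where C: "0 \<le> C" "\<And>u. u holomorphic_on unit_disc \<Longrightarrow>
       (\<integral>\<^sup>+x. x powr (\<alpha> + 1 - p) * norm (u (1 - of_real x)) powr p \<partial>unit_ivl)
       \<le> ennreal C * (ennreal (norm (u 0) powr p) + bergman_energy p \<alpha> (deriv u))"
    using radial_Lp_le_energy[OF p \<alpha>(1)] by blast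
  show ?thesis
  proof (rule that[OF C(1)])
    fix u assume u: "u holomorphic_on unit_disc"
    have "(\<integral>\<^sup>+x. norm (u (1 - of_real x)) powr p \<partial>unit_ivl)
      \<le> (\<integral>\<^sup>+x. x powr (\<alpha> + 1 - p) * norm (u (1 - of_real x)) powr p \<partial>unit_ivl)"
    proof (intro nn_integral_mono ennreal_leI)
      fix x assume "x \<in> space unit_ivl"
      then have "1 powr (\<alpha> + 1 - p) \<le> x powr (\<alpha> + 1 - p)"
        using \<alpha> by (intro powr_mono2') auto
      then have "1 * norm (u (1 - of_real x)) powr p \<le> x powr (\<alpha> + 1 - p) * norm (u (1 - of_real x)) powr p"
        by (intro mult_right_mono) auto
      then show "norm (u (1 - of_real x)) powr p \<le> x powr (\<alpha> + 1 - p) * norm (u (1 - of_real x)) powr p" by simp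
    qed
    also note C(2)[OF u]
    finally show "(\<integral>\<^sup>+x. norm (u (1 - of_real x)) powr p \<partial>unit_ivl)
       \<le> ennreal C * (ennreal (norm (u 0) powr p) + bergman_energy p \<alpha> (deriv u))" .
  qed
qed

text \<open>This makes the integral in \<open>gen_hilbert\<close> converge absolutely at every point
  of the disc, so that its default value does not enter. It follows from
  \<open>t \<le> 1 + t powr p\<close>.\<close>

lemma radial_L1_finite:
  assumes p: "1 < p" and \<alpha>: "p - 2 < \<alpha>" "\<alpha> \<le> p - 1" and u: "u \<in> dirichlet_space p \<alpha>"
  shows "(\<integral>\<^sup>+x. norm (u (1 - of_real x)) \<partial>unit_ivl) < \<infinity>"
proof -
  have hol: "u holomorphic_on unit_disc" and fin: "bergman_energy p \<alpha> (deriv u) < \<infinity>"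
    using u by (auto simp: dirichlet_space_iff)
  obtain C where C: "0 \<le> C" "\<And>u. u holomorphic_on unit_disc \<Longrightarrow> (\<integral>\<^sup>+x. norm (u (1 - of_real x)) powr p \<partial>unit_ivl)
       \<le> ennreal C * (ennreal (norm (u 0) powr p) + bergman_energy p \<alpha> (deriv u))"
    using radial_Lp_bounds[OF p \<alpha>] by blast
  note [measurable] = radial_measurable[OF hol]
  have "(\<integral>\<^sup>+x. norm (u (1 - of_real x)) \<partial>unit_ivl) \<le> (\<integral>\<^sup>+x. 1 + ennreal (norm (u (1 - of_real x)) powr p) \<partial>unit_ivl)"
  proof (rule nn_integral_mono)
    fix x :: real
    have "t \<le> 1 + t powr p" if "0 \<le> t" for t :: real
    proof (cases "t \<le> 1")
      case False
      then have "t powr 1 \<le> t powr p" using p by (intro powr_mono) auto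
      then show ?thesis using False by simp
    qed (use that in \<open>simp add: add_increasing2\<close>)
    from this[of "norm (u (1 - of_real x))"]
    have "ennreal (norm (u (1 - of_real x))) \<le> ennreal (1 + norm (u (1 - of_real x)) powr p)"
      by (intro ennreal_leI) auto
    then show "ennreal (norm (u (1 - of_real x))) \<le> 1 + ennreal (norm (u (1 - of_real x)) powr p)" by simp
  qed
  also have "\<dots> = 1 + (\<integral>\<^sup>+x. norm (u (1 - of_real x)) powr p \<partial>unit_ivl)"
    by (simp add: nn_integral_add emeasure_unit_ivl)
  also have "\<dots> \<le> 1 + ennreal C * (ennreal (norm (u 0) powr p) + bergman_energy p \<alpha> (deriv u))"
    by (intro add_left_mono C hol)
  also have "\<dots> < \<infinity>" using fin by (simp add: ennreal_mult_less_top)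
  finally show ?thesis .
qed

text \<open>A norm bound gives a bound in L^p of the radius with \<open>p > 1\<close>, which
  excludes concentration, so pointwise convergence suffices. In this form the compactness of the
  embedding into L^1 of the radius serves both directions of the equivalence.\<close>

lemma radial_L1_tendsto_0:
  assumes p: "1 < p" and \<alpha>: "p - 2 < \<alpha>" "\<alpha> \<le> p - 1" and u: "\<And>n. u n holomorphic_on unit_disc"
    and K: "\<And>n. ennreal (norm (u n 0) powr p) + bergman_energy p \<alpha> (deriv (u n)) \<le> ennreal K"
    and lim: "\<And>x. 0 < x \<Longrightarrow> x < 1 \<Longrightarrow> (\<lambda>n. u n (1 - of_real x)) \<longlonglongrightarrow> 0"
  shows "(\<lambda>n. \<integral>\<^sup>+x. norm (u n (1 - of_real x)) \<partial>unit_ivl) \<longlonglongrightarrow> 0"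
proof -
  obtain C where C: "0 \<le> C" "\<And>u. u holomorphic_on unit_disc \<Longrightarrow> (\<integral>\<^sup>+x. norm (u (1 - of_real x)) powr p \<partial>unit_ivl)
       \<le> ennreal C * (ennreal (norm (u 0) powr p) + bergman_energy p \<alpha> (deriv u))"
    using radial_Lp_bounds[OF p \<alpha>] by blast
  show ?thesis
  proof (rule L1_tendsto_of_Lp_bounded[OF _ _ _ p])
    show "(\<lambda>x. norm (u n (1 - of_real x))) \<in> borel_measurable unit_ivl" for n
      using radial_measurable[OF u] by measurable
    show "AE x in unit_ivl. (\<lambda>n. norm (u n (1 - of_real x))) \<longlonglongrightarrow> 0"
      using lim by (intro AE_I2 tendsto_norm_zero) auto
    show "(\<integral>\<^sup>+x. norm (u n (1 - of_real x)) powr p \<partial>unit_ivl) \<le> ennreal (C * max K 0)" for n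
    proof -
      have "(\<integral>\<^sup>+x. norm (u n (1 - of_real x)) powr p \<partial>unit_ivl) \<le> ennreal C * ennreal K"
        by (rule order_trans[OF C(2)[OF u]]) (intro mult_left_mono K, simp)
      also have "\<dots> \<le> ennreal C * ennreal (max K 0)" by (intro mult_left_mono ennreal_leI) auto
      finally show ?thesis using C by (simp add: ennreal_mult)
    qed
  qed (auto simp: emeasure_unit_ivl)
qed

text \<open>Energy bounds become uniform bounds on compact sets, so Montel's theorem gives a locally
  uniformly convergent subsequence. Its derivatives converge too, and Fatou's lemma keeps the limit
  in the space.\<close>

lemma dirichlet_bounded_subsequence:
  fixes f :: "nat \<Rightarrow> complex \<Rightarrow> complex"
  assumes p: "1 < p" and f: "\<And>n. f n holomorphic_on unit_disc"
    and K: "\<And>n. ennreal (norm (f n 0) powr p) + bergman_energy p \<alpha> (deriv (f n)) \<le> ennreal K" and K0: "0 \<le> K"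
  obtains r h where "strict_mono (r :: nat \<Rightarrow> nat)" "h \<in> dirichlet_space p \<alpha>"
    "\<And>z. norm z < 1 \<Longrightarrow> (\<lambda>n. f (r n) z) \<longlonglongrightarrow> h z"
proof -
  have df: "deriv (f n) holomorphic_on unit_disc" for n by (intro holomorphic_deriv f) auto
  have bd: "\<exists>B. \<forall>h\<in>range f. \<forall>z\<in>S. norm (h z) \<le> B" if S: "compact S" "S \<subseteq> unit_disc" for S
  proof -
    obtain \<rho> where \<rho>: "0 \<le> \<rho>" "\<rho> < 1" "S \<subseteq> cball 0 \<rho>"
    proof (cases "S = {}")
      case False
      obtain m where m: "m \<in> S" "\<And>z. z \<in> S \<Longrightarrow> norm z \<le> norm m"
        using continuous_attains_sup[OF S(1) False, of norm] by (auto intro: continuous_intros)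
      then show ?thesis using S(2) by (intro that[of "norm m"]) auto
    qed (use that[of 0] in auto)
    obtain C where C: "0 \<le> C" "\<And>F (w :: complex). F holomorphic_on unit_disc \<Longrightarrow> norm w \<le> \<rho> \<Longrightarrow> ennreal (norm (F w) powr p) \<le> ennreal C * bergman_energy p \<alpha> F"
      using bergman_pointwise_bound[OF \<rho>(1,2) p] by blast
    define B where "B = (C * K) powr (1 / p)"
    have root: "x \<le> M powr (1 / p)" if "ennreal (x powr p) \<le> ennreal M" "0 \<le> x" "0 \<le> M" for x M
    proof -
      have "(x powr p) powr (1 / p) \<le> M powr (1 / p)"
        using that p by (intro powr_mono2) (auto simp: ennreal_le_iff)
      then show ?thesis using that p by (simp add: powr_powr)
    qed
    have der: "norm (deriv (f n) w) \<le> B" if w: "w \<in> cball 0 \<rho>" for n w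
    proof -
      have "ennreal (norm (deriv (f n) w) powr p) \<le> ennreal C * bergman_energy p \<alpha> (deriv (f n))"
        using w by (intro C df) auto
      also have "\<dots> \<le> ennreal C * ennreal K"
        using K[of n] by (intro mult_left_mono order_trans[OF _ K[of n]]) auto
      also have "\<dots> = ennreal (C * K)" using C K0 by (simp add: ennreal_mult)
      finally show ?thesis unfolding B_def using C K0 by (intro root) auto
    qed
    have zero: "norm (f n 0) \<le> K powr (1 / p)" for n
      using order_trans[OF _ K[of n], of "ennreal (norm (f n 0) powr p)"] K0 by (intro root) auto
    have "norm (f n z) \<le> K powr (1 / p) + B * 1" if "z \<in> S" for n z
    proof -
      have z: "z \<in> cball 0 \<rho>" using that \<rho> by auto
      have "norm (f n z - f n 0) \<le> B * norm (z - 0)"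
      proof (rule field_differentiable_bound[of "cball 0 \<rho>" "f n" "deriv (f n)"])
        fix w assume "w \<in> cball (0::complex) \<rho>"
        then show "(f n has_field_derivative deriv (f n) w) (at w within cball 0 \<rho>)"
          using \<rho> by (intro has_field_derivative_at_within[OF holomorphic_derivI[OF f]]) auto
      qed (use der z \<rho> in auto)
      also have "\<dots> \<le> B * 1" using z \<rho> by (intro mult_left_mono) (auto simp: B_def)
      finally show ?thesis using zero[of n] norm_triangle_sub[of "f n z" "f n 0"] by linarith
    qed
    then show ?thesis by (intro exI[of _ "K powr (1 / p) + B * 1"]) auto
  qed
  obtain h r where h: "h holomorphic_on unit_disc" and r: "strict_mono (r :: nat \<Rightarrow> nat)"
    and lim: "\<And>z. z \<in> unit_disc \<Longrightarrow> (\<lambda>n. f (r n) z) \<longlonglongrightarrow> h z"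
    and ulim: "\<And>S. compact S \<Longrightarrow> S \<subseteq> unit_disc \<Longrightarrow> uniform_limit S (f \<circ> r) h sequentially"
  proof (rule Montel[of unit_disc "range f" f])
    show "\<exists>B. \<forall>h\<in>range f. \<forall>z\<in>S. norm (h z) \<le> B" if "compact S" "S \<subseteq> unit_disc" for S
      by (rule bd[OF that])
  qed (use f in auto)
  have dh: "deriv h holomorphic_on unit_disc" by (intro holomorphic_deriv h) auto
  have "\<exists>g'. \<forall>z\<in>unit_disc. (h has_field_derivative g' z) (at z) \<and> (\<lambda>n. deriv (f (r n)) z) \<longlonglongrightarrow> g' z"
  proof (rule has_complex_derivative_uniform_sequence[of unit_disc "\<lambda>n. f (r n)"])
    show "(f (r n) has_field_derivative deriv (f (r n)) x) (at x)" if "x \<in> unit_disc" for n x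
      using that by (intro holomorphic_derivI[OF f]) auto
    fix x :: complex assume "x \<in> unit_disc"
    then obtain d where "0 < d" "cball x d \<subseteq> unit_disc" by (meson open_ball open_contains_cball)
    then show "\<exists>d>0. cball x d \<subseteq> unit_disc \<and> uniform_limit (cball x d) (\<lambda>n. f (r n)) h sequentially"
      using ulim[of "cball x d"] by (auto simp: o_def)
  qed auto
  then have dlim: "(\<lambda>n. deriv (f (r n)) z) \<longlonglongrightarrow> deriv h z" if "z \<in> unit_disc" for z
    using that DERIV_imp_deriv by metis
  note [measurable] = holomorphic_measurable_disc[OF df] holomorphic_measurable_disc[OF dh]
  have "bergman_energy p \<alpha> (deriv h)
      = (\<integral>\<^sup>+z. liminf (\<lambda>n. ennreal (norm (deriv (f (r n)) z) powr p * (1 - (norm z)\<^sup>2) powr \<alpha>)) \<partial>disc)"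
    unfolding bergman_energy_def
  proof (rule nn_integral_cong)
    fix z assume "z \<in> space disc"
    then have "(\<lambda>n. ennreal (norm (deriv (f (r n)) z) powr p * (1 - (norm z)\<^sup>2) powr \<alpha>))
      \<longlonglongrightarrow> ennreal (norm (deriv h z) powr p * (1 - (norm z)\<^sup>2) powr \<alpha>)"
      using p dlim[of z] by (intro tendsto_intros tendsto_ennrealI tendsto_powr2) auto
    then show "ennreal (norm (deriv h z) powr p * (1 - (norm z)\<^sup>2) powr \<alpha>)
      = liminf (\<lambda>n. ennreal (norm (deriv (f (r n)) z) powr p * (1 - (norm z)\<^sup>2) powr \<alpha>))"
      by (intro lim_imp_Liminf[symmetric]) auto
  qed
  also have "\<dots> \<le> liminf (\<lambda>n. bergman_energy p \<alpha> (deriv (f (r n))))"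
    unfolding bergman_energy_def by (rule nn_integral_liminf) measurable
  also have "\<dots> \<le> ennreal K"
  proof (rule Liminf_le[OF sequentially_bot], intro always_eventually allI)
    fix n
    have "bergman_energy p \<alpha> (deriv (f (r n))) \<le> ennreal (norm (f (r n) 0) powr p) + bergman_energy p \<alpha> (deriv (f (r n)))"
      by simp
    also note K
    finally show "bergman_energy p \<alpha> (deriv (f (r n))) \<le> ennreal K" .
  qed
  finally have "h \<in> dirichlet_space p \<alpha>" using h by (auto simp: dirichlet_space_iff intro: le_less_trans)
  then show ?thesis using that r lim by simp
qed

text \<open>For holomorphic \<open>F\<close> and \<open>e > 0\<close> this is M_p(r, F) = o((1 -
  r)^(-e)) as r tends to 1. The constant \<open>C\<close> absorbs the radii away from 1, so the
  bound holds on all of [0, 1) and can be used under an integral over the radius.\<close>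

definition little_growth :: "real \<Rightarrow> (complex \<Rightarrow> complex) \<Rightarrow> real \<Rightarrow> bool" where
  "little_growth p F e \<longleftrightarrow> (\<forall>\<epsilon>>0. \<exists>C\<ge>0. \<forall>r. 0 \<le> r \<longrightarrow> r < 1 \<longrightarrow>
     circle_mean p F r \<le> ennreal ((\<epsilon> * (1 - r) powr - e + C) powr p))"

lemma dirichlet_norm_bounds:
  assumes p: "1 < p" and \<alpha>: "-1 < \<alpha>"
  obtains \<kappa> where "0 < \<kappa>"
    "\<And>f. f \<in> dirichlet_space p \<alpha> \<Longrightarrow> ennreal (norm (f 0) powr p) + bergman_energy p \<alpha> (deriv f) \<le> ennreal (\<kappa> * dirichlet_norm p \<alpha> f powr p)"
    "\<And>f x y. f \<in> dirichlet_space p \<alpha> \<Longrightarrow> norm (f 0) powr p \<le> x \<Longrightarrow> bergman_energy p \<alpha> (deriv f) \<le> ennreal y \<Longrightarrow> 0 \<le> y \<Longrightarrow>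
       dirichlet_norm p \<alpha> f powr p \<le> \<kappa> * (x + y)"
proof -
  define c where "c = (\<alpha> + 1) / pi"
  have c: "0 < c" using \<alpha> by (simp add: c_def)
  \<comment> \<open>The summands \<open>1 / c\<close> and \<open>c\<close> serve the two directions
    of the comparison of energies, the summand 1 the value at the origin.\<close>
  define \<kappa> where "\<kappa> = 1 + 1 / c + c"
  have \<kappa>: "1 \<le> \<kappa>" "1 / c \<le> \<kappa>" "c \<le> \<kappa>" using c by (auto simp: \<kappa>_def)
  show ?thesis
  proof (rule that[of \<kappa>])
    show "0 < \<kappa>" using \<kappa> by simp
    fix f assume f: "f \<in> dirichlet_space p \<alpha>"
    obtain e where e: "bergman_energy p \<alpha> (deriv f) = ennreal e" "0 \<le> e"
      using f by (cases "bergman_energy p \<alpha> (deriv f)" rule: ennreal_cases) (auto simp: dirichlet_space_iff)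
    have "ennreal (dirichlet_norm p \<alpha> f powr p) = ennreal (norm (f 0) powr p + c * e)"
      using dirichlet_norm_powr[OF p \<alpha> f, folded c_def] e c
      by (simp add: ennreal_mult[symmetric] ennreal_plus[symmetric] del: ennreal_plus)
    then have eq: "dirichlet_norm p \<alpha> f powr p = norm (f 0) powr p + c * e"
      using e c by (subst (asm) ennreal_inj) auto
    have "e = 1 / c * (c * e)" using c by simp
    also have "\<dots> \<le> \<kappa> * (c * e)" using \<kappa> c e by (intro mult_right_mono) auto
    finally have "1 * norm (f 0) powr p + e \<le> \<kappa> * norm (f 0) powr p + \<kappa> * (c * e)"
      using \<kappa> by (intro add_mono mult_right_mono) auto
    then have "norm (f 0) powr p + e \<le> \<kappa> * dirichlet_norm p \<alpha> f powr p"
      by (simp add: eq distrib_left)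
    then show "ennreal (norm (f 0) powr p) + bergman_energy p \<alpha> (deriv f) \<le> ennreal (\<kappa> * dirichlet_norm p \<alpha> f powr p)"
      using e by (simp add: ennreal_leI ennreal_plus[symmetric] del: ennreal_plus)
    fix x y assume x: "norm (f 0) powr p \<le> x" and y: "bergman_energy p \<alpha> (deriv f) \<le> ennreal y" "0 \<le> y"
    have ey: "e \<le> y" using y e by simp
    have x0: "0 \<le> x" using x powr_ge_zero order_trans by blast
    have "norm (f 0) powr p + c * e \<le> 1 * x + c * y" using x ey c by (intro add_mono mult_left_mono) auto
    also have "\<dots> \<le> \<kappa> * x + \<kappa> * y" using \<kappa> x0 y by (intro add_mono mult_right_mono) auto
    finally show "dirichlet_norm p \<alpha> f powr p \<le> \<kappa> * (x + y)" by (simp add: eq distrib_left)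
  qed
qed

lemma gen_hilbert_0_le:
  assumes "u holomorphic_on unit_disc" "g holomorphic_on unit_disc"
    and L: "(\<integral>\<^sup>+y. norm (u (1 - of_real y)) \<partial>unit_ivl) = ennreal L" "0 \<le> L"
  shows "norm (gen_hilbert g u 0) \<le> norm (deriv g 0) * L"
proof -
  note [measurable] = radial_measurable[OF assms(1)]
  have "ennreal (norm (gen_hilbert g u 0)) \<le> (\<integral>\<^sup>+y. norm (u (1 - of_real y)) * norm (deriv g (of_real (1 - y) * 0)) \<partial>unit_ivl)"
    by (rule norm_gen_hilbert_le) (use assms in auto)
  also have "\<dots> = (\<integral>\<^sup>+y. ennreal (norm (deriv g 0)) * ennreal (norm (u (1 - of_real y))) \<partial>unit_ivl)"
    by (intro nn_integral_cong) (simp add: ennreal_mult[symmetric] mult.commute)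
  also have "\<dots> = ennreal (norm (deriv g 0)) * ennreal L"
    unfolding L(1)[symmetric] by (rule nn_integral_cmult) measurable
  also have "\<dots> = ennreal (norm (deriv g 0) * L)" using L by (simp add: ennreal_mult)
  finally show ?thesis using L by (subst (asm) ennreal_le_iff) auto
qed

lemma compact_operator_of_little_growth:
  assumes p: "1 < p" and \<alpha>: "p - 2 < \<alpha>" "\<alpha> \<le> p - 1" and g: "g holomorphic_on unit_disc"
    and growth: "little_growth p (deriv (deriv g)) (2 - 1 / p)"
  shows "compact_operator_on (dirichlet_space p \<alpha>) (dirichlet_norm p \<alpha>) (gen_hilbert g)"
proof -
  let ?V = "dirichlet_space p \<alpha>" and ?N = "dirichlet_norm p \<alpha>" and ?T = "gen_hilbert g"
  let ?E = "\<lambda>f. bergman_energy p \<alpha> (deriv f)"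
  have \<alpha>1: "-1 < \<alpha>" using \<alpha> p by simp
  obtain C where C: "0 \<le> C"
    "\<And>g u a b L. g holomorphic_on unit_disc \<Longrightarrow> u holomorphic_on unit_disc \<Longrightarrow> 0 < a \<Longrightarrow> 0 \<le> b \<Longrightarrow>
       (\<And>s. 0 \<le> s \<Longrightarrow> s < 1 \<Longrightarrow> circle_mean p (deriv (deriv g)) s \<le> ennreal ((a * (1 - s) powr (1 / p - 2) + b) powr p)) \<Longrightarrow>
       (\<integral>\<^sup>+y. norm (u (1 - of_real y)) \<partial>unit_ivl) = ennreal L \<Longrightarrow> 0 \<le> L \<Longrightarrow>
       bergman_energy p \<alpha> (deriv (gen_hilbert g u))
         \<le> ennreal (C * a powr p) * (ennreal (norm (u 0) powr p) + bergman_energy p \<alpha> (deriv u))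
           + ennreal (C * (b * L) powr p)"
    using bergman_energy_gen_hilbert_le[OF p \<alpha>] by blast
  have E_T: "\<exists>b\<ge>0. \<forall>u L. u holomorphic_on unit_disc \<longrightarrow> (\<integral>\<^sup>+y. norm (u (1 - of_real y)) \<partial>unit_ivl) = ennreal L \<longrightarrow> 0 \<le> L \<longrightarrow>
     ?E (?T u) \<le> ennreal (C * a powr p) * (ennreal (norm (u 0) powr p) + ?E u) + ennreal (C * (b * L) powr p)"
    if a: "0 < a" for a
  proof -
    obtain b where b: "0 \<le> b" "\<And>s. 0 \<le> s \<Longrightarrow> s < 1 \<Longrightarrow> circle_mean p (deriv (deriv g)) s \<le> ennreal ((a * (1 - s) powr - (2 - 1 / p) + b) powr p)"
      using growth a unfolding little_growth_def by blast
    show ?thesis using C(2)[OF g _ a b(1)] b by (intro exI[of _ b]) auto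
  qed
  have L1: "\<exists>L\<ge>0. (\<integral>\<^sup>+y. norm (u (1 - of_real y)) \<partial>unit_ivl) = ennreal L" if "u \<in> ?V" for u
    using radial_L1_finite[OF p \<alpha> that]
    by (cases "\<integral>\<^sup>+y. norm (u (1 - of_real y)) \<partial>unit_ivl" rule: ennreal_cases) auto
  have TV: "?T u \<in> ?V" if u: "u \<in> ?V" for u
  proof -
    have hol: "u holomorphic_on unit_disc" and fin: "?E u < \<infinity>" using u by (auto simp: dirichlet_space_iff)
    obtain L where L: "0 \<le> L" "(\<integral>\<^sup>+y. norm (u (1 - of_real y)) \<partial>unit_ivl) = ennreal L" using L1[OF u] by blast
    obtain b where "?E (?T u) \<le> ennreal (C * 1 powr p) * (ennreal (norm (u 0) powr p) + ?E u) + ennreal (C * (b * L) powr p)"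
      using E_T[of 1] hol L by auto
    also have "\<dots> < \<infinity>" using fin by (simp add: ennreal_mult_less_top)
    finally show ?thesis
      using gen_hilbert_holomorphic[OF hol g] L by (auto simp: dirichlet_space_iff)
  qed
  obtain \<kappa> where \<kappa>: "0 < \<kappa>"
    "\<And>f. f \<in> ?V \<Longrightarrow> ennreal (norm (f 0) powr p) + ?E f \<le> ennreal (\<kappa> * ?N f powr p)"
    "\<And>f x y. f \<in> ?V \<Longrightarrow> norm (f 0) powr p \<le> x \<Longrightarrow> ?E f \<le> ennreal y \<Longrightarrow> 0 \<le> y \<Longrightarrow> ?N f powr p \<le> \<kappa> * (x + y)"
    using dirichlet_norm_bounds[OF p \<alpha>1] by blast
  show ?thesis
    unfolding compact_operator_on_def
  proof (intro conjI allI impI)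
    show "?T ` ?V \<subseteq> ?V" using TV by auto
    fix f :: "nat \<Rightarrow> complex \<Rightarrow> complex"
    assume "range f \<subseteq> ?V \<and> bdd_above (range (\<lambda>n. ?N (f n)))"
    then have fV: "\<And>n. f n \<in> ?V" and "bdd_above (range (\<lambda>n. ?N (f n)))" by auto
    then obtain K1 where K1: "\<And>n. ?N (f n) \<le> K1" by (auto simp: bdd_above_def)
    have fh: "f n holomorphic_on unit_disc" for n using fV[of n] by (simp add: dirichlet_space_iff)
    define K where "K = \<kappa> * (max K1 0) powr p"
    have K0: "0 \<le> K" using \<kappa> by (simp add: K_def)
    have K: "ennreal (norm (f n 0) powr p) + ?E (f n) \<le> ennreal K" for n
    proof -
      have "?N (f n) powr p \<le> (max K1 0) powr p"
        using K1[of n] p by (intro powr_mono2) (auto simp: dirichlet_norm_nonneg)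
      then have "\<kappa> * ?N (f n) powr p \<le> K" using \<kappa>(1) by (simp add: K_def)
      from order_trans[OF \<kappa>(2)[OF fV[of n]] ennreal_leI[OF this]] show ?thesis .
    qed
    obtain r h where r: "strict_mono (r :: nat \<Rightarrow> nat)" and h: "h \<in> ?V"
      and lim: "\<And>z. norm z < 1 \<Longrightarrow> (\<lambda>n. f (r n) z) \<longlonglongrightarrow> h z"
      using dirichlet_bounded_subsequence[where f = f, OF p fh K K0] by metis
    have hh: "h holomorphic_on unit_disc" using h by (simp add: dirichlet_space_iff)
    define Kh where "Kh = \<kappa> * ?N h powr p"
    have Kh: "ennreal (norm (h 0) powr p) + ?E h \<le> ennreal Kh" "0 \<le> Kh"
      using \<kappa>(1,2) h by (auto simp: Kh_def)
    \<comment> \<open>The differences stay bounded in norm and tend to 0 pointwise, so the L^1 term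
      of the operator estimate vanishes in the limit.\<close>
    define u where "u n z = f (r n) z - h z" for n z
    have uh: "u n holomorphic_on unit_disc" for n unfolding u_def[abs_def] by (intro holomorphic_intros fh hh)
    define K2 where "K2 = 2 powr p * (K + Kh)"
    have K2: "0 \<le> K2" using K0 Kh by (simp add: K2_def)
    have dfh: "deriv (f n) holomorphic_on unit_disc" for n by (intro holomorphic_deriv fh) auto
    have dhh: "deriv h holomorphic_on unit_disc" by (intro holomorphic_deriv hh) auto
    have uK: "ennreal (norm (u n 0) powr p) + ?E (u n) \<le> ennreal K2" for n
    proof -
      have "norm (u n 0) powr p \<le> (norm (f (r n) 0) + norm (h 0)) powr p"
        unfolding u_def using p by (intro powr_mono2 norm_triangle_ineq4) auto
      also have "\<dots> \<le> 2 powr p * (norm (f (r n) 0) powr p + norm (h 0) powr p)"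
        using p by (intro powr_add_le) auto
      finally have 1: "ennreal (norm (u n 0) powr p) \<le> ennreal (2 powr p) * (ennreal (norm (f (r n) 0) powr p) + ennreal (norm (h 0) powr p))"
        by (simp add: ennreal_leI ennreal_mult[symmetric] ennreal_plus[symmetric] del: ennreal_plus)
      have "?E (u n) = bergman_energy p \<alpha> (\<lambda>z. deriv (f (r n)) z - deriv h z)"
      proof (rule bergman_energy_cong)
        fix z :: complex assume "norm z < 1"
        then have z: "z \<in> unit_disc" by simp
        have "(u n has_field_derivative deriv (f (r n)) z - deriv h z) (at z)"
          unfolding u_def[abs_def]
          by (intro DERIV_diff holomorphic_derivI[OF fh _ z] holomorphic_derivI[OF hh _ z] open_ball)
        then show "deriv (u n) z = deriv (f (r n)) z - deriv h z" by (rule DERIV_imp_deriv)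
      qed
      also have "\<dots> \<le> ennreal (2 powr p) * (?E (f (r n)) + ?E h)"
        by (rule bergman_energy_diff_le[OF dfh dhh p])
      finally have 2: "?E (u n) \<le> ennreal (2 powr p) * (?E (f (r n)) + ?E h)" .
      have "ennreal (norm (u n 0) powr p) + ?E (u n)
        \<le> ennreal (2 powr p) * (ennreal (norm (f (r n) 0) powr p) + ennreal (norm (h 0) powr p))
          + ennreal (2 powr p) * (?E (f (r n)) + ?E h)"
        by (rule add_mono[OF 1 2])
      also have "\<dots> = ennreal (2 powr p) * ((ennreal (norm (f (r n) 0) powr p) + ?E (f (r n))) + (ennreal (norm (h 0) powr p) + ?E h))"
        by (simp only: distrib_left add_ac)
      also have "\<dots> \<le> ennreal (2 powr p) * (ennreal K + ennreal Kh)"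
        by (intro mult_left_mono add_mono K Kh) auto
      also have "\<dots> = ennreal K2" using K0 Kh by (simp add: K2_def ennreal_mult ennreal_plus)
      finally show ?thesis .
    qed
    have uV: "u n \<in> ?V" for n
    proof -
      have "?E (u n) \<le> ennreal (norm (u n 0) powr p) + ?E (u n)" by simp
      also note uK
      finally show ?thesis using uh by (auto simp: dirichlet_space_iff intro: le_less_trans)
    qed
    obtain L where L: "\<And>n. 0 \<le> L n" "\<And>n. (\<integral>\<^sup>+y. norm (u n (1 - of_real y)) \<partial>unit_ivl) = ennreal (L n)"
      using L1[OF uV] by metis
    have "(\<lambda>n. \<integral>\<^sup>+x. norm (u n (1 - of_real x)) \<partial>unit_ivl) \<longlonglongrightarrow> 0"
    proof (rule radial_L1_tendsto_0[OF p \<alpha> uh uK])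
      fix x :: real assume "0 < x" "x < 1"
      then have "norm (1 - of_real x :: complex) < 1" using norm_one_minus_of_real[of x] by simp
      then have "(\<lambda>n. f (r n) (1 - of_real x) - h (1 - of_real x)) \<longlonglongrightarrow> h (1 - of_real x) - h (1 - of_real x)"
        by (intro tendsto_diff lim tendsto_const)
      then show "(\<lambda>n. u n (1 - of_real x)) \<longlonglongrightarrow> 0" by (simp add: u_def)
    qed
    then have L0: "L \<longlonglongrightarrow> 0" using L by (simp add: tendsto_ennreal_iff flip: ennreal_0)
    define x where "x n = ?N (\<lambda>z. ?T (f (r n)) z - ?T h z)" for n
    \<comment> \<open>\<open>b\<close> depends on \<open>a\<close> but not on \<open>n\<close>; for
      fixed \<open>a\<close> only the term \<open>C * a powr p * K2\<close> survives as
      \<open>n\<close> grows.\<close>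
    have x_le: "\<exists>b\<ge>0. \<forall>n. x n powr p \<le> \<kappa> * ((norm (deriv g 0) * L n) powr p + (C * a powr p * K2 + C * (b * L n) powr p))"
      if a: "0 < a" for a
    proof -
      obtain b where b: "0 \<le> b" "\<And>u L. u holomorphic_on unit_disc \<Longrightarrow> (\<integral>\<^sup>+y. norm (u (1 - of_real y)) \<partial>unit_ivl) = ennreal L \<Longrightarrow> 0 \<le> L \<Longrightarrow>
         ?E (?T u) \<le> ennreal (C * a powr p) * (ennreal (norm (u 0) powr p) + ?E u) + ennreal (C * (b * L) powr p)"
        using E_T[OF a] by blast
      have "x n powr p \<le> \<kappa> * ((norm (deriv g 0) * L n) powr p + (C * a powr p * K2 + C * (b * L n) powr p))" for n
        unfolding x_def
      proof (rule \<kappa>(3))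
        have eq: "?T (f (r n)) z - ?T h z = ?T (u n) z" if "norm z < 1" for z
          using gen_hilbert_diff[OF fh hh g _ _ that] radial_L1_finite[OF p \<alpha>] fV h by (simp add: u_def[abs_def])
        \<comment> \<open>The two functions are known to agree only inside the disc, which is all
          that the energy sees.\<close>
        have Eeq: "?E (\<lambda>z. ?T (f (r n)) z - ?T h z) = ?E (?T (u n))"
          by (rule bergman_energy_cong) (use eq deriv_cong_disc[of "\<lambda>z. ?T (f (r n)) z - ?T h z" "?T (u n)"] in auto)
        show "(\<lambda>z. ?T (f (r n)) z - ?T h z) \<in> ?V"
          using TV[OF uV[of n]] TV[OF fV[of "r n"]] TV[OF h] Eeq
          by (auto simp: dirichlet_space_iff intro!: holomorphic_intros)
        have "norm (?T (u n) 0) \<le> norm (deriv g 0) * L n" by (rule gen_hilbert_0_le[OF uh g L(2,1)])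
        then show "norm (?T (f (r n)) 0 - ?T h 0) powr p \<le> (norm (deriv g 0) * L n) powr p"
          using p eq[of 0] by (simp add: powr_mono2)
        have "?E (?T (u n)) \<le> ennreal (C * a powr p) * (ennreal (norm (u n 0) powr p) + ?E (u n)) + ennreal (C * (b * L n) powr p)"
          by (rule b(2)[OF uh L(2,1)])
        also have "\<dots> \<le> ennreal (C * a powr p) * ennreal K2 + ennreal (C * (b * L n) powr p)"
          by (intro add_right_mono mult_left_mono uK) auto
        also have "\<dots> = ennreal (C * a powr p * K2 + C * (b * L n) powr p)"
          using C(1) K2 by (simp add: ennreal_mult[symmetric])
        finally show "?E (\<lambda>z. ?T (f (r n)) z - ?T h z) \<le> ennreal (C * a powr p * K2 + C * (b * L n) powr p)"
          unfolding Eeq .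
        show "0 \<le> C * a powr p * K2 + C * (b * L n) powr p" using C(1) K2 by simp
      qed
      then show ?thesis using b(1) by blast
    qed
    have "(\<lambda>n. x n powr p) \<longlonglongrightarrow> 0"
    proof (rule order_tendstoI)
      show "\<forall>\<^sub>F n in sequentially. y < x n powr p" if "y < 0" for y
        using that by (intro always_eventually allI) (auto intro: less_le_trans)
      fix \<delta> :: real assume \<delta>: "0 < \<delta>"
      \<comment> \<open>The summand 1 keeps \<open>M\<close> positive. With
        \<open>a powr p = \<delta> / (2 * M)\<close> the term that does not tend to 0 stays below
        \<open>\<delta> / 2\<close>.\<close>
      define M where "M = \<kappa> * (C * K2) + 1"
      have M: "0 < M" using \<kappa>(1) C(1) K2 by (simp add: M_def add_nonneg_pos)
      define a where "a = (\<delta> / (2 * M)) powr (1 / p)"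
      have a: "0 < a" "a powr p = \<delta> / (2 * M)" using \<delta> M p by (auto simp: a_def powr_powr)
      obtain b where b: "0 \<le> b" "\<And>n. x n powr p \<le> \<kappa> * ((norm (deriv g 0) * L n) powr p + (C * a powr p * K2 + C * (b * L n) powr p))"
        using x_le[OF a(1)] by blast
      have main: "\<kappa> * (C * a powr p * K2) < \<delta>"
      proof -
        have "\<kappa> * (C * a powr p * K2) = (\<kappa> * (C * K2)) * a powr p" by (simp add: mult_ac)
        also have "\<dots> < M * a powr p" using a(1) by (intro mult_strict_right_mono) (auto simp: M_def)
        also have "\<dots> = \<delta> / 2" using a M by simp
        finally show ?thesis using \<delta> by simp
      qed
      have z: "(\<lambda>n. (c * L n) powr p) \<longlonglongrightarrow> 0" if "0 \<le> c" for c
        using p that L tendsto_mult[OF tendsto_const L0, of c]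
        by (intro tendsto_zero_powrI[OF _ tendsto_const]) auto
      have "(\<lambda>n. \<kappa> * ((norm (deriv g 0) * L n) powr p + (C * a powr p * K2 + C * (b * L n) powr p)))
         \<longlonglongrightarrow> \<kappa> * (0 + (C * a powr p * K2 + C * 0))"
        by (intro tendsto_intros z b) auto
      then have "\<forall>\<^sub>F n in sequentially. \<kappa> * ((norm (deriv g 0) * L n) powr p + (C * a powr p * K2 + C * (b * L n) powr p)) < \<delta>"
        by (rule order_tendstoD(2)) (use main in simp)
      then show "\<forall>\<^sub>F n in sequentially. x n powr p < \<delta>"
        by eventually_elim (use b(2) le_less_trans in blast)
    qed
    then have "(\<lambda>n. (x n powr p) powr (1 / p)) \<longlonglongrightarrow> 0"
      by (rule tendsto_zero_powrI[OF _ tendsto_const[of "1 / p"]]) (use p in \<open>auto intro!: always_eventually\<close>)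
    moreover have "(x n powr p) powr (1 / p) = x n" for n
      using p by (simp add: powr_powr x_def dirichlet_norm_nonneg)
    ultimately have "x \<longlonglongrightarrow> 0" by simp
    then show "\<exists>h\<in>?V. \<exists>r. strict_mono r \<and> (\<lambda>n. ?N (\<lambda>z. ?T (f (r n)) z - h z)) \<longlonglongrightarrow> 0"
      using TV[OF h] r unfolding x_def by blast
  qed
qed

section \<open>Test functions\<close>

lemma dirichlet_norm_cong:
  assumes "f 0 = g 0" "\<And>z. norm z < 1 \<Longrightarrow> deriv f z = deriv g z"
  shows "dirichlet_norm p \<alpha> f = dirichlet_norm p \<alpha> g"
proof -
  have "(LINT z:unit_disc|area. norm (deriv f z) powr p * (1 - (norm z)\<^sup>2) powr \<alpha>)
      = (LINT z:unit_disc|area. norm (deriv g z) powr p * (1 - (norm z)\<^sup>2) powr \<alpha>)"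
    unfolding set_lebesgue_integral_def
    by (intro Bochner_Integration.integral_cong) (auto simp: indicator_def assms)
  then show ?thesis by (simp add: dirichlet_norm_def bergman_norm_def assms)
qed

lemma dirichlet_space_diff:
  assumes p: "1 < p" and "f \<in> dirichlet_space p \<alpha>" "g \<in> dirichlet_space p \<alpha>"
  shows "(\<lambda>z. f z - g z) \<in> dirichlet_space p \<alpha>"
    and "norm z < 1 \<Longrightarrow> deriv (\<lambda>z. f z - g z) z = deriv f z - deriv g z"
proof -
  have f: "f holomorphic_on unit_disc" "bergman_energy p \<alpha> (deriv f) < \<infinity>"
    and g: "g holomorphic_on unit_disc" "bergman_energy p \<alpha> (deriv g) < \<infinity>"
    using assms by (auto simp: dirichlet_space_iff)
  have d: "deriv (\<lambda>z. f z - g z) z = deriv f z - deriv g z" if "norm z < 1" for z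
  proof -
    have z: "z \<in> unit_disc" using that by simp
    show ?thesis
      by (rule DERIV_imp_deriv)
         (intro DERIV_diff holomorphic_derivI[OF f(1) _ z] holomorphic_derivI[OF g(1) _ z] open_ball)
  qed
  then show "norm z < 1 \<Longrightarrow> deriv (\<lambda>z. f z - g z) z = deriv f z - deriv g z" .
  have df: "deriv f holomorphic_on unit_disc" "deriv g holomorphic_on unit_disc"
    by (auto intro!: holomorphic_deriv f g)
  have "bergman_energy p \<alpha> (deriv (\<lambda>z. f z - g z)) = bergman_energy p \<alpha> (\<lambda>z. deriv f z - deriv g z)"
    by (rule bergman_energy_cong[OF d])
  also have "\<dots> \<le> ennreal (2 powr p) * (bergman_energy p \<alpha> (deriv f) + bergman_energy p \<alpha> (deriv g))"
    by (rule bergman_energy_diff_le[OF df p])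
  also have "\<dots> < \<infinity>" using f g by (simp add: ennreal_mult_less_top)
  finally show "(\<lambda>z. f z - g z) \<in> dirichlet_space p \<alpha>"
    using f g by (auto simp: dirichlet_space_iff intro!: holomorphic_intros)
qed

section \<open>Null sequences under a compact operator\<close>

lemma norm_powr_tendsto_0D:
  fixes x :: "nat \<Rightarrow> complex"
  assumes p: "1 < p" and le: "\<And>n. ennreal (norm (x n) powr p) \<le> ennreal (C * y n)" and C: "0 \<le> C" "\<And>n. 0 \<le> y n" and y: "y \<longlonglongrightarrow> 0"
  shows "x \<longlonglongrightarrow> 0"
proof -
  have le': "norm (x n) powr p \<le> C * y n" for n using le[of n] C by (subst (asm) ennreal_le_iff) auto
  have "(\<lambda>n. norm (x n) powr p) \<longlonglongrightarrow> 0"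
  proof (rule tendsto_sandwich[OF _ _ tendsto_const])
    show "(\<lambda>n. C * y n) \<longlonglongrightarrow> 0" using tendsto_mult[OF tendsto_const y, of C] by simp
  qed (use le' in auto)
  then have "(\<lambda>n. (norm (x n) powr p) powr (1 / p)) \<longlonglongrightarrow> 0"
    by (rule tendsto_zero_powrI[OF _ tendsto_const[of "1 / p"]]) (use p in auto)
  then have "(\<lambda>n. norm (x n)) \<longlonglongrightarrow> 0" using p by (simp add: powr_powr)
  then show ?thesis by (simp add: tendsto_norm_zero_iff)
qed

text \<open>If the norms stayed away from 0 along a subsequence, compactness would give a further
  one whose images converge in norm to some \<open>h\<close>. Norm convergence carries the values at
  0 and the derivatives to those of \<open>h\<close>. The L^1 norms of the arguments on the radius
  tend to 0, which sends the same quantities to 0. Hence \<open>h\<close> has norm 0, a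
  contradiction.\<close>

lemma compact_gen_hilbert_tendsto_0:
  fixes u :: "nat \<Rightarrow> complex \<Rightarrow> complex"
  assumes p: "1 < p" and \<alpha>: "p - 2 < \<alpha>" "\<alpha> \<le> p - 1" and g: "g holomorphic_on unit_disc"
    and comp: "compact_operator_on (dirichlet_space p \<alpha>) (dirichlet_norm p \<alpha>) (gen_hilbert g)"
    and u: "\<And>n. u n \<in> dirichlet_space p \<alpha>" and bd: "\<And>n. dirichlet_norm p \<alpha> (u n) \<le> K"
    and lim: "\<And>x. 0 < x \<Longrightarrow> x < 1 \<Longrightarrow> (\<lambda>n. u n (1 - of_real x)) \<longlonglongrightarrow> 0"
  shows "(\<lambda>n. dirichlet_norm p \<alpha> (gen_hilbert g (u n))) \<longlonglongrightarrow> 0"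
proof (rule ccontr)
  let ?V = "dirichlet_space p \<alpha>" and ?N = "dirichlet_norm p \<alpha>" and ?T = "gen_hilbert g"
  let ?E = "\<lambda>f. bergman_energy p \<alpha> (deriv f)"
  have \<alpha>1: "-1 < \<alpha>" using \<alpha> p by simp
  have g1: "deriv g holomorphic_on unit_disc" by (intro holomorphic_deriv g) auto
  have g2: "deriv (deriv g) holomorphic_on unit_disc" by (intro holomorphic_deriv g1) auto
  assume "\<not> (\<lambda>n. ?N (?T (u n))) \<longlonglongrightarrow> 0"
  then obtain \<epsilon> where \<epsilon>: "0 < \<epsilon>" "\<not> (\<forall>\<^sub>F n in sequentially. dist (?N (?T (u n))) 0 < \<epsilon>)"
    unfolding tendsto_iff by blast
  then have "infinite {n. \<not> ?N (?T (u n)) < \<epsilon>}"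
    by (simp add: not_eventually frequently_cofinite cofinite_eq_sequentially[symmetric] dirichlet_norm_nonneg)
  then obtain s where s: "strict_mono (s :: nat \<Rightarrow> nat)" "\<And>n. \<not> ?N (?T (u (s n))) < \<epsilon>"
    using infinite_enumerate[of "{n. \<not> ?N (?T (u n)) < \<epsilon>}"] by auto
  have "range (\<lambda>n. u (s n)) \<subseteq> ?V \<and> bdd_above (range (\<lambda>n. ?N (u (s n))))"
    using u bd by (auto intro!: bdd_aboveI[of _ K])
  then obtain h r where h: "h \<in> ?V" and r: "strict_mono r"
    and conv: "(\<lambda>n. ?N (\<lambda>z. ?T (u (s (r n))) z - h z)) \<longlonglongrightarrow> 0"
    using comp[unfolded compact_operator_on_def] by blast
  define v where "v n = u (s (r n))" for n
  have vV: "v n \<in> ?V" for n by (simp add: v_def u)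
  have vh: "v n holomorphic_on unit_disc" for n using vV by (simp add: dirichlet_space_iff)
  have TV: "?T (v n) \<in> ?V" for n using comp vV by (auto simp: compact_operator_on_def)
  define F where "F n = (\<lambda>z. ?T (v n) z - h z)" for n
  have FV: "F n \<in> ?V" and dF: "norm z < 1 \<Longrightarrow> deriv (F n) z = deriv (?T (v n)) z - deriv h z" for n z
    unfolding F_def using dirichlet_space_diff[OF p TV h] by auto
  have N0: "(\<lambda>n. ?N (F n)) \<longlonglongrightarrow> 0" using conv by (simp add: F_def v_def)
  obtain \<kappa> where \<kappa>: "0 < \<kappa>"
    "\<And>f. f \<in> ?V \<Longrightarrow> ennreal (norm (f 0) powr p) + ?E f \<le> ennreal (\<kappa> * ?N f powr p)"
    using dirichlet_norm_bounds[OF p \<alpha>1] by metis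
  have Np: "(\<lambda>n. ?N (F n) powr p) \<longlonglongrightarrow> 0"
    by (rule tendsto_zero_powrI[OF N0 tendsto_const]) (use p in \<open>auto simp: dirichlet_norm_nonneg\<close>)
  have F0: "(\<lambda>n. F n 0) \<longlonglongrightarrow> 0"
  proof (rule norm_powr_tendsto_0D[OF p _ less_imp_le[OF \<kappa>(1)] _ Np])
    fix n
    have "ennreal (norm (F n 0) powr p) \<le> ennreal (norm (F n 0) powr p) + ?E (F n)" by simp
    also note \<kappa>(2)[OF FV]
    finally show "ennreal (norm (F n 0) powr p) \<le> ennreal (\<kappa> * ?N (F n) powr p)" .
  qed simp
  have F1: "(\<lambda>n. deriv (F n) w) \<longlonglongrightarrow> 0" if w: "norm w < 1" for w
  proof -
    obtain C where C: "0 \<le> C" "\<And>G z. G holomorphic_on unit_disc \<Longrightarrow> norm z \<le> norm w \<Longrightarrow> ennreal (norm (G z) powr p) \<le> ennreal C * bergman_energy p \<alpha> G"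
      using bergman_pointwise_bound[OF _ w p] by auto
    show ?thesis
    proof (rule norm_powr_tendsto_0D[OF p _ _ _ Np, of _ "C * \<kappa>"])
      fix n
      have "deriv (F n) holomorphic_on unit_disc"
        using FV[of n] by (intro holomorphic_deriv) (auto simp: dirichlet_space_iff)
      then have "ennreal (norm (deriv (F n) w) powr p) \<le> ennreal C * ?E (F n)" by (intro C) auto
      also have "?E (F n) \<le> ennreal (norm (F n 0) powr p) + ?E (F n)" by simp
      also note \<kappa>(2)[OF FV]
      also have "ennreal C * ennreal (\<kappa> * ?N (F n) powr p) = ennreal (C * \<kappa> * ?N (F n) powr p)"
        using C \<kappa>(1) by (simp add: ennreal_mult[symmetric] mult.assoc)
      finally show "ennreal (norm (deriv (F n) w) powr p) \<le> ennreal (C * \<kappa> * ?N (F n) powr p)"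
        by (simp add: mult_left_mono)
    qed (use C \<kappa>(1) in auto)
  qed
  have "\<exists>L\<ge>0. (\<integral>\<^sup>+y. norm (v n (1 - of_real y)) \<partial>unit_ivl) = ennreal L" for n
    using radial_L1_finite[OF p \<alpha> vV[of n]]
    by (cases "\<integral>\<^sup>+y. norm (v n (1 - of_real y)) \<partial>unit_ivl" rule: ennreal_cases) auto
  then obtain L where L: "\<And>n. 0 \<le> L n" "\<And>n. (\<integral>\<^sup>+y. norm (v n (1 - of_real y)) \<partial>unit_ivl) = ennreal (L n)"
    by metis
  have "(\<lambda>n. \<integral>\<^sup>+x. norm (v n (1 - of_real x)) \<partial>unit_ivl) \<longlonglongrightarrow> 0"
  proof (rule radial_L1_tendsto_0[OF p \<alpha> vh])
    fix n
    have "?N (v n) powr p \<le> (max K 0) powr p"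
      using bd[of "s (r n)"] p by (intro powr_mono2) (auto simp: dirichlet_norm_nonneg v_def)
    then have "\<kappa> * ?N (v n) powr p \<le> \<kappa> * (max K 0) powr p" using \<kappa>(1) by simp
    from order_trans[OF \<kappa>(2)[OF vV] ennreal_leI[OF this]]
    show "ennreal (norm (v n 0) powr p) + ?E (v n) \<le> ennreal (\<kappa> * (max K 0) powr p)" .
  next
    fix x :: real assume "0 < x" "x < 1"
    from LIMSEQ_subseq_LIMSEQ[OF LIMSEQ_subseq_LIMSEQ[OF lim[OF this] s(1)] r]
    show "(\<lambda>n. v n (1 - of_real x)) \<longlonglongrightarrow> 0" by (simp add: v_def o_def)
  qed
  then have L0: "L \<longlonglongrightarrow> 0" using L by (simp add: tendsto_ennreal_iff flip: ennreal_0)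
  have T0: "(\<lambda>n. ?T (v n) 0) \<longlonglongrightarrow> 0"
  proof (rule Lim_null_comparison)
    show "\<forall>\<^sub>F n in sequentially. norm (?T (v n) 0) \<le> norm (deriv g 0) * L n"
      using gen_hilbert_0_le[OF vh g L(2,1)] by (intro always_eventually allI)
    show "(\<lambda>n. norm (deriv g 0) * L n) \<longlonglongrightarrow> 0" using tendsto_mult[OF tendsto_const L0] by simp
  qed
  have T1: "(\<lambda>n. deriv (?T (v n)) w) \<longlonglongrightarrow> 0" if w: "norm w < 1" for w
  proof -
    have sub: "cball 0 (norm w) \<subseteq> unit_disc" using w by auto
    obtain B where B: "\<forall>z\<in>cball 0 (norm w). norm (deriv (deriv g) z) \<le> B"
      using compact_imp_bounded[OF compact_continuous_image[OF continuous_on_subset[OF holomorphic_on_imp_continuous_on[OF g2] sub]]]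
      by (auto simp: bounded_iff)
    have B0: "0 \<le> B" using B norm_ge_zero order_trans by (metis centre_in_cball norm_ge_zero)
    show ?thesis
    proof (rule Lim_null_comparison)
      show "(\<lambda>n. B * L n) \<longlonglongrightarrow> 0" using tendsto_mult[OF tendsto_const L0, of B] by simp
      have "norm (deriv (?T (v n)) w) \<le> B * L n" for n
      proof -
        note [measurable] = radial_measurable[OF vh]
        have "ennreal (norm (deriv (?T (v n)) w))
          \<le> (\<integral>\<^sup>+y. norm (v n (1 - of_real y)) * norm (deriv (deriv g) (of_real (1 - y) * w)) \<partial>unit_ivl)"
          by (rule norm_deriv_gen_hilbert_le[OF vh g _ w]) (simp add: L)
        also have "\<dots> \<le> (\<integral>\<^sup>+y. ennreal B * ennreal (norm (v n (1 - of_real y))) \<partial>unit_ivl)"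
        proof (rule nn_integral_mono)
          fix y assume "y \<in> space unit_ivl"
          then have "of_real (1 - y) * w \<in> cball 0 (norm w)"
            using mult_left_le_one_le[of "norm w" "1 - y"] by (simp add: norm_mult norm_one_minus_of_real)
          then have "norm (v n (1 - of_real y)) * norm (deriv (deriv g) (of_real (1 - y) * w)) \<le> norm (v n (1 - of_real y)) * B"
            using B by (intro mult_left_mono norm_ge_zero) blast
          then show "ennreal (norm (v n (1 - of_real y)) * norm (deriv (deriv g) (of_real (1 - y) * w))) \<le> ennreal B * ennreal (norm (v n (1 - of_real y)))"
            using B0 by (simp add: ennreal_mult[symmetric] mult.commute ennreal_leI)
        qed
        also have "\<dots> = ennreal B * ennreal (L n)"
          unfolding L(2)[symmetric] by (rule nn_integral_cmult) measurable
        also have "\<dots> = ennreal (B * L n)" using B0 L by (simp add: ennreal_mult)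
        finally show ?thesis using B0 L by (subst (asm) ennreal_le_iff) auto
      qed
      then show "\<forall>\<^sub>F n in sequentially. norm (deriv (?T (v n)) w) \<le> B * L n" by (intro always_eventually allI)
    qed
  qed
  have h0: "h 0 = 0"
    using tendsto_diff[OF T0 F0] by (simp add: F_def LIMSEQ_const_iff)
  have dh: "deriv h w = 0" if "norm w < 1" for w
    using tendsto_diff[OF T1[OF that] F1[OF that]] by (simp add: dF[OF that] LIMSEQ_const_iff)
  \<comment> \<open>\<open>h\<close> may be arbitrary outside the disc, but subtracting it changes
    neither the value at 0 nor the derivative inside.\<close>
  have "?N (F n) = ?N (?T (v n))" for n
    by (rule dirichlet_norm_cong) (use h0 dh dF in \<open>auto simp: F_def\<close>)
  then have "(\<lambda>n. ?N (?T (v n))) \<longlonglongrightarrow> 0" using N0 by simp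
  then have "\<forall>\<^sub>F n in sequentially. ?N (?T (v n)) < \<epsilon>" using \<epsilon>(1) by (rule order_tendstoD(2))
  then show False using s(2) by (auto simp: v_def eventually_sequentially)
qed

text \<open>The derivative is a multiple of the power \<open>k + 1\<close> of
  \<open>1 / (1 - of_real a * z)\<close>, whose energy is of order
  \<open>(1 - a) powr (\<alpha> + 2 - (k + 1) * p)\<close> for \<open>k\<close> in
  \<open>{1, 2}\<close>. With \<open>\<sigma> = 1 - (\<alpha> + 2) / p\<close> the numerator
  compensates exactly this growth.\<close>

definition test_fun :: "real \<Rightarrow> real \<Rightarrow> nat \<Rightarrow> complex \<Rightarrow> complex" where
  "test_fun \<sigma> a k z = of_real ((1 - a) powr (\<sigma> + k)) / (1 - of_real a * z) ^ k"

lemma one_minus_mult_bounds: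
  assumes "0 \<le> a" "a < 1" "norm (z :: complex) \<le> 1"
  shows "1 - a * norm z \<le> norm (1 - of_real a * z)" "1 - a \<le> norm (1 - of_real a * z)" "1 - of_real a * z \<noteq> 0"
proof -
  show 1: "1 - a * norm z \<le> norm (1 - of_real a * z)"
    using norm_triangle_ineq2[of 1 "of_real a * z"] assms by (simp add: norm_mult)
  have "a * norm z \<le> a * 1" using assms by (intro mult_left_mono) auto
  then show 2: "1 - a \<le> norm (1 - of_real a * z)" using 1 by simp
  then show "1 - of_real a * z \<noteq> 0" using assms by auto
qed

lemma test_fun_has_derivative:
  assumes "0 \<le> a" "a < 1" "norm z \<le> 1"
  shows "(test_fun \<sigma> a k has_field_derivative
     of_nat k * of_real a * of_real ((1 - a) powr (\<sigma> + k)) / (1 - of_real a * z) ^ Suc k) (at z)"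
proof -
  have ne: "1 - of_real a * z \<noteq> 0" by (rule one_minus_mult_bounds(3)[OF assms])
  \<comment> \<open>For \<open>k = 0\<close> the factor \<open>of_nat k\<close> removes the term in
    which \<open>k - 1\<close> is truncated to 0.\<close>
  have alg: "- (c * (of_nat k * (- b) * d ^ (k - 1))) / (d ^ k * d ^ k) = of_nat k * b * c / d ^ Suc k"
    if "d \<noteq> 0" for b c d :: complex
    using that by (cases k) (auto simp: divide_simps)
  have D: "((\<lambda>z. (1 - of_real a * z) ^ k) has_field_derivative of_nat k * (- of_real a) * (1 - of_real a * z) ^ (k - 1)) (at z)"
    by (auto intro!: derivative_eq_intros)
  have "((\<lambda>z. of_real ((1 - a) powr (\<sigma> + k)) / (1 - of_real a * z) ^ k) has_field_derivative
      - (of_real ((1 - a) powr (\<sigma> + k)) * (of_nat k * (- of_real a) * (1 - of_real a * z) ^ (k - 1))) / ((1 - of_real a * z) ^ k * (1 - of_real a * z) ^ k)) (at z)"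
    using ne by (auto intro!: derivative_eq_intros D)
  also have "- (of_real ((1 - a) powr (\<sigma> + k)) * (of_nat k * (- of_real a) * (1 - of_real a * z) ^ (k - 1))) / ((1 - of_real a * z) ^ k * (1 - of_real a * z) ^ k)
      = of_nat k * of_real a * of_real ((1 - a) powr (\<sigma> + k)) / (1 - of_real a * z) ^ Suc k"
    by (rule alg[OF ne])
  finally show ?thesis unfolding test_fun_def[abs_def] .
qed

lemma test_fun_holomorphic:
  assumes "0 \<le> a" "a < 1"
  shows "test_fun \<sigma> a k holomorphic_on unit_disc"
proof -
  have "\<exists>f'. (test_fun \<sigma> a k has_field_derivative f') (at z)" if "z \<in> unit_disc" for z
    using test_fun_has_derivative[OF assms, of z] that by (intro exI) auto
  then show ?thesis by (simp add: holomorphic_on_open)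
qed

text \<open>On the circle of radius \<open>sqrt (1 - x)\<close> put
  \<open>s = a * sqrt (1 - x)\<close>. All but two of the \<open>2 * p\<close> powers of
  \<open>1 / norm (1 - of_real s * w)\<close> are bounded by \<open>1 / (1 - s)\<close>, and the
  remaining two integrate as a Poisson kernel; this gives the exponent \<open>B = 2 * p - 1\<close>.
  Then \<open>max (1 - a) x / 2 \<le> 1 - s\<close> leads to
  \<open>nn_integral_powr_max\<close>.\<close>

lemma bergman_energy_kernel_le:
  assumes p: "1 < p" and \<alpha>: "-1 < \<alpha>" "\<alpha> + 2 < 2 * p"
  obtains C where "0 \<le> C"
    "\<And>a. 0 \<le> a \<Longrightarrow> a < 1 \<Longrightarrow> bergman_energy p \<alpha> (\<lambda>z. 1 / (1 - of_real a * z)\<^sup>2) \<le> ennreal (C * (1 - a) powr (\<alpha> + 2 - 2 * p))"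
proof -
  define B where "B = 2 * p - 1"
  have B: "\<alpha> + 1 < B" "0 < B" using \<alpha> p by (auto simp: B_def)
  define c where "c = 1 / (\<alpha> + 1) + 1 / (B - \<alpha> - 1)"
  have c: "0 \<le> c" using \<alpha> B by (auto simp: c_def)
  show ?thesis
  proof (rule that)
    show "0 \<le> pi * 2 powr B * c" using c by simp
    fix a :: real assume a: "0 \<le> a" "a < 1"
    let ?F = "\<lambda>z. 1 / (1 - of_real a * z)\<^sup>2 :: complex"
    have F: "?F holomorphic_on unit_disc"
      using one_minus_mult_bounds(3)[OF a] by (auto intro!: holomorphic_intros)
    have mean: "circle_mean p ?F (sqrt (1 - x)) \<le> ennreal (2 powr B * max (1 - a) x powr - B)" if x: "0 < x" "x < 1" for x
    proof -
      define r where "r = sqrt (1 - x)"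
      define s where "s = a * r"
      have r: "0 \<le> r" "r < 1" using x by (auto simp: r_def)
      have sa: "s \<le> a" "s \<le> r" "0 \<le> s"
        using a r mult_left_le[of r a] mult_left_le_one_le[of r a] by (auto simp: s_def)
      then have s: "0 \<le> s" "s < 1" "s \<le> a" "s \<le> r" using a by auto
      have "r \<le> 1 - x / 2"
        unfolding r_def by (rule real_le_lsqrt) (use x in \<open>auto simp: power2_eq_square algebra_simps\<close>)
      then have m: "max (1 - a) x / 2 \<le> 1 - s" using s a x by (auto simp: max_def field_simps)
      \<comment> \<open>Multiplying by \<open>cnj w\<close> turns \<open>w - of_real s\<close> into
        the conjugate of \<open>1 - of_real s * w\<close>; this brings the kernel into Poisson
        form.\<close>
      have nrm: "norm (1 - of_real s * w) = norm (w - of_real s)" if w: "norm w = 1" for w :: complex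
      proof -
        have "norm (1 - of_real s * w) = norm (cnj (1 - of_real s * w))" by (rule complex_mod_cnj[symmetric])
        also have "cnj (1 - of_real s * w) = 1 - of_real s * cnj w" by simp
        also have "norm (1 - of_real s * cnj w) = norm w * norm (1 - of_real s * cnj w)" using w by simp
        also have "\<dots> = norm (w - of_real s * (w * cnj w))" by (simp add: norm_mult[symmetric] algebra_simps)
        also have "w * cnj w = 1" using w by (simp add: complex_norm_square[symmetric])
        finally show ?thesis by simp
      qed
      have "circle_mean p ?F r = (\<integral>\<^sup>+w. ennreal (norm (1 / (1 - of_real s * w)\<^sup>2) powr p) \<partial>circ)"
        by (simp add: circle_mean_def s_def mult.assoc)
      also have "\<dots> \<le> (\<integral>\<^sup>+w. ennreal ((1 - s) powr (2 - 2 * p)) * ennreal (1 / (norm (w - of_real s))\<^sup>2) \<partial>circ)"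
      proof (rule nn_integral_mono)
        fix w assume "w \<in> space circ"
        then have w: "norm w = 1" by simp
        define q where "q = norm (1 - of_real s * w)"
        have q: "1 - s \<le> q" using one_minus_mult_bounds(2)[OF s(1,2), of w] w by (simp add: q_def)
        have q0: "0 < q" using q s by simp
        have "norm (1 / (1 - of_real s * w)\<^sup>2) powr p = (q powr - 2) powr p"
          using q0 by (simp add: norm_divide norm_power q_def powr_minus_divide)
        also have "\<dots> = q powr (2 - 2 * p) * q powr - 2"
          by (simp add: powr_powr powr_add[symmetric])
        also have "\<dots> \<le> (1 - s) powr (2 - 2 * p) * q powr - 2"
          using q s p by (intro mult_right_mono powr_mono2') auto
        also have "q powr - 2 = 1 / (norm (w - of_real s))\<^sup>2"
          using q0 nrm[OF w] by (simp add: q_def powr_minus_divide)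
        finally show "ennreal (norm (1 / (1 - of_real s * w)\<^sup>2) powr p)
          \<le> ennreal ((1 - s) powr (2 - 2 * p)) * ennreal (1 / (norm (w - of_real s))\<^sup>2)"
          by (simp add: ennreal_mult[symmetric] ennreal_leI)
      qed
      also have "\<dots> = ennreal ((1 - s) powr (2 - 2 * p)) * (\<integral>\<^sup>+w. ennreal (1 / (norm (w - of_real s))\<^sup>2) \<partial>circ)"
        by (rule nn_integral_cmult) measurable
      also have "(\<integral>\<^sup>+w. ennreal (1 / (norm (w - of_real s))\<^sup>2) \<partial>circ) = ennreal (1 / (1 - s\<^sup>2))"
        using nn_integral_poisson_kernel[of "of_real s"] s by simp
      also have "\<dots> \<le> ennreal ((1 - s) powr - 1)"
      proof (rule ennreal_leI)
        have "s\<^sup>2 \<le> s" using s by (simp add: power2_eq_square mult_left_le)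
        then have "1 / (1 - s\<^sup>2) \<le> 1 / (1 - s)" using s by (intro divide_left_mono mult_pos_pos) (auto simp: power_less_one_iff)
        then show "1 / (1 - s\<^sup>2) \<le> (1 - s) powr - 1" using s by (simp add: powr_minus_divide)
      qed
      also have "ennreal ((1 - s) powr (2 - 2 * p)) * ennreal ((1 - s) powr - 1) = ennreal ((1 - s) powr - B)"
      proof -
        have "- B = (2 - 2 * p) + - 1" by (simp add: B_def)
        then have "(1 - s) powr - B = (1 - s) powr (2 - 2 * p) * (1 - s) powr - 1" by (simp only: powr_add)
        then show ?thesis by (simp only: ennreal_mult powr_ge_zero)
      qed
      also have "\<dots> \<le> ennreal ((max (1 - a) x / 2) powr - B)"
        using m x B by (intro ennreal_leI powr_mono2') auto
      also have "(max (1 - a) x / 2) powr - B = 2 powr B * max (1 - a) x powr - B"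
        using x by (simp add: powr_divide powr_minus_divide)
      finally show ?thesis by (simp add: r_def mult_left_mono)
    qed
    have "bergman_energy p \<alpha> ?F = ennreal pi * (\<integral>\<^sup>+x. ennreal (x powr \<alpha>) * circle_mean p ?F (sqrt (1 - x)) \<partial>unit_ivl)"
      by (rule bergman_energy_polar[OF F])
    also have "\<dots> \<le> ennreal pi * (\<integral>\<^sup>+x. ennreal (2 powr B) * ennreal (x powr \<alpha> * max (1 - a) x powr - B) \<partial>unit_ivl)"
    proof (intro mult_left_mono nn_integral_mono)
      fix x assume "x \<in> space unit_ivl"
      then have "ennreal (x powr \<alpha>) * circle_mean p ?F (sqrt (1 - x)) \<le> ennreal (x powr \<alpha>) * ennreal (2 powr B * max (1 - a) x powr - B)"
        by (intro mult_left_mono mean) auto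
      also have "\<dots> = ennreal (2 powr B) * ennreal (x powr \<alpha> * max (1 - a) x powr - B)"
        by (simp add: ennreal_mult mult_ac)
      finally show "ennreal (x powr \<alpha>) * circle_mean p ?F (sqrt (1 - x)) \<le> \<dots>" .
    qed simp
    also have "\<dots> = ennreal pi * (ennreal (2 powr B) * (\<integral>\<^sup>+x. x powr \<alpha> * max (1 - a) x powr - B \<partial>unit_ivl))"
      by (subst nn_integral_cmult) auto
    also have "\<dots> \<le> ennreal pi * (ennreal (2 powr B) * ennreal (c * (1 - a) powr (\<alpha> + 1 - B)))"
      unfolding c_def using \<alpha> B a by (intro mult_left_mono nn_integral_powr_max) auto
    also have "\<dots> = ennreal (pi * 2 powr B * c * (1 - a) powr (\<alpha> + 1 - B))"
      using c by (simp add: ennreal_mult[symmetric] mult.assoc)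
    also have "\<alpha> + 1 - B = \<alpha> + 2 - 2 * p" by (simp add: B_def)
    finally show "bergman_energy p \<alpha> ?F \<le> ennreal (pi * 2 powr B * c * (1 - a) powr (\<alpha> + 2 - 2 * p))" .
  qed
qed

lemma test_fun_bounded:
  assumes p: "1 < p" and \<alpha>: "p - 2 < \<alpha>" "\<alpha> \<le> p - 1"
  defines "\<sigma> \<equiv> 1 - (\<alpha> + 2) / p"
  obtains K where
    "\<And>a k. 0 \<le> a \<Longrightarrow> a < 1 \<Longrightarrow> k \<in> {1, 2} \<Longrightarrow> test_fun \<sigma> a k \<in> dirichlet_space p \<alpha> \<and> dirichlet_norm p \<alpha> (test_fun \<sigma> a k) \<le> K"
proof -
  have \<alpha>1: "-1 < \<alpha>" "\<alpha> + 2 < 2 * p" using \<alpha> p by auto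
  have "(\<alpha> + 2) / p < 2" using \<alpha>1 p by (simp add: field_simps)
  then have \<sigma>: "0 < \<sigma> + 1" by (simp add: \<sigma>_def)
  obtain C where C: "0 \<le> C" "\<And>a. 0 \<le> a \<Longrightarrow> a < 1 \<Longrightarrow>
      bergman_energy p \<alpha> (\<lambda>z. 1 / (1 - of_real a * z)\<^sup>2) \<le> ennreal (C * (1 - a) powr (\<alpha> + 2 - 2 * p))"
    using bergman_energy_kernel_le[OF p \<alpha>1] by blast
  obtain \<kappa> where \<kappa>: "0 < \<kappa>" "\<And>f x y. f \<in> dirichlet_space p \<alpha> \<Longrightarrow> norm (f 0) powr p \<le> x \<Longrightarrow> bergman_energy p \<alpha> (deriv f) \<le> ennreal y \<Longrightarrow> 0 \<le> y \<Longrightarrow>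
       dirichlet_norm p \<alpha> f powr p \<le> \<kappa> * (x + y)"
    using dirichlet_norm_bounds[OF p \<alpha>1(1)] by metis
  define M where "M = \<kappa> * (1 + 2 powr p * C)"
  show ?thesis
  proof (rule that[of "M powr (1 / p)"])
    fix a :: real and k :: nat assume a: "0 \<le> a" "a < 1" and k: "k \<in> {1, 2}"
    let ?f = "test_fun \<sigma> a k"
    \<comment> \<open>Both derivatives are at most \<open>c\<close> times
      \<open>norm (1 / (1 - of_real a * z)\<^sup>2)\<close>: the 2 bounds \<open>k\<close>, and for
      \<open>k = 2\<close> the surplus factor \<open>(1 - a) / q\<close>, with
      \<open>q = norm (1 - of_real a * z)\<close>, is at most 1.\<close>
    define c where "c = 2 * (1 - a) powr (\<sigma> + 1)"
    have c: "0 \<le> c" by (simp add: c_def)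
    have Fm[measurable]: "(\<lambda>z. 1 / (1 - of_real a * z)\<^sup>2 :: complex) \<in> borel_measurable disc"
      by (rule holomorphic_measurable_disc) (use one_minus_mult_bounds(3)[OF a] in \<open>auto intro!: holomorphic_intros\<close>)
    have "bergman_energy p \<alpha> (deriv ?f)
      \<le> (\<integral>\<^sup>+z. ennreal (c powr p) * ennreal (norm (1 / (1 - of_real a * z)\<^sup>2) powr p * (1 - (norm z)\<^sup>2) powr \<alpha>) \<partial>disc)"
      unfolding bergman_energy_def
    proof (rule nn_integral_mono)
      fix z assume "z \<in> space disc"
      then have z: "norm z \<le> 1" by simp
      define q where "q = norm (1 - of_real a * z)"
      have q: "1 - a \<le> q" "0 < q" using one_minus_mult_bounds[OF a z] by (auto simp: q_def)
      have "norm (deriv ?f z) = real k * a * (1 - a) powr (\<sigma> + real k) / q ^ Suc k"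
        unfolding DERIV_imp_deriv[OF test_fun_has_derivative[OF a z]]
        using a by (simp add: norm_divide norm_mult norm_power q_def)
      also have "\<dots> \<le> 2 * 1 * (1 - a) powr (\<sigma> + real k) / q ^ Suc k"
        using a k q by (intro divide_right_mono mult_right_mono mult_mono) auto
      also have "\<dots> = c * (((1 - a) / q) ^ (k - 1) * (1 / q\<^sup>2))"
        using k a q by (auto simp: c_def powr_add power2_eq_square power3_eq_cube numeral_3_eq_3 field_simps powr_realpow numeral_2_eq_2)
      also have "\<dots> \<le> c * (1 * (1 / q\<^sup>2))"
        using q a c by (intro mult_left_mono mult_right_mono power_le_one) auto
      also have "\<dots> = c * norm (1 / (1 - of_real a * z)\<^sup>2)" by (simp add: q_def norm_divide norm_power)
      finally have "norm (deriv ?f z) powr p \<le> (c * norm (1 / (1 - of_real a * z)\<^sup>2)) powr p"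
        using p by (intro powr_mono2) auto
      also have "\<dots> = c powr p * norm (1 / (1 - of_real a * z)\<^sup>2) powr p" using c by (simp add: powr_mult)
      finally have "norm (deriv ?f z) powr p * (1 - (norm z)\<^sup>2) powr \<alpha>
        \<le> (c powr p * norm (1 / (1 - of_real a * z)\<^sup>2) powr p) * (1 - (norm z)\<^sup>2) powr \<alpha>"
        by (rule mult_right_mono) simp
      then show "ennreal (norm (deriv ?f z) powr p * (1 - (norm z)\<^sup>2) powr \<alpha>)
        \<le> ennreal (c powr p) * ennreal (norm (1 / (1 - of_real a * z)\<^sup>2) powr p * (1 - (norm z)\<^sup>2) powr \<alpha>)"
        by (simp only: ennreal_mult[symmetric] mult.assoc ennreal_leI powr_ge_zero mult_nonneg_nonneg)
    qed
    also have "\<dots> = ennreal (c powr p) * bergman_energy p \<alpha> (\<lambda>z. 1 / (1 - of_real a * z)\<^sup>2)"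
      unfolding bergman_energy_def by (rule nn_integral_cmult) measurable
    also have "\<dots> \<le> ennreal (c powr p) * ennreal (C * (1 - a) powr (\<alpha> + 2 - 2 * p))"
      by (intro mult_left_mono C a) auto
    also have "\<dots> = ennreal (2 powr p * C)"
    proof -
      \<comment> \<open>This cancellation is what determines \<open>\<sigma>\<close>.\<close>
      have "(\<sigma> + 1) * p + (\<alpha> + 2 - 2 * p) = 0" using p by (simp add: \<sigma>_def field_simps)
      then have "(1 - a) powr ((\<sigma> + 1) * p) * (1 - a) powr (\<alpha> + 2 - 2 * p) = 1"
        using a by (simp only: powr_add[symmetric]) simp
      then have "c powr p * (C * (1 - a) powr (\<alpha> + 2 - 2 * p)) = 2 powr p * C"
        by (simp add: c_def powr_mult powr_powr)
      then show ?thesis using C by (simp only: ennreal_mult[symmetric] powr_ge_zero mult_nonneg_nonneg)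
    qed
    finally have E: "bergman_energy p \<alpha> (deriv ?f) \<le> ennreal (2 powr p * C)" .
    have V: "?f \<in> dirichlet_space p \<alpha>"
      using test_fun_holomorphic[OF a] E by (auto simp: dirichlet_space_iff intro: le_less_trans)
    have "norm (?f 0) \<le> 1"
      using a \<sigma> k by (auto simp: test_fun_def intro!: powr_le1)
    then have "norm (?f 0) powr p \<le> 1" using p by (intro powr_le1) auto
    from \<kappa>(2)[OF V this E] C have "dirichlet_norm p \<alpha> ?f powr p \<le> M" by (simp add: M_def)
    then have "(dirichlet_norm p \<alpha> ?f powr p) powr (1 / p) \<le> M powr (1 / p)"
      using p by (intro powr_mono2) auto
    then have "dirichlet_norm p \<alpha> ?f \<le> M powr (1 / p)"
      using p by (simp add: powr_powr dirichlet_norm_nonneg)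
    with V show "?f \<in> dirichlet_space p \<alpha> \<and> dirichlet_norm p \<alpha> ?f \<le> M powr (1 / p)" by simp
  qed
qed

text \<open>Integrating the derivative of \<^term>\<open>t * f t * deriv g (t * z)\<close> over the radius recovers \<^term>\<open>g\<close>
  from the operator, because \<^term>\<open>z * test_fun \<sigma> a 1 z\<close> has derivative \<^term>\<open>test_fun \<sigma> a 2 z / (1 - a)\<close>.\<close>
lemma gen_hilbert_test_fun_identity:
  assumes a: "0 \<le> a" "a < 1" and g: "g holomorphic_on unit_disc" and z: "norm z < 1"
    and fin: "\<And>k. k \<in> {1, 2} \<Longrightarrow> (\<integral>\<^sup>+y. norm (test_fun \<sigma> a k (1 - of_real y)) \<partial>unit_ivl) < \<infinity>"
  shows "of_real ((1 - a) powr \<sigma>) * deriv g z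
     = of_real (1 / (1 - a)) * gen_hilbert g (test_fun \<sigma> a 2) z + z * deriv (gen_hilbert g (test_fun \<sigma> a 1)) z"
proof -
  let ?f1 = "test_fun \<sigma> a 1" and ?f2 = "test_fun \<sigma> a 2"
  have g1: "deriv g holomorphic_on unit_disc" by (intro holomorphic_deriv g) auto
  have g2: "deriv (deriv g) holomorphic_on unit_disc" by (intro holomorphic_deriv g1) auto
  have hol: "?f1 holomorphic_on unit_disc" "?f2 holomorphic_on unit_disc" by (auto intro!: test_fun_holomorphic a)
  \<comment> \<open>The sign is that of the substitution \<open>y = 1 - t\<close>. Since
    \<open>Q 1 = 0\<close>, only the endpoint \<open>t = 1\<close> contributes, where
    \<open>?f1\<close> has the value \<open>(1 - a) powr \<sigma>\<close>.\<close>
  define Q where "Q y = - ((1 - of_real y) * ?f1 (1 - of_real y) * deriv g ((1 - of_real y) * z))" for y :: real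
  define A where "A y = of_real (1 / (1 - a)) * (?f2 (1 - of_real y) * deriv g ((1 - of_real y) * z))" for y :: real
  define B where "B y = z * (?f1 (1 - of_real y) * ((1 - of_real y) * deriv (deriv g) ((1 - of_real y) * z)))" for y :: real
  have n1: "norm (1 - of_real y :: complex) \<le> 1" if "y \<in> {0..1}" for y
    using that norm_of_real[of "1 - y", where 'a = complex] by simp
  have n2: "norm ((1 - of_real y) * z) < 1" if "y \<in> {0..1}" for y
    using mult_left_le_one_le[of "norm z" "norm (1 - of_real y :: complex)"] n1[OF that] z by (simp add: norm_mult)
  have ct: "continuous_on (cball 0 1) (test_fun \<sigma> a k)" for k
    by (intro continuous_at_imp_continuous_on ballI DERIV_isCont[OF test_fun_has_derivative[OF a]]) auto
  have cont: "continuous_on {0..1} (\<lambda>y. A y + B y)"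
    unfolding A_def B_def
    by (intro continuous_intros continuous_on_compose2[OF ct] continuous_on_compose2[OF holomorphic_on_imp_continuous_on[OF g1]]
          continuous_on_compose2[OF holomorphic_on_imp_continuous_on[OF g2]])
       (use n1 n2 in auto)
  have "has_bochner_integral lborel (\<lambda>y. indicator {0..1} y *\<^sub>R (A y + B y)) (Q 1 - Q 0)"
  proof (rule has_bochner_integral_FTC_Icc[OF _ _ cont])
    fix y :: real assume y: "0 \<le> y" "y \<le> 1"
    define t where "t = (1 - of_real y :: complex)"
    have t: "norm t \<le> 1" "norm (t * z) < 1" using n1[of y] n2[of y] y by (auto simp: t_def)
    have ne: "1 - of_real a * t \<noteq> 0" by (rule one_minus_mult_bounds(3)[OF a t(1)])
    have dg: "(deriv g has_field_derivative deriv (deriv g) (t * z)) (at (t * z))"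
      using t by (intro holomorphic_derivI[OF g1]) auto
    have dg': "((\<lambda>t. deriv g (t * z)) has_field_derivative deriv (deriv g) (t * z) * z) (at t)"
      by (rule DERIV_chain2[where f = "deriv g" and g = "\<lambda>t. t * z", OF dg]) (auto intro!: derivative_eq_intros)
    define D where "D = (?f1 t + t * (of_nat 1 * of_real a * of_real ((1 - a) powr (\<sigma> + 1)) / (1 - of_real a * t) ^ Suc 1)) * deriv g (t * z)
          + (deriv (deriv g) (t * z) * z) * (t * ?f1 t)"
    have "((\<lambda>t. t * ?f1 t * deriv g (t * z)) has_field_derivative D) (at t)"
      unfolding D_def
      using DERIV_mult[OF DERIV_mult[OF DERIV_ident test_fun_has_derivative[OF a t(1), of \<sigma> 1]] dg']
      by (simp add: algebra_simps)
    moreover have "((\<lambda>y. 1 - complex_of_real y) has_vector_derivative -1) (at y within {0..1})"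
      by (auto intro!: derivative_eq_intros)
    ultimately have "((\<lambda>t. t * ?f1 t * deriv g (t * z)) \<circ> (\<lambda>y. 1 - complex_of_real y) has_vector_derivative - 1 * D) (at y within {0..1})"
      unfolding t_def by (intro field_vector_diff_chain_within) (auto intro: has_field_derivative_at_within)
    then have 1: "(Q has_vector_derivative D) (at y within {0..1})"
      unfolding Q_def[abs_def] o_def by (drule_tac has_vector_derivative_minus) simp
    have "?f1 t + t * (of_nat 1 * of_real a * of_real ((1 - a) powr (\<sigma> + 1)) / (1 - of_real a * t) ^ Suc 1)
        = of_real (1 / (1 - a)) * ?f2 t"
    proof -
      have "?f1 t + t * (of_nat 1 * of_real a * of_real ((1 - a) powr (\<sigma> + 1)) / (1 - of_real a * t) ^ Suc 1)
        = of_real ((1 - a) powr (\<sigma> + 1)) / (1 - of_real a * t)\<^sup>2"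
      proof -
        have "c / d + t * (b * c / (d * d)) = c / (d * d)" if "d \<noteq> 0" "d + b * t = 1" for b c d :: complex
        proof -
          have "c / d + t * (b * c / (d * d)) = c * (d + b * t) / (d * d)"
            using that(1) by (simp add: distrib_left add_divide_distrib mult_ac)
          then show ?thesis by (simp add: that(2))
        qed
        from this[OF ne, of "of_real a" "of_real ((1 - a) powr (\<sigma> + 1))"] show ?thesis
          by (simp add: test_fun_def power2_eq_square)
      qed
      moreover have "(1 - a) powr (\<sigma> + 2) = (1 - a) * (1 - a) powr (\<sigma> + 1)"
        using a powr_add[of "1 - a" "\<sigma> + 1" 1] by (simp add: add.assoc)
      ultimately show ?thesis using a by (simp add: test_fun_def)
    qed
    then have "D = A y + B y" unfolding D_def A_def B_def t_def[symmetric] by (simp add: mult_ac)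
    with 1 show "(Q has_vector_derivative A y + B y) (at y within {0..1})" by simp
  qed auto
  then have hb: "integrable lborel (\<lambda>y. indicator {0..1} y *\<^sub>R (A y + B y))"
      "(LINT y|lborel. indicator {0..1} y *\<^sub>R (A y + B y)) = Q 1 - Q 0"
    by (auto simp: has_bochner_integral_iff)
  have "of_real ((1 - a) powr (\<sigma> + 1)) / (1 - of_real a) = (of_real ((1 - a) powr \<sigma>) :: complex)"
  proof -
    have "(1 - a) powr (\<sigma> + 1) / (1 - a) = (1 - a) powr \<sigma>" using a by (simp add: powr_add)
    then have "complex_of_real ((1 - a) powr (\<sigma> + 1) / (1 - a)) = of_real ((1 - a) powr \<sigma>)" by (rule arg_cong)
    then show ?thesis by (simp only: of_real_divide of_real_diff of_real_1)
  qed
  then have Q: "Q 1 - Q 0 = of_real ((1 - a) powr \<sigma>) * deriv g z"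
    by (simp add: Q_def test_fun_def)
  have intA: "integrable unit_ivl A"
    unfolding A_def using gen_hilbert_integrable[OF hol(2) g fin[of 2] z] by simp
  have TA: "(LINT y|unit_ivl. A y) = of_real (1 / (1 - a)) * gen_hilbert g ?f2 z"
    unfolding A_def by (simp add: gen_hilbert_eq_unit_ivl[OF hol(2) g z])
  have TB: "(LINT y|unit_ivl. B y) = z * deriv (gen_hilbert g ?f1) z"
    unfolding B_def using deriv_gen_hilbert_eq[OF hol(1) g fin[of 1] z] by simp
  have ind: "indicator {0<..<1} y *\<^sub>R (indicator {0..1} y *\<^sub>R (A y + B y)) = indicator {0<..<1} y *\<^sub>R (A y + B y)" for y :: real
    by (auto simp: indicator_def)
  have "integrable lborel (\<lambda>y. indicator {0<..<1} y *\<^sub>R (indicator {0..1} y *\<^sub>R (A y + B y)))"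
    by (rule integrable_mult_indicator[OF _ hb(1)]) simp
  then have intAB: "integrable unit_ivl (\<lambda>y. A y + B y)"
    unfolding ind unit_ivl_def by (subst integrable_restrict_space) auto
  have intB: "integrable unit_ivl B"
    using Bochner_Integration.integrable_diff[OF intAB intA] by simp
  have "(LINT y|unit_ivl. A y + B y) = (LINT y|lborel. indicator {0<..<1} y *\<^sub>R (A y + B y))"
    unfolding unit_ivl_def by (subst integral_restrict_space) auto
  also have "\<dots> = (LINT y|lborel. indicator {0..1} y *\<^sub>R (A y + B y))"
  proof (rule integral_cong_AE)
    show "(\<lambda>y. indicator {0..1} y *\<^sub>R (A y + B y)) \<in> borel_measurable lborel"
      using hb(1) by (rule borel_measurable_integrable)
    show "(\<lambda>y. indicator {0<..<1} y *\<^sub>R (A y + B y)) \<in> borel_measurable lborel"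
      unfolding ind[symmetric] using borel_measurable_integrable[OF hb(1)] by measurable
    show "AE y in lborel. indicator {0<..<1} y *\<^sub>R (A y + B y) = indicator {0..1} y *\<^sub>R (A y + B y)"
      using AE_lborel_singleton[of 0] AE_lborel_singleton[of 1] by eventually_elim (auto simp: indicator_def)
  qed
  finally have "(LINT y|unit_ivl. A y + B y) = of_real ((1 - a) powr \<sigma>) * deriv g z" using hb(2) Q by simp
  then show ?thesis using TA TB intA intB by simp
qed

text \<open>The identity for the test functions is differentiated and evaluated with
  \<open>a = r\<close>, the radius of the circle over which it is averaged. The mean of a derivative
  of a Dirichlet function costs \<open>(1 - r) powr - (\<alpha> + 1)\<close>; the factor
  \<open>1 / (1 - r)\<close> and one further differentiation each cost
  \<open>(1 - r) powr - p\<close>. So all terms obey one bound \<open>X\<close>.\<close>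

lemma circle_mean_second_deriv_le:
  assumes p: "1 < p" and \<alpha>: "p - 2 < \<alpha>" "\<alpha> \<le> p - 1" and g: "g holomorphic_on unit_disc"
    and T: "gen_hilbert g ` dirichlet_space p \<alpha> \<subseteq> dirichlet_space p \<alpha>"
  defines "\<sigma> \<equiv> 1 - (\<alpha> + 2) / p"
  obtains c where "0 \<le> c"
    "\<And>r \<eta>. 0 \<le> r \<Longrightarrow> r < 1 \<Longrightarrow> 0 \<le> \<eta> \<Longrightarrow>
       (\<And>k. k \<in> {1, 2} \<Longrightarrow> dirichlet_norm p \<alpha> (gen_hilbert g (test_fun \<sigma> r k)) \<le> \<eta>) \<Longrightarrow>
       circle_mean p (deriv (deriv g)) r \<le> ennreal ((c * \<eta> * (1 - r) powr - (2 - 1 / p)) powr p)"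
proof -
  let ?V = "dirichlet_space p \<alpha>" and ?N = "dirichlet_norm p \<alpha>"
  let ?E = "\<lambda>f. bergman_energy p \<alpha> (deriv f)"
  have \<alpha>1: "-1 < \<alpha>" using \<alpha> p by simp
  obtain \<kappa> where \<kappa>: "0 < \<kappa>"
    "\<And>f. f \<in> ?V \<Longrightarrow> ennreal (norm (f 0) powr p) + ?E f \<le> ennreal (\<kappa> * ?N f powr p)"
    using dirichlet_norm_bounds[OF p \<alpha>1] by metis
  obtain K0 where K0: "\<And>a k. 0 \<le> a \<Longrightarrow> a < 1 \<Longrightarrow> k \<in> {1, 2} \<Longrightarrow> test_fun \<sigma> a k \<in> ?V \<and> ?N (test_fun \<sigma> a k) \<le> K0"
    using test_fun_bounded[OF p \<alpha>] unfolding \<sigma>_def by metis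
  define c1 where "c1 = (\<alpha> + 1) / pi"
  have c1: "0 \<le> c1" using \<alpha>1 by (simp add: c1_def)
  \<comment> \<open>The power of 2 pays for passing to the midpoint between \<open>r\<close> and 1
    in the bound of the second derivative of \<open>h 1\<close>: both the gap for Cauchy's estimate
    and the distance to the boundary become half of \<open>1 - r\<close>.\<close>
  define K where "K = c1 * \<kappa> * 2 powr (p + (\<alpha> + 1))"
  have two: "1 \<le> (2::real) powr (p + (\<alpha> + 1))" using p \<alpha>1 by (intro ge_one_powr_ge_zero) auto
  have K: "0 \<le> K" "c1 * \<kappa> \<le> K"
    using c1 \<kappa>(1) mult_left_mono[OF two, of "c1 * \<kappa>"] by (auto simp: K_def)
  \<comment> \<open>\<open>4 powr p\<close> comes from splitting a sum of three terms in two steps,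
    3 from their number.\<close>
  define c where "c = (4 powr p * (3 * K)) powr (1 / p)"
  show ?thesis
  proof (rule that)
    show "0 \<le> c" by (simp add: c_def)
    fix r \<eta> :: real
    assume r: "0 \<le> r" "r < 1" and \<eta>: "0 \<le> \<eta>" and N\<eta>: "\<And>k. k \<in> {1, 2} \<Longrightarrow> ?N (gen_hilbert g (test_fun \<sigma> r k)) \<le> \<eta>"
    define d where "d = 1 - r"
    have d: "0 < d" "d \<le> 1" using r by (auto simp: d_def)
    define h where "h k = gen_hilbert g (test_fun \<sigma> r k)" for k
    have hV: "h k \<in> ?V" if "k \<in> {1, 2}" for k
      using K0[OF r that] T by (auto simp: h_def)
    have hh: "h k holomorphic_on unit_disc" if "k \<in> {1, 2}" for k using hV[OF that] by (simp add: dirichlet_space_iff)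
    have dh: "deriv (h k) holomorphic_on unit_disc" if "k \<in> {1, 2}" for k by (intro holomorphic_deriv hh that) auto
    have ddh: "deriv (deriv (h 1)) holomorphic_on unit_disc" by (intro holomorphic_deriv dh) auto
    have g1: "deriv g holomorphic_on unit_disc" by (intro holomorphic_deriv g) auto
    have fin: "(\<integral>\<^sup>+y. norm (test_fun \<sigma> r k (1 - of_real y)) \<partial>unit_ivl) < \<infinity>" if "k \<in> {1, 2}" for k
      using radial_L1_finite[OF p \<alpha>] K0[OF r that] by blast
    have id1: "of_real (d powr \<sigma>) * deriv g z = of_real (1 / d) * h 2 z + z * deriv (h 1) z" if "norm z < 1" for z
      using gen_hilbert_test_fun_identity[OF r g that fin] by (simp add: d_def h_def)
    have id2: "of_real (d powr \<sigma>) * deriv (deriv g) z = of_real (1 / d) * deriv (h 2) z + (deriv (h 1) z + z * deriv (deriv (h 1)) z)"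
      if z: "norm z < 1" for z
    proof -
      have zz: "z \<in> unit_disc" using z by simp
      have L: "((\<lambda>z. of_real (d powr \<sigma>) * deriv g z) has_field_derivative of_real (d powr \<sigma>) * deriv (deriv g) z) (at z)"
        by (intro DERIV_cmult holomorphic_derivI[OF g1 _ zz] open_ball)
      have "((\<lambda>z. of_real (1 / d) * h 2 z + z * deriv (h 1) z) has_field_derivative
          of_real (1 / d) * deriv (h 2) z + (1 * deriv (h 1) z + deriv (deriv (h 1)) z * z)) (at z)"
        by (intro DERIV_add DERIV_cmult DERIV_mult DERIV_ident holomorphic_derivI[OF hh _ zz] holomorphic_derivI[OF dh _ zz] open_ball) auto
      then have R: "((\<lambda>z. of_real (d powr \<sigma>) * deriv g z) has_field_derivative
          of_real (1 / d) * deriv (h 2) z + (1 * deriv (h 1) z + deriv (deriv (h 1)) z * z)) (at z)"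
        by (rule has_field_derivative_transform_within_open[OF _ open_ball zz]) (use id1 in auto)
      from DERIV_unique[OF L R] show ?thesis by (simp add: mult.commute)
    qed
    have m1: "circle_mean p (deriv (h k)) \<rho> \<le> ennreal (c1 * (1 - \<rho>) powr - (\<alpha> + 1) * (\<kappa> * \<eta> powr p))"
      if k: "k \<in> {1, 2}" and \<rho>: "0 \<le> \<rho>" "\<rho> < 1" for k \<rho>
    proof -
      have "circle_mean p (deriv (h k)) \<rho> \<le> ennreal (c1 * (1 - \<rho>) powr - (\<alpha> + 1)) * ?E (h k)"
        unfolding c1_def by (rule circle_mean_le_energy[OF dh[OF k] \<rho> p \<alpha>1])
      also have "?E (h k) \<le> ennreal (norm (h k 0) powr p) + ?E (h k)" by simp
      also note \<kappa>(2)[OF hV[OF k]]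
      also have "ennreal (\<kappa> * ?N (h k) powr p) \<le> ennreal (\<kappa> * \<eta> powr p)"
        using N\<eta>[OF k] \<kappa>(1) p by (intro ennreal_leI mult_left_mono powr_mono2) (auto simp: h_def dirichlet_norm_nonneg)
      also have "ennreal (c1 * (1 - \<rho>) powr - (\<alpha> + 1)) * \<dots> = ennreal (c1 * (1 - \<rho>) powr - (\<alpha> + 1) * (\<kappa> * \<eta> powr p))"
        using c1 \<kappa>(1) by (simp only: ennreal_mult[symmetric] mult_nonneg_nonneg powr_ge_zero less_imp_le)
      finally show ?thesis by (simp add: mult_left_mono)
    qed
    define X where "X = K * (d powr (- p - (\<alpha> + 1)) * \<eta> powr p)"
    have X0: "0 \<le> X" using K by (simp add: X_def)
    have dp: "1 \<le> d powr - p" using d p powr_mono2'[of "-p" d 1] by simp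
    have base: "c1 * d powr - (\<alpha> + 1) * (\<kappa> * \<eta> powr p) * d powr - p \<le> X"
    proof -
      have dd: "d powr (- p - (\<alpha> + 1)) = d powr - p * d powr - (\<alpha> + 1)"
        using powr_add[of d "- p" "- (\<alpha> + 1)"] by (simp only: add_uminus_conv_diff)
      have "c1 * d powr - (\<alpha> + 1) * (\<kappa> * \<eta> powr p) * d powr - p = (c1 * \<kappa>) * (d powr (- p - (\<alpha> + 1)) * \<eta> powr p)"
        unfolding dd by (simp only: mult_ac)
      also have "\<dots> \<le> X" unfolding X_def by (intro mult_right_mono K) auto
      finally show ?thesis .
    qed
    have A1: "ennreal (d powr - p) * circle_mean p (deriv (h 2)) r \<le> ennreal X"
    proof -
      have "ennreal (d powr - p) * circle_mean p (deriv (h 2)) r \<le> ennreal (d powr - p) * ennreal (c1 * d powr - (\<alpha> + 1) * (\<kappa> * \<eta> powr p))"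
        using m1[of 2 r] r by (intro mult_left_mono) (auto simp: d_def)
      also have "\<dots> \<le> ennreal X"
        using base c1 \<kappa>(1) by (simp add: ennreal_mult[symmetric] ennreal_leI mult.commute)
      finally show ?thesis .
    qed
    have A2: "circle_mean p (deriv (h 1)) r \<le> ennreal X"
    proof -
      have "c1 * d powr - (\<alpha> + 1) * (\<kappa> * \<eta> powr p) * 1 \<le> c1 * d powr - (\<alpha> + 1) * (\<kappa> * \<eta> powr p) * d powr - p"
        using c1 \<kappa>(1) by (intro mult_left_mono dp) auto
      then have "c1 * d powr - (\<alpha> + 1) * (\<kappa> * \<eta> powr p) \<le> X" using base by linarith
      then show ?thesis using order_trans[OF m1[of 1 r] ennreal_leI] r by (simp add: d_def)
    qed
    have A3: "circle_mean p (deriv (deriv (h 1))) r \<le> ennreal X"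
    proof -
      define \<rho> where "\<rho> = (1 + r) / 2"
      have \<rho>: "0 \<le> \<rho>" "r < \<rho>" "\<rho> < 1" "\<rho> - r = d / 2" "1 - \<rho> = d / 2" using r by (auto simp: \<rho>_def d_def field_simps)
      have "circle_mean p (deriv (deriv (h 1))) r \<le> ennreal ((1 / (\<rho> - r)) powr p) * circle_mean p (deriv (h 1)) \<rho>"
        by (rule circle_mean_deriv_le[OF dh r(1) \<rho>(2,3) p]) simp
      also have "\<dots> \<le> ennreal ((1 / (d / 2)) powr p) * ennreal (c1 * (d / 2) powr - (\<alpha> + 1) * (\<kappa> * \<eta> powr p))"
        unfolding \<rho>(4) using m1[of 1 \<rho>] \<rho>(1,3) unfolding \<rho>(5) by (intro mult_left_mono) auto
      also have "\<dots> = ennreal ((1 / (d / 2)) powr p * (c1 * (d / 2) powr - (\<alpha> + 1) * (\<kappa> * \<eta> powr p)))"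
        using c1 \<kappa>(1) by (intro ennreal_mult[symmetric]) auto
      also have "(1 / (d / 2)) powr p * (c1 * (d / 2) powr - (\<alpha> + 1) * (\<kappa> * \<eta> powr p)) = X"
      proof -
        have "1 / (d / 2) = (d / 2) powr - 1" using d by (simp add: powr_minus_divide)
        then have "(1 / (d / 2)) powr p = (d / 2) powr - p" by (simp only: powr_powr) simp
        then have "(1 / (d / 2)) powr p * (d / 2) powr - (\<alpha> + 1) = (d / 2) powr (- p - (\<alpha> + 1))"
          using powr_add[of "d / 2" "- p" "- (\<alpha> + 1)"] by (simp only: add_uminus_conv_diff)
        also have "\<dots> = d powr (- p - (\<alpha> + 1)) / 2 powr (- p - (\<alpha> + 1))" using d by (simp add: powr_divide)
        also have "\<dots> = d powr (- p - (\<alpha> + 1)) * 2 powr (- (- p - (\<alpha> + 1)))" by (simp only: powr_minus divide_inverse)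
        also have "- (- p - (\<alpha> + 1)) = p + (\<alpha> + 1)" by simp
        finally have e: "(1 / (d / 2)) powr p * (d / 2) powr - (\<alpha> + 1) = d powr (- p - (\<alpha> + 1)) * 2 powr (p + (\<alpha> + 1))" .
        have "(1 / (d / 2)) powr p * (c1 * (d / 2) powr - (\<alpha> + 1) * (\<kappa> * \<eta> powr p))
          = ((1 / (d / 2)) powr p * (d / 2) powr - (\<alpha> + 1)) * (c1 * (\<kappa> * \<eta> powr p))" by (simp only: mult_ac)
        then show ?thesis unfolding e X_def K_def by (simp only: mult_ac)
      qed
      finally show ?thesis .
    qed
    have nr: "norm (of_real r * w) < 1" if "norm w = 1" for w :: complex using that r by (simp add: norm_mult)
    have ms: "(\<lambda>w. norm (F (of_real r * w))) \<in> borel_measurable circ" if "F holomorphic_on unit_disc" for F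
    proof -
      have "(\<lambda>w. F (of_real r * w)) \<in> borel_measurable circ"
        by (rule holomorphic_measurable_comp[OF that]) (use nr in auto)
      then show ?thesis by measurable
    qed
    note [measurable] = ms[OF dh[of 1]] ms[OF dh[of 2]] ms[OF ddh]
    define Y where "Y = d powr (- \<sigma> * p) * 4 powr p"
    have "circle_mean p (deriv (deriv g)) r \<le>
      (\<integral>\<^sup>+w. ennreal Y * (ennreal (d powr - p) * ennreal (norm (deriv (h 2) (of_real r * w)) powr p)
          + (ennreal (norm (deriv (h 1) (of_real r * w)) powr p) + ennreal (norm (deriv (deriv (h 1)) (of_real r * w)) powr p))) \<partial>circ)"
      unfolding circle_mean_def
    proof (rule nn_integral_mono)
      fix w assume "w \<in> space circ"
      then have w: "norm w = 1" by simp
      define z where "z = of_real r * w"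
      have z: "norm z < 1" using nr[OF w] by (simp add: z_def)
      define x1 x2 x3 where "x1 = norm (deriv (h 2) z)" and "x2 = norm (deriv (h 1) z)" and "x3 = norm (deriv (deriv (h 1)) z)"
      have x: "0 \<le> x1" "0 \<le> x2" "0 \<le> x3" by (auto simp: x1_def x2_def x3_def)
      have "d powr \<sigma> * norm (deriv (deriv g) z) = norm (of_real (d powr \<sigma>) * deriv (deriv g) z)" by (simp add: norm_mult)
      also have "\<dots> = norm (of_real (1 / d) * deriv (h 2) z + (deriv (h 1) z + z * deriv (deriv (h 1)) z))"
        by (simp only: id2[OF z])
      also have "\<dots> \<le> norm (of_real (1 / d) * deriv (h 2) z) + (norm (deriv (h 1) z) + norm (z * deriv (deriv (h 1)) z))"
        by (intro norm_triangle_le add_left_mono norm_triangle_ineq)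
      also have "\<dots> \<le> x1 / d + (x2 + 1 * x3)"
        unfolding norm_mult x1_def x2_def x3_def using d z by (intro add_mono mult_right_mono) (auto simp: norm_divide)
      finally have "d powr - \<sigma> * (d powr \<sigma> * norm (deriv (deriv g) z)) \<le> d powr - \<sigma> * (x1 / d + (x2 + x3))"
        by (intro mult_left_mono) auto
      then have "norm (deriv (deriv g) z) \<le> d powr - \<sigma> * (x1 / d + (x2 + x3))"
        using d by (simp add: mult.assoc[symmetric] powr_add[symmetric])
      then have "norm (deriv (deriv g) z) powr p \<le> (d powr - \<sigma> * (x1 / d + (x2 + x3))) powr p"
        using p by (intro powr_mono2) auto
      also have "\<dots> = d powr (- \<sigma> * p) * (x1 / d + (x2 + x3)) powr p"
        using d x by (simp add: powr_mult powr_powr)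
      also have "\<dots> \<le> d powr (- \<sigma> * p) * (4 powr p * (d powr - p * x1 powr p + (x2 powr p + x3 powr p)))"
      proof (rule mult_left_mono)
        have "(x1 / d + (x2 + x3)) powr p \<le> 2 powr p * ((x1 / d) powr p + (x2 + x3) powr p)"
          using x d p by (intro powr_add_le) auto
        also have "\<dots> \<le> 2 powr p * (2 powr p * (x1 / d) powr p + 2 powr p * (x2 powr p + x3 powr p))"
        proof (intro mult_left_mono add_mono)
          have "1 * (x1 / d) powr p \<le> 2 powr p * (x1 / d) powr p" using p by (intro mult_right_mono ge_one_powr_ge_zero) auto
          then show "(x1 / d) powr p \<le> 2 powr p * (x1 / d) powr p" by simp
          show "(x2 + x3) powr p \<le> 2 powr p * (x2 powr p + x3 powr p)" using x p by (intro powr_add_le) auto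
        qed simp
        also have "\<dots> = (2 powr p * 2 powr p) * ((x1 / d) powr p + (x2 powr p + x3 powr p))" by (simp add: algebra_simps)
        also have "2 powr p * 2 powr p = (4::real) powr p" by (simp add: powr_mult[symmetric])
        also have "(x1 / d) powr p = d powr - p * x1 powr p" using x d by (simp add: powr_divide powr_minus_divide)
        finally show "(x1 / d + (x2 + x3)) powr p \<le> 4 powr p * (d powr - p * x1 powr p + (x2 powr p + x3 powr p))" .
      qed simp
      also have "\<dots> = Y * (d powr - p * x1 powr p + (x2 powr p + x3 powr p))" by (simp add: Y_def mult.assoc)
      finally have "ennreal (norm (deriv (deriv g) z) powr p) \<le> ennreal \<dots>" by (rule ennreal_leI)
      also have "\<dots> = ennreal Y * (ennreal (d powr - p) * ennreal (x1 powr p) + (ennreal (x2 powr p) + ennreal (x3 powr p)))"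
        by (simp add: ennreal_mult Y_def)
      finally show "ennreal (norm (deriv (deriv g) (of_real r * w)) powr p) \<le>
        ennreal Y * (ennreal (d powr - p) * ennreal (norm (deriv (h 2) (of_real r * w)) powr p)
          + (ennreal (norm (deriv (h 1) (of_real r * w)) powr p) + ennreal (norm (deriv (deriv (h 1)) (of_real r * w)) powr p)))"
        by (simp only: z_def x1_def x2_def x3_def)
    qed
    also have "\<dots> = ennreal Y * (ennreal (d powr - p) * circle_mean p (deriv (h 2)) r
        + (circle_mean p (deriv (h 1)) r + circle_mean p (deriv (deriv (h 1))) r))"
      unfolding circle_mean_def
      by (subst nn_integral_cmult, measurable, subst nn_integral_add, measurable, subst nn_integral_add, measurable,
          subst nn_integral_cmult, measurable)
    also have "\<dots> \<le> ennreal Y * (ennreal X + (ennreal X + ennreal X))"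
      by (intro mult_left_mono add_mono A1 A2 A3) auto
    also have "\<dots> = ennreal (Y * (3 * X))"
    proof -
      have "ennreal (3 * X) = ennreal (X + (X + X))" by simp
      also have "\<dots> = ennreal X + (ennreal X + ennreal X)" using X0 by (simp only: ennreal_plus add_nonneg_nonneg)
      finally have "ennreal X + (ennreal X + ennreal X) = ennreal (3 * X)" by simp
      then show ?thesis using X0 by (simp only: ennreal_mult Y_def mult_nonneg_nonneg powr_ge_zero zero_le_numeral)
    qed
    also have "Y * (3 * X) = (c * \<eta> * (1 - r) powr - (2 - 1 / p)) powr p"
    proof -
      \<comment> \<open>Here \<open>\<alpha>\<close> disappears: dividing by
        \<open>d powr \<sigma>\<close> leaves exactly the exponent
        \<open>- (2 - 1 / p)\<close>.\<close>
      have "- \<sigma> * p + (- p - (\<alpha> + 1)) = - (2 - 1 / p) * p" using p by (simp add: \<sigma>_def field_simps)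
      then have "d powr (- \<sigma> * p) * d powr (- p - (\<alpha> + 1)) = d powr (- (2 - 1 / p) * p)"
        by (simp only: powr_add[symmetric])
      also have "\<dots> = (d powr - (2 - 1 / p)) powr p" by (simp only: powr_powr)
      finally have dd: "d powr (- \<sigma> * p) * d powr (- p - (\<alpha> + 1)) = (d powr - (2 - 1 / p)) powr p" .
      have "(c * \<eta> * d powr - (2 - 1 / p)) powr p = c powr p * \<eta> powr p * (d powr - (2 - 1 / p)) powr p"
        using \<eta> by (simp add: powr_mult c_def)
      also have "c powr p = 4 powr p * (3 * K)" using p K by (simp add: c_def powr_powr)
      finally show ?thesis unfolding dd[symmetric] Y_def X_def d_def[symmetric] by (simp only: mult_ac)
    qed
    finally show "circle_mean p (deriv (deriv g)) r \<le> ennreal ((c * \<eta> * (1 - r) powr - (2 - 1 / p)) powr p)" .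
  qed
qed

section \<open>Little-oh growth from compactness\<close>

lemma circle_mean_finite:
  assumes F: "F holomorphic_on unit_disc" and r: "0 \<le> r" "r < 1" and p: "1 < p"
  obtains C where "0 \<le> C" "circle_mean p F r \<le> ennreal (C powr p)"
proof -
  have "compact (cball 0 r :: complex set)" "cball 0 r \<subseteq> unit_disc" using r by auto
  from compact_imp_bounded[OF compact_continuous_image[OF continuous_on_subset[OF holomorphic_on_imp_continuous_on[OF F] this(2)] this(1)]]
  obtain B where B: "\<forall>z\<in>cball 0 r. norm (F z) \<le> B" by (auto simp: bounded_iff)
  have "norm (F 0) \<le> B" using B r by auto
  then have B0: "0 \<le> B" using norm_ge_zero order_trans by blast
  have "circle_mean p F r \<le> (\<integral>\<^sup>+w. ennreal (B powr p) \<partial>circ)"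
    unfolding circle_mean_def
  proof (intro nn_integral_mono ennreal_leI powr_mono2)
    fix w assume "w \<in> space circ"
    then show "norm (F (of_real r * w)) \<le> B" using r B by (auto simp: norm_mult)
  qed (use p in auto)
  also have "\<dots> = ennreal (B powr p)" by (simp add: emeasure_circ)
  finally show ?thesis using that B0 by blast
qed

lemma little_growth_of_compact_operator:
  assumes p: "1 < p" and \<alpha>: "p - 2 < \<alpha>" "\<alpha> \<le> p - 1" and g: "g holomorphic_on unit_disc"
    and comp: "compact_operator_on (dirichlet_space p \<alpha>) (dirichlet_norm p \<alpha>) (gen_hilbert g)"
  shows "little_growth p (deriv (deriv g)) (2 - 1 / p)"
proof -
  let ?V = "dirichlet_space p \<alpha>" and ?N = "dirichlet_norm p \<alpha>"
  define \<sigma> where "\<sigma> = 1 - (\<alpha> + 2) / p"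
  have \<sigma>: "0 < \<sigma> + 1" using \<alpha> p by (simp add: \<sigma>_def field_simps)
  have g1: "deriv g holomorphic_on unit_disc" by (intro holomorphic_deriv g) auto
  have g2: "deriv (deriv g) holomorphic_on unit_disc" by (intro holomorphic_deriv g1) auto
  have T: "gen_hilbert g ` ?V \<subseteq> ?V" using comp by (simp add: compact_operator_on_def)
  obtain c where c: "0 \<le> c"
    "\<And>r \<eta>. 0 \<le> r \<Longrightarrow> r < 1 \<Longrightarrow> 0 \<le> \<eta> \<Longrightarrow>
       (\<And>k. k \<in> {1, 2} \<Longrightarrow> ?N (gen_hilbert g (test_fun \<sigma> r k)) \<le> \<eta>) \<Longrightarrow>
       circle_mean p (deriv (deriv g)) r \<le> ennreal ((c * \<eta> * (1 - r) powr - (2 - 1 / p)) powr p)"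
    using circle_mean_second_deriv_le[OF p \<alpha> g T] unfolding \<sigma>_def by metis
  obtain K0 where K0: "\<And>a k. 0 \<le> a \<Longrightarrow> a < 1 \<Longrightarrow> k \<in> {1, 2} \<Longrightarrow> test_fun \<sigma> a k \<in> ?V \<and> ?N (test_fun \<sigma> a k) \<le> K0"
    using test_fun_bounded[OF p \<alpha>] unfolding \<sigma>_def by metis
  \<comment> \<open>Compactness is sequential, so the limit at 1 is taken along arbitrary sequences.
    At \<open>1 - of_real x\<close> the numerators tend to 0 because
    \<open>0 < \<sigma> + 1\<close>, while the denominators tend to a power of
    \<open>x\<close>.\<close>
  have lim: "((\<lambda>a. ?N (gen_hilbert g (test_fun \<sigma> a k))) \<longlongrightarrow> 0) (at_left 1)" if k: "k \<in> {1, 2}" for k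
  proof (rule tendsto_at_left_sequentially[of 0])
    fix S :: "nat \<Rightarrow> real" assume S: "\<And>n. S n < 1" "\<And>n. 0 < S n" "S \<longlonglongrightarrow> 1"
    show "(\<lambda>n. ?N (gen_hilbert g (test_fun \<sigma> (S n) k))) \<longlonglongrightarrow> 0"
    proof (rule compact_gen_hilbert_tendsto_0[OF p \<alpha> g comp])
      show "test_fun \<sigma> (S n) k \<in> ?V" "?N (test_fun \<sigma> (S n) k) \<le> K0" for n
        using K0[OF less_imp_le[OF S(2)] S(1) k] by auto
      fix x :: real assume x: "0 < x" "x < 1"
      have "(\<lambda>n. (1 - S n) powr (\<sigma> + real k)) \<longlonglongrightarrow> 0"
      proof (rule tendsto_zero_powrI[OF _ tendsto_const])
        show "(\<lambda>n. 1 - S n) \<longlonglongrightarrow> 0" using tendsto_diff[OF tendsto_const[of 1] S(3)] by simp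
      qed (use S \<sigma> k in \<open>auto simp: less_imp_le\<close>)
      then have "(\<lambda>n. complex_of_real ((1 - S n) powr (\<sigma> + real k))) \<longlonglongrightarrow> 0"
        using tendsto_of_real[of _ 0] by fastforce
      moreover have "(\<lambda>n. (1 - complex_of_real (S n) * (1 - of_real x)) ^ k) \<longlonglongrightarrow> (1 - of_real 1 * (1 - of_real x)) ^ k"
        by (intro tendsto_intros S)
      ultimately have "(\<lambda>n. complex_of_real ((1 - S n) powr (\<sigma> + real k)) / (1 - complex_of_real (S n) * (1 - of_real x)) ^ k)
          \<longlonglongrightarrow> 0 / (1 - of_real 1 * (1 - of_real x)) ^ k"
        by (intro tendsto_divide) (use x in auto)
      then show "(\<lambda>n. test_fun \<sigma> (S n) k (1 - of_real x)) \<longlonglongrightarrow> 0" by (simp add: test_fun_def)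
    qed
  qed simp
  show ?thesis
    unfolding little_growth_def
  proof (intro allI impI)
    fix \<epsilon> :: real assume \<epsilon>: "0 < \<epsilon>"
    \<comment> \<open>\<open>c\<close> may be 0; dividing by \<open>c + 1\<close> still gives
      \<open>c * \<eta> \<le> \<epsilon>\<close>.\<close>
    define \<eta> where "\<eta> = \<epsilon> / (c + 1)"
    have \<eta>: "0 < \<eta>" using \<epsilon> c(1) by (simp add: \<eta>_def)
    have "c * \<eta> \<le> (c + 1) * \<eta>" using \<eta> by (intro mult_right_mono) auto
    also have "\<dots> = \<epsilon>" using c(1) by (simp add: \<eta>_def)
    finally have c\<eta>: "c * \<eta> \<le> \<epsilon>" .
    have ev: "\<forall>\<^sub>F a in at_left 1. ?N (gen_hilbert g (test_fun \<sigma> a 1)) < \<eta> \<and> ?N (gen_hilbert g (test_fun \<sigma> a 2)) < \<eta>"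
      using \<eta> by (intro eventually_conj order_tendstoD(2)[OF lim]) auto
    obtain b where b: "b < 1" "\<And>a. b < a \<Longrightarrow> a < 1 \<Longrightarrow> ?N (gen_hilbert g (test_fun \<sigma> a 1)) < \<eta> \<and> ?N (gen_hilbert g (test_fun \<sigma> a 2)) < \<eta>"
      using ev unfolding eventually_at_left_field by blast
    \<comment> \<open>Beyond \<open>r0\<close> the images are small in norm; up to \<open>r0\<close>
      the increasing means are bounded by the one at \<open>r0\<close>, which provides the constant
      \<open>C\<close>.\<close>
    define r0 where "r0 = max b 0"
    have r0: "0 \<le> r0" "r0 < 1" "b \<le> r0" using b(1) by (auto simp: r0_def)
    obtain C where C: "0 \<le> C" "circle_mean p (deriv (deriv g)) r0 \<le> ennreal (C powr p)"
      by (rule circle_mean_finite[OF g2 r0(1,2) p])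
    show "\<exists>C\<ge>0. \<forall>r. 0 \<le> r \<longrightarrow> r < 1 \<longrightarrow>
      circle_mean p (deriv (deriv g)) r \<le> ennreal ((\<epsilon> * (1 - r) powr - (2 - 1 / p) + C) powr p)"
    proof (intro exI[of _ C] conjI allI impI C(1))
      fix r :: real assume r: "0 \<le> r" "r < 1"
      show "circle_mean p (deriv (deriv g)) r \<le> ennreal ((\<epsilon> * (1 - r) powr - (2 - 1 / p) + C) powr p)"
      proof (cases "r \<le> r0")
        case True
        have "circle_mean p (deriv (deriv g)) r \<le> ennreal (C powr p)"
          using circle_mean_mono[OF g2 r(1) True r0(2) p] C(2) by (rule order_trans)
        also have "\<dots> \<le> ennreal ((\<epsilon> * (1 - r) powr - (2 - 1 / p) + C) powr p)"
          using p C(1) \<epsilon> by (intro ennreal_leI powr_mono2) auto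
        finally show ?thesis .
      next
        case False
        then have br: "b < r" using r0 by simp
        have "circle_mean p (deriv (deriv g)) r \<le> ennreal ((c * \<eta> * (1 - r) powr - (2 - 1 / p)) powr p)"
          using b(2)[OF br r(2)] by (intro c(2) r) (use \<eta> in auto)
        also have "\<dots> \<le> ennreal ((\<epsilon> * (1 - r) powr - (2 - 1 / p) + C) powr p)"
          using c(1) c\<eta> \<eta> C(1) p by (intro ennreal_leI powr_mono2 add_increasing2 mult_right_mono) auto
        finally show ?thesis .
      qed
    qed
  qed
qed

section \<open>Boundary functions\<close>

text \<open>The limit along a fixed sequence of radii is measurable even where the radial limit fails to exist.\<close>
definition radial_lim :: "(complex \<Rightarrow> complex) \<Rightarrow> complex \<Rightarrow> complex" where
  "radial_lim g w = lim (\<lambda>n. g (of_real (1 - 1 / real (n + 2)) * w))"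

text \<open>The p-th power of the L^p distance between the boundary function and its rotation. The
  rotation is given by a point and not by an angle, because the quotient of two points of the circle
  is the natural variable of Cauchy's kernel.\<close>

definition boundary_diff :: "real \<Rightarrow> (complex \<Rightarrow> complex) \<Rightarrow> complex \<Rightarrow> ennreal" where
  "boundary_diff p g \<xi> = (\<integral>\<^sup>+w. ennreal (norm (radial_lim g (\<xi> * w) - radial_lim g w) powr p) \<partial>circ)"

text \<open>The shift by 2 keeps every radius strictly between 0 and 1.\<close>

lemma radii: "0 < 1 - 1 / real (n + 2)" "1 - 1 / real (n + 2) < 1"
  "filterlim (\<lambda>n. 1 - 1 / real (n + 2)) (at_left 1) sequentially"
proof -
  show *: "0 < 1 - 1 / real (n + 2)" "1 - 1 / real (n + 2) < 1" for n by auto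
  have "(\<lambda>n. 1 - 1 / real (n + 2)) \<longlonglongrightarrow> 1 - 0"
    by (intro tendsto_diff tendsto_const LIMSEQ_ignore_initial_segment[OF lim_inverse_n'])
  then show "filterlim (\<lambda>n. 1 - 1 / real (n + 2)) (at_left 1) sequentially"
    unfolding filterlim_at using * by (auto intro!: always_eventually)
qed

lemma dilation_measurable_circ:
  assumes "g holomorphic_on unit_disc" "0 \<le> r" "r < 1"
  shows "(\<lambda>w. g (of_real r * w)) \<in> borel_measurable circ"
  by (rule borel_measurable_circ_continuous[OF dilation_regular(3)[OF assms]])

lemma radial_lim_measurable:
  assumes g: "g holomorphic_on unit_disc"
  shows "radial_lim g \<in> borel_measurable circ"
  unfolding radial_lim_def[abs_def]
  by (intro borel_measurable_lim_metric dilation_measurable_circ[OF g] less_imp_le[OF radii(1)] radii(2))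

lemma radial_lim_eq:
  assumes "((\<lambda>r::real. g (of_real r * w)) \<longlongrightarrow> l) (at_left 1)"
  shows "radial_lim g w = l" "boundary_fun g w = l"
    "(\<lambda>n. g (of_real (1 - 1 / real (n + 2)) * w)) \<longlonglongrightarrow> l"
proof -
  show 1: "(\<lambda>n. g (of_real (1 - 1 / real (n + 2)) * w)) \<longlonglongrightarrow> l"
    by (rule filterlim_compose[OF assms radii(3)])
  then show "radial_lim g w = l" by (simp add: radial_lim_def limI)
  show "boundary_fun g w = l" unfolding boundary_fun_def by (rule tendsto_Lim[OF _ assms]) simp
qed

lemma integral_mean_powr:
  assumes g: "g holomorphic_on unit_disc" and r: "0 \<le> r" "r < 1" and p: "1 < p"
  shows "ennreal (integral_mean p r g powr p) = circle_mean p g r"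
proof -
  note [measurable] = dilation_measurable_circ[OF g r]
  obtain C where C: "0 \<le> C" "circle_mean p g r \<le> ennreal (C powr p)" by (rule circle_mean_finite[OF g r p])
  define h where "h t = norm (g (of_real r * cis t)) powr p" for t
  have [measurable]: "h \<in> borel_measurable borel"
    unfolding h_def using measurable_compose[OF measurable_cis' dilation_measurable_circ[OF g r]] by measurable
  have "(LINT t:{0..2 * pi}|lborel. h t) = enn2real (\<integral>\<^sup>+t. ennreal (indicator {0..2 * pi} t * h t) \<partial>lborel)"
    unfolding set_lebesgue_integral_def real_scaleR_def
    by (intro integral_eq_nn_integral) (auto simp: h_def)
  also have "(\<integral>\<^sup>+t. ennreal (indicator {0..2 * pi} t * h t) \<partial>lborel) = (\<integral>\<^sup>+t. indicator {0..<2 * pi} t * ennreal (h t) \<partial>lborel)"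
    by (rule nn_integral_cong_AE) (use AE_lborel_singleton[of "2 * pi"] in \<open>eventually_elim, auto simp: indicator_def\<close>)
  finally have 1: "(LINT t:{0..2 * pi}|lborel. h t) = enn2real (\<integral>\<^sup>+t. indicator {0..<2 * pi} t * ennreal (h t) \<partial>lborel)" .
  have 2: "circle_mean p g r = ennreal (1 / (2 * pi)) * (\<integral>\<^sup>+t. indicator {0..<2 * pi} t * ennreal (h t) \<partial>lborel)"
    unfolding circle_mean_def by (subst nn_integral_circ, measurable) (simp add: nn_integral_cmult h_def[symmetric])
  have "integral_mean p r g powr p = 1 / (2 * pi) * (LINT t:{0..2 * pi}|lborel. h t)"
    using p unfolding integral_mean_def h_def[symmetric] 1 by (simp add: powr_powr)
  also have "\<dots> = enn2real (circle_mean p g r)"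
    unfolding 1 2 by (simp add: enn2real_mult)
  finally show ?thesis using C(2) by (simp add: le_less_trans)
qed

lemma hardy_space_iff:
  assumes p: "1 < p"
  shows "g \<in> hardy_space p \<longleftrightarrow> g holomorphic_on unit_disc \<and>
    (\<exists>K\<ge>0. \<forall>r. 0 < r \<longrightarrow> r < 1 \<longrightarrow> circle_mean p g r \<le> ennreal (K powr p))"
proof (intro iffI conjI)
  assume "g \<in> hardy_space p"
  then have g: "g holomorphic_on unit_disc" and "bdd_above ((\<lambda>r. integral_mean p r g) ` {0<..<1})"
    by (auto simp: hardy_space_def)
  then obtain K where K: "\<forall>r\<in>{0<..<1}. integral_mean p r g \<le> K" by (auto simp: bdd_above_def)
  show "g holomorphic_on unit_disc" by fact
  show "\<exists>K\<ge>0. \<forall>r. 0 < r \<longrightarrow> r < 1 \<longrightarrow> circle_mean p g r \<le> ennreal (K powr p)"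
  proof (intro exI[of _ "max K 0"] conjI allI impI)
    fix r :: real assume r: "0 < r" "r < 1"
    have "integral_mean p r g \<le> K" using K r by simp
    then have "integral_mean p r g \<le> max K 0" by simp
    then show "circle_mean p g r \<le> ennreal (max K 0 powr p)"
      unfolding integral_mean_powr[OF g less_imp_le[OF r(1)] r(2) p, symmetric] using p
      by (intro ennreal_leI powr_mono2) (auto simp: integral_mean_def)
  qed simp
next
  assume "g holomorphic_on unit_disc \<and> (\<exists>K\<ge>0. \<forall>r. 0 < r \<longrightarrow> r < 1 \<longrightarrow> circle_mean p g r \<le> ennreal (K powr p))"
  then obtain K where g: "g holomorphic_on unit_disc" and K: "0 \<le> K" "\<And>r. 0 < r \<Longrightarrow> r < 1 \<Longrightarrow> circle_mean p g r \<le> ennreal (K powr p)"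
    by blast
  have "integral_mean p r g \<le> K" if r: "0 < r" "r < 1" for r
  proof -
    have "integral_mean p r g powr p \<le> K powr p"
      using K(2)[OF r] unfolding integral_mean_powr[OF g less_imp_le[OF r(1)] r(2) p, symmetric] by simp
    then have "(integral_mean p r g powr p) powr (1 / p) \<le> (K powr p) powr (1 / p)" using p by (rule_tac powr_mono2) auto
    moreover have "0 \<le> integral_mean p r g" by (simp add: integral_mean_def)
    ultimately show ?thesis using p K(1) by (simp add: powr_powr)
  qed
  then show "g \<in> hardy_space p" using g by (auto simp: hardy_space_def intro!: bdd_aboveI)
qed

lemma AE_lborel_shift:
  fixes h :: real and P :: "real \<Rightarrow> bool"
  assumes "AE t in lborel. P t"
  shows "AE t in lborel. P (t + h)"
proof -
  have "distr lborel borel ((+) h) = (lborel :: real measure)" by (rule lborel_distr_plus)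
  with assms have "AE t in distr lborel borel ((+) h). P t" by metis
  then obtain N where N: "{t. \<not> P t} \<subseteq> N" "N \<in> null_sets (distr lborel borel ((+) h))"
    by (auto elim!: AE_E simp: null_sets_def)
  have "(+) h -` N \<inter> space lborel \<in> null_sets lborel"
  proof -
    have "(+) h -` N \<in> sets borel"
      using N(2) by (intro measurable_sets_borel[of "(+) h" borel]) (auto simp: null_sets_def)
    then show ?thesis using N(2) by (auto simp: null_sets_def emeasure_distr)
  qed
  then show ?thesis by (rule AE_I') (use N(1) in \<open>auto simp: add.commute\<close>)
qed

text \<open>\<open>boundary_fun\<close> is a limit that may fail to exist, so its measurability is
  not evident. It agrees almost everywhere with the measurable \<open>radial_lim\<close>, and the
  completeness of \<open>lebesgue\<close> transfers measurability to the integrand.\<close>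

lemma mean_modulus_integral:
  assumes g: "g holomorphic_on unit_disc"
    and ex: "AE \<theta> in lebesgue. \<exists>l. ((\<lambda>r::real. g (of_real r * cis \<theta>)) \<longlongrightarrow> l) (at_left 1)"
  shows "(LINT \<theta>:{0..2 * pi}|lebesgue. norm (boundary_fun g (cis (\<theta> + h)) - boundary_fun g (cis \<theta>)) powr p / (2 * pi))
    = enn2real (boundary_diff p g (cis h))"
proof -
  note [measurable] = radial_lim_measurable[OF g]
  have eq: "AE \<theta> in lborel. boundary_fun g (cis \<theta>) = radial_lim g (cis \<theta>)"
    using ex unfolding AE_completion_iff by eventually_elim (auto simp: radial_lim_eq)
  define H where "H \<theta> = norm (radial_lim g (cis h * cis \<theta>) - radial_lim g (cis \<theta>)) powr p / (2 * pi)" for \<theta>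
  have [measurable]: "(\<lambda>w. radial_lim g (cis h * w)) \<in> borel_measurable circ"
    by (rule measurable_compose[OF measurable_circ_mult]) auto
  have [measurable]: "(\<lambda>\<theta>. radial_lim g (cis h * cis \<theta>)) \<in> borel_measurable borel"
    by (rule measurable_compose[OF measurable_cis' \<open>(\<lambda>w. radial_lim g (cis h * w)) \<in> borel_measurable circ\<close>])
  have [measurable]: "(\<lambda>\<theta>. radial_lim g (cis \<theta>)) \<in> borel_measurable borel"
    by (rule measurable_compose[OF measurable_cis' radial_lim_measurable[OF g]])
  have [measurable]: "H \<in> borel_measurable borel" unfolding H_def by measurable
  let ?G = "\<lambda>\<theta>. indicator {0..2 * pi} \<theta> * (norm (boundary_fun g (cis (\<theta> + h)) - boundary_fun g (cis \<theta>)) powr p / (2 * pi))"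
  let ?I = "\<lambda>\<theta>. indicator {0..2 * pi} \<theta> * H \<theta>"
  have AE: "AE \<theta> in lborel. ?I \<theta> = ?G \<theta>"
    using eq AE_lborel_shift[OF eq, of h]
    by eventually_elim (simp add: H_def cis_mult add.commute)
  have Im: "?I \<in> borel_measurable lebesgue" by (intro measurable_completion) measurable
  have Gm: "?G \<in> borel_measurable lebesgue"
    by (rule borel_measurable_AE[OF Im]) (use AE in \<open>simp add: AE_completion_iff\<close>)
  have "(LINT \<theta>:{0..2 * pi}|lebesgue. norm (boundary_fun g (cis (\<theta> + h)) - boundary_fun g (cis \<theta>)) powr p / (2 * pi))
      = enn2real (\<integral>\<^sup>+\<theta>. ennreal (?G \<theta>) \<partial>lebesgue)"
    unfolding set_lebesgue_integral_def real_scaleR_def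
    by (intro integral_eq_nn_integral Gm) auto
  also have "(\<integral>\<^sup>+\<theta>. ennreal (?G \<theta>) \<partial>lebesgue) = (\<integral>\<^sup>+\<theta>. ennreal (?G \<theta>) \<partial>lborel)"
    by (rule nn_integral_completion)
  also have "\<dots> = (\<integral>\<^sup>+\<theta>. ennreal (1 / (2 * pi)) * (indicator {0..<2 * pi} \<theta> * ennreal (norm (radial_lim g (cis h * cis \<theta>) - radial_lim g (cis \<theta>)) powr p)) \<partial>lborel)"
  proof (rule nn_integral_cong_AE)
    show "AE \<theta> in lborel. ennreal (?G \<theta>) = ennreal (1 / (2 * pi)) * (indicator {0..<2 * pi} \<theta> * ennreal (norm (radial_lim g (cis h * cis \<theta>) - radial_lim g (cis \<theta>)) powr p))"
      using AE AE_lborel_singleton[of "2 * pi"]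
    proof eventually_elim
      case (elim \<theta>)
      then show ?case unfolding elim(1)[symmetric] H_def by (auto simp: indicator_def ennreal_mult[symmetric])
    qed
  qed
  also have "\<dots> = boundary_diff p g (cis h)"
    unfolding boundary_diff_def by (rule nn_integral_circ[symmetric]) measurable
  finally show ?thesis .
qed

lemma mean_modulus_eq:
  assumes "g holomorphic_on unit_disc"
    and "AE \<theta> in lebesgue. \<exists>l. ((\<lambda>r::real. g (of_real r * cis \<theta>)) \<longlongrightarrow> l) (at_left 1)"
  shows "mean_modulus p g t = (SUP h\<in>{0<..t}. enn2real (boundary_diff p g (cis h)) powr (1 / p))"
  unfolding mean_modulus_def by (simp only: mean_modulus_integral[OF assms])

text \<open>The chord is at least \<open>\<bar>sin h\<bar>\<close>, and
  \<open>x \<le> 2 * sin x\<close> on [0, 1] because the cosine is at least \<open>1 / 2\<close> up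
  to \<open>pi / 3 > 1\<close>.\<close>

lemma abs_le_cis_diff:
  assumes "\<bar>h\<bar> \<le> 1"
  shows "\<bar>h\<bar> \<le> 2 * norm (cis h - 1)"
proof -
  have pos: "x \<le> 2 * sin x" if x: "0 \<le> x" "x \<le> 1" for x :: real
  proof -
    have "(\<lambda>x. 2 * sin x - x) 0 \<le> (\<lambda>x. 2 * sin x - x) x"
    proof (rule DERIV_nonneg_imp_nondecreasing[OF x(1)])
      fix y assume y: "0 \<le> y" "y \<le> x"
      have "cos (pi / 3) \<le> cos y"
        using y x pi_gt3 by (intro cos_monotone_0_pi_le) auto
      then have "0 \<le> 2 * cos y - 1" by (simp add: cos_60)
      moreover have "((\<lambda>x. 2 * sin x - x) has_real_derivative (2 * cos y - 1)) (at y)"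
        by (auto intro!: derivative_eq_intros)
      ultimately show "\<exists>d. ((\<lambda>x. 2 * sin x - x) has_real_derivative d) (at y) \<and> 0 \<le> d" by blast
    qed
    then show ?thesis by simp
  qed
  have "\<bar>h\<bar> \<le> 2 * \<bar>sin h\<bar>"
    using pos[of "\<bar>h\<bar>"] assms by (cases "0 \<le> h") (auto simp: abs_if split: if_splits)
  also have "\<bar>sin h\<bar> \<le> norm (cis h - 1)" using abs_Im_le_cmod[of "cis h - 1"] by simp
  finally show ?thesis by simp
qed

lemma cis_diff_ge:
  assumes "0 < \<delta>" "\<delta> \<le> pi" "\<delta> \<le> \<bar>h\<bar>" "\<bar>h\<bar> \<le> pi"
  shows "sqrt (2 - 2 * cos \<delta>) \<le> norm (cis h - 1)" "0 < sqrt (2 - 2 * cos \<delta>)"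
proof -
  have "cos \<bar>h\<bar> \<le> cos \<delta>" using assms by (intro cos_monotone_0_pi_le) auto
  then have c: "cos h \<le> cos \<delta>" by simp
  have "(norm (cis h - 1))\<^sup>2 = (cos h - 1)\<^sup>2 + (sin h)\<^sup>2" by (simp add: cmod_power2)
  also have "\<dots> = ((sin h)\<^sup>2 + (cos h)\<^sup>2) + 1 - 2 * cos h" by (simp add: power2_eq_square algebra_simps)
  also have "\<dots> = 2 - 2 * cos h" by simp
  finally show "sqrt (2 - 2 * cos \<delta>) \<le> norm (cis h - 1)" using c by (intro real_le_lsqrt) auto
  have "cos \<delta> < cos 0" using assms by (intro cos_monotone_0_pi) auto
  then show "0 < sqrt (2 - 2 * cos \<delta>)" by simp
qed

text \<open>Replacing \<open>w\<close> by \<open>\<xi> * w\<close> exchanges the two terms of the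
  difference. The modulus of continuity involves positive angles only; this yields the negative
  ones.\<close>

lemma boundary_diff_inverse:
  assumes g: "g holomorphic_on unit_disc" and \<xi>: "norm \<xi> = 1"
  shows "boundary_diff p g (cnj \<xi>) = boundary_diff p g \<xi>"
proof -
  note [measurable] = radial_lim_measurable[OF g]
  have c: "norm (cnj \<xi>) = 1" using \<xi> by simp
  have [measurable]: "(\<lambda>w. radial_lim g (cnj \<xi> * w)) \<in> borel_measurable circ"
    by (rule measurable_compose[OF measurable_circ_mult[OF c]]) auto
  have one: "cnj \<xi> * (\<xi> * w) = w" for w
    using \<xi> by (simp add: mult.assoc[symmetric] mult.commute[of "cnj \<xi>"] complex_norm_square[symmetric])
  have "boundary_diff p g (cnj \<xi>) = (\<integral>\<^sup>+w. ennreal (norm (radial_lim g (cnj \<xi> * (\<xi> * w)) - radial_lim g (\<xi> * w)) powr p) \<partial>circ)"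
    unfolding boundary_diff_def
    by (rule nn_integral_circ_rotate[OF _ \<xi>, symmetric]) measurable
  also have "\<dots> = boundary_diff p g \<xi>"
    unfolding boundary_diff_def one by (simp add: norm_minus_commute)
  finally show ?thesis .
qed

text \<open>Fatou's lemma along the chosen radii transfers the Hardy bound to the boundary function.
  Pointwise convergence and the L^p bound then give convergence in L^1, enough to pass to the limit
  in Cauchy's formula at a fixed point.\<close>

lemma boundary_estimates:
  assumes p: "1 < p" and g: "g holomorphic_on unit_disc"
    and K: "0 \<le> K" "\<And>r. 0 < r \<Longrightarrow> r < 1 \<Longrightarrow> circle_mean p g r \<le> ennreal (K powr p)"
    and lim: "AE w in circ. (\<lambda>n. g (of_real (1 - 1 / real (n + 2)) * w)) \<longlonglongrightarrow> radial_lim g w"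
  shows "(\<integral>\<^sup>+w. ennreal (norm (radial_lim g w) powr p) \<partial>circ) \<le> ennreal (K powr p)"
    and "norm \<xi> = 1 \<Longrightarrow> boundary_diff p g \<xi> \<le> ennreal (2 powr p * (2 * K powr p))"
    and "(\<lambda>n. \<integral>\<^sup>+w. ennreal (norm (g (of_real (1 - 1 / real (n + 2)) * w) - radial_lim g w)) \<partial>circ) \<longlonglongrightarrow> 0"
proof -
  let ?r = "\<lambda>n. 1 - 1 / real (n + 2)"
  note [measurable] = radial_lim_measurable[OF g] dilation_measurable_circ[OF g less_imp_le[OF radii(1)] radii(2)]
  have Kn: "(\<integral>\<^sup>+w. ennreal (norm (g (of_real (?r n) * w)) powr p) \<partial>circ) \<le> ennreal (K powr p)" for n
    using K(2)[OF radii(1,2), of n] by (simp only: circle_mean_def)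
  have "(\<integral>\<^sup>+w. ennreal (norm (radial_lim g w) powr p) \<partial>circ)
      \<le> (\<integral>\<^sup>+w. liminf (\<lambda>n. ennreal (norm (g (of_real (?r n) * w)) powr p)) \<partial>circ)"
  proof (rule nn_integral_mono_AE)
    show "AE w in circ. ennreal (norm (radial_lim g w) powr p) \<le> liminf (\<lambda>n. ennreal (norm (g (of_real (?r n) * w)) powr p))"
      using lim
    proof eventually_elim
      case (elim w)
      then have "(\<lambda>n. ennreal (norm (g (of_real (?r n) * w)) powr p)) \<longlonglongrightarrow> ennreal (norm (radial_lim g w) powr p)"
        using p by (intro tendsto_ennrealI tendsto_powr2 tendsto_norm tendsto_const) auto
      from lim_imp_Liminf[OF sequentially_bot this] show ?case by (rule eq_refl[OF sym])
    qed
  qed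
  also have "\<dots> \<le> liminf (\<lambda>n. \<integral>\<^sup>+w. ennreal (norm (g (of_real (?r n) * w)) powr p) \<partial>circ)"
    by (rule nn_integral_liminf) measurable
  also have "\<dots> \<le> ennreal (K powr p)"
    by (rule Liminf_le[OF sequentially_bot]) (intro always_eventually allI Kn)
  finally show bK: "(\<integral>\<^sup>+w. ennreal (norm (radial_lim g w) powr p) \<partial>circ) \<le> ennreal (K powr p)" .
  have diff: "(\<integral>\<^sup>+w. ennreal (norm (a w - b w) powr p) \<partial>circ) \<le> ennreal (2 powr p * (2 * K powr p))"
    if [measurable]: "a \<in> borel_measurable circ" "b \<in> borel_measurable circ"
      and ab: "(\<integral>\<^sup>+w. ennreal (norm (a w) powr p) \<partial>circ) \<le> ennreal (K powr p)" "(\<integral>\<^sup>+w. ennreal (norm (b w) powr p) \<partial>circ) \<le> ennreal (K powr p)"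
    for a b :: "complex \<Rightarrow> complex"
  proof -
    have "(\<integral>\<^sup>+w. ennreal (norm (a w - b w) powr p) \<partial>circ)
      \<le> (\<integral>\<^sup>+w. ennreal (2 powr p) * (ennreal (norm (a w) powr p) + ennreal (norm (b w) powr p)) \<partial>circ)"
    proof (rule nn_integral_mono)
      fix w
      have "norm (a w - b w) powr p \<le> (norm (a w) + norm (b w)) powr p"
        using p by (intro powr_mono2 norm_triangle_ineq4) auto
      also have "\<dots> \<le> 2 powr p * (norm (a w) powr p + norm (b w) powr p)"
        using p by (intro powr_add_le) auto
      finally have "ennreal (norm (a w - b w) powr p) \<le> ennreal \<dots>" by (rule ennreal_leI)
      then show "ennreal (norm (a w - b w) powr p) \<le> ennreal (2 powr p) * (ennreal (norm (a w) powr p) + ennreal (norm (b w) powr p))"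
        by (simp add: ennreal_mult)
    qed
    also have "\<dots> = ennreal (2 powr p) * ((\<integral>\<^sup>+w. ennreal (norm (a w) powr p) \<partial>circ) + (\<integral>\<^sup>+w. ennreal (norm (b w) powr p) \<partial>circ))"
      by (subst nn_integral_cmult, measurable, subst nn_integral_add, measurable)
    also have "\<dots> \<le> ennreal (2 powr p) * (ennreal (K powr p) + ennreal (K powr p))"
      by (intro mult_left_mono add_mono ab) auto
    also have "\<dots> = ennreal (2 powr p) * ennreal (K powr p + K powr p)" by (simp only: ennreal_plus powr_ge_zero)
    also have "\<dots> = ennreal (2 powr p * (2 * K powr p))" by (simp only: ennreal_mult[symmetric] powr_ge_zero add_nonneg_nonneg mult_2)
    finally show ?thesis .
  qed
  show "boundary_diff p g \<xi> \<le> ennreal (2 powr p * (2 * K powr p))" if \<xi>: "norm \<xi> = 1"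
    unfolding boundary_diff_def
  proof (rule diff)
    show "(\<lambda>w. radial_lim g (\<xi> * w)) \<in> borel_measurable circ"
      by (rule measurable_compose[OF measurable_circ_mult[OF \<xi>]]) measurable
    have "(\<integral>\<^sup>+w. ennreal (norm (radial_lim g (\<xi> * w)) powr p) \<partial>circ) = (\<integral>\<^sup>+w. ennreal (norm (radial_lim g w) powr p) \<partial>circ)"
      by (rule nn_integral_circ_rotate[OF _ \<xi>]) measurable
    then show "(\<integral>\<^sup>+w. ennreal (norm (radial_lim g (\<xi> * w)) powr p) \<partial>circ) \<le> ennreal (K powr p)" using bK by simp
  qed (use bK in measurable)
  show "(\<lambda>n. \<integral>\<^sup>+w. ennreal (norm (g (of_real (?r n) * w) - radial_lim g w)) \<partial>circ) \<longlonglongrightarrow> 0"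
  proof (rule L1_tendsto_of_Lp_bounded[OF _ _ _ p])
    show "(\<lambda>w. norm (g (of_real (?r n) * w) - radial_lim g w)) \<in> borel_measurable circ" for n by measurable
    show "AE w in circ. (\<lambda>n. norm (g (of_real (?r n) * w) - radial_lim g w)) \<longlonglongrightarrow> 0"
      using lim
    proof eventually_elim
      case (elim w)
      from tendsto_diff[OF this tendsto_const[of "radial_lim g w"]] show ?case
        by (intro tendsto_norm_zero) simp
    qed
    show "(\<integral>\<^sup>+w. ennreal (norm (g (of_real (?r n) * w) - radial_lim g w) powr p) \<partial>circ) \<le> ennreal (2 powr p * (2 * K powr p))" for n
      by (rule diff[OF _ _ Kn bK]) measurable
  qed (auto simp: emeasure_circ)
qed

text \<open>Cauchy's formula is applied to dilations of \<open>g\<close> minus \<open>c\<close>; the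
  constant does not affect derivatives and can later be the boundary value nearest to
  \<open>z\<close>. For fixed \<open>z\<close> the kernel is bounded by \<open>2 / d ^ 3\<close>
  with \<open>d = 1 - norm z\<close>, so L^1 convergence removes the dilation.\<close>

lemma second_deriv_boundary_le:
  assumes g: "g holomorphic_on unit_disc" and z: "norm z < 1"
    and L1: "(\<lambda>n. \<integral>\<^sup>+w. ennreal (norm (g (of_real (1 - 1 / real (n + 2)) * w) - radial_lim g w)) \<partial>circ) \<longlonglongrightarrow> 0"
  shows "ennreal (norm (deriv (deriv g) z)) \<le> (\<integral>\<^sup>+w. ennreal (2 / norm (w - z) ^ 3 * norm (radial_lim g w - c)) \<partial>circ)"
proof -
  let ?r = "\<lambda>n. 1 - 1 / real (n + 2)"
  note [measurable] = radial_lim_measurable[OF g] dilation_measurable_circ[OF g less_imp_le[OF radii(1)] radii(2)]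
  have g1: "deriv g holomorphic_on unit_disc" by (intro holomorphic_deriv g) auto
  have g2: "deriv (deriv g) holomorphic_on unit_disc" by (intro holomorphic_deriv g1) auto
  define d where "d = 1 - norm z"
  have d: "0 < d" using z by (simp add: d_def)
  have wz: "d \<le> norm (w - z)" if "norm w = 1" for w using norm_triangle_ineq2[of w z] that by (simp add: d_def)
  define X where "X = (\<integral>\<^sup>+w. ennreal (2 / norm (w - z) ^ 3 * norm (radial_lim g w - c)) \<partial>circ)"
  define e where "e n = (\<integral>\<^sup>+w. ennreal (norm (g (of_real (?r n) * w) - radial_lim g w)) \<partial>circ)" for n
  have bound: "ennreal (norm (of_real (?r n) ^ 2 * deriv (deriv g) (of_real (?r n) * z))) \<le> X + ennreal (2 / d ^ 3) * e n" for n
  proof -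
    define R where "R = ?r n"
    have R: "0 \<le> R" "R < 1" unfolding R_def using less_imp_le[OF radii(1)] radii(2) by blast+
    have Rz: "norm (of_real R * w) < 1" if "norm w < 1" for w :: complex
      using R that mult_left_le_one_le[of "norm w" R] by (simp add: norm_mult)
    note dil = dilation_regular[OF g R]
    define F where "F z = g (of_real R * z) - c" for z
    have Fc: "continuous_on (cball 0 1) F" "F holomorphic_on unit_disc"
      unfolding F_def by (intro continuous_intros holomorphic_intros dil)+
    have D1: "deriv F w = of_real R * deriv g (of_real R * w)" if w: "norm w < 1" for w
    proof (rule DERIV_imp_deriv)
      have "(g has_field_derivative deriv g (of_real R * w)) (at (of_real R * w))"
        using Rz[OF w] by (intro holomorphic_derivI[OF g]) auto
      from DERIV_chain2[where f = g and g = "\<lambda>z. of_real R * z", OF this, of "of_real R"]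
      have "((\<lambda>z. g (of_real R * z)) has_field_derivative deriv g (of_real R * w) * of_real R) (at w)"
        by (auto intro!: derivative_eq_intros)
      then show "(F has_field_derivative of_real R * deriv g (of_real R * w)) (at w)"
        unfolding F_def by (auto intro!: derivative_eq_intros simp: mult.commute)
    qed
    have D2: "deriv (deriv F) z = of_real R ^ 2 * deriv (deriv g) (of_real R * z)"
    proof -
      have "deriv (deriv F) z = deriv (\<lambda>w. of_real R * deriv g (of_real R * w)) z"
        by (rule deriv_cong_disc[OF D1 z])
      also have "\<dots> = of_real R ^ 2 * deriv (deriv g) (of_real R * z)"
      proof (rule DERIV_imp_deriv)
        have "(deriv g has_field_derivative deriv (deriv g) (of_real R * z)) (at (of_real R * z))"
          using Rz[OF z] by (intro holomorphic_derivI[OF g1]) auto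
        from DERIV_chain2[where f = "deriv g" and g = "\<lambda>z. of_real R * z", OF this, of "of_real R"]
        have "((\<lambda>z. deriv g (of_real R * z)) has_field_derivative deriv (deriv g) (of_real R * z) * of_real R) (at z)"
          by (auto intro!: derivative_eq_intros)
        then show "((\<lambda>w. of_real R * deriv g (of_real R * w)) has_field_derivative of_real R ^ 2 * deriv (deriv g) (of_real R * z)) (at z)"
          by (auto intro!: derivative_eq_intros simp: power2_eq_square)
      qed
      finally show ?thesis .
    qed
    have "has_bochner_integral circ (\<lambda>w. F w * w / (w - z) ^ Suc 2) ((deriv ^^ 2) F z / fact 2)"
      by (rule cauchy_integral_circ[OF Fc z])
    from has_bochner_integral_mult_right[OF this, of 2]
    have "has_bochner_integral circ (\<lambda>w. 2 * (F w * w / (w - z) ^ 3)) (of_real R ^ 2 * deriv (deriv g) (of_real R * z))"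
      by (simp add: numeral_2_eq_2 numeral_3_eq_3 D2[simplified numeral_2_eq_2])
    then have "ennreal (norm (of_real R ^ 2 * deriv (deriv g) (of_real R * z)))
      \<le> (\<integral>\<^sup>+w. ennreal (2 / norm (w - z) ^ 3 * norm (F w)) \<partial>circ)"
      by (rule norm_le_nn_integral_circ) (simp add: norm_mult norm_divide norm_power)
    also have "\<dots> \<le> (\<integral>\<^sup>+w. ennreal (2 / norm (w - z) ^ 3 * norm (radial_lim g w - c))
        + ennreal (2 / d ^ 3) * ennreal (norm (g (of_real R * w) - radial_lim g w)) \<partial>circ)"
    proof (rule nn_integral_mono)
      fix w assume "w \<in> space circ"
      then have w: "d \<le> norm (w - z)" using wz by simp
      have wp: "d ^ 3 \<le> norm (w - z) ^ 3" using w d by (intro power_mono) auto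
      have "norm (F w) \<le> norm (radial_lim g w - c) + norm (g (of_real R * w) - radial_lim g w)"
        using norm_triangle_ineq[of "radial_lim g w - c" "g (of_real R * w) - radial_lim g w"] by (simp add: F_def)
      then have "2 / norm (w - z) ^ 3 * norm (F w) \<le> 2 / norm (w - z) ^ 3 * (norm (radial_lim g w - c) + norm (g (of_real R * w) - radial_lim g w))"
        by (intro mult_left_mono) auto
      also have "\<dots> = 2 / norm (w - z) ^ 3 * norm (radial_lim g w - c) + 2 / norm (w - z) ^ 3 * norm (g (of_real R * w) - radial_lim g w)"
        by (rule distrib_left)
      also have "\<dots> \<le> 2 / norm (w - z) ^ 3 * norm (radial_lim g w - c) + 2 / d ^ 3 * norm (g (of_real R * w) - radial_lim g w)"
        using wp d by (intro add_left_mono mult_right_mono divide_left_mono mult_pos_pos) auto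
      finally have "ennreal (2 / norm (w - z) ^ 3 * norm (F w)) \<le> ennreal \<dots>" by (rule ennreal_leI)
      also have "\<dots> = ennreal (2 / norm (w - z) ^ 3 * norm (radial_lim g w - c)) + ennreal (2 / d ^ 3) * ennreal (norm (g (of_real R * w) - radial_lim g w))"
        using d by (simp add: ennreal_mult[symmetric])
      finally show "ennreal (2 / norm (w - z) ^ 3 * norm (F w)) \<le> \<dots>" .
    qed
    also have "\<dots> = X + ennreal (2 / d ^ 3) * e n"
      unfolding X_def e_def R_def[symmetric] using dilation_measurable_circ[OF g R, measurable]
      by (subst nn_integral_add, measurable, subst nn_integral_cmult, measurable)
    finally show ?thesis by (simp only: R_def)
  qed
  have lim1: "(\<lambda>n. complex_of_real (?r n)) \<longlonglongrightarrow> of_real 1"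
    using radii(3) by (intro tendsto_of_real) (simp add: filterlim_at)
  then have lz: "(\<lambda>n. complex_of_real (?r n) * z) \<longlonglongrightarrow> z" using tendsto_mult[OF lim1 tendsto_const[of z]] by simp
  have "isCont (deriv (deriv g)) z"
    using holomorphic_on_imp_continuous_on[OF g2] z by (simp add: continuous_on_eq_continuous_at)
  from isCont_tendsto_compose[OF this lz]
  have "(\<lambda>n. ennreal (norm (of_real (?r n) ^ 2 * deriv (deriv g) (of_real (?r n) * z)))) \<longlonglongrightarrow> ennreal (norm (of_real 1 ^ 2 * deriv (deriv g) z))"
    by (intro tendsto_ennrealI tendsto_norm tendsto_mult tendsto_power lim1)
  moreover have "(\<lambda>n. X + ennreal (2 / d ^ 3) * e n) \<longlonglongrightarrow> X + ennreal (2 / d ^ 3) * 0"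
    by (intro tendsto_add tendsto_const ennreal_tendsto_cmult L1[folded e_def]) auto
  ultimately have "ennreal (norm (of_real 1 ^ 2 * deriv (deriv g) z)) \<le> X + ennreal (2 / d ^ 3) * 0"
    by (rule LIMSEQ_le) (use bound in auto)
  then show ?thesis by (simp add: X_def)
qed

text \<open>Existence of a radial limit is not evidently a measurable condition; being Cauchy along
  the fixed radii is one, and it follows from that existence.\<close>

lemma AE_circ_radial_limit:
  assumes g: "g holomorphic_on unit_disc"
    and ex: "AE \<theta> in lborel. \<exists>l. ((\<lambda>r::real. g (of_real r * cis \<theta>)) \<longlongrightarrow> l) (at_left 1)"
  shows "AE w in circ. (\<lambda>n. g (of_real (1 - 1 / real (n + 2)) * w)) \<longlonglongrightarrow> radial_lim g w"
proof -
  note [measurable] = dilation_measurable_circ[OF g less_imp_le[OF radii(1)] radii(2)]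
  have "AE w in circ. Cauchy (\<lambda>n. g (of_real (1 - 1 / real (n + 2)) * w))"
  proof (rule AE_circ)
    show "AE t in lborel. Cauchy (\<lambda>n. g (of_real (1 - 1 / real (n + 2)) * cis t))"
      using ex by eventually_elim (metis radial_lim_eq(3) LIMSEQ_imp_Cauchy)
    show "{w \<in> space circ. Cauchy (\<lambda>n. g (of_real (1 - 1 / real (n + 2)) * w))} \<in> sets circ"
      by (rule sets_Collect_Cauchy) measurable
  qed
  then show ?thesis
    by eventually_elim (simp add: radial_lim_def Cauchy_convergent_iff convergent_LIMSEQ_iff)
qed

text \<open>Rotations away from 1 obey only the trivial bound \<open>M\<close>. It is written as a
  multiple of \<open>norm (\<xi> - 1) ^ 3\<close> because the cube cancels the kernel of Cauchy's
  formula for the second derivative, where this part then contributes only a constant.\<close>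

lemma boundary_diff_le_of_mean_lipschitz:
  assumes p: "1 < p" and g: "g holomorphic_on unit_disc"
    and ex: "AE \<theta> in lebesgue. \<exists>l. ((\<lambda>r::real. g (of_real r * cis \<theta>)) \<longlongrightarrow> l) (at_left 1)"
    and M: "0 \<le> M" "\<And>\<xi>. norm \<xi> = 1 \<Longrightarrow> boundary_diff p g \<xi> \<le> ennreal (M powr p)"
    and small: "mean_modulus p g \<in> o[at_right 0](\<lambda>t. t powr (1 / p))" and \<epsilon>: "0 < \<epsilon>"
  shows "\<exists>C\<ge>0. \<forall>\<xi>. norm \<xi> = 1 \<longrightarrow> boundary_diff p g \<xi> \<le> ennreal ((\<epsilon> * norm (\<xi> - 1) powr (1 / p) + C * norm (\<xi> - 1) ^ 3) powr p)"
proof -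
  let ?D = "boundary_diff p g"
  \<comment> \<open>A factor 2 is lost when the angle is replaced by the chord:
    \<open>\<bar>h\<bar> \<le> 2 * norm (\<xi> - 1)\<close> and
    \<open>2 powr (1 / p) \<le> 2\<close>.\<close>
  define \<epsilon>' where "\<epsilon>' = \<epsilon> / 2"
  have \<epsilon>': "0 < \<epsilon>'" using \<epsilon> by (simp add: \<epsilon>'_def)
  have "\<forall>\<^sub>F t in at_right 0. norm (mean_modulus p g t) \<le> \<epsilon>' * norm (t powr (1 / p))"
    using landau_o.smallD[OF small \<epsilon>'] by simp
  then obtain b where b: "0 < b" "\<And>t. 0 < t \<Longrightarrow> t < b \<Longrightarrow> norm (mean_modulus p g t) \<le> \<epsilon>' * norm (t powr (1 / p))"
    unfolding eventually_at_right_field by blast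
  have fin: "?D (cis h) = ennreal (enn2real (?D (cis h)))" "enn2real (?D (cis h)) \<le> M powr p" for h
  proof -
    have le: "?D (cis h) \<le> ennreal (M powr p)" by (rule M) simp
    then show "?D (cis h) = ennreal (enn2real (?D (cis h)))" by (simp add: le_less_trans)
    then show "enn2real (?D (cis h)) \<le> M powr p" using le by (metis ennreal_le_iff powr_ge_zero)
  qed
  have pos: "?D (cis h) \<le> ennreal ((\<epsilon>' * h powr (1 / p)) powr p)" if h: "0 < h" "h < b" for h
  proof -
    let ?S = "(\<lambda>h. enn2real (?D (cis h)) powr (1 / p)) ` {0<..h}"
    \<comment> \<open>The bound by \<open>M\<close> is what lets the supremum in
      \<open>mean_modulus\<close> dominate its members; for an unbounded set its value would be
      unspecified.\<close>
    have "bdd_above ?S"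
      using fin(2) p by (intro bdd_aboveI2[of _ _ "(M powr p) powr (1 / p)"]) (auto intro!: powr_mono2)
    then have "enn2real (?D (cis h)) powr (1 / p) \<le> mean_modulus p g h"
      unfolding mean_modulus_eq[OF g ex] using h by (intro cSUP_upper) auto
    also have "\<dots> \<le> \<epsilon>' * h powr (1 / p)" using b(2)[OF h] by simp
    finally have "(enn2real (?D (cis h)) powr (1 / p)) powr p \<le> (\<epsilon>' * h powr (1 / p)) powr p"
      using p by (rule_tac powr_mono2) auto
    then have "enn2real (?D (cis h)) \<le> (\<epsilon>' * h powr (1 / p)) powr p" using p by (simp add: powr_powr)
    then show ?thesis by (subst fin(1)) (rule ennreal_leI)
  qed
  \<comment> \<open>\<open>b / 2\<close> stays inside the range of the little-oh estimate, and 1 is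
    the range in which arc and chord are compared.\<close>
  define \<delta> where "\<delta> = min (b / 2) 1"
  have \<delta>: "0 < \<delta>" "\<delta> \<le> 1" "\<delta> < b" using b(1) by (auto simp: \<delta>_def)
  define s where "s = sqrt (2 - 2 * cos \<delta>)"
  have \<delta>pi: "\<delta> \<le> pi" using \<delta>(2) pi_gt3 by simp
  have s: "0 < s" unfolding s_def using cis_diff_ge(2)[of \<delta> \<delta>] \<delta> \<delta>pi by simp
  define C where "C = M / s ^ 3"
  have C: "0 \<le> C" using M s by (simp add: C_def)
  have "?D \<xi> \<le> ennreal ((\<epsilon> * norm (\<xi> - 1) powr (1 / p) + C * norm (\<xi> - 1) ^ 3) powr p)" if \<xi>: "norm \<xi> = 1" for \<xi>
  proof -
    define h where "h = Arg \<xi>"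
    have "\<xi> \<noteq> 0" using \<xi> by auto
    then have h: "\<bar>h\<bar> \<le> pi" "\<xi> = cis h"
      using Arg_bounded[of \<xi>] cis_Arg[of \<xi>] \<xi> by (auto simp: h_def sgn_eq)
    show ?thesis
    proof (cases "\<bar>h\<bar> \<le> \<delta>")
      case True
      have D_abs: "?D \<xi> = ?D (cis \<bar>h\<bar>)"
      proof (cases "0 \<le> h")
        case False
        have "?D (cnj (cis \<bar>h\<bar>)) = ?D (cis \<bar>h\<bar>)" by (rule boundary_diff_inverse[OF g]) simp
        then show ?thesis using False h(2) by (simp add: cis_cnj)
      qed (use h in simp)
      show ?thesis
      proof (cases "h = 0")
        case True
        then show ?thesis using h(2) by (simp add: boundary_diff_def)
      next
        case False
        have "\<bar>h\<bar> powr (1 / p) \<le> (2 * norm (\<xi> - 1)) powr (1 / p)"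
          using abs_le_cis_diff[of h] True \<delta> p h(2) by (intro powr_mono2) auto
        also have "\<dots> = 2 powr (1 / p) * norm (\<xi> - 1) powr (1 / p)" by (simp add: powr_mult)
        also have "\<dots> \<le> 2 powr 1 * norm (\<xi> - 1) powr (1 / p)" using p by (intro mult_right_mono powr_mono) auto
        finally have "\<epsilon>' * \<bar>h\<bar> powr (1 / p) \<le> \<epsilon>' * (2 * norm (\<xi> - 1) powr (1 / p))"
          using \<epsilon>' by (intro mult_left_mono) auto
        also have "\<dots> \<le> \<epsilon> * norm (\<xi> - 1) powr (1 / p) + C * norm (\<xi> - 1) ^ 3" using C by (simp add: \<epsilon>'_def)
        finally have "(\<epsilon>' * \<bar>h\<bar> powr (1 / p)) powr p \<le> (\<epsilon> * norm (\<xi> - 1) powr (1 / p) + C * norm (\<xi> - 1) ^ 3) powr p"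
          using \<epsilon>' p by (rule_tac powr_mono2) auto
        moreover have "?D (cis \<bar>h\<bar>) \<le> ennreal ((\<epsilon>' * \<bar>h\<bar> powr (1 / p)) powr p)"
          using False True \<delta> by (intro pos) auto
        ultimately show ?thesis unfolding D_abs by (meson ennreal_leI order_trans)
      qed
    next
      case False
      have sx: "s \<le> norm (\<xi> - 1)" unfolding s_def h(2) using cis_diff_ge(1)[of \<delta> h] False h(1) \<delta> \<delta>pi by simp
      have "M = C * s ^ 3" using s by (simp add: C_def)
      also have "\<dots> \<le> C * norm (\<xi> - 1) ^ 3" using sx s C by (intro mult_left_mono power_mono) auto
      also have "\<dots> \<le> \<epsilon> * norm (\<xi> - 1) powr (1 / p) + C * norm (\<xi> - 1) ^ 3" using \<epsilon> by simp
      finally have "M powr p \<le> (\<epsilon> * norm (\<xi> - 1) powr (1 / p) + C * norm (\<xi> - 1) ^ 3) powr p"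
        using M(1) p by (rule_tac powr_mono2) auto
      with M(2)[OF \<xi>] show ?thesis by (meson ennreal_leI order_trans)
    qed
  qed
  then show ?thesis using C by blast
qed

text \<open>In the relative variable \<open>\<xi>\<close>, Minkowski's inequality reduces the mean
  of the second derivative to \<open>boundary_diff\<close> integrated against
  \<open>2 / q \<xi> ^ 3\<close>. Of the resulting \<open>q \<xi> powr (1 / p - 3)\<close> the part
  \<open>q \<xi> powr (1 / p - 1)\<close> is at most its value at 1, and the remaining inverse
  square is a Poisson kernel.\<close>

lemma little_growth_of_mean_lipschitz:
  assumes p: "1 < p" and gl: "g \<in> little_mean_lipschitz p (1 / p)"
  shows "little_growth p (deriv (deriv g)) (2 - 1 / p)"
proof -
  have hardy: "g \<in> hardy_space p"
    and ex: "AE \<theta> in lebesgue. \<exists>l. ((\<lambda>r::real. g (of_real r * cis \<theta>)) \<longlongrightarrow> l) (at_left 1)"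
    and small: "mean_modulus p g \<in> o[at_right 0](\<lambda>t. t powr (1 / p))"
    using gl by (auto simp: little_mean_lipschitz_def)
  obtain K where g: "g holomorphic_on unit_disc" and K: "0 \<le> K" "\<And>r. 0 < r \<Longrightarrow> r < 1 \<Longrightarrow> circle_mean p g r \<le> ennreal (K powr p)"
    using hardy unfolding hardy_space_iff[OF p] by blast
  note [measurable] = radial_lim_measurable[OF g]
  note est = boundary_estimates[OF p g K AE_circ_radial_limit[OF g ex[unfolded AE_completion_iff]]]
  define M where "M = (2 powr p * (2 * K powr p)) powr (1 / p)"
  have M: "0 \<le> M" "M powr p = 2 powr p * (2 * K powr p)" using p by (auto simp: M_def powr_powr)
  have g1: "deriv g holomorphic_on unit_disc" by (intro holomorphic_deriv g) auto
  have g2: "deriv (deriv g) holomorphic_on unit_disc" by (intro holomorphic_deriv g1) auto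
  show ?thesis
    unfolding little_growth_def
  proof (intro allI impI)
    fix \<epsilon> :: real assume \<epsilon>: "0 < \<epsilon>"
    \<comment> \<open>The kernel times \<open>\<epsilon> / 4 * (2 * q \<xi>) powr (1 / p)\<close> is
      at most \<open>\<epsilon> * q \<xi> powr (1 / p - 3)\<close>.\<close>
    have "0 < \<epsilon> / 4" using \<epsilon> by simp
    from boundary_diff_le_of_mean_lipschitz[OF p g ex M(1) est(2)[folded M(2)] small this]
    obtain C where C: "0 \<le> C" "\<And>\<xi>. norm \<xi> = 1 \<Longrightarrow> boundary_diff p g \<xi> \<le> ennreal ((\<epsilon> / 4 * norm (\<xi> - 1) powr (1 / p) + C * norm (\<xi> - 1) ^ 3) powr p)"
      by blast
    show "\<exists>C\<ge>0. \<forall>r. 0 \<le> r \<longrightarrow> r < 1 \<longrightarrow>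
      circle_mean p (deriv (deriv g)) r \<le> ennreal ((\<epsilon> * (1 - r) powr - (2 - 1 / p) + C) powr p)"
    \<comment> \<open>\<open>16 * C\<close> is the kernel \<open>2 / q \<xi> ^ 3\<close> times the
      cubic term \<open>C * (2 * q \<xi>) ^ 3\<close>.\<close>
    proof (intro exI[of _ "16 * C"] conjI allI impI)
      show "0 \<le> 16 * C" using C by simp
      fix r :: real assume r: "0 \<le> r" "r < 1"
      define q where "q \<xi> = norm (\<xi> - complex_of_real r)" for \<xi>
      have q: "1 - r \<le> q \<xi>" "norm (\<xi> - 1) \<le> 2 * q \<xi>" if "norm \<xi> = 1" for \<xi>
      proof -
        show 1: "1 - r \<le> q \<xi>" using norm_triangle_ineq2[of \<xi> "of_real r"] that r by (simp add: q_def)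
        have "norm (\<xi> - 1) \<le> q \<xi> + norm (complex_of_real r - 1)"
          using norm_triangle_ineq[of "\<xi> - of_real r" "of_real r - 1"] by (simp add: q_def)
        also have "norm (complex_of_real r - 1) = 1 - r" using r norm_of_real[of "r - 1", where 'a = complex] by simp
        finally show "norm (\<xi> - 1) \<le> 2 * q \<xi>" using 1 by simp
      qed
      \<comment> \<open>Replacing \<open>norm (\<xi> - 1)\<close> by the larger
        \<open>2 * q \<xi>\<close> keeps \<open>\<psi>\<close> positive also at
        \<open>\<xi> = 1\<close>; Minkowski's inequality divides by it.\<close>
      define \<psi> where "\<psi> \<xi> = \<epsilon> / 4 * (2 * q \<xi>) powr (1 / p) + C * (2 * q \<xi>) ^ 3" for \<xi>
      have mm: "(\<lambda>z. norm (radial_lim g (fst z * snd z) - radial_lim g (fst z))) \<in> borel_measurable (circ \<Otimes>\<^sub>M circ)"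
      proof -
        have mult: "(\<lambda>x. fst x * snd x) \<in> circ \<Otimes>\<^sub>M circ \<rightarrow>\<^sub>M circ"
          unfolding measurable_cong_sets[OF refl sets_circ]
          by (intro measurable_restrict_space2) (auto simp: norm_mult space_pair_measure)
        show ?thesis
          using measurable_compose[OF mult radial_lim_measurable[OF g]]
            measurable_compose[OF measurable_fst[of circ circ] radial_lim_measurable[OF g]]
          by measurable
      qed
      show "circle_mean p (deriv (deriv g)) r \<le> ennreal ((\<epsilon> * (1 - r) powr - (2 - 1 / p) + 16 * C) powr p)"
        unfolding circle_mean_def
      proof (rule nn_integral_minkowski[where N = circ and k = "\<lambda>\<xi>. 2 / q \<xi> ^ 3" and \<phi> = \<psi>
            and f = "\<lambda>\<eta> \<xi>. norm (radial_lim g (\<eta> * \<xi>) - radial_lim g \<eta>)"])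
        show "sigma_finite_measure circ" "sigma_finite_measure circ" by unfold_locales
        show "(\<lambda>(\<eta>, \<xi>). norm (radial_lim g (\<eta> * \<xi>) - radial_lim g \<eta>)) \<in> borel_measurable (circ \<Otimes>\<^sub>M circ)"
          using mm by (simp add: case_prod_beta')
        show "(\<lambda>\<xi>. 2 / q \<xi> ^ 3) \<in> borel_measurable circ" "\<psi> \<in> borel_measurable circ"
          unfolding q_def \<psi>_def[abs_def] by measurable
        show "0 < \<psi> \<xi>" if "\<xi> \<in> space circ" for \<xi>
          unfolding \<psi>_def using q(1)[of \<xi>] that r \<epsilon> C by (intro add_pos_nonneg mult_pos_pos) auto
        show "(\<integral>\<^sup>+\<eta>. norm (radial_lim g (\<eta> * \<xi>) - radial_lim g \<eta>) powr p \<partial>circ) \<le> ennreal (\<psi> \<xi> powr p)"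
          if "\<xi> \<in> space circ" for \<xi>
        proof -
          have \<xi>: "norm \<xi> = 1" using that by simp
          have "(\<integral>\<^sup>+\<eta>. norm (radial_lim g (\<eta> * \<xi>) - radial_lim g \<eta>) powr p \<partial>circ) = boundary_diff p g \<xi>"
            unfolding boundary_diff_def by (simp add: mult.commute)
          also note C(2)[OF \<xi>]
          also have "ennreal ((\<epsilon> / 4 * norm (\<xi> - 1) powr (1 / p) + C * norm (\<xi> - 1) ^ 3) powr p) \<le> ennreal (\<psi> \<xi> powr p)"
            unfolding \<psi>_def using q(2)[OF \<xi>] \<epsilon> C(1) p
            by (intro ennreal_leI powr_mono2 add_mono mult_left_mono power_mono) auto
          finally show ?thesis .
        qed
        show "(\<integral>\<^sup>+\<xi>. ennreal (2 / q \<xi> ^ 3 * \<psi> \<xi>) \<partial>circ) \<le> ennreal (\<epsilon> * (1 - r) powr - (2 - 1 / p) + 16 * C)"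
        proof -
          let ?a = "\<epsilon> * (1 - r) powr (1 / p - 1)"
          have "(\<integral>\<^sup>+\<xi>. ennreal (2 / q \<xi> ^ 3 * \<psi> \<xi>) \<partial>circ)
              \<le> (\<integral>\<^sup>+\<xi>. ennreal ?a * ennreal (1 / (norm (\<xi> - complex_of_real r))\<^sup>2) + ennreal (16 * C) \<partial>circ)"
          proof (rule nn_integral_mono)
            fix \<xi> assume "\<xi> \<in> space circ"
            then have \<xi>: "norm \<xi> = 1" by simp
            have q0: "0 < q \<xi>" using q(1)[OF \<xi>] r by simp
            have "2 / q \<xi> ^ 3 * \<psi> \<xi> = \<epsilon> / 2 * 2 powr (1 / p) * (q \<xi> powr (1 / p) / q \<xi> ^ 3) + 16 * C"
              using q0 by (simp add: \<psi>_def powr_mult field_simps power_mult_distrib)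
            also have "q \<xi> powr (1 / p) / q \<xi> ^ 3 = q \<xi> powr (1 / p - 1) * (1 / q \<xi> ^ 2)"
              using q0 by (simp add: powr_diff power2_eq_square power3_eq_cube)
            also have "\<epsilon> / 2 * 2 powr (1 / p) * (q \<xi> powr (1 / p - 1) * (1 / q \<xi> ^ 2)) + 16 * C
               \<le> \<epsilon> / 2 * 2 powr 1 * ((1 - r) powr (1 / p - 1) * (1 / q \<xi> ^ 2)) + 16 * C"
            proof (intro add_right_mono mult_mono mult_left_mono mult_right_mono)
              show "2 powr (1 / p) \<le> (2::real) powr 1" using p by (intro powr_mono) auto
              show "q \<xi> powr (1 / p - 1) \<le> (1 - r) powr (1 / p - 1)" using p r q(1)[OF \<xi>] by (intro powr_mono2') auto
            qed (use \<epsilon> in auto)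
            finally have "2 / q \<xi> ^ 3 * \<psi> \<xi> \<le> ?a * (1 / (norm (\<xi> - complex_of_real r))\<^sup>2) + 16 * C" by (simp add: q_def)
            then have "ennreal (2 / q \<xi> ^ 3 * \<psi> \<xi>) \<le> ennreal \<dots>" by (rule ennreal_leI)
            also have "\<dots> = ennreal ?a * ennreal (1 / (norm (\<xi> - complex_of_real r))\<^sup>2) + ennreal (16 * C)"
              using \<epsilon> C(1) by (simp add: ennreal_mult[symmetric])
            finally show "ennreal (2 / q \<xi> ^ 3 * \<psi> \<xi>) \<le> \<dots>" .
          qed
          also have "\<dots> = ennreal ?a * (\<integral>\<^sup>+\<xi>. ennreal (1 / (norm (\<xi> - complex_of_real r))\<^sup>2) \<partial>circ) + ennreal (16 * C)"
            by (subst nn_integral_add, measurable, subst nn_integral_cmult, measurable) (simp add: emeasure_circ)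
          also have "(\<integral>\<^sup>+\<xi>. ennreal (1 / (norm (\<xi> - complex_of_real r))\<^sup>2) \<partial>circ) = ennreal (1 / (1 - r\<^sup>2))"
            using nn_integral_poisson_kernel[of "of_real r"] r by simp
          also have "ennreal (1 / (1 - r\<^sup>2)) \<le> ennreal ((1 - r) powr - 1)"
          proof (rule ennreal_leI)
            have "r\<^sup>2 \<le> r" using r by (simp add: power2_eq_square mult_left_le)
            then have "1 / (1 - r\<^sup>2) \<le> 1 / (1 - r)" using r by (intro divide_left_mono mult_pos_pos) (auto simp: power_less_one_iff)
            then show "1 / (1 - r\<^sup>2) \<le> (1 - r) powr - 1" using r by (simp add: powr_minus_divide)
          qed
          also have "ennreal ?a * ennreal ((1 - r) powr - 1) = ennreal (\<epsilon> * (1 - r) powr - (2 - 1 / p))"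
          proof -
            have "- (2 - 1 / p) = (1 / p - 1) + - 1" by simp
            then have "(1 - r) powr - (2 - 1 / p) = (1 - r) powr (1 / p - 1) * (1 - r) powr - 1" by (simp only: powr_add)
            then have "?a * (1 - r) powr - 1 = \<epsilon> * (1 - r) powr - (2 - 1 / p)" by (simp only: mult.assoc)
            then show ?thesis using \<epsilon> by (simp only: ennreal_mult[symmetric] mult_nonneg_nonneg powr_ge_zero less_imp_le)
          qed
          also have "ennreal (\<epsilon> * (1 - r) powr - (2 - 1 / p)) + ennreal (16 * C) = ennreal (\<epsilon> * (1 - r) powr - (2 - 1 / p) + 16 * C)"
            using \<epsilon> C(1) by (intro ennreal_plus[symmetric]) auto
          finally show ?thesis by (simp add: mult_left_mono add_right_mono)
        qed
        show "AE \<eta> in circ. 0 \<le> norm (deriv (deriv g) (of_real r * \<eta>)) \<and> ennreal (norm (deriv (deriv g) (of_real r * \<eta>)))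
           \<le> (\<integral>\<^sup>+\<xi>. ennreal (2 / q \<xi> ^ 3 * norm (radial_lim g (\<eta> * \<xi>) - radial_lim g \<eta>)) \<partial>circ)"
        proof (intro AE_I2 conjI norm_ge_zero)
          fix \<eta> assume "\<eta> \<in> space circ"
          then have \<eta>: "norm \<eta> = 1" by simp
          have "ennreal (norm (deriv (deriv g) (of_real r * \<eta>)))
            \<le> (\<integral>\<^sup>+w. ennreal (2 / norm (w - of_real r * \<eta>) ^ 3 * norm (radial_lim g w - radial_lim g \<eta>)) \<partial>circ)"
            by (rule second_deriv_boundary_le[OF g _ est(3)]) (use \<eta> r in \<open>simp add: norm_mult\<close>)
          also have "\<dots> = (\<integral>\<^sup>+\<xi>. ennreal (2 / norm (\<eta> * \<xi> - of_real r * \<eta>) ^ 3 * norm (radial_lim g (\<eta> * \<xi>) - radial_lim g \<eta>)) \<partial>circ)"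
            by (rule nn_integral_circ_rotate[OF _ \<eta>, symmetric]) measurable
          also have "\<dots> = (\<integral>\<^sup>+\<xi>. ennreal (2 / q \<xi> ^ 3 * norm (radial_lim g (\<eta> * \<xi>) - radial_lim g \<eta>)) \<partial>circ)"
            using norm_rotate_diff[OF \<eta>, of _ "of_real r"] by (simp only: q_def mult.commute[of "of_real r" \<eta>])
          finally show "ennreal (norm (deriv (deriv g) (of_real r * \<eta>)))
            \<le> (\<integral>\<^sup>+\<xi>. ennreal (2 / q \<xi> ^ 3 * norm (radial_lim g (\<eta> * \<xi>) - radial_lim g \<eta>)) \<partial>circ)" .
        qed
        show "0 \<le> \<epsilon> * (1 - r) powr - (2 - 1 / p) + 16 * C" using \<epsilon> C(1) by simp
        show "0 \<le> 2 / q \<xi> ^ 3" if "\<xi> \<in> space circ" for \<xi> by (simp add: q_def)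
      qed (use p in auto)
    qed
  qed
qed

section \<open>From growth of the derivative to the boundary modulus\<close>

lemma powr_add_ge:
  fixes a b p :: real
  assumes "0 \<le> a" "0 \<le> b" "1 < p"
  shows "a powr p + b powr p \<le> 2 powr p * (a + b) powr p"
proof -
  have "a powr p + b powr p \<le> (a + b) powr p + (a + b) powr p"
    using assms by (intro add_mono powr_mono2) auto
  also have "\<dots> = 2 powr 1 * (a + b) powr p" by simp
  also have "\<dots> \<le> 2 powr p * (a + b) powr p" using assms by (intro mult_right_mono powr_mono) auto
  finally show ?thesis .
qed

lemma radial_segment_bound:
  assumes G: "G holomorphic_on unit_disc" and w: "norm w = 1" and ab: "0 \<le> a" "a \<le> b" "b < 1"
  shows "ennreal (norm (G (of_real b * w) - G (of_real a * w)))
    \<le> (\<integral>\<^sup>+s. ennreal (indicator {a..b} s * norm (deriv G (of_real s * w))) \<partial>unit_ivl)"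
proof -
  have dG: "deriv G holomorphic_on unit_disc" by (intro holomorphic_deriv G) auto
  have "ennreal (norm (G (of_real b * w) - G (of_real a * w)))
    \<le> (\<integral>\<^sup>+s. ennreal (norm (w * deriv G (of_real s * w))) * indicator {a..b} s \<partial>lborel)"
  proof (rule norm_diff_le_nn_integral[OF ab(2)])
    fix s assume s: "a \<le> s" "s \<le> b"
    then have "of_real s * w \<in> unit_disc" using ab w by (simp add: norm_mult)
    then have "(G has_field_derivative deriv G (of_real s * w)) (at (of_real s * w))"
      by (intro holomorphic_derivI[OF G]) auto
    moreover have "((\<lambda>s. of_real s * w) has_vector_derivative w) (at s within {a..b})"
      by (auto intro!: derivative_eq_intros)
    ultimately have "(G \<circ> (\<lambda>s. of_real s * w) has_vector_derivative w * deriv G (of_real s * w)) (at s within {a..b})"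
      by (intro field_vector_diff_chain_within) (auto intro: has_field_derivative_at_within)
    then show "((\<lambda>s. G (of_real s * w)) has_vector_derivative w * deriv G (of_real s * w)) (at s within {a..b})"
      by (simp add: o_def)
  next
    show "continuous_on {a..b} (\<lambda>s. w * deriv G (of_real s * w))"
      by (intro continuous_intros continuous_on_compose2[OF holomorphic_on_imp_continuous_on[OF dG]])
         (use ab w in \<open>auto simp: norm_mult\<close>)
  qed
  also have "\<dots> = (\<integral>\<^sup>+s. ennreal (indicator {a..b} s * norm (deriv G (of_real s * w))) \<partial>unit_ivl)"
    unfolding nn_integral_unit_ivl
  proof (rule nn_integral_cong_AE)
    show "AE s in lborel. ennreal (norm (w * deriv G (of_real s * w))) * indicator {a..b} s
       = ennreal (indicator {a..b} s * norm (deriv G (of_real s * w))) * indicator {0<..<1} s"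
      using AE_lborel_singleton[of 0]
      by eventually_elim (use ab w in \<open>auto simp: indicator_def norm_mult\<close>)
  qed
  finally show ?thesis .
qed

lemma radial_deriv_measurable:
  assumes G: "G holomorphic_on unit_disc"
  shows "(\<lambda>(w, s). norm (deriv G (of_real s * w))) \<in> borel_measurable (circ \<Otimes>\<^sub>M unit_ivl)"
proof -
  have dG: "deriv G holomorphic_on unit_disc" by (intro holomorphic_deriv G) auto
  have "(\<lambda>z. deriv G (of_real (snd z) * fst z)) \<in> borel_measurable (circ \<Otimes>\<^sub>M unit_ivl)"
    by (rule holomorphic_measurable_comp[OF dG]) (auto simp: norm_mult space_pair_measure)
  then show ?thesis by (simp add: case_prod_beta')
qed

text \<open>Minkowski's inequality along the radius, with \<open>\<Phi>\<close> bounding the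
  integral of \<open>\<phi>\<close>. The 4 joins the two factors \<open>2 powr p\<close> that arise
  from comparing the power of a sum with the sum of powers, once in each direction.\<close>

lemma circle_mean_integrate:
  assumes G: "G holomorphic_on unit_disc" and p: "1 < p"
    and [measurable]: "\<phi> \<in> borel_measurable unit_ivl" and \<phi>: "\<And>s. s \<in> {0<..<1} \<Longrightarrow> 0 < \<phi> s"
    and le: "\<And>s. s \<in> {0<..<1} \<Longrightarrow> circle_mean p (deriv G) s \<le> ennreal (\<phi> s powr p)"
    and r: "0 \<le> r" "r < 1" and \<Phi>: "(\<integral>\<^sup>+s. ennreal (indicator {0..r} s * \<phi> s) \<partial>unit_ivl) \<le> ennreal \<Phi>" "0 \<le> \<Phi>"
  shows "circle_mean p G r \<le> ennreal ((4 * (norm (G 0) + \<Phi>)) powr p)"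
proof -
  have [measurable]: "(\<lambda>w. norm (G (of_real r * w) - G 0)) \<in> borel_measurable circ"
    using dilation_measurable_circ[OF G r] by measurable
  have A: "(\<integral>\<^sup>+w. ennreal (norm (G (of_real r * w) - G 0) powr p) \<partial>circ) \<le> ennreal (\<Phi> powr p)"
  proof (rule nn_integral_minkowski[where N = unit_ivl and k = "indicator {0..r}" and \<phi> = \<phi>
        and f = "\<lambda>w s. norm (deriv G (of_real s * w))"])
    show "(\<lambda>(w, s). norm (deriv G (of_real s * w))) \<in> borel_measurable (circ \<Otimes>\<^sub>M unit_ivl)"
      by (rule radial_deriv_measurable[OF G])
    show "sigma_finite_measure circ" "sigma_finite_measure unit_ivl" by unfold_locales
    show "(\<integral>\<^sup>+w. norm (deriv G (of_real s * w)) powr p \<partial>circ) \<le> ennreal (\<phi> s powr p)" if "s \<in> space unit_ivl" for s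
      using le[of s] that by (simp add: circle_mean_def)
    show "AE w in circ. 0 \<le> norm (G (of_real r * w) - G 0) \<and> ennreal (norm (G (of_real r * w) - G 0))
        \<le> (\<integral>\<^sup>+s. ennreal (indicator {0..r} s * norm (deriv G (of_real s * w))) \<partial>unit_ivl)"
      using radial_segment_bound[OF G _ order_refl r] by (intro AE_I2) simp
    show "indicator {0..r} \<in> borel_measurable unit_ivl"
      unfolding unit_ivl_def by (intro measurable_restrict_space1 borel_measurable_indicator) auto
  qed (use \<phi> \<Phi> p in auto)
  have "circle_mean p G r \<le> (\<integral>\<^sup>+w. ennreal (2 powr p) * (ennreal (norm (G (of_real r * w) - G 0) powr p) + ennreal (norm (G 0) powr p)) \<partial>circ)"
    unfolding circle_mean_def
  proof (rule nn_integral_mono)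
    fix w
    have "norm (G (of_real r * w)) powr p \<le> (norm (G (of_real r * w) - G 0) + norm (G 0)) powr p"
      using p norm_triangle_sub[of "G (of_real r * w)" "G 0"] by (intro powr_mono2) (auto simp: add.commute)
    also have "\<dots> \<le> 2 powr p * (norm (G (of_real r * w) - G 0) powr p + norm (G 0) powr p)"
      using p by (intro powr_add_le) auto
    finally have "ennreal (norm (G (of_real r * w)) powr p) \<le> ennreal \<dots>" by (rule ennreal_leI)
    then show "ennreal (norm (G (of_real r * w)) powr p) \<le> ennreal (2 powr p) * (ennreal (norm (G (of_real r * w) - G 0) powr p) + ennreal (norm (G 0) powr p))"
      by (simp add: ennreal_mult)
  qed
  also have "\<dots> = ennreal (2 powr p) * ((\<integral>\<^sup>+w. ennreal (norm (G (of_real r * w) - G 0) powr p) \<partial>circ) + ennreal (norm (G 0) powr p))"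
    by (subst nn_integral_cmult, measurable, subst nn_integral_add, measurable) (simp add: emeasure_circ)
  also have "\<dots> \<le> ennreal (2 powr p) * (ennreal (\<Phi> powr p) + ennreal (norm (G 0) powr p))"
    by (intro mult_left_mono add_right_mono A) simp
  also have "\<dots> = ennreal (2 powr p * (norm (G 0) powr p + \<Phi> powr p))"
    by (simp only: ennreal_plus[symmetric] ennreal_mult[symmetric] powr_ge_zero add_nonneg_nonneg add.commute)
  also have "\<dots> \<le> ennreal ((4 * (norm (G 0) + \<Phi>)) powr p)"
  proof (rule ennreal_leI)
    have "2 powr p * (norm (G 0) powr p + \<Phi> powr p) \<le> 2 powr p * (2 powr p * (norm (G 0) + \<Phi>) powr p)"
      using \<Phi> p by (intro mult_left_mono powr_add_ge) auto
    also have "\<dots> = (4 * (norm (G 0) + \<Phi>)) powr p"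
      using \<Phi> by (simp add: powr_mult mult.assoc[symmetric] powr_mult[symmetric])
    finally show "2 powr p * (norm (G 0) powr p + \<Phi> powr p) \<le> (4 * (norm (G 0) + \<Phi>)) powr p" .
  qed
  finally show ?thesis .
qed

lemma nn_integral_unit_ivl_reflect:
  assumes [measurable]: "f \<in> borel_measurable borel"
  shows "(\<integral>\<^sup>+s. f s \<partial>unit_ivl) = (\<integral>\<^sup>+y. f (1 - y) \<partial>unit_ivl)"
proof -
  have "(\<integral>\<^sup>+s. f s * indicator {0<..<1} s \<partial>lborel) = (\<integral>\<^sup>+y. f (1 - y) * indicator {0<..<1} (1 - y) \<partial>lborel)"
    using nn_integral_real_affine[of "\<lambda>s. f s * indicator {0<..<1} s" "-1" 1] by simp
  also have "\<dots> = (\<integral>\<^sup>+y. f (1 - y) * indicator {0<..<1} y \<partial>lborel)"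
    by (intro nn_integral_cong) (auto simp: indicator_def)
  finally show ?thesis by (simp only: nn_integral_unit_ivl)
qed

lemma nn_integral_growth_from_0:
  assumes e: "0 < e" and \<epsilon>: "0 \<le> \<epsilon>" and C: "0 \<le> C" and r: "0 \<le> r" "r < 1"
  shows "(\<integral>\<^sup>+s. ennreal (indicator {0..r} s * (\<epsilon> * (1 - s) powr - (e + 1) + C)) \<partial>unit_ivl) \<le> ennreal (\<epsilon> / e * (1 - r) powr - e + C)"
proof -
  have "(\<integral>\<^sup>+s. ennreal (indicator {0..r} s * (\<epsilon> * (1 - s) powr - (e + 1) + C)) \<partial>unit_ivl)
     = (\<integral>\<^sup>+y. ennreal (indicator {0..r} (1 - y) * (\<epsilon> * (1 - (1 - y)) powr - (e + 1) + C)) \<partial>unit_ivl)"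
    by (rule nn_integral_unit_ivl_reflect) measurable
  also have "\<dots> \<le> (\<integral>\<^sup>+y. ennreal \<epsilon> * (ennreal (y powr - (e + 1)) * indicator {1 - r..} y) + ennreal C * indicator {0..1} y \<partial>lborel)"
    unfolding nn_integral_unit_ivl
  proof (rule nn_integral_mono)
    fix y :: real
    show "ennreal (indicator {0..r} (1 - y) * (\<epsilon> * (1 - (1 - y)) powr - (e + 1) + C)) * indicator {0<..<1} y
      \<le> ennreal \<epsilon> * (ennreal (y powr - (e + 1)) * indicator {1 - r..} y) + ennreal C * indicator {0..1} y"
      using \<epsilon> C r by (auto simp: indicator_def ennreal_mult[symmetric] ennreal_plus[symmetric] simp del: ennreal_plus)
  qed
  also have "\<dots> = ennreal \<epsilon> * ennreal ((1 - r) powr (1 - (e + 1)) / (e + 1 - 1)) + ennreal C"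
    using nn_integral_powr_to_inf[of "e + 1" "1 - r"] e r
    by (simp add: nn_integral_add nn_integral_cmult nn_integral_cmult_indicator)
  also have "\<dots> = ennreal (\<epsilon> / e * (1 - r) powr - e + C)"
    using \<epsilon> C e by (simp add: ennreal_mult[symmetric] ennreal_plus[symmetric] del: ennreal_plus)
  finally show ?thesis .
qed

lemma nn_integral_growth_to_1:
  assumes e: "0 < e" "e < 1" and \<epsilon>: "0 \<le> \<epsilon>" and C: "0 \<le> C" and h: "0 \<le> h" "h \<le> 1"
  shows "(\<integral>\<^sup>+s. ennreal (indicator {1 - h..1} s * (\<epsilon> * (1 - s) powr - e + C)) \<partial>unit_ivl) \<le> ennreal (\<epsilon> / (1 - e) * h powr (1 - e) + C * h)"
proof -
  have "(\<integral>\<^sup>+s. ennreal (indicator {1 - h..1} s * (\<epsilon> * (1 - s) powr - e + C)) \<partial>unit_ivl)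
     = (\<integral>\<^sup>+y. ennreal (indicator {1 - h..1} (1 - y) * (\<epsilon> * (1 - (1 - y)) powr - e + C)) \<partial>unit_ivl)"
    by (rule nn_integral_unit_ivl_reflect) measurable
  also have "\<dots> \<le> (\<integral>\<^sup>+y. ennreal \<epsilon> * (ennreal (y powr - e) * indicator {0..h} y) + ennreal C * indicator {0..h} y \<partial>lborel)"
    unfolding nn_integral_unit_ivl
  proof (rule nn_integral_mono)
    fix y :: real
    show "ennreal (indicator {1 - h..1} (1 - y) * (\<epsilon> * (1 - (1 - y)) powr - e + C)) * indicator {0<..<1} y
      \<le> ennreal \<epsilon> * (ennreal (y powr - e) * indicator {0..h} y) + ennreal C * indicator {0..h} y"
      using \<epsilon> C h by (auto simp: indicator_def ennreal_mult[symmetric] ennreal_plus[symmetric] simp del: ennreal_plus)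
  qed
  also have "\<dots> = ennreal \<epsilon> * ennreal (h powr (- e + 1) / (- e + 1)) + ennreal C * ennreal h"
    using nn_integral_powr_from_0[of "- e" h] e h
    by (simp add: nn_integral_add nn_integral_cmult nn_integral_cmult_indicator)
  also have "\<dots> = ennreal (\<epsilon> / (1 - e) * h powr (1 - e) + C * h)"
    using \<epsilon> C e h by (simp add: ennreal_mult[symmetric] ennreal_plus[symmetric] del: ennreal_plus)
  finally show ?thesis .
qed

lemma little_growth_integrate:
  assumes G: "G holomorphic_on unit_disc" and p: "1 < p" and e: "0 < e" and lg: "little_growth p (deriv G) (e + 1)"
  shows "little_growth p G e"
  unfolding little_growth_def
proof (intro allI impI)
  fix \<epsilon> :: real assume \<epsilon>: "0 < \<epsilon>"
  \<comment> \<open>Integrating the power divides by \<open>e\<close>, and passing to means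
    multiplies by 4.\<close>
  define \<epsilon>' where "\<epsilon>' = \<epsilon> * e / 4"
  have \<epsilon>': "0 < \<epsilon>'" using \<epsilon> e by (simp add: \<epsilon>'_def)
  obtain C where C: "0 \<le> C" "\<And>s. 0 \<le> s \<Longrightarrow> s < 1 \<Longrightarrow> circle_mean p (deriv G) s \<le> ennreal ((\<epsilon>' * (1 - s) powr - (e + 1) + C) powr p)"
    using lg \<epsilon>' unfolding little_growth_def by blast
  show "\<exists>C\<ge>0. \<forall>r. 0 \<le> r \<longrightarrow> r < 1 \<longrightarrow> circle_mean p G r \<le> ennreal ((\<epsilon> * (1 - r) powr - e + C) powr p)"
  proof (intro exI[of _ "4 * (norm (G 0) + C)"] conjI allI impI)
    show "0 \<le> 4 * (norm (G 0) + C)" using C by simp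
    fix r :: real assume r: "0 \<le> r" "r < 1"
    have "circle_mean p G r \<le> ennreal ((4 * (norm (G 0) + (\<epsilon>' / e * (1 - r) powr - e + C))) powr p)"
    proof (rule circle_mean_integrate[OF G p _ _ _ r, where \<phi> = "\<lambda>s. \<epsilon>' * (1 - s) powr - (e + 1) + C"])
      show "0 < \<epsilon>' * (1 - s) powr - (e + 1) + C" if "s \<in> {0<..<1}" for s
        using that \<epsilon>' C by (intro add_pos_nonneg mult_pos_pos) auto
      show "(\<integral>\<^sup>+s. ennreal (indicator {0..r} s * (\<epsilon>' * (1 - s) powr - (e + 1) + C)) \<partial>unit_ivl) \<le> ennreal (\<epsilon>' / e * (1 - r) powr - e + C)"
        using \<epsilon>' by (intro nn_integral_growth_from_0 e C(1) r) auto
    qed (use C \<epsilon>' e in auto)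
    also have "4 * (norm (G 0) + (\<epsilon>' / e * (1 - r) powr - e + C)) = \<epsilon> * (1 - r) powr - e + 4 * (norm (G 0) + C)"
      using e by (simp add: \<epsilon>'_def algebra_simps)
    finally show "circle_mean p G r \<le> ennreal ((\<epsilon> * (1 - r) powr - e + 4 * (norm (G 0) + C)) powr p)" .
  qed
qed

text \<open>The length of the image under \<open>g\<close> of the radius from \<open>r * w\<close>
  to the boundary. Where it is finite the radial limit exists, and it bounds the distance of
  \<open>g (r * w)\<close> from that limit.\<close>

definition radial_tail :: "(complex \<Rightarrow> complex) \<Rightarrow> real \<Rightarrow> complex \<Rightarrow> ennreal" where
  "radial_tail g r w = (\<integral>\<^sup>+s. ennreal (indicator {r..1} s * norm (deriv g (of_real s * w))) \<partial>unit_ivl)"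

lemma ennreal_enn2real_le: "ennreal (enn2real x) \<le> x"
  by (cases x rule: ennreal_cases) auto

lemma indicator_measurable_unit_ivl: "A \<in> sets borel \<Longrightarrow> (indicator A :: real \<Rightarrow> real) \<in> borel_measurable unit_ivl"
  unfolding unit_ivl_def by (intro measurable_restrict_space1 borel_measurable_indicator) auto

lemma radial_deriv_measurable_unit_ivl:
  assumes g: "g holomorphic_on unit_disc" and w: "norm w = 1"
  shows "(\<lambda>s. norm (deriv g (of_real s * w))) \<in> borel_measurable unit_ivl"
proof -
  have dg: "deriv g holomorphic_on unit_disc" by (intro holomorphic_deriv g) auto
  have "(\<lambda>s. deriv g (of_real s * w)) \<in> borel_measurable unit_ivl"
    by (rule holomorphic_measurable_comp[OF dg]) (use w in \<open>auto simp: norm_mult\<close>)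
  then show ?thesis by measurable
qed

lemma radial_tail_measurable:
  assumes g: "g holomorphic_on unit_disc"
  shows "radial_tail g r \<in> borel_measurable circ"
proof -
  note [measurable] = radial_deriv_measurable[OF g] indicator_measurable_unit_ivl[of "{r..1}", simplified]
  have "(\<lambda>z. indicator {r..1} (snd z) :: real) \<in> borel_measurable (circ \<Otimes>\<^sub>M unit_ivl)"
    by (rule measurable_compose[OF measurable_snd indicator_measurable_unit_ivl]) simp
  then have "(\<lambda>(w, s). ennreal (indicator {r..1} s * norm (deriv g (of_real s * w)))) \<in> borel_measurable (circ \<Otimes>\<^sub>M unit_ivl)"
    using radial_deriv_measurable[OF g] by (simp add: case_prod_beta')
  then show ?thesis
    unfolding radial_tail_def[abs_def] by (rule unit_ivl.borel_measurable_nn_integral)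
qed

text \<open>Minkowski's inequality over the radial segment: the singularity
  \<open>(1 - s) powr - (1 - 1 / p)\<close> is integrable and contributes
  \<open>p * h powr (1 / p)\<close>.\<close>

lemma radial_tail_Lp:
  assumes p: "1 < p" and g: "g holomorphic_on unit_disc" and \<epsilon>: "0 < \<epsilon>" and C: "0 \<le> C"
    and le: "\<And>s. 0 \<le> s \<Longrightarrow> s < 1 \<Longrightarrow> circle_mean p (deriv g) s \<le> ennreal ((\<epsilon> * (1 - s) powr - (1 - 1 / p) + C) powr p)"
    and h: "0 \<le> h" "h \<le> 1"
  shows "(\<integral>\<^sup>+w. ennreal (enn2real (radial_tail g (1 - h) w) powr p) \<partial>circ) \<le> ennreal ((\<epsilon> * p * h powr (1 / p) + C * h) powr p)"
proof (rule nn_integral_minkowski[where N = unit_ivl and k = "indicator {1 - h..1}" and \<phi> = "\<lambda>s. \<epsilon> * (1 - s) powr - (1 - 1 / p) + C"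
      and f = "\<lambda>w s. norm (deriv g (of_real s * w))"])
  show "(\<lambda>(w, s). norm (deriv g (of_real s * w))) \<in> borel_measurable (circ \<Otimes>\<^sub>M unit_ivl)"
    by (rule radial_deriv_measurable[OF g])
  show "sigma_finite_measure circ" "sigma_finite_measure unit_ivl" by unfold_locales
  show "indicator {1 - h..1} \<in> borel_measurable unit_ivl" unfolding unit_ivl_def by (intro measurable_restrict_space1 borel_measurable_indicator) auto
  show "(\<lambda>s. \<epsilon> * (1 - s) powr - (1 - 1 / p) + C) \<in> borel_measurable unit_ivl" by measurable
  show "(\<integral>\<^sup>+w. norm (deriv g (of_real s * w)) powr p \<partial>circ) \<le> ennreal ((\<epsilon> * (1 - s) powr - (1 - 1 / p) + C) powr p)"
    if "s \<in> space unit_ivl" for s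
    using le[of s] that by (simp add: circle_mean_def)
  show "0 < \<epsilon> * (1 - s) powr - (1 - 1 / p) + C" if "s \<in> space unit_ivl" for s
    using that \<epsilon> C by (intro add_pos_nonneg mult_pos_pos) auto
  show "(\<integral>\<^sup>+s. ennreal (indicator {1 - h..1} s * (\<epsilon> * (1 - s) powr - (1 - 1 / p) + C)) \<partial>unit_ivl) \<le> ennreal (\<epsilon> * p * h powr (1 / p) + C * h)"
    using nn_integral_growth_to_1[of "1 - 1 / p" \<epsilon> C h] p \<epsilon> C h by simp
  show "AE w in circ. 0 \<le> enn2real (radial_tail g (1 - h) w) \<and> ennreal (enn2real (radial_tail g (1 - h) w))
     \<le> (\<integral>\<^sup>+s. ennreal (indicator {1 - h..1} s * norm (deriv g (of_real s * w))) \<partial>unit_ivl)"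
    unfolding radial_tail_def[symmetric] using ennreal_enn2real_le by (intro AE_I2) simp
qed (use p \<epsilon> C h in auto)

lemma AE_radial_tail_finite:
  assumes p: "1 < p" and g: "g holomorphic_on unit_disc" and \<epsilon>: "0 < \<epsilon>" and C: "0 \<le> C"
    and le: "\<And>s. 0 \<le> s \<Longrightarrow> s < 1 \<Longrightarrow> circle_mean p (deriv g) s \<le> ennreal ((\<epsilon> * (1 - s) powr - (1 - 1 / p) + C) powr p)"
  shows "(\<integral>\<^sup>+w. radial_tail g 0 w \<partial>circ) < \<infinity>"
proof -
  interpret P: pair_sigma_finite circ unit_ivl ..
  have dg: "deriv g holomorphic_on unit_disc" by (intro holomorphic_deriv g) auto
  let ?\<phi> = "\<lambda>s. \<epsilon> * (1 - s) powr - (1 - 1 / p) + C"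
  have [measurable]: "(\<lambda>(w, s). ennreal (norm (deriv g (of_real s * w)))) \<in> borel_measurable (circ \<Otimes>\<^sub>M unit_ivl)"
    using radial_deriv_measurable[OF g] by (simp add: case_prod_beta')
  have "(\<integral>\<^sup>+w. radial_tail g 0 w \<partial>circ) = (\<integral>\<^sup>+w. \<integral>\<^sup>+s. ennreal (norm (deriv g (of_real s * w))) \<partial>unit_ivl \<partial>circ)"
    unfolding radial_tail_def by (intro nn_integral_cong) (auto simp: indicator_def)
  also have "\<dots> = (\<integral>\<^sup>+s. \<integral>\<^sup>+w. ennreal (norm (deriv g (of_real s * w))) \<partial>circ \<partial>unit_ivl)"
    by (rule P.Fubini'[symmetric]) measurable
  also have "\<dots> \<le> (\<integral>\<^sup>+s. ennreal (indicator {1 - 1..1} s * ?\<phi> s) \<partial>unit_ivl)"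
  proof (rule nn_integral_mono)
    fix s assume "s \<in> space unit_ivl"
    then have s: "0 < s" "s < 1" by auto
    have \<phi>: "0 \<le> ?\<phi> s" using \<epsilon> C by simp
    let ?X = "\<integral>\<^sup>+w. ennreal (norm (deriv g (of_real s * w))) \<partial>circ"
    \<comment> \<open>Jensen's inequality with weight 1 bounds every real number below the integral.
      Used for the integral itself if it is finite, and for \<open>?\<phi> s + 1\<close> otherwise,
      it also excludes the infinite value.\<close>
    have key: "a \<le> ?\<phi> s" if a: "0 \<le> a" "ennreal a \<le> ?X" for a
    proof -
      have [measurable]: "(\<lambda>w. norm (deriv g (of_real s * w))) \<in> borel_measurable circ"
        using dilation_measurable_circ[OF dg less_imp_le[OF s(1)] s(2)] by measurable
      have "ennreal (a powr p) \<le> ennreal (1 powr (p - 1)) * (\<integral>\<^sup>+w. ennreal (norm (deriv g (of_real s * w)) powr p * 1) \<partial>circ)"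
        by (rule nn_integral_jensen_powr) (use a p in \<open>auto simp: emeasure_circ\<close>)
      also have "\<dots> = circle_mean p (deriv g) s" by (simp add: circle_mean_def)
      also have "\<dots> \<le> ennreal (?\<phi> s powr p)" using s by (intro le) auto
      finally have "a powr p \<le> ?\<phi> s powr p" by simp
      then have "(a powr p) powr (1 / p) \<le> (?\<phi> s powr p) powr (1 / p)" using p by (rule_tac powr_mono2) auto
      then show ?thesis using p a \<phi> by (simp add: powr_powr)
    qed
    have "?X \<le> ennreal (?\<phi> s)"
    proof (cases ?X rule: ennreal_cases)
      case (real a)
      then show ?thesis using key[of a] by (simp add: ennreal_leI)
    next
      case top
      then show ?thesis using key[of "?\<phi> s + 1"] \<phi> by simp
    qed
    then show "?X \<le> ennreal (indicator {1 - 1..1} s * ?\<phi> s)" using s by simp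
  qed
  also have "\<dots> \<le> ennreal (\<epsilon> / (1 - (1 - 1 / p)) * 1 powr (1 - (1 - 1 / p)) + C * 1)"
    using p \<epsilon> C by (intro nn_integral_growth_to_1) auto
  also have "\<dots> < \<infinity>" by simp
  finally show ?thesis .
qed

text \<open>Finite length makes the tails tend to 0 by dominated convergence, and the tail from
  \<open>r\<close> bounds all later increments. This is a Cauchy condition, used first along a
  sequence to produce \<open>l\<close> and then for all radii.\<close>

lemma radial_limit_of_tail:
  assumes g: "g holomorphic_on unit_disc" and w: "norm w = 1" and fin: "radial_tail g 0 w < \<infinity>"
  obtains l where "((\<lambda>r::real. g (of_real r * w)) \<longlongrightarrow> l) (at_left 1)"
    "\<And>r. 0 \<le> r \<Longrightarrow> r < 1 \<Longrightarrow> ennreal (norm (l - g (of_real r * w))) \<le> radial_tail g r w"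
proof -
  let ?T = "\<lambda>r. radial_tail g r w" and ?r = "\<lambda>n. 1 - 1 / real (n + 2)"
  note [measurable] = radial_deriv_measurable_unit_ivl[OF g w]
  have seg: "ennreal (norm (g (of_real r' * w) - g (of_real r * w))) \<le> ?T r" if "0 \<le> r" "r \<le> r'" "r' < 1" for r r'
  proof -
    have "ennreal (norm (g (of_real r' * w) - g (of_real r * w)))
      \<le> (\<integral>\<^sup>+s. ennreal (indicator {r..r'} s * norm (deriv g (of_real s * w))) \<partial>unit_ivl)"
      by (rule radial_segment_bound[OF g w that])
    also have "\<dots> \<le> ?T r"
      unfolding radial_tail_def using that by (intro nn_integral_mono ennreal_leI mult_right_mono) (auto simp: indicator_def)
    finally show ?thesis .
  qed
  have T0: "(?T \<longlongrightarrow> 0) (at_left 1)"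
  proof (rule tendsto_at_left_sequentially[of 0])
    fix S :: "nat \<Rightarrow> real" assume S: "\<And>n. S n < 1" "\<And>n. 0 < S n" "S \<longlonglongrightarrow> 1"
    have "(\<lambda>n. \<integral>\<^sup>+s. ennreal (indicator {S n..1} s * norm (deriv g (of_real s * w))) \<partial>unit_ivl) \<longlonglongrightarrow> (\<integral>\<^sup>+s. 0 \<partial>unit_ivl)"
    proof (rule nn_integral_dominated_convergence[where w = "\<lambda>s. ennreal (indicator {0..1} s * norm (deriv g (of_real s * w)))"])
      have [measurable]: "(indicator {a..1} :: real \<Rightarrow> real) \<in> borel_measurable unit_ivl" for a
        by (rule indicator_measurable_unit_ivl) simp
      show "(\<lambda>s. ennreal (indicator {S n..1} s * norm (deriv g (of_real s * w)))) \<in> borel_measurable unit_ivl" for n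
        by measurable
      show "(\<lambda>s. ennreal (indicator {0..1} s * norm (deriv g (of_real s * w)))) \<in> borel_measurable unit_ivl"
        by measurable
      show "(\<integral>\<^sup>+s. ennreal (indicator {0..1} s * norm (deriv g (of_real s * w))) \<partial>unit_ivl) < \<infinity>"
        using fin by (simp add: radial_tail_def)
      show "AE s in unit_ivl. ennreal (indicator {S n..1} s * norm (deriv g (of_real s * w))) \<le> ennreal (indicator {0..1} s * norm (deriv g (of_real s * w)))" for n
        using S(2)[of n] by (intro AE_I2 ennreal_leI mult_right_mono) (auto simp: indicator_def)
      show "AE s in unit_ivl. (\<lambda>n. ennreal (indicator {S n..1} s * norm (deriv g (of_real s * w)))) \<longlonglongrightarrow> 0"
      proof (intro AE_I2)
        fix s assume "s \<in> space unit_ivl"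
        then have "\<forall>\<^sub>F n in sequentially. s < S n" using S(3) by (intro order_tendstoD(1)) auto
        then have "\<forall>\<^sub>F n in sequentially. ennreal (indicator {S n..1} s * norm (deriv g (of_real s * w))) = 0"
          by eventually_elim (simp add: indicator_def)
        then show "(\<lambda>n. ennreal (indicator {S n..1} s * norm (deriv g (of_real s * w)))) \<longlonglongrightarrow> 0"
          by (rule tendsto_eventually)
      qed
    qed simp
    then show "(\<lambda>n. ?T (S n)) \<longlonglongrightarrow> 0" by (simp add: radial_tail_def)
  qed simp
  have mono: "?r m \<le> ?r n" if "m \<le> n" for m n using that by (simp add: frac_le)
  have "Cauchy (\<lambda>n. g (of_real (?r n) * w))"
  proof (rule metric_CauchyI)
    fix \<epsilon> :: real assume \<epsilon>: "0 < \<epsilon>"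
    have "\<forall>\<^sub>F n in sequentially. ?T (?r n) < ennreal (\<epsilon> / 2)"
      using filterlim_compose[OF T0 radii(3)] \<epsilon> by (intro order_tendstoD(2)) auto
    then obtain N where N: "?T (?r N) < ennreal (\<epsilon> / 2)" by (auto simp: eventually_sequentially)
    have near: "dist (g (of_real (?r n) * w)) (g (of_real (?r N) * w)) < \<epsilon> / 2" if "N \<le> n" for n
    proof -
      have "ennreal (norm (g (of_real (?r n) * w) - g (of_real (?r N) * w))) < ennreal (\<epsilon> / 2)"
        by (rule le_less_trans[OF seg[OF less_imp_le[OF radii(1)] mono[OF that] radii(2)] N])
      then show ?thesis unfolding dist_norm by (subst (asm) ennreal_less_iff) auto
    qed
    show "\<exists>M. \<forall>m\<ge>M. \<forall>n\<ge>M. dist (g (of_real (?r m) * w)) (g (of_real (?r n) * w)) < \<epsilon>"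
      using near dist_triangle_half_l by blast
  qed
  then obtain l where l: "(\<lambda>n. g (of_real (?r n) * w)) \<longlonglongrightarrow> l" by (auto simp: Cauchy_convergent_iff convergent_def)
  have bound: "ennreal (norm (l - g (of_real r * w))) \<le> ?T r" if r: "0 \<le> r" "r < 1" for r
  proof (rule tendsto_upperbound)
    show "(\<lambda>n. ennreal (norm (g (of_real (?r n) * w) - g (of_real r * w)))) \<longlonglongrightarrow> ennreal (norm (l - g (of_real r * w)))"
      by (intro tendsto_ennrealI tendsto_norm tendsto_diff l tendsto_const)
    have "\<forall>\<^sub>F n in sequentially. r < ?r n"
      using radii(3) r by (intro order_tendstoD(1)[of ?r 1]) (auto simp: filterlim_at)
    then show "\<forall>\<^sub>F n in sequentially. ennreal (norm (g (of_real (?r n) * w) - g (of_real r * w))) \<le> ?T r"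
      by eventually_elim (intro seg r(1) radii(2) less_imp_le)
  qed simp
  have "((\<lambda>r::real. g (of_real r * w)) \<longlongrightarrow> l) (at_left 1)"
  proof (rule tendstoI)
    fix \<epsilon> :: real assume \<epsilon>: "0 < \<epsilon>"
    have "\<forall>\<^sub>F r in at_left 1. ?T r < ennreal \<epsilon>" using T0 \<epsilon> by (intro order_tendstoD(2)) auto
    moreover have "\<forall>\<^sub>F r in at_left 1. r \<in> {0<..<1::real}" by (rule eventually_at_left_real) simp
    ultimately show "\<forall>\<^sub>F r in at_left 1. dist (g (of_real r * w)) l < \<epsilon>"
    proof eventually_elim
      case (elim r)
      have "ennreal (norm (l - g (of_real r * w))) < ennreal \<epsilon>"
        using bound[of r] elim by (auto intro: le_less_trans)
      then show ?case unfolding dist_norm norm_minus_commute[of l] by (subst (asm) ennreal_less_iff) auto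
    qed
  qed
  then show ?thesis using that bound by blast
qed

text \<open>\<open>circ\<close> sees the angles of one period only; the exceptional set is covered
  by its translates under the countably many multiples of \<open>2 * pi\<close>.\<close>

lemma AE_lborel_of_AE_circ:
  assumes "AE w in circ. P w"
  shows "AE \<theta> in lborel. P (cis \<theta>)"
proof -
  have "AE t in density lborel (\<lambda>t::real. ennreal (1 / (2 * pi)) * indicator {0..<2 * pi} t). P (cis t)"
    using assms unfolding circ_def by (rule AE_distrD[rotated]) measurable
  then have "AE t in lborel. 0 < ennreal (1 / (2 * pi)) * indicator {0..<2 * pi} t \<longrightarrow> P (cis t)"
    by (subst (asm) AE_density) measurable
  then have base: "AE t in lborel. t \<in> {0..<2 * pi} \<longrightarrow> P (cis t)"
    by eventually_elim (simp add: indicator_def)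
  have "AE t in lborel. \<forall>k::int. t + of_int k * (2 * pi) \<in> {0..<2 * pi} \<longrightarrow> P (cis (t + of_int k * (2 * pi)))"
    unfolding AE_all_countable by (intro allI AE_lborel_shift[OF base])
  then show ?thesis
  proof eventually_elim
    case (elim t)
    define k where "k = - \<lfloor>t / (2 * pi)\<rfloor>"
    have "0 < 2 * pi" by simp
    moreover have "of_int \<lfloor>t / (2 * pi)\<rfloor> \<le> t / (2 * pi)" "t / (2 * pi) < of_int \<lfloor>t / (2 * pi)\<rfloor> + 1" by linarith+
    ultimately have "of_int \<lfloor>t / (2 * pi)\<rfloor> * (2 * pi) \<le> t" "t < (of_int \<lfloor>t / (2 * pi)\<rfloor> + 1) * (2 * pi)"
      by (simp_all only: pos_le_divide_eq pos_divide_less_eq)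
    then have "t + of_int k * (2 * pi) \<in> {0..<2 * pi}" by (simp add: k_def algebra_simps)
    then have "P (cis (t + of_int k * (2 * pi)))" using elim by blast
    moreover have "cis (t + of_int k * (2 * pi)) = cis t"
    proof -
      have "cis (of_int k * (2 * pi)) = 1" by (simp add: complex_eq_iff mult.commute[of "of_int k"] cos_int_2pin sin_int_2pin)
      then show ?thesis by (simp add: cis_mult[symmetric])
    qed
    ultimately show ?case by simp
  qed
qed

text \<open>By rotation invariance the mean of the derivative is the same at every angle along the
  arc, so Minkowski's inequality gives this mean times the arc length, which is at most
  \<open>h\<close>.\<close>

lemma arc_Lp:
  assumes p: "1 < p" and g: "g holomorphic_on unit_disc" and r: "0 \<le> r" "r < 1" and h: "0 < h" "h < 1"
    and \<phi>: "0 < \<phi>" "circle_mean p (deriv g) r \<le> ennreal (\<phi> powr p)"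
  shows "(\<integral>\<^sup>+w. ennreal (norm (g (of_real r * (cis h * w)) - g (of_real r * w)) powr p) \<partial>circ) \<le> ennreal ((h * \<phi>) powr p)"
proof -
  have dg: "deriv g holomorphic_on unit_disc" by (intro holomorphic_deriv g) auto
  have nr: "norm (of_real r * (cis u * w)) < 1" if "norm w = 1" for u w using that r by (simp add: norm_mult)
  show ?thesis
  proof (rule nn_integral_minkowski[where N = unit_ivl and k = "indicator {0..h}" and \<phi> = "\<lambda>_. \<phi>"
      and f = "\<lambda>w u. norm (deriv g (of_real r * (cis u * w)))"])
    have [measurable]: "(\<lambda>z. cis (snd z)) \<in> borel_measurable (circ \<Otimes>\<^sub>M unit_ivl)"
      by (rule measurable_compose[of _ _ borel]) (auto intro!: borel_measurable_continuous_onI continuous_intros)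
    have "(\<lambda>z. deriv g (of_real r * (cis (snd z) * fst z))) \<in> borel_measurable (circ \<Otimes>\<^sub>M unit_ivl)"
      by (rule holomorphic_measurable_comp[OF dg]) (use nr in \<open>auto simp: space_pair_measure\<close>)
    then show "(\<lambda>(w, u). norm (deriv g (of_real r * (cis u * w)))) \<in> borel_measurable (circ \<Otimes>\<^sub>M unit_ivl)"
      by (simp add: case_prod_beta')
    show "sigma_finite_measure circ" "sigma_finite_measure unit_ivl" by unfold_locales
    show "indicator {0..h} \<in> borel_measurable unit_ivl"
      unfolding unit_ivl_def by (intro measurable_restrict_space1 borel_measurable_indicator) auto
    show "(\<integral>\<^sup>+w. norm (deriv g (of_real r * (cis u * w))) powr p \<partial>circ) \<le> ennreal (\<phi> powr p)" for u
    proof -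
      note [measurable] = dilation_measurable_circ[OF dg r]
      have "(\<integral>\<^sup>+w. norm (deriv g (of_real r * (cis u * w))) powr p \<partial>circ) = circle_mean p (deriv g) r"
        unfolding circle_mean_def
        by (rule nn_integral_circ_rotate[of "\<lambda>w. ennreal (norm (deriv g (of_real r * w)) powr p)"]) auto
      then show ?thesis using \<phi> by simp
    qed
    show "(\<integral>\<^sup>+u. ennreal (indicator {0..h} u * \<phi>) \<partial>unit_ivl) \<le> ennreal (h * \<phi>)"
    proof -
      have "(\<integral>\<^sup>+u. ennreal (indicator {0..h} u * \<phi>) \<partial>unit_ivl) \<le> (\<integral>\<^sup>+u. ennreal \<phi> * indicator {0..h} u \<partial>lborel)"
        unfolding nn_integral_unit_ivl by (intro nn_integral_mono) (auto simp: indicator_def)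
      also have "\<dots> = ennreal (h * \<phi>)" using h \<phi> by (simp add: nn_integral_cmult_indicator ennreal_mult[symmetric] mult.commute)
      finally show ?thesis .
    qed
    show "AE w in circ. 0 \<le> norm (g (of_real r * (cis h * w)) - g (of_real r * w)) \<and>
        ennreal (norm (g (of_real r * (cis h * w)) - g (of_real r * w)))
        \<le> (\<integral>\<^sup>+u. ennreal (indicator {0..h} u * norm (deriv g (of_real r * (cis u * w)))) \<partial>unit_ivl)"
    proof (intro AE_I2 conjI norm_ge_zero)
      fix w assume "w \<in> space circ"
      then have w: "norm w = 1" by simp
      have "ennreal (norm (g (of_real r * (cis h * w)) - g (of_real r * (cis 0 * w))))
        \<le> (\<integral>\<^sup>+u. ennreal (norm (of_real r * (\<i> * cis u * w) * deriv g (of_real r * (cis u * w)))) * indicator {0..h} u \<partial>lborel)"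
      proof (rule norm_diff_le_nn_integral)
        fix u :: real
        have "of_real r * (cis u * w) \<in> unit_disc" using nr[OF w] by simp
        then have "(g has_field_derivative deriv g (of_real r * (cis u * w))) (at (of_real r * (exp (\<i> * of_real u) * w)))"
          unfolding cis_conv_exp by (intro holomorphic_derivI[OF g]) auto
        moreover have "((\<lambda>v. of_real r * (exp (\<i> * v) * w)) has_field_derivative of_real r * (\<i> * cis u * w)) (at (of_real u))"
          unfolding cis_conv_exp by (auto intro!: derivative_eq_intros)
        ultimately have "((\<lambda>v. g (of_real r * (exp (\<i> * v) * w))) has_field_derivative
            deriv g (of_real r * (cis u * w)) * (of_real r * (\<i> * cis u * w))) (at (of_real u))"
          by (rule DERIV_chain2)
        then have "((\<lambda>u. g (of_real r * (exp (\<i> * of_real u) * w))) has_vector_derivative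
            deriv g (of_real r * (cis u * w)) * (of_real r * (\<i> * cis u * w))) (at u within {0..h})"
          by (intro has_vector_derivative_real_field) (auto intro: has_field_derivative_at_within)
        then show "((\<lambda>u. g (of_real r * (cis u * w))) has_vector_derivative
            of_real r * (\<i> * cis u * w) * deriv g (of_real r * (cis u * w))) (at u within {0..h})"
          by (simp only: cis_conv_exp[symmetric] mult.commute[of "deriv g (of_real r * (cis u * w))"])
      next
        show "continuous_on {0..h} (\<lambda>u. of_real r * (\<i> * cis u * w) * deriv g (of_real r * (cis u * w)))"
          by (intro continuous_intros continuous_on_compose2[OF holomorphic_on_imp_continuous_on[OF dg]])
             (use nr[OF w] in auto)
      qed (use h in auto)
      also have "\<dots> \<le> (\<integral>\<^sup>+u. ennreal (indicator {0..h} u * norm (deriv g (of_real r * (cis u * w)))) \<partial>unit_ivl)"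
        unfolding nn_integral_unit_ivl
      proof (rule nn_integral_mono_AE)
        have le: "norm (of_real r * (\<i> * cis u * w) * deriv g (of_real r * (cis u * w))) \<le> norm (deriv g (of_real r * (cis u * w)))" for u
          using mult_left_le_one_le[of "norm (deriv g (of_real r * (cis u * w)))" r] r w by (simp add: norm_mult)
        show "AE u in lborel. ennreal (norm (of_real r * (\<i> * cis u * w) * deriv g (of_real r * (cis u * w)))) * indicator {0..h} u
           \<le> ennreal (indicator {0..h} u * norm (deriv g (of_real r * (cis u * w)))) * indicator {0<..<1} u"
          using AE_lborel_singleton[of 0]
        proof eventually_elim
          case (elim u)
          show ?case
          proof (cases "u \<in> {0..h}")
            case True
            then have "u \<in> {0<..<1}" using elim h by auto
            then show ?thesis using True ennreal_leI[OF le[of u]] by simp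
          qed simp
        qed
      qed
      finally show "ennreal (norm (g (of_real r * (cis h * w)) - g (of_real r * w)))
        \<le> (\<integral>\<^sup>+u. ennreal (indicator {0..h} u * norm (deriv g (of_real r * (cis u * w)))) \<partial>unit_ivl)" by simp
    qed
  qed (use \<phi> h p in auto)
qed

lemma AE_circ_finite_tail:
  assumes p: "1 < p" and g: "g holomorphic_on unit_disc" and lg: "little_growth p (deriv g) (1 - 1 / p)"
  shows "AE w in circ. radial_tail g 0 w < \<infinity>"
proof -
  obtain C where C: "0 \<le> C" "\<And>s. 0 \<le> s \<Longrightarrow> s < 1 \<Longrightarrow> circle_mean p (deriv g) s \<le> ennreal ((1 * (1 - s) powr - (1 - 1 / p) + C) powr p)"
    using lg zero_less_one unfolding little_growth_def by blast
  have "(\<integral>\<^sup>+w. radial_tail g 0 w \<partial>circ) < \<infinity>" by (rule AE_radial_tail_finite[OF p g zero_less_one C])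
  then have "AE w in circ. radial_tail g 0 w \<noteq> \<infinity>"
    by (intro nn_integral_PInf_AE radial_tail_measurable[OF g]) simp
  then show ?thesis by eventually_elim (simp add: less_top)
qed

text \<open>Rotation invariance is available for integrals, so the exceptional set is encoded by the
  integral of the function that is 1 where \<open>f\<close> is infinite and 0 elsewhere.\<close>

lemma AE_circ_rotate:
  assumes "AE w in circ. f w < \<infinity>" and [measurable]: "f \<in> borel_measurable circ" and \<xi>: "norm \<xi> = 1"
  shows "AE w in circ. (f (\<xi> * w) :: ennreal) < \<infinity>"
proof -
  note [measurable] = measurable_circ_mult[OF \<xi>]
  have "AE w in circ. (if f w = \<infinity> then 1 else 0 :: ennreal) = 0"
    using assms(1) by eventually_elim simp
  then have "(\<integral>\<^sup>+w. (if f w = \<infinity> then 1 else 0 :: ennreal) \<partial>circ) = (\<integral>\<^sup>+w. 0 \<partial>circ)"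
    by (rule nn_integral_cong_AE)
  then have "(\<integral>\<^sup>+w. (if f w = \<infinity> then 1 else 0 :: ennreal) \<partial>circ) = 0"
    by simp
  then have "(\<integral>\<^sup>+w. (if f (\<xi> * w) = \<infinity> then 1 else 0 :: ennreal) \<partial>circ) = 0"
    using nn_integral_circ_rotate[of "\<lambda>w. if f w = \<infinity> then 1 else 0", OF _ \<xi>] by simp
  then have "AE w in circ. (if f (\<xi> * w) = \<infinity> then 1 else 0 :: ennreal) = 0"
    by (subst (asm) nn_integral_0_iff_AE) auto
  then show ?thesis by eventually_elim (auto simp: less_top split: if_splits)
qed

text \<open>The radius \<open>1 - h\<close> balances the path: the two radial segments cost order
  \<open>h powr (1 / p)\<close>, and the arc costs \<open>h * h powr - (1 - 1 / p)\<close>, which is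
  the same.\<close>

lemma boundary_diff_le_of_little_growth:
  assumes p: "1 < p" and g: "g holomorphic_on unit_disc" and lg: "little_growth p (deriv g) (1 - 1 / p)" and \<epsilon>: "0 < \<epsilon>"
  shows "\<exists>C\<ge>0. \<forall>h. 0 < h \<longrightarrow> h < 1 \<longrightarrow> boundary_diff p g (cis h) \<le> ennreal ((16 * (\<epsilon> * p * h powr (1 / p) + C * h)) powr p)"
proof -
  obtain C where C: "0 \<le> C" "\<And>s. 0 \<le> s \<Longrightarrow> s < 1 \<Longrightarrow> circle_mean p (deriv g) s \<le> ennreal ((\<epsilon> * (1 - s) powr - (1 - 1 / p) + C) powr p)"
    using lg \<epsilon> unfolding little_growth_def by blast
  have "boundary_diff p g (cis h) \<le> ennreal ((16 * (\<epsilon> * p * h powr (1 / p) + C * h)) powr p)" if h: "0 < h" "h < 1" for h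
  proof -
    define \<xi> where "\<xi> = cis h"
    have \<xi>: "norm \<xi> = 1" by (simp add: \<xi>_def)
    note [measurable] = measurable_circ_mult[OF \<xi>]
    define \<Phi> where "\<Phi> = \<epsilon> * p * h powr (1 / p) + C * h"
    have \<Phi>: "0 \<le> \<Phi>" using \<epsilon> p C h by (simp add: \<Phi>_def)
    define A where "A w = enn2real (radial_tail g (1 - h) w)" for w
    define B where "B w = norm (g (of_real (1 - h) * (\<xi> * w)) - g (of_real (1 - h) * w))" for w
    have [measurable]: "A \<in> borel_measurable circ"
      unfolding A_def using radial_tail_measurable[OF g] by measurable
    have [measurable]: "(\<lambda>w. g (of_real (1 - h) * w)) \<in> borel_measurable circ"
      using h by (intro dilation_measurable_circ[OF g]) auto
    have [measurable]: "(\<lambda>w. g (of_real (1 - h) * (\<xi> * w))) \<in> borel_measurable circ"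
      by (rule measurable_compose[of "times \<xi>" circ circ "\<lambda>w. g (of_real (1 - h) * w)"]) measurable
    have [measurable]: "B \<in> borel_measurable circ" unfolding B_def by measurable
    have A: "(\<integral>\<^sup>+w. ennreal (A w powr p) \<partial>circ) \<le> ennreal (\<Phi> powr p)"
      unfolding A_def \<Phi>_def by (rule radial_tail_Lp[OF p g \<epsilon> C]) (use h in auto)
    have A': "(\<integral>\<^sup>+w. ennreal (A (\<xi> * w) powr p) \<partial>circ) \<le> ennreal (\<Phi> powr p)"
      using A nn_integral_circ_rotate[of "\<lambda>w. ennreal (A w powr p)", OF _ \<xi>] by simp
    have B: "(\<integral>\<^sup>+w. ennreal (B w powr p) \<partial>circ) \<le> ennreal (\<Phi> powr p)"
    proof -
      have "(\<integral>\<^sup>+w. ennreal (B w powr p) \<partial>circ) \<le> ennreal ((h * (\<epsilon> * (1 - (1 - h)) powr - (1 - 1 / p) + C)) powr p)"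
        unfolding B_def \<xi>_def
        by (rule arc_Lp[OF p g _ _ h _ C(2)]) (use h \<epsilon> C in \<open>auto intro!: add_pos_nonneg mult_pos_pos\<close>)
      also have "\<dots> \<le> ennreal (\<Phi> powr p)"
      proof (intro ennreal_leI powr_mono2)
        have "h * h powr - (1 - 1 / p) = h powr (1 + - (1 - 1 / p))" using h by (simp only: powr_add powr_one)
        then have e: "h * h powr - (1 - 1 / p) = h powr (1 / p)" by simp
        have "h * (\<epsilon> * (1 - (1 - h)) powr - (1 - 1 / p) + C) = \<epsilon> * (h * h powr - (1 - 1 / p)) + C * h"
          by (simp add: algebra_simps)
        also have "\<dots> = \<epsilon> * 1 * h powr (1 / p) + C * h" unfolding e by simp
        also have "\<dots> \<le> \<Phi>" unfolding \<Phi>_def using \<epsilon> p by (intro add_mono mult_right_mono mult_left_mono) (use h in auto)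
        finally show "h * (\<epsilon> * (1 - (1 - h)) powr - (1 - 1 / p) + C) \<le> \<Phi>" .
      qed (use p h \<epsilon> C in auto)
      finally show ?thesis .
    qed
    note fin = AE_circ_finite_tail[OF p g lg]
    have fin': "AE w in circ. radial_tail g 0 (\<xi> * w) < \<infinity>"
      by (rule AE_circ_rotate[OF fin radial_tail_measurable[OF g] \<xi>])
    \<comment> \<open>Finiteness of the tail makes \<open>enn2real\<close> exact, so
      \<open>A w\<close> does bound the distance to the radial limit.\<close>
    have lim: "norm (radial_lim g w - g (of_real (1 - h) * w)) \<le> A w" if w: "norm w = 1" "radial_tail g 0 w < \<infinity>" for w
    proof -
      obtain l where l: "((\<lambda>r::real. g (of_real r * w)) \<longlongrightarrow> l) (at_left 1)"
        "\<And>r. 0 \<le> r \<Longrightarrow> r < 1 \<Longrightarrow> ennreal (norm (l - g (of_real r * w))) \<le> radial_tail g r w"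
        using radial_limit_of_tail[OF g w] by metis
      have "radial_tail g (1 - h) w \<le> radial_tail g 0 w"
        unfolding radial_tail_def using h by (intro nn_integral_mono ennreal_leI mult_right_mono) (auto simp: indicator_def)
      then have "radial_tail g (1 - h) w = ennreal (A w)" using w(2) by (simp add: A_def le_less_trans)
      moreover have "0 \<le> A w" by (simp add: A_def)
      ultimately show ?thesis using l(2)[of "1 - h"] h by (simp add: radial_lim_eq(1)[OF l(1)])
    qed
    have "boundary_diff p g \<xi> \<le> (\<integral>\<^sup>+w. ennreal (2 powr p) * (ennreal (A (\<xi> * w) powr p) +
        ennreal (2 powr p) * (ennreal (A w powr p) + ennreal (B w powr p))) \<partial>circ)"
      unfolding boundary_diff_def
    proof (rule nn_integral_mono_AE)
      show "AE w in circ. ennreal (norm (radial_lim g (\<xi> * w) - radial_lim g w) powr p) \<le> ennreal (2 powr p) * (ennreal (A (\<xi> * w) powr p) +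
        ennreal (2 powr p) * (ennreal (A w powr p) + ennreal (B w powr p)))"
        using fin fin' AE_space
      proof eventually_elim
        case (elim w)
        have w: "norm w = 1" "norm (\<xi> * w) = 1" using elim \<xi> by (auto simp: norm_mult)
        have n: "0 \<le> A w" "0 \<le> A (\<xi> * w)" "0 \<le> B w" by (auto simp: A_def B_def)
        have "radial_lim g (\<xi> * w) - radial_lim g w = (radial_lim g (\<xi> * w) - g (of_real (1 - h) * (\<xi> * w)))
           + (- (radial_lim g w - g (of_real (1 - h) * w)) + (g (of_real (1 - h) * (\<xi> * w)) - g (of_real (1 - h) * w)))" by simp
        also have "norm \<dots> \<le> norm (radial_lim g (\<xi> * w) - g (of_real (1 - h) * (\<xi> * w)))
           + (norm (- (radial_lim g w - g (of_real (1 - h) * w))) + B w)"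
          unfolding B_def by (intro order_trans[OF norm_triangle_ineq] add_left_mono norm_triangle_ineq)
        also have "\<dots> \<le> A (\<xi> * w) + (A w + B w)"
          unfolding norm_minus_cancel by (intro add_mono order_refl lim elim w)
        finally have "norm (radial_lim g (\<xi> * w) - radial_lim g w) powr p \<le> (A (\<xi> * w) + (A w + B w)) powr p"
          using p by (intro powr_mono2) auto
        also have "\<dots> \<le> 2 powr p * (A (\<xi> * w) powr p + (A w + B w) powr p)"
          using n p by (intro powr_add_le) auto
        also have "\<dots> \<le> 2 powr p * (A (\<xi> * w) powr p + 2 powr p * (A w powr p + B w powr p))"
          using n p by (intro mult_left_mono add_left_mono powr_add_le) auto
        finally show ?case
          using n by (simp add: ennreal_mult[symmetric] ennreal_plus[symmetric] ennreal_leI del: ennreal_plus)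
      qed
    qed
    also have "\<dots> = ennreal (2 powr p) * ((\<integral>\<^sup>+w. ennreal (A (\<xi> * w) powr p) \<partial>circ) +
        ennreal (2 powr p) * ((\<integral>\<^sup>+w. ennreal (A w powr p) \<partial>circ) + (\<integral>\<^sup>+w. ennreal (B w powr p) \<partial>circ)))"
      by (simp add: nn_integral_add nn_integral_cmult)
    also have "\<dots> \<le> ennreal (2 powr p) * (ennreal (\<Phi> powr p) + ennreal (2 powr p) * (ennreal (\<Phi> powr p) + ennreal (\<Phi> powr p)))"
      by (intro mult_left_mono add_mono A A' B) auto
    also have "\<dots> = ennreal ((2 powr p + 2 * (2 powr p * 2 powr p)) * \<Phi> powr p)"
      by (simp add: ennreal_mult[symmetric] ennreal_plus[symmetric] del: ennreal_plus) (simp add: algebra_simps)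
    also have "\<dots> \<le> ennreal ((16 * \<Phi>) powr p)"
    proof (rule ennreal_leI)
      \<comment> \<open>Splitting three terms produces \<open>2 powr p + 2 * 4 powr p\<close>; the
        factor 16 is chosen to absorb it.\<close>
      define x :: real where "x = 2 powr p"
      have "(2::real) powr 1 \<le> 2 powr p" using p by (intro powr_mono) auto
      then have x: "2 \<le> x" by (simp add: x_def)
      have "x + 2 * (x * x) \<le> x * x + 2 * (x * x)" using x by simp
      also have "\<dots> \<le> (2 * 2) * (x * x)" by simp
      also have "\<dots> \<le> (x * x) * (x * x)" using x by (intro mult_right_mono mult_mono) auto
      finally have "x + 2 * (x * x) \<le> x * x * (x * x)" .
      moreover have "x * x * (x * x) = 16 powr p" unfolding x_def by (simp add: powr_mult[symmetric])
      ultimately have "(x + 2 * (x * x)) * \<Phi> powr p \<le> 16 powr p * \<Phi> powr p" by (intro mult_right_mono) auto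
      then show "(2 powr p + 2 * (2 powr p * 2 powr p)) * \<Phi> powr p \<le> (16 * \<Phi>) powr p"
        using \<Phi> by (simp add: x_def powr_mult)
    qed
    finally show ?thesis by (simp add: \<xi>_def \<Phi>_def)
  qed
  then show ?thesis using C(1) by blast
qed

lemma mean_lipschitz_of_little_growth:
  assumes p: "1 < p" and g: "g holomorphic_on unit_disc" and lg: "little_growth p (deriv g) (1 - 1 / p)"
  shows "g \<in> little_mean_lipschitz p (1 / p)"
proof -
  have hardy: "g \<in> hardy_space p"
  proof -
    obtain C where C: "0 \<le> C" "\<And>s. 0 \<le> s \<Longrightarrow> s < 1 \<Longrightarrow> circle_mean p (deriv g) s \<le> ennreal ((1 * (1 - s) powr - (1 - 1 / p) + C) powr p)"
      using lg zero_less_one unfolding little_growth_def by blast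
    have "circle_mean p g r \<le> ennreal ((4 * (norm (g 0) + (p + C))) powr p)" if r: "0 < r" "r < 1" for r
    proof (rule circle_mean_integrate[OF g p, where \<phi> = "\<lambda>s. 1 * (1 - s) powr - (1 - 1 / p) + C"])
      show "0 < 1 * (1 - s) powr - (1 - 1 / p) + C" if "s \<in> {0<..<1}" for s
        using that C by (intro add_pos_nonneg mult_pos_pos) auto
      have "(\<integral>\<^sup>+s. ennreal (indicator {0..r} s * (1 * (1 - s) powr - (1 - 1 / p) + C)) \<partial>unit_ivl)
        \<le> (\<integral>\<^sup>+s. ennreal (indicator {1 - 1..1} s * (1 * (1 - s) powr - (1 - 1 / p) + C)) \<partial>unit_ivl)"
        using C r by (intro nn_integral_mono ennreal_leI mult_right_mono) (auto simp: indicator_def)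
      also have "\<dots> \<le> ennreal (1 / (1 - (1 - 1 / p)) * 1 powr (1 - (1 - 1 / p)) + C * 1)"
        using p C by (intro nn_integral_growth_to_1) auto
      finally show "(\<integral>\<^sup>+s. ennreal (indicator {0..r} s * (1 * (1 - s) powr - (1 - 1 / p) + C)) \<partial>unit_ivl) \<le> ennreal (p + C)" by simp
    qed (use C r p in auto)
    then show ?thesis unfolding hardy_space_iff[OF p] using g p C by (intro conjI exI[of _ "4 * (norm (g 0) + (p + C))"]) auto
  qed
  have "AE w in circ. \<exists>l. ((\<lambda>r::real. g (of_real r * w)) \<longlongrightarrow> l) (at_left 1)"
    using AE_circ_finite_tail[OF p g lg] AE_space
  proof eventually_elim
    case (elim w)
    then have "norm w = 1" by simp
    then show ?case by (rule radial_limit_of_tail[OF g _ elim(1)]) blast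
  qed
  then have "AE \<theta> in lborel. \<exists>l. ((\<lambda>r::real. g (of_real r * cis \<theta>)) \<longlongrightarrow> l) (at_left 1)" by (rule AE_lborel_of_AE_circ)
  then have ex: "AE \<theta> in lebesgue. \<exists>l. ((\<lambda>r::real. g (of_real r * cis \<theta>)) \<longlongrightarrow> l) (at_left 1)"
    unfolding AE_completion_iff .
  have small: "mean_modulus p g \<in> o[at_right 0](\<lambda>t. t powr (1 / p))"
  proof (rule landau_o.smallI)
    fix c :: real assume c: "0 < c"
    \<comment> \<open>The linear term \<open>C * h\<close> will be bounded by the main term, which
      doubles it, so that \<open>16 * (2 * (\<epsilon> * p)) = c\<close>.\<close>
    define \<epsilon> where "\<epsilon> = c / (32 * p)"
    have \<epsilon>: "0 < \<epsilon>" using c p by (simp add: \<epsilon>_def)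
    obtain C where C: "0 \<le> C" "\<And>h. 0 < h \<Longrightarrow> h < 1 \<Longrightarrow> boundary_diff p g (cis h) \<le> ennreal ((16 * (\<epsilon> * p * h powr (1 / p) + C * h)) powr p)"
      using boundary_diff_le_of_little_growth[OF p g lg \<epsilon>] by blast
    \<comment> \<open>The linear term is of lower order than \<open>h powr (1 / p)\<close> because
      \<open>p > 1\<close>.\<close>
    have "((\<lambda>t. C * t powr (1 - 1 / p)) \<longlongrightarrow> C * 0) (at_right 0)"
      using p by (intro tendsto_mult tendsto_const tendsto_zero_powrI[where b = "1 - 1 / p"] tendsto_ident_at) (auto intro!: eventually_at_rightI[of 0 1])
    then have "\<forall>\<^sub>F t in at_right 0. C * t powr (1 - 1 / p) < \<epsilon> * p"
      using \<epsilon> p by (intro order_tendstoD(2)) auto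
    moreover have "\<forall>\<^sub>F t in at_right 0. t \<in> {0<..<1::real}" by (rule eventually_at_right_real) simp
    ultimately show "\<forall>\<^sub>F t in at_right 0. norm (mean_modulus p g t) \<le> c * norm (t powr (1 / p))"
    proof eventually_elim
      case (elim t)
      let ?D = "\<lambda>h. enn2real (boundary_diff p g (cis h)) powr (1 / p)"
      have D: "?D h \<le> c * t powr (1 / p)" if h: "0 < h" "h \<le> t" for h
      proof -
        have h1: "h < 1" using h elim by simp
        have Ch: "C * h \<le> \<epsilon> * p * h powr (1 / p)"
        proof -
          have "h powr (1 - 1 / p + 1 / p) = h powr (1 - 1 / p) * h powr (1 / p)" by (rule powr_add)
          then have "C * h = C * h powr (1 - 1 / p) * h powr (1 / p)" using h by simp
          also have "\<dots> \<le> C * t powr (1 - 1 / p) * h powr (1 / p)"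
            using C h p by (intro mult_right_mono mult_left_mono powr_mono2) auto
          also have "\<dots> \<le> \<epsilon> * p * h powr (1 / p)" using elim by (intro mult_right_mono) auto
          finally show ?thesis .
        qed
        have nn: "0 \<le> 16 * (\<epsilon> * p * h powr (1 / p) + C * h)" using \<epsilon> p C h by simp
        have "enn2real (boundary_diff p g (cis h)) \<le> enn2real (ennreal ((16 * (\<epsilon> * p * h powr (1 / p) + C * h)) powr p))"
          by (intro enn2real_mono C(2) h h1) simp
        then have "?D h \<le> ((16 * (\<epsilon> * p * h powr (1 / p) + C * h)) powr p) powr (1 / p)"
          using p by (rule_tac powr_mono2) auto
        also have "\<dots> = 16 * (\<epsilon> * p * h powr (1 / p) + C * h)" using p nn by (simp add: powr_powr)
        also have "\<dots> \<le> 16 * (\<epsilon> * p * h powr (1 / p) + \<epsilon> * p * h powr (1 / p))" using Ch by simp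
        also have "\<dots> = c * h powr (1 / p)" using p by (simp add: \<epsilon>_def)
        also have "\<dots> \<le> c * t powr (1 / p)" using h c p by (intro mult_left_mono powr_mono2) auto
        finally show ?thesis .
      qed
      have "mean_modulus p g t \<le> c * t powr (1 / p)"
        unfolding mean_modulus_eq[OF g ex] using elim D by (intro cSUP_least) auto
      \<comment> \<open>The little-oh condition concerns the absolute value, so a lower bound is
        needed as well: the supremum dominates its nonnegative member at \<open>t\<close>.\<close>
      moreover have "?D t \<le> mean_modulus p g t"
        unfolding mean_modulus_eq[OF g ex] using elim D by (intro cSUP_upper bdd_aboveI2[of _ _ "c * t powr (1 / p)"]) auto
      moreover have "0 \<le> ?D t" by simp
      ultimately have "\<bar>mean_modulus p g t\<bar> \<le> c * t powr (1 / p)" by linarith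
      then show ?case by simp
    qed
  qed
  show ?thesis using hardy ex small by (simp add: little_mean_lipschitz_def)
qed

theorem theorem10:
  fixes p \<alpha> :: real and g :: "complex \<Rightarrow> complex"
  assumes "1 < p" and "p - 2 < \<alpha>" and "\<alpha> \<le> p - 1"
    and "g holomorphic_on unit_disc"
  shows "compact_operator_on (dirichlet_space p \<alpha>) (dirichlet_norm p \<alpha>) (gen_hilbert g)
           \<longleftrightarrow> g \<in> little_mean_lipschitz p (1 / p)"
proof
  assume "compact_operator_on (dirichlet_space p \<alpha>) (dirichlet_norm p \<alpha>) (gen_hilbert g)"
  then have "little_growth p (deriv (deriv g)) (2 - 1 / p)"
    by (rule little_growth_of_compact_operator[OF assms])
  then have "little_growth p (deriv (deriv g)) ((1 - 1 / p) + 1)" by simp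
  moreover have "deriv g holomorphic_on unit_disc" by (intro holomorphic_deriv assms) auto
  \<comment> \<open>With a positive exponent the integrated bound is still singular at the boundary,
    so integration lowers the exponent by exactly 1.\<close>
  moreover have "0 < 1 - 1 / p" using assms(1) by simp
  ultimately have "little_growth p (deriv g) (1 - 1 / p)"
    using assms(1) by (rule_tac little_growth_integrate)
  then show "g \<in> little_mean_lipschitz p (1 / p)"
    by (rule mean_lipschitz_of_little_growth[OF assms(1,4)])
next
  assume "g \<in> little_mean_lipschitz p (1 / p)"
  then have "little_growth p (deriv (deriv g)) (2 - 1 / p)"
    by (rule little_growth_of_mean_lipschitz[OF assms(1)])
  then show "compact_operator_on (dirichlet_space p \<alpha>) (dirichlet_norm p \<alpha>) (gen_hilbert g)"
    by (rule compact_operator_of_little_growth[OF assms])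
qed

end
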